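(* Let $G=G_1\ast\cdots\ast G_n$ be a free product of finitely many nontrivial finite groups, and let $\Sigma Aut_1(G)$ be the group of automorphisms of $G$ mapping each $G_i$ to a conjugate of $G_i$. Let $L(G)$ be the complex defined in the context. Then $L(G)$ is an $\underline{E}\,\Sigma Aut_1(G)$-space: $L(G)$ is contractible, $\Sigma Aut_1(G)$ acts on it with finite stabilizers and with finite quotient, and for every finite subgroup $F\le \Sigma Aut_1(G)$ the fixed point subcomplex $L(G)^F$ is contractible.
   Context: Bases. Since the $G_i$ are finite, every automorphism of $G$ maps each $G_i$ to a conjugate of some $G_j$. A basis of $G$ is a set $\mathcal{H}=\{H_1,\dots,H_n\}$ of subgroups with $H_i$ conjugate to $G_i$ and $G=H_1\ast\cdots\ast H_n$ (internal free product); $H_i$ is said to have label $i$. For $g\in G$, $|g|_{\mathcal{H}}$ is the length of the reduced (normal form) word of $g$ in the free product $H_1\ast\cdots\ast H_n$. Pointed trees. A pointed labelled tree is a finite bipartite tree $T$ whose vertices are either labelled, with labels exactly $\ast,1,\dots,n$ each used once, or unlabelled; every edge joins a labelled to an unlabelled vertex, unlabelled vertices have valence at least 2, and $\ast$ has valence 1 (trees are taken up to label-preserving isomorphism). For a labelled vertex $k$, the petals of $T$ at $k$ are the sets of labels in the components of $T-\{k\}$; they form a partition $\underline{\underline{A}}(k)$ of $\{\ast,1,\dots,n\}\setminus\{k\}$, and $T$ is determined by the family $\underline{\underline{A}}$ of these partitions. For two such trees, $\underline{\underline{A}}\le\underline{\underline{B}}$ means that for every $k$ each petal of $\underline{\underline{A}}(k)$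 is a union of petals of $\underline{\underline{B}}(k)$. The trivial tree has one unlabelled vertex adjacent to all labelled vertices. Symmetric Whitehead automorphisms. Given a basis $\mathcal{H}$, an index $k\in\{1,\dots,n\}$ and elements $x_j\in H_k$ ($j\ne k$, with $x_k=1$), the symmetric Whitehead automorphism $(\mathcal{H},x)$ with operative factor $k$ is the automorphism of $G$ acting on $H_j$ by $h\mapsto x_jhx_j^{-1}$ and as the identity on $H_k$. It is carried by $(\mathcal{H},\underline{\underline{A}})$ if $x$ is constant on each petal of $\underline{\underline{A}}(k)$ and $x_j=1$ for $j$ in the petal containing $\ast$. The complex $L(G)$. Pairs $(\mathcal{H},\underline{\underline{A}})$ ($\mathcal{H}$ a basis, $\underline{\underline{A}}$ a pointed labelled tree) are related when $\mathcal{H}'=\rho(\mathcal{H})$ for some product $\rho$ of symmetric Whitehead automorphisms carried by $(\mathcal{H},\underline{\underline{A}})$, the tree being unchanged; $[\mathcal{H},\underline{\underline{A}}]$ denotes the equivalence class (vertex type). These classes are partially ordered by $[\mathcal{H},\underline{\underline{A}}]\le[\mathcal{K},\underline{\underline{B}}]$ iff they have representatives with a common basis $(\mathcal{H}',\underline{\underline{A}})$, $(\mathcal{H}',\underline{\underline{B}})$ and $\underline{\underline{A}}\le\underline{\underline{B}}$. $L(G)$ is the geometric realization of this poset. An automorphism $\phi$ acts by $\phi\cdot[\mathcal{H},\underline{\underline{A}}]=[\phi(\mathcal{H}),\phi(\underline{\underline{A}})]$, where the labels are transported along $\phi$ (a vertex labelled by the factor $H$ of $\mathcal{H}$ becomes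 labelled by $\phi(H)$). *)

theory Defs
  imports "HOL-Analysis.Analysis" "HOL-Algebra.Bij" "HOL-Algebra.Generated_Groups"
begin

definition word_prod :: "('a, 'b) monoid_scheme \<Rightarrow> (nat \<times> 'a) list \<Rightarrow> 'a" where
  "word_prod G w = foldr (\<lambda>(i, h) acc. h \<otimes>\<^bsub>G\<^esub> acc) w \<one>\<^bsub>G\<^esub>"

definition reduced_word :: "('a, 'b) monoid_scheme \<Rightarrow> nat \<Rightarrow> (nat \<Rightarrow> 'a set) \<Rightarrow> (nat \<times> 'a) list \<Rightarrow> bool" where
  "reduced_word G n H w \<longleftrightarrow>
     w \<noteq> [] \<and>
     (\<forall>(i, h) \<in> set w. i \<in> {1..n} \<and> h \<in> H i \<and> h \<noteq> \<one>\<^bsub>G\<^esub>) \<and>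
     (\<forall>j. Suc j < length w \<longrightarrow> fst (w ! j) \<noteq> fst (w ! Suc j))"

definition internal_free_product :: "('a, 'b) monoid_scheme \<Rightarrow> nat \<Rightarrow> (nat \<Rightarrow> 'a set) \<Rightarrow> bool" where
  "internal_free_product G n H \<longleftrightarrow>
     (\<forall>i \<in> {1..n}. subgroup (H i) G) \<and>
     generate G (\<Union>i \<in> {1..n}. H i) = carrier G \<and>
     (\<forall>w. reduced_word G n H w \<longrightarrow> word_prod G w \<noteq> \<one>\<^bsub>G\<^esub>)"

definition conj_set :: "('a, 'b) monoid_scheme \<Rightarrow> 'a \<Rightarrow> 'a set \<Rightarrow> 'a set" where
  "conj_set G g S = (\<lambda>h. g \<otimes>\<^bsub>G\<^esub> h \<otimes>\<^bsub>G\<^esub> inv\<^bsub>G\<^esub> g) ` S"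

text \<open>Sigma Aut_1(G): automorphisms mapping each G_i to a conjugate of G_i.
  Automorphisms are extensional functions (HOL-Algebra auto).\<close>
definition SigmaAut1 :: "('a, 'b) monoid_scheme \<Rightarrow> nat \<Rightarrow> (nat \<Rightarrow> 'a set) \<Rightarrow> ('a \<Rightarrow> 'a) set" where
  "SigmaAut1 G n Gi = {\<phi> \<in> auto G. \<forall>i \<in> {1..n}. \<exists>g \<in> carrier G. \<phi> ` Gi i = conj_set G g (Gi i)}"

text \<open>A basis is a labelled family H_1..H_n (label i), H_i conjugate to G_i,
  with G the internal free product; H i = {} outside 1..n (normalisation).\<close>
definition is_basis :: "('a, 'b) monoid_scheme \<Rightarrow> nat \<Rightarrow> (nat \<Rightarrow> 'a set) \<Rightarrow> (nat \<Rightarrow> 'a set) \<Rightarrow> bool" where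
  "is_basis G n Gi H \<longleftrightarrow>
     (\<forall>i. i \<notin> {1..n} \<longrightarrow> H i = {}) \<and>
     (\<forall>i \<in> {1..n}. \<exists>g \<in> carrier G. H i = conj_set G g (Gi i)) \<and>
     internal_free_product G n H"

text \<open>Labels: 0 stands for the base label *, and 1..n for the factors.
  Vertices: Inl l is the vertex labelled l, Inr m are unlabelled vertices.
  Edges are two-element sets.\<close>

definition tree_adj :: "(nat + nat) set set \<Rightarrow> (nat + nat) \<Rightarrow> (nat + nat) \<Rightarrow> bool" where
  "tree_adj E u v \<longleftrightarrow> {u, v} \<in> E"

definition pointed_labelled_tree :: "nat \<Rightarrow> (nat + nat) set \<Rightarrow> (nat + nat) set set \<Rightarrow> bool" where
  "pointed_labelled_tree n V E \<longleftrightarrow>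
     finite V \<and>
     (\<forall>l. Inl l \<in> V \<longleftrightarrow> l \<le> n) \<and>
     (\<forall>e \<in> E. e \<subseteq> V \<and> (\<exists>l m. e = {Inl l, Inr m})) \<and>
     (\<forall>u \<in> V. \<forall>v \<in> V. (tree_adj E)\<^sup>*\<^sup>* u v) \<and>
     card E + 1 = card V \<and>
     (\<forall>m. Inr m \<in> V \<longrightarrow> card {e \<in> E. Inr m \<in> e} \<ge> 2) \<and>
     card {e \<in> E. Inl 0 \<in> e} = 1"

definition petals :: "(nat + nat) set \<Rightarrow> (nat + nat) set set \<Rightarrow> nat \<Rightarrow> nat set set" where
  "petals V E k =
     {{l. Inl l \<in> V \<and> (\<lambda>a b. {a, b} \<in> E \<and> a \<noteq> Inl k \<and> b \<noteq> Inl k)\<^sup>*\<^sup>* u (Inl l)} | u. u \<in> V - {Inl k}}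
     - {{}}"

definition petal_family :: "nat \<Rightarrow> (nat + nat) set \<Rightarrow> (nat + nat) set set \<Rightarrow> nat \<Rightarrow> nat set set" where
  "petal_family n V E = (\<lambda>k. if k \<le> n then petals V E k else {})"

text \<open>Pointed labelled trees up to isomorphism, represented by their petal families.\<close>
definition trees :: "nat \<Rightarrow> (nat \<Rightarrow> nat set set) set" where
  "trees n = {petal_family n V E | V E. pointed_labelled_tree n V E}"

definition tree_le :: "(nat \<Rightarrow> nat set set) \<Rightarrow> (nat \<Rightarrow> nat set set) \<Rightarrow> bool" where
  "tree_le A B \<longleftrightarrow> (\<forall>k. \<forall>P \<in> A k. \<exists>Q \<subseteq> B k. P = \<Union>Q)"

definition sym_whitehead :: "('a, 'b) monoid_scheme \<Rightarrow> nat \<Rightarrow> (nat \<Rightarrow> 'a set) \<Rightarrow> nat \<Rightarrow> (nat \<Rightarrow> 'a) \<Rightarrow> ('a \<Rightarrow> 'a) \<Rightarrow> bool" where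
  "sym_whitehead G n H k x \<phi> \<longleftrightarrow>
     k \<in> {1..n} \<and> x k = \<one>\<^bsub>G\<^esub> \<and> (\<forall>j \<in> {1..n}. x j \<in> H k) \<and>
     \<phi> \<in> auto G \<and>
     (\<forall>j \<in> {1..n}. \<forall>h \<in> H j. \<phi> h = x j \<otimes>\<^bsub>G\<^esub> h \<otimes>\<^bsub>G\<^esub> inv\<^bsub>G\<^esub> (x j))"

definition carried_by :: "('a, 'b) monoid_scheme \<Rightarrow> nat \<Rightarrow> (nat \<Rightarrow> 'a set) \<Rightarrow> (nat \<Rightarrow> nat set set) \<Rightarrow> ('a \<Rightarrow> 'a) \<Rightarrow> bool" where
  "carried_by G n H A \<phi> \<longleftrightarrow>
     (\<exists>k x. sym_whitehead G n H k x \<phi> \<and>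
        (\<forall>P \<in> A k. \<forall>i \<in> P. \<forall>j \<in> P. i \<in> {1..n} \<longrightarrow> j \<in> {1..n} \<longrightarrow> x i = x j) \<and>
        (\<forall>P \<in> A k. 0 \<in> P \<longrightarrow> (\<forall>j \<in> P. j \<in> {1..n} \<longrightarrow> x j = \<one>\<^bsub>G\<^esub>)))"

inductive_set carried_products ::
    "('a, 'b) monoid_scheme \<Rightarrow> nat \<Rightarrow> (nat \<Rightarrow> 'a set) \<Rightarrow> (nat \<Rightarrow> nat set set) \<Rightarrow> ('a \<Rightarrow> 'a) set"
  for G n H A where
    cp_id: "(\<lambda>x \<in> carrier G. x) \<in> carried_products G n H A"
  | cp_step: "carried_by G n H A \<phi> \<Longrightarrow> \<psi> \<in> carried_products G n H A \<Longrightarrow>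
              compose (carrier G) \<phi> \<psi> \<in> carried_products G n H A"

type_synonym ('a) vtx = "((nat \<Rightarrow> 'a set) \<times> (nat \<Rightarrow> nat set set)) set"

definition valid_pair :: "('a, 'b) monoid_scheme \<Rightarrow> nat \<Rightarrow> (nat \<Rightarrow> 'a set) \<Rightarrow> (nat \<Rightarrow> 'a set) \<times> (nat \<Rightarrow> nat set set) \<Rightarrow> bool" where
  "valid_pair G n Gi p \<longleftrightarrow> is_basis G n Gi (fst p) \<and> snd p \<in> trees n"

definition pair_rel :: "('a, 'b) monoid_scheme \<Rightarrow> nat \<Rightarrow> (nat \<Rightarrow> 'a set)
    \<Rightarrow> (nat \<Rightarrow> 'a set) \<times> (nat \<Rightarrow> nat set set) \<Rightarrow> (nat \<Rightarrow> 'a set) \<times> (nat \<Rightarrow> nat set set) \<Rightarrow> bool" where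
  "pair_rel G n Gi p q \<longleftrightarrow>
     valid_pair G n Gi p \<and> snd q = snd p \<and>
     (\<exists>\<rho> \<in> carried_products G n (fst p) (snd p). fst q = (\<lambda>i. \<rho> ` fst p i))"

definition vclass :: "('a, 'b) monoid_scheme \<Rightarrow> nat \<Rightarrow> (nat \<Rightarrow> 'a set)
    \<Rightarrow> (nat \<Rightarrow> 'a set) \<times> (nat \<Rightarrow> nat set set) \<Rightarrow> 'a vtx" where
  "vclass G n Gi p = {q. equivclp (pair_rel G n Gi) p q}"

definition L_vertices :: "('a, 'b) monoid_scheme \<Rightarrow> nat \<Rightarrow> (nat \<Rightarrow> 'a set) \<Rightarrow> 'a vtx set" where
  "L_vertices G n Gi = {vclass G n Gi p | p. valid_pair G n Gi p}"

definition L_le :: "'a vtx \<Rightarrow> 'a vtx \<Rightarrow> bool" where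
  "L_le C D \<longleftrightarrow> (\<exists>H A B. (H, A) \<in> C \<and> (H, B) \<in> D \<and> tree_le A B)"

definition is_chain :: "('v \<Rightarrow> 'v \<Rightarrow> bool) \<Rightarrow> 'v set \<Rightarrow> 'v set \<Rightarrow> bool" where
  "is_chain R P \<sigma> \<longleftrightarrow> \<sigma> \<subseteq> P \<and> finite \<sigma> \<and> \<sigma> \<noteq> {} \<and> (\<forall>x \<in> \<sigma>. \<forall>y \<in> \<sigma>. R x y \<or> R y x)"

definition closed_simplex :: "'v set \<Rightarrow> ('v \<Rightarrow> real) set" where
  "closed_simplex \<sigma> = {t. (\<forall>v. 0 \<le> t v) \<and> (\<forall>v. v \<notin> \<sigma> \<longrightarrow> t v = 0) \<and> sum t \<sigma> = 1}"

definition realization_points :: "('v \<Rightarrow> 'v \<Rightarrow> bool) \<Rightarrow> 'v set \<Rightarrow> ('v \<Rightarrow> real) set" where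
  "realization_points R P = (\<Union>\<sigma> \<in> {\<sigma>. is_chain R P \<sigma>}. closed_simplex \<sigma>)"

definition realization :: "('v \<Rightarrow> 'v \<Rightarrow> bool) \<Rightarrow> 'v set \<Rightarrow> ('v \<Rightarrow> real) topology" where
  "realization R P = topology (\<lambda>U. U \<subseteq> realization_points R P \<and>
      (\<forall>\<sigma>. is_chain R P \<sigma> \<longrightarrow>
         openin (subtopology (product_topology (\<lambda>_. euclideanreal) UNIV) (closed_simplex \<sigma>))
                (U \<inter> closed_simplex \<sigma>)))"

definition L_complex :: "('a, 'b) monoid_scheme \<Rightarrow> nat \<Rightarrow> (nat \<Rightarrow> 'a set) \<Rightarrow> ('a vtx \<Rightarrow> real) topology" where
  "L_complex G n Gi = realization L_le (L_vertices G n Gi)"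

text \<open>For phi in Sigma Aut_1(G), phi(H_i) is again conjugate to G_i, so labels are
  unchanged: phi . [H, A] = [phi(H), A].\<close>
definition vact :: "('a \<Rightarrow> 'a) \<Rightarrow> 'a vtx \<Rightarrow> 'a vtx" where
  "vact \<phi> C = (\<lambda>(H, A). ((\<lambda>i. \<phi> ` H i), A)) ` C"

definition fixes_point :: "('a, 'b) monoid_scheme \<Rightarrow> nat \<Rightarrow> (nat \<Rightarrow> 'a set) \<Rightarrow> ('a \<Rightarrow> 'a) \<Rightarrow> ('a vtx \<Rightarrow> real) \<Rightarrow> bool" where
  "fixes_point G n Gi \<phi> t \<longleftrightarrow> (\<forall>C \<in> L_vertices G n Gi. t (vact \<phi> C) = t C)"

definition fixed_set :: "('a, 'b) monoid_scheme \<Rightarrow> nat \<Rightarrow> (nat \<Rightarrow> 'a set) \<Rightarrow> ('a \<Rightarrow> 'a) set \<Rightarrow> ('a vtx \<Rightarrow> real) set" where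
  "fixed_set G n Gi F = {t \<in> topspace (L_complex G n Gi). \<forall>\<phi> \<in> F. fixes_point G n Gi \<phi> t}"

definition simplex_orbits :: "('a, 'b) monoid_scheme \<Rightarrow> nat \<Rightarrow> (nat \<Rightarrow> 'a set) \<Rightarrow> 'a vtx set set set" where
  "simplex_orbits G n Gi =
     {{vact \<phi> ` \<sigma> | \<phi>. \<phi> \<in> SigmaAut1 G n Gi} | \<sigma>. is_chain L_le (L_vertices G n Gi) \<sigma>}"

end

theory Submission
  imports Defs
begin

text \<open>Bases are compared by a norm: the weighted total length, with respect to a basis, of a finite set of group
  elements invariant under the finite group \<open>F\<close>. The norm of the basis obtained from \<open>H\<close> by compatible Whitehead
  moves is a sum over the operative factors of the costs of the moves, and two crossing moves can be uncrossed without
  increasing their total cost. Consequently the trees above a given one which carry a norm-reducing move form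
  a contractible poset, and a discrete Morse argument, filtering the vertices by the least norm of their bases and
  then by their trees, reduces the poset of \<open>F\<close>-fixed vertices to the vertices of least norm. Since any two bases
  are connected by Whitehead moves (Nielsen reduction), a confluence argument shows that every basis without a
  norm-reducing move is a minimiser; for suitable weights uncrossing is strict at the minimisers, so that the moves between
  them are compatible. Hence all minimisers belong to a single vertex, onto which the vertices of least norm contract.\<close>

section \<open>Realizations of posets\<close>

text \<open>Enlarging the tree enlarges the set of bases of a vertex, so the least norm can only
  drop when going up. The vertices of smaller rank comparable with a given one thus fall into a
  lower part (smaller tree, same norm) and an upper part (larger tree, smaller norm), and every
  lower one lies below every upper one: the descending link is a join, for which one contractible
  part suffices. Fixed points need no separate argument: vertices above a fixed one are fixed, and
  the tree spanned by the norm-preserving moves is canonical, so \<open>F\<close> enters only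
  through the invariance of the norm. Two obstacles shape the rest. The complex is infinite and
  carries the weak topology, so infinitely many deformations have to be fitted into unit time. And
  uncrossing is only a weak inequality, while crossing neutral moves at a minimiser would prevent
  the minimisers from forming one vertex; strictness is needed there only, and words of at most
  three syllables detect it. Moves are not normalised at the base label, since uncrossing may change
  the value there.\<close>

lemma product_euclideanreal: "product_topology (\<lambda>_::'v. euclideanreal) UNIV = euclidean"
  by (rule euclidean_product_topology)

lemma openin_realization:
  "openin (realization R P) U \<longleftrightarrow> U \<subseteq> realization_points R P \<and>
     (\<forall>\<sigma>. is_chain R P \<sigma> --> openin (top_of_set (closed_simplex \<sigma>)) (U \<inter> closed_simplex \<sigma>))"
proof -
  have "istopology (\<lambda>U. U \<subseteq> realization_points R P \<and>
     (\<forall>\<sigma>. is_chain R P \<sigma> --> openin (top_of_set (closed_simplex \<sigma>)) (U \<inter> closed_simplex \<sigma>)))"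
    unfolding istopology_def
  proof (intro conjI allI impI)
    fix S T \<sigma>
    assume S: "S \<subseteq> realization_points R P \<and>
        (\<forall>\<sigma>. is_chain R P \<sigma> --> openin (top_of_set (closed_simplex \<sigma>)) (S \<inter> closed_simplex \<sigma>))"
      and T: "T \<subseteq> realization_points R P \<and>
        (\<forall>\<sigma>. is_chain R P \<sigma> --> openin (top_of_set (closed_simplex \<sigma>)) (T \<inter> closed_simplex \<sigma>))"
    show "S \<inter> T \<subseteq> realization_points R P" using S by blast
    assume \<sigma>: "is_chain R P \<sigma>"
    have "S \<inter> T \<inter> closed_simplex \<sigma> = (S \<inter> closed_simplex \<sigma>) \<inter> (T \<inter> closed_simplex \<sigma>)" by blast
    then show "openin (top_of_set (closed_simplex \<sigma>)) (S \<inter> T \<inter> closed_simplex \<sigma>)"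
      using S T \<sigma> by (metis openin_Int)
  next
    fix \<K> :: "('a => real) set set" and \<sigma>
    assume K: "\<forall>K\<in>\<K>. K \<subseteq> realization_points R P \<and>
        (\<forall>\<sigma>. is_chain R P \<sigma> --> openin (top_of_set (closed_simplex \<sigma>)) (K \<inter> closed_simplex \<sigma>))"
    show "\<Union>\<K> \<subseteq> realization_points R P" using K by blast
    assume \<sigma>: "is_chain R P \<sigma>"
    have "\<Union>\<K> \<inter> closed_simplex \<sigma> = \<Union>((\<lambda>K. K \<inter> closed_simplex \<sigma>) ` \<K>)" by blast
    then show "openin (top_of_set (closed_simplex \<sigma>)) (\<Union>\<K> \<inter> closed_simplex \<sigma>)"
      using K \<sigma> by (metis (no_types, lifting) imageE openin_Union)
  qed
  then show ?thesis unfolding realization_def product_euclideanreal by (simp add: topology_inverse')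
qed

lemma closed_simplex_subset_points: "is_chain R P \<sigma> ==> closed_simplex \<sigma> \<subseteq> realization_points R P"
  unfolding realization_points_def by blast

lemma topspace_realization [simp]: "topspace (realization R P) = realization_points R P"
proof
  show "topspace (realization R P) \<subseteq> realization_points R P"
    unfolding topspace_def openin_realization by blast
  have "openin (realization R P) (realization_points R P)"
    unfolding openin_realization
    by (auto simp: closed_simplex_subset_points Int_absorb1)
  then show "realization_points R P \<subseteq> topspace (realization R P)"
    by (simp add: openin_subset)
qed

lemma closedin_realization:
  "closedin (realization R P) C \<longleftrightarrow> C \<subseteq> realization_points R P \<and>
     (\<forall>\<sigma>. is_chain R P \<sigma> --> closedin (top_of_set (closed_simplex \<sigma>)) (C \<inter> closed_simplex \<sigma>))"
proof -
  have "(realization_points R P - C) \<inter> closed_simplex \<sigma> = closed_simplex \<sigma> - C \<inter> closed_simplex \<sigma>"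
    if "is_chain R P \<sigma>" for \<sigma>
    using closed_simplex_subset_points[OF that] by blast
  then show ?thesis
    unfolding closedin_def topspace_realization openin_realization by auto
qed

lemma closed_closed_simplex:
  fixes \<sigma> :: "'v set"
  assumes "finite \<sigma>" shows "closed (closed_simplex \<sigma>)"
proof -
  have c: "continuous_on UNIV (\<lambda>t::'v=>real. t v)" for v by simp
  have "closed_simplex \<sigma> = (\<Inter>v. {t. 0 \<le> t v}) \<inter> (\<Inter>v\<in>-\<sigma>. {t. t v = 0}) \<inter> {t. sum t \<sigma> = 1}"
    unfolding closed_simplex_def by auto
  moreover have "closed {t::'v=>real. 0 \<le> t v}" for v
    by (intro closed_Collect_le c continuous_on_const)
  moreover have "closed {t::'v=>real. t v = 0}" for v
    by (intro closed_Collect_eq c continuous_on_const)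
  moreover have "closed {t::'v=>real. sum t \<sigma> = 1}"
    by (intro closed_Collect_eq continuous_on_sum c continuous_on_const)
  ultimately show ?thesis by (auto intro!: closed_Int closed_INT)
qed

lemma is_chain_mono: "is_chain R P \<sigma> ==> P \<subseteq> Q ==> is_chain R Q \<sigma>"
  unfolding is_chain_def by blast

lemma realization_points_mono: "P \<subseteq> Q ==> realization_points R P \<subseteq> realization_points R Q"
  unfolding realization_points_def using is_chain_mono by blast

text \<open>Only the finitely many simplices over \<open>Q0\<close> meet the image. A closed set of
  the weak topology meets each of them in a set closed in the product topology, and a finite union
  of such sets is closed; so continuity for the product topology is enough.\<close>

lemma continuous_map_into_realization:
  assumes fin: "finite Q0" and sub: "Q0 \<subseteq> Q" and cont: "continuous_map X euclidean f"
    and im: "\<And>x. x \<in> topspace X ==> f x \<in> realization_points R Q0"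
  shows "continuous_map X (realization R Q) f"
  unfolding continuous_map_closedin
proof (intro conjI allI impI)
  show "f \<in> topspace X \<rightarrow> topspace (realization R Q)"
    using im realization_points_mono[OF sub] by auto
next
  fix C assume C: "closedin (realization R Q) C"
  have finc: "finite {\<sigma>. is_chain R Q0 \<sigma>}"
    using fin by (rule rev_finite_subset[OF finite_Pow_iff[THEN iffD2]]) (auto simp: is_chain_def)
  have cl: "closed (C \<inter> closed_simplex \<sigma>)" if "is_chain R Q0 \<sigma>" for \<sigma>
  proof -
    have "closedin (top_of_set (closed_simplex \<sigma>)) (C \<inter> closed_simplex \<sigma>)"
      using C is_chain_mono[OF that sub] unfolding closedin_realization by blast
    moreover have "closed (closed_simplex \<sigma>)"
      using that by (auto simp: is_chain_def intro: closed_closed_simplex)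
    ultimately show ?thesis using closedin_closed_trans by blast
  qed
  have "closed (\<Union>\<sigma>\<in>{\<sigma>. is_chain R Q0 \<sigma>}. C \<inter> closed_simplex \<sigma>)"
    using finc cl by (intro closed_UN) auto
  then have "closedin X {x \<in> topspace X. f x \<in> (\<Union>\<sigma>\<in>{\<sigma>. is_chain R Q0 \<sigma>}. C \<inter> closed_simplex \<sigma>)}"
    using cont unfolding continuous_map_closedin closed_closedin[symmetric] by blast
  also have "{x \<in> topspace X. f x \<in> (\<Union>\<sigma>\<in>{\<sigma>. is_chain R Q0 \<sigma>}. C \<inter> closed_simplex \<sigma>)} = {x \<in> topspace X. f x \<in> C}"
    using im unfolding realization_points_def by blast
  finally show "closedin X {x \<in> topspace X. f x \<in> C}" .
qed

lemma quotient_map_realization: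
  "quotient_map (sum_topology (\<lambda>\<sigma>. top_of_set (closed_simplex \<sigma>)) {\<sigma>. is_chain R P \<sigma>}) (realization R P) snd"
  unfolding quotient_map_def
proof (intro conjI allI impI)
  let ?S = "sum_topology (\<lambda>\<sigma>. top_of_set (closed_simplex \<sigma>)) {\<sigma>. is_chain R P \<sigma>}"
  show "snd ` topspace ?S = topspace (realization R P)"
    by (force simp: realization_points_def)
  fix U assume "U \<subseteq> topspace (realization R P)"
  moreover have "{x. (i, x) \<in> topspace ?S \<and> x \<in> U} = U \<inter> closed_simplex i" if "is_chain R P i" for i
    using that by auto
  ultimately show "openin ?S {x \<in> topspace ?S. snd x \<in> U} = openin (realization R P) U"
    unfolding openin_sum_topology openin_realization by auto
qed

text \<open>The weak topology is a quotient of the disjoint union of the closed simplices. Since the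
  unit interval is locally compact, the product with it is again a quotient map, and a homotopy may
  be checked on one simplex at a time.\<close>

lemma continuous_map_prod_realization:
  assumes "\<And>\<sigma>. is_chain R P \<sigma> ==> continuous_map (top_of_set ({0..1::real} \<times> closed_simplex \<sigma>)) Y F"
  shows "continuous_map (prod_topology (top_of_set {0..1}) (realization R P)) Y F"
proof -
  let ?I = "top_of_set {0..1::real}"
  let ?C = "{\<sigma>. is_chain R P \<sigma>}"
  let ?S = "sum_topology (\<lambda>\<sigma>. top_of_set (closed_simplex \<sigma>)) ?C"
  have "quotient_map (prod_topology ?I ?S) (prod_topology ?I (realization R P)) (\<lambda>(x, y). (x, snd y))"
    by (rule quotient_map_prod_right[OF _ _ quotient_map_realization])
       (auto simp: locally_compact_space_euclidean intro: compact_imp_locally_compact_space compact_imp_locally_compact_space[OF compact_space_subtopology] Hausdorff_space_subtopology)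
  then show ?thesis
  proof (rule continuous_compose_quotient_map)
    let ?T = "\<lambda>\<sigma>. {0..1::real} \<times> ({\<sigma>} \<times> closed_simplex \<sigma>)"
    show "continuous_map (prod_topology ?I ?S) Y (F \<circ> (\<lambda>(x, y). (x, snd y)))"
    proof (rule pasting_lemma[where I = ?C and T = ?T and f = "\<lambda>_. F \<circ> (\<lambda>(x, y). (x, snd y))"])
      fix \<sigma> assume \<sigma>: "\<sigma> \<in> ?C"
      have oc: "openin (top_of_set (closed_simplex i)) {x. i = \<sigma> \<and> x \<in> closed_simplex \<sigma>}" for i
        by (cases "i = \<sigma>") (auto simp: openin_subtopology_self)
      have "openin ?S ({\<sigma>} \<times> closed_simplex \<sigma>)"
        using \<sigma> oc unfolding openin_sum_topology by auto
      then show "openin (prod_topology ?I ?S) (?T \<sigma>)"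
        by (simp add: openin_prod_Times_iff openin_subtopology_self)
      have "continuous_map ?S euclidean snd"
        unfolding continuous_map_def
      proof (intro conjI allI impI)
        fix U :: "('a => real) set" assume "openin euclidean U"
        then have "{x. (i, x) \<in> topspace ?S \<and> x \<in> U} = closed_simplex i \<inter> U" "open U" if "is_chain R P i" for i
          using that by auto
        then show "openin ?S {x \<in> topspace ?S. snd x \<in> U}"
          unfolding openin_sum_topology by (auto simp: openin_open)
      qed auto
      then have "continuous_map (prod_topology ?I ?S) euclidean (snd \<circ> snd)"
        using continuous_map_compose continuous_map_snd by blast
      moreover have "continuous_map (prod_topology ?I ?S) euclidean fst"
        using continuous_map_fst continuous_map_into_fulltopology by blast
      ultimately have "continuous_map (prod_topology ?I ?S) (prod_topology euclidean euclidean) (\<lambda>(x, y). (x, snd y))"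
        unfolding continuous_map_pairwise by (simp add: o_def split_def)
      then have "continuous_map (subtopology (prod_topology ?I ?S) (?T \<sigma>)) (top_of_set ({0..1} \<times> closed_simplex \<sigma>)) (\<lambda>(x, y). (x, snd y))"
        by (intro continuous_map_into_subtopology) (auto simp: continuous_map_from_subtopology)
      then show "continuous_map (subtopology (prod_topology ?I ?S) (?T \<sigma>)) Y (F \<circ> (\<lambda>(x, y). (x, snd y)))"
        using assms \<sigma> continuous_map_compose by blast
    qed auto
  qed
qed

lemma continuous_map_realization_into_euclidean:
  "continuous_map (realization R P) euclidean id"
  unfolding continuous_map_def
  by (auto simp: openin_realization realization_points_def openin_open)

lemma realization_finite:
  assumes "finite P"
  shows "realization R P = top_of_set (realization_points R P)"
proof (rule topology_eq[THEN iffD2, rule_format])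
  fix U
  have "continuous_map (top_of_set (realization_points R P)) (realization R P) id"
    by (rule continuous_map_into_realization[OF assms subset_refl]) auto
  moreover have "continuous_map (realization R P) (top_of_set (realization_points R P)) id"
    using continuous_map_realization_into_euclidean by (auto simp: continuous_map_in_subtopology)
  ultimately have "homeomorphic_maps (realization R P) (top_of_set (realization_points R P)) id id"
    by (auto simp: homeomorphic_maps_def)
  then have "homeomorphic_map (realization R P) (top_of_set (realization_points R P)) id"
    using homeomorphic_maps_map by blast
  then show "openin (realization R P) U = openin (top_of_set (realization_points R P)) U"
    by (simp add: homeomorphic_map_id)
qed

lemma continuous_map_prod_realization_into:
  fixes F :: "real \<times> ('v => real) => ('w => real)"
  assumes "\<And>\<sigma>. is_chain R P \<sigma> ==> \<exists>Q0. finite Q0 \<and> Q0 \<subseteq> Q \<and>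
     (\<forall>s\<in>{0..1}. \<forall>t\<in>closed_simplex \<sigma>. F (s, t) \<in> realization_points R' Q0)"
    and "\<And>\<sigma>. is_chain R P \<sigma> ==> continuous_on ({0..1} \<times> closed_simplex \<sigma>) F"
  shows "continuous_map (prod_topology (top_of_set {0..1}) (realization R P)) (realization R' Q) F"
proof (rule continuous_map_prod_realization)
  fix \<sigma> assume \<sigma>: "is_chain R P \<sigma>"
  obtain Q0 where "finite Q0" "Q0 \<subseteq> Q" "\<forall>s\<in>{0..1}. \<forall>t\<in>closed_simplex \<sigma>. F (s, t) \<in> realization_points R' Q0"
    using assms(1)[OF \<sigma>] by blast
  then show "continuous_map (top_of_set ({0..1} \<times> closed_simplex \<sigma>)) (realization R' Q) F"
    using assms(2)[OF \<sigma>] by (intro continuous_map_into_realization) auto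
qed

text \<open>A full subcomplex meets a closed simplex in a face or not at all, and faces are closed;
  hence closed sets of the small weak topology stay closed in the large one. This serves both the
  filtration of the Morse argument and the fixed point sets.\<close>

lemma subtopology_realization:
  assumes "P' \<subseteq> P"
  shows "subtopology (realization R P) (realization_points R P') = realization R P'"
proof (rule topology_eq[THEN iffD2, rule_format])
  fix U
  have sub: "realization_points R P' \<subseteq> realization_points R P" by (rule realization_points_mono[OF assms])
  have inter: "realization_points R P' \<inter> closed_simplex \<sigma> = closed_simplex (\<sigma> \<inter> P') \<and> is_chain R P' (\<sigma> \<inter> P')
     \<or> realization_points R P' \<inter> closed_simplex \<sigma> = {}"
    if \<sigma>: "is_chain R P \<sigma>" for \<sigma>
  proof (cases "\<sigma> \<inter> P' = {}")
    case True
    have False if t: "t \<in> closed_simplex \<sigma>" "t \<in> closed_simplex \<tau>" "is_chain R P' \<tau>" for t \<tau>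
    proof -
      have "sum t \<sigma> = 0" using t True by (intro sum.neutral) (auto simp: closed_simplex_def is_chain_def)
      then show False using t by (simp add: closed_simplex_def)
    qed
    then show ?thesis by (auto simp: realization_points_def)
  next
    case False
    have ch: "is_chain R P' (\<sigma> \<inter> P')" using \<sigma> False by (auto simp: is_chain_def)
    have "closed_simplex (\<sigma> \<inter> P') \<subseteq> closed_simplex \<sigma>"
    proof
      fix t assume t: "t \<in> closed_simplex (\<sigma> \<inter> P')"
      have "sum t \<sigma> = sum t (\<sigma> \<inter> P')"
        using \<sigma> t by (intro sum.mono_neutral_right) (auto simp: is_chain_def closed_simplex_def)
      then show "t \<in> closed_simplex \<sigma>" using t by (auto simp: closed_simplex_def)
    qed
    moreover have "t \<in> closed_simplex (\<sigma> \<inter> P')"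
      if t: "t \<in> closed_simplex \<sigma>" "t \<in> closed_simplex \<tau>" "is_chain R P' \<tau>" for t \<tau>
    proof -
      have z: "t v = 0" if "v \<notin> \<sigma> \<inter> P'" for v
        using t that by (auto simp: closed_simplex_def is_chain_def)
      have "sum t \<sigma> = sum t (\<sigma> \<inter> P')"
        using \<sigma> z by (intro sum.mono_neutral_right) (auto simp: is_chain_def)
      then show ?thesis using t z by (auto simp: closed_simplex_def)
    qed
    ultimately show ?thesis using ch by (auto simp: realization_points_def)
  qed
  have "closedin (realization R P) C" if C: "closedin (realization R P') C" for C
    unfolding closedin_realization
  proof (intro conjI allI impI)
    show "C \<subseteq> realization_points R P" using C sub closedin_subset by fastforce
    fix \<sigma> assume \<sigma>: "is_chain R P \<sigma>"
    have CC: "C \<inter> closed_simplex \<sigma> = C \<inter> (realization_points R P' \<inter> closed_simplex \<sigma>)"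
      using closedin_subset[OF C] by auto
    show "closedin (top_of_set (closed_simplex \<sigma>)) (C \<inter> closed_simplex \<sigma>)"
      using inter[OF \<sigma>]
    proof
      assume a: "realization_points R P' \<inter> closed_simplex \<sigma> = closed_simplex (\<sigma> \<inter> P') \<and> is_chain R P' (\<sigma> \<inter> P')"
      then have "closedin (top_of_set (closed_simplex (\<sigma> \<inter> P'))) (C \<inter> closed_simplex (\<sigma> \<inter> P'))"
        using C unfolding closedin_realization by blast
      moreover have "closed (closed_simplex (\<sigma> \<inter> P'))"
        using \<sigma> by (auto simp: is_chain_def intro: closed_closed_simplex)
      ultimately have "closed (C \<inter> closed_simplex (\<sigma> \<inter> P'))" using closedin_closed_trans by blast
      then show ?thesis using CC a closedin_closed_eq by (metis closed_subset inf.cobounded2)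
    next
      assume "realization_points R P' \<inter> closed_simplex \<sigma> = {}"
      then show ?thesis using CC by simp
    qed
  qed
  then have 1: "closedin (subtopology (realization R P) (realization_points R P')) C"
    if C: "closedin (realization R P') C" for C
    using that closedin_subset[OF C] by (intro closedin_subset_topspace) simp_all
  have 2: "openin (realization R P') U" if "openin (realization R P) W" "U = W \<inter> realization_points R P'" for W U
  proof -
    have "U \<inter> closed_simplex \<sigma> = W \<inter> closed_simplex \<sigma>" if "is_chain R P' \<sigma>" for \<sigma>
      using closed_simplex_subset_points[OF that] \<open>U = W \<inter> realization_points R P'\<close> by blast
    then show ?thesis using that is_chain_mono[OF _ assms] unfolding openin_realization by auto
  qed
  have ts: "topspace (subtopology (realization R P) (realization_points R P')) = topspace (realization R P')"
    using sub by auto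
  show "openin (subtopology (realization R P) (realization_points R P')) U = openin (realization R P') U"
  proof
    assume "openin (subtopology (realization R P) (realization_points R P')) U"
    then show "openin (realization R P') U" using 2 by (auto simp: openin_subtopology)
  next
    assume "openin (realization R P') U"
    then have "closedin (realization R P') (topspace (realization R P') - U)" by blast
    from 1[OF this] show "openin (subtopology (realization R P) (realization_points R P')) U"
      using ts \<open>openin (realization R P') U\<close> by (metis openin_closedin openin_subset)
  qed
qed

section \<open>Order homotopies\<close>

definition poset_map :: "('v => 'v => bool) => 'v set => ('w => 'w => bool) => 'w set => ('v => 'w) => bool" where
  "poset_map R P R' Q f \<longleftrightarrow> f \<in> P \<rightarrow> Q \<and> (\<forall>x\<in>P. \<forall>y\<in>P. R x y --> R' (f x) (f y))"

definition order_homotopy_step :: "('v => 'v => bool) => 'v set => ('w => 'w => bool) => 'w set => ('v => 'w) => ('v => 'w) => bool" where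
  "order_homotopy_step R P R' Q f g \<longleftrightarrow> poset_map R P R' Q f \<and> poset_map R P R' Q g \<and>
     ((\<forall>x\<in>P. R' (f x) (g x)) \<or> (\<forall>x\<in>P. R' (g x) (f x)))"

text \<open>A combinatorial form of contractibility, chosen because it passes through the cone,
  retraction and join arguments below; topology re-enters only when a link is turned into its
  realization.\<close>

definition order_contractible :: "('v => 'v => bool) => 'v set => bool" where
  "order_contractible R P \<longleftrightarrow> (\<exists>p\<in>P. (order_homotopy_step R P R P)\<^sup>*\<^sup>* id (\<lambda>_. p))"

definition porder :: "('v => 'v => bool) => 'v set => bool" where
  "porder R P \<longleftrightarrow> (\<forall>x\<in>P. R x x) \<and> (\<forall>x\<in>P. \<forall>y\<in>P. R x y --> R y x --> x = y) \<and>
     (\<forall>x\<in>P. \<forall>y\<in>P. \<forall>z\<in>P. R x y --> R y z --> R x z)"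

lemma porder_subset: "porder R P ==> Q \<subseteq> P ==> porder R Q"
  unfolding porder_def by blast

lemma poset_map_id: "poset_map R P R P id"
  by (auto simp: poset_map_def)

lemma poset_map_const: "porder R' Q ==> p \<in> Q ==> poset_map R P R' Q (\<lambda>_. p)"
  by (auto simp: poset_map_def porder_def)

lemma poset_map_comp:
  "poset_map R P R' Q f ==> poset_map R' Q R'' S g ==> poset_map R P R'' S (g \<circ> f)"
  unfolding poset_map_def by (auto simp: Pi_iff)

lemma order_contractible_nonempty: "order_contractible R P ==> P \<noteq> {}"
  unfolding order_contractible_def by blast

text \<open>Conical contraction in the sense of Quillen, with \<open>f\<close> above both the
  identity and the constant \<open>p\<close>: two order homotopies suffice.\<close>

lemma order_contractible_cone_up:
  assumes "porder R P" "p \<in> P" "poset_map R P R P f" "\<And>x. x \<in> P ==> R x (f x)" "\<And>x. x \<in> P ==> R p (f x)"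
  shows "order_contractible R P"
proof -
  have "order_homotopy_step R P R P id f" "order_homotopy_step R P R P f (\<lambda>_. p)"
    using assms poset_map_id poset_map_const[OF assms(1,2)] by (auto simp: order_homotopy_step_def)
  then show ?thesis unfolding order_contractible_def using assms(2)
    by (meson converse_rtranclp_into_rtranclp rtranclp.rtrancl_refl)
qed

lemma order_contractible_cone_down:
  assumes "porder R P" "p \<in> P" "poset_map R P R P f" "\<And>x. x \<in> P ==> R (f x) x" "\<And>x. x \<in> P ==> R (f x) p"
  shows "order_contractible R P"
proof -
  have "order_homotopy_step R P R P id f" "order_homotopy_step R P R P f (\<lambda>_. p)"
    using assms poset_map_id poset_map_const[OF assms(1,2)] by (auto simp: order_homotopy_step_def)
  then show ?thesis unfolding order_contractible_def using assms(2)
    by (meson converse_rtranclp_into_rtranclp rtranclp.rtrancl_refl)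
qed

lemma order_homotopy_compose:
  assumes "poset_map R P R' Q f" "poset_map R' Q R P g" "(order_homotopy_step R' Q R' Q)\<^sup>*\<^sup>* h k"
  shows "(order_homotopy_step R P R P)\<^sup>*\<^sup>* (g \<circ> h \<circ> f) (g \<circ> k \<circ> f)"
  using assms(3)
proof (induction rule: rtranclp_induct)
  case (step y z)
  have m: "poset_map R P R P (g \<circ> y \<circ> f)" "poset_map R P R P (g \<circ> z \<circ> f)"
    using step(2) assms(1,2) unfolding order_homotopy_step_def by (meson poset_map_comp)+
  have "order_homotopy_step R P R P (g \<circ> y \<circ> f) (g \<circ> z \<circ> f)"
    using step(2) m assms(1,2) unfolding order_homotopy_step_def poset_map_def by (auto simp: Pi_iff)
  then show ?case using step(3) by (meson rtranclp.rtrancl_into_rtrancl)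
qed simp

text \<open>Composed with \<open>f\<close> and \<open>g\<close>, a contraction of \<open>Q\<close>
  joins \<open>g \<circ> f\<close> to a constant map, and \<open>g \<circ> f\<close> is comparable
  with the identity of \<open>P\<close>.\<close>

lemma order_contractible_retract:
  assumes "porder R P" "poset_map R P R' Q f" "poset_map R' Q R P g" "order_contractible R' Q"
    and "(\<forall>x\<in>P. R (g (f x)) x) \<or> (\<forall>x\<in>P. R x (g (f x)))"
  shows "order_contractible R P"
proof -
  obtain q where q: "q \<in> Q" "(order_homotopy_step R' Q R' Q)\<^sup>*\<^sup>* id (\<lambda>_. q)"
    using assms(4) by (auto simp: order_contractible_def)
  have "(order_homotopy_step R P R P)\<^sup>*\<^sup>* (g \<circ> id \<circ> f) (g \<circ> (\<lambda>_. q) \<circ> f)"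
    by (rule order_homotopy_compose[OF assms(2,3) q(2)])
  moreover have "order_homotopy_step R P R P id (g \<circ> id \<circ> f)"
    using assms poset_map_id poset_map_comp[OF assms(2,3)] by (auto simp: order_homotopy_step_def)
  moreover have "g \<circ> (\<lambda>_. q) \<circ> f = (\<lambda>_. g q)" by auto
  moreover have "g q \<in> P" using assms(3) q(1) by (auto simp: poset_map_def)
  ultimately show ?thesis unfolding order_contractible_def
    by (metis converse_rtranclp_into_rtranclp)
qed

text \<open>A contraction of \<open>P2\<close> to \<open>q\<close> extends by the identity on
  \<open>P1\<close>; it stays monotone because all of \<open>P1\<close> lies below all of
  \<open>P2\<close>. The extended final map lies below the constant \<open>q\<close>, which gives
  one more homotopy.\<close>

lemma order_contractible_join:
  assumes po: "porder R P" and P: "P = P1 \<union> P2" and lt: "\<And>x y. x \<in> P1 ==> y \<in> P2 ==> R x y \<and> x \<noteq> y"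
    and oc: "order_contractible R P2"
  shows "order_contractible R P"
proof -
  have P12: "\<not> R y x" if "x \<in> P1" "y \<in> P2" for x y
    using lt[OF that] po that P unfolding porder_def by blast
  have disj: "P1 \<inter> P2 = {}" using lt by blast
  obtain q where q: "q \<in> P2" "(order_homotopy_step R P2 R P2)\<^sup>*\<^sup>* id (\<lambda>_. q)"
    using oc by (auto simp: order_contractible_def)
  define ext where "ext = (\<lambda>f x. if x \<in> P2 then f x else x)"
  have rf: "R x x" if "x \<in> P" for x using that po by (simp add: porder_def)
  have mm: "poset_map R P R P (ext f)" if "poset_map R P2 R P2 f" for f
    unfolding poset_map_def
  proof (intro conjI ballI impI)
    have fP2: "f x \<in> P2" if "x \<in> P2" for x using that \<open>poset_map R P2 R P2 f\<close> by (auto simp: poset_map_def)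
    show "ext f \<in> P \<rightarrow> P" using fP2 unfolding ext_def P by simp
    fix x y assume "x \<in> P" "y \<in> P" "R x y"
    moreover have "R (f x) (f y)" if "x \<in> P2" "y \<in> P2"
      using that \<open>R x y\<close> \<open>poset_map R P2 R P2 f\<close> by (simp add: poset_map_def)
    moreover have "x \<in> P1" if "x \<notin> P2" using that \<open>x \<in> P\<close> P by blast
    moreover have "y \<in> P1" if "y \<notin> P2" using that \<open>y \<in> P\<close> P by blast
    ultimately show "R (ext f x) (ext f y)"
      using lt P12 fP2 unfolding ext_def by (cases "x \<in> P2"; cases "y \<in> P2") simp_all
  qed
  have gen: "(order_homotopy_step R P R P)\<^sup>*\<^sup>* (ext h) (ext k)"
    if "(order_homotopy_step R P2 R P2)\<^sup>*\<^sup>* h k" for h k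
    using that
  proof (induction rule: rtranclp_induct)
    case (step y z)
    have "order_homotopy_step R P R P (ext y) (ext z)"
    proof -
      have "(\<forall>x\<in>P. R (ext y x) (ext z x)) \<or> (\<forall>x\<in>P. R (ext z x) (ext y x))"
        using step(2) rf unfolding order_homotopy_step_def ext_def by auto
      then show ?thesis using step(2) mm unfolding order_homotopy_step_def by blast
    qed
    then show ?case using step(3) by (meson rtranclp.rtrancl_into_rtrancl)
  qed simp
  note gen[OF q(2)]
  moreover have "ext id = id" by (auto simp: ext_def)
  moreover have "order_homotopy_step R P R P (ext (\<lambda>_. q)) (\<lambda>_. q)"
  proof -
    have "poset_map R P2 R P2 (\<lambda>_. q)"
      using porder_subset[OF po] P q(1) by (intro poset_map_const) auto
    then have "poset_map R P R P (ext (\<lambda>_. q))" by (rule mm)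
    moreover have "poset_map R P R P (\<lambda>_. q)" using po P q(1) by (intro poset_map_const) auto
    moreover have "R (ext (\<lambda>_. q) x) q" if "x \<in> P" for x
      using that lt[OF _ q(1)] rf[of q] q(1) P by (simp add: ext_def) blast
    ultimately show ?thesis unfolding order_homotopy_step_def by blast
  qed
  ultimately show ?thesis unfolding order_contractible_def using q(1) P
    by (metis UnCI rtranclp.rtrancl_into_rtrancl)
qed

definition realization_map :: "('v => 'w) => ('v => real) => 'w => real" where
  "realization_map f t w = (\<Sum>x\<in>{x. t x \<noteq> 0}. if f x = w then t x else 0)"

text \<open>The homotopy from \<open>f\<close> to \<open>g\<close> moves the mass of a point of a simplex from \<open>f x\<close> to \<open>g x\<close>
  starting with the largest vertices, so that its support stays a chain.\<close>

definition moved_mass :: "('v => 'v => bool) => real => ('v => real) => 'v => real" where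
  "moved_mass R s t x = max 0 (min (t x) (s - (\<Sum>y\<in>{y. t y \<noteq> 0}. if R x y \<and> y \<noteq> x then t y else 0)))"

definition order_homotopy :: "('v => 'v => bool) => ('v => 'w) => ('v => 'w) => real \<times> ('v => real) => 'w => real" where
  "order_homotopy R f g = (\<lambda>(s, t) w. \<Sum>x\<in>{x. t x \<noteq> 0}.
      (if f x = w then t x - moved_mass R s t x else 0) + (if g x = w then moved_mass R s t x else 0))"

lemma closed_simplexD:
  assumes "t \<in> closed_simplex \<sigma>"
  shows "0 \<le> t v" "v \<notin> \<sigma> ==> t v = 0" "sum t \<sigma> = 1" "{x. t x \<noteq> 0} \<subseteq> \<sigma>"
  using assms by (auto simp: closed_simplex_def)

lemma sum_support:
  assumes "finite \<sigma>" "{x. t x \<noteq> 0} \<subseteq> \<sigma>" "\<And>x. t x = 0 ==> F x = 0"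
  shows "(\<Sum>x\<in>{x. t x \<noteq> (0::real)}. F x) = (\<Sum>x\<in>\<sigma>. F x :: real)"
  using assms by (intro sum.mono_neutral_left) auto

lemma moved_mass_simplex:
  assumes "finite \<sigma>" "t \<in> closed_simplex \<sigma>"
  shows "moved_mass R s t x = max 0 (min (t x) (s - (\<Sum>y\<in>\<sigma>. if R x y \<and> y \<noteq> x then t y else 0)))"
  unfolding moved_mass_def using sum_support[OF assms(1) closed_simplexD(4)[OF assms(2)], of "\<lambda>y. if R x y \<and> y \<noteq> x then t y else 0"]
  by simp

lemma moved_mass_bounds: "0 \<le> t x ==> 0 \<le> moved_mass R s t x" "0 \<le> t x ==> moved_mass R s t x \<le> t x"
  by (auto simp: moved_mass_def)

lemma order_homotopy_simplex:
  assumes "finite \<sigma>" "t \<in> closed_simplex \<sigma>"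
  shows "order_homotopy R f g (s, t) w = (\<Sum>x\<in>\<sigma>.
      (if f x = w then t x - moved_mass R s t x else 0) + (if g x = w then moved_mass R s t x else 0))"
proof -
  have "moved_mass R s t x = 0" if "t x = 0" for x using that by (simp add: moved_mass_def)
  then show ?thesis unfolding order_homotopy_def
    using sum_support[OF assms(1) closed_simplexD(4)[OF assms(2)]] by simp
qed

lemma realization_map_simplex:
  assumes "finite \<sigma>" "t \<in> closed_simplex \<sigma>"
  shows "realization_map f t w = (\<Sum>x\<in>\<sigma>. if f x = w then t x else 0)"
  unfolding realization_map_def by (rule sum_support[OF assms(1) closed_simplexD(4)[OF assms(2)]]) simp

lemma order_homotopy_0:
  assumes "is_chain R P \<sigma>" "t \<in> closed_simplex \<sigma>"
  shows "order_homotopy R f g (0, t) = realization_map f t"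
proof
  fix w
  have fin: "finite \<sigma>" using assms by (simp add: is_chain_def)
  have "moved_mass R 0 t x = 0" for x
  proof -
    have "0 \<le> (\<Sum>y\<in>\<sigma>. if R x y \<and> y \<noteq> x then t y else 0)"
      using closed_simplexD(1)[OF assms(2)] by (intro sum_nonneg) auto
    then show ?thesis using closed_simplexD(1)[OF assms(2), of x] by (auto simp: moved_mass_simplex[OF fin assms(2)])
  qed
  then show "order_homotopy R f g (0, t) w = realization_map f t w"
    by (simp add: order_homotopy_simplex[OF fin assms(2)] realization_map_simplex[OF fin assms(2)] cong: if_cong)
qed

lemma order_homotopy_1:
  assumes "is_chain R P \<sigma>" "t \<in> closed_simplex \<sigma>"
  shows "order_homotopy R f g (1, t) = realization_map g t"
proof
  fix w
  have fin: "finite \<sigma>" using assms by (simp add: is_chain_def)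
  have "moved_mass R 1 t x = t x" for x
  proof (cases "x \<in> \<sigma>")
    case True
    have "(\<Sum>y\<in>\<sigma>. if R x y \<and> y \<noteq> x then t y else 0) + t x
        = (\<Sum>y\<in>\<sigma>. (if R x y \<and> y \<noteq> x then t y else 0) + (if y = x then t y else 0))"
      using True fin by (simp add: sum.distrib)
    also have "\<dots> \<le> sum t \<sigma>"
      using closed_simplexD(1)[OF assms(2)] by (intro sum_mono) auto
    finally have "(\<Sum>y\<in>\<sigma>. if R x y \<and> y \<noteq> x then t y else 0) + t x \<le> 1"
      using closed_simplexD(3)[OF assms(2)] by simp
    then show ?thesis using closed_simplexD(1)[OF assms(2), of x] by (simp add: moved_mass_simplex[OF fin assms(2)])
  next
    case False
    then show ?thesis using closed_simplexD(2)[OF assms(2)] by (auto simp: moved_mass_def)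
  qed
  then show "order_homotopy R f g (1, t) w = realization_map g t w"
    by (simp add: order_homotopy_simplex[OF fin assms(2)] realization_map_simplex[OF fin assms(2)] cong: if_cong)
qed

text \<open>The support consists of the \<open>f x\<close> whose mass is not yet fully moved and the
  \<open>g z\<close> which have received mass. Since such an \<open>x\<close> lies below such a
  \<open>z\<close>, there is the chain \<open>f x\<close>, \<open>f z\<close>, \<open>g z\<close>,
  so any two elements of the support are comparable.\<close>

lemma order_homotopy_in_points:
  assumes po: "porder R P" and po': "porder R' Q" and f: "poset_map R P R' Q f" and g: "poset_map R P R' Q g"
    and fg: "\<And>x. x \<in> P ==> R' (f x) (g x)"
    and \<sigma>: "is_chain R P \<sigma>" and t: "t \<in> closed_simplex \<sigma>"
  shows "order_homotopy R f g (s, t) \<in> realization_points R' (f ` \<sigma> \<union> g ` \<sigma>)"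
proof -
  have fin: "finite \<sigma>" and \<sigma>P: "\<sigma> \<subseteq> P" using \<sigma> by (auto simp: is_chain_def)
  let ?a = "moved_mass R s t"
  have a: "0 \<le> ?a x" "?a x \<le> t x" for x using moved_mass_bounds closed_simplexD(1)[OF t] by metis+
  define \<tau> where "\<tau> = f ` {x\<in>\<sigma>. t x - ?a x > 0} \<union> g ` {x\<in>\<sigma>. ?a x > 0}"
  \<comment> \<open>Otherwise \<open>x\<close> is strictly above \<open>z\<close>. Then
    \<open>x\<close> and everything above it count among the elements above \<open>z\<close>, whose
    total mass is less than \<open>s\<close> because \<open>z\<close> has begun to move; so
    \<open>x\<close> would already be finished.\<close>
  have le: "R x z" if x: "x \<in> \<sigma>" "t x - ?a x > 0" and z: "z \<in> \<sigma>" "?a z > 0" for x z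
  proof (rule ccontr)
    assume n: "\<not> R x z"
    then have zx: "R z x" "x \<noteq> z" using \<sigma> x z po \<sigma>P unfolding is_chain_def porder_def by blast+
    have "(\<Sum>y\<in>\<sigma>. if R x y \<and> y \<noteq> x then t y else 0) + t x
        = (\<Sum>y\<in>\<sigma>. (if R x y \<and> y \<noteq> x then t y else 0) + (if y = x then t y else 0))"
      using x fin by (simp add: sum.distrib)
    also have "\<dots> \<le> (\<Sum>y\<in>\<sigma>. if R z y \<and> y \<noteq> z then t y else 0)"
    proof (rule sum_mono)
      fix y assume y: "y \<in> \<sigma>"
      have "R z y \<and> y \<noteq> z" if "R x y"
        using that zx n po x z y \<sigma>P unfolding porder_def by blast
      then show "(if R x y \<and> y \<noteq> x then t y else 0) + (if y = x then t y else 0) \<le> (if R z y \<and> y \<noteq> z then t y else 0)"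
        using zx closed_simplexD(1)[OF t, of y] by auto
    qed
    also have "\<dots> < s" using z(2) by (simp add: moved_mass_simplex[OF fin t])
    finally have "?a x = t x" using closed_simplexD(1)[OF t, of x] by (simp add: moved_mass_simplex[OF fin t])
    then show False using x by simp
  qed
  have mf: "R' (f x) (f y)" "R' (g x) (g y)" if "R x y" "x \<in> \<sigma>" "y \<in> \<sigma>" for x y
    using that f g \<sigma>P unfolding poset_map_def by blast+
  have inQ: "f x \<in> Q" "g x \<in> Q" if "x \<in> \<sigma>" for x using that f g \<sigma>P by (auto simp: poset_map_def)
  have cmp: "R x y \<or> R y x" if "x \<in> \<sigma>" "y \<in> \<sigma>" for x y using that \<sigma> by (auto simp: is_chain_def)
  have fgle: "R' (f x) (g z)" if "x \<in> \<sigma>" "t x - ?a x > 0" "z \<in> \<sigma>" "?a z > 0" for x z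
  proof -
    have "R' (f x) (f z)" "R' (f z) (g z)" using le[OF that] mf that fg \<sigma>P by auto
    then show ?thesis using po' inQ that unfolding porder_def by blast
  qed
  have ff: "R' (f x) (f y) \<or> R' (f y) (f x)" and gg: "R' (g x) (g y) \<or> R' (g y) (g x)" if "x \<in> \<sigma>" "y \<in> \<sigma>" for x y
    using cmp[OF that] mf that by blast+
  have tot: "\<forall>u\<in>\<tau>. \<forall>v\<in>\<tau>. R' u v \<or> R' v u"
    unfolding \<tau>_def using ff gg fgle by blast
  let ?h = "order_homotopy R f g (s, t)"
  have h: "?h w = (\<Sum>x\<in>\<sigma>. (if f x = w then t x - ?a x else 0) + (if g x = w then ?a x else 0))" for w
    by (rule order_homotopy_simplex[OF fin t])
  have h0: "?h w = 0" if "w \<notin> \<tau>" for w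
  proof -
    have "(if f x = w then t x - ?a x else 0) + (if g x = w then ?a x else 0) = 0" if "x \<in> \<sigma>" for x
    proof -
      have "\<not> (f x = w \<and> t x - ?a x > 0)" "\<not> (g x = w \<and> ?a x > 0)"
        using that \<open>w \<notin> \<tau>\<close> unfolding \<tau>_def by auto
      then show ?thesis using a[of x] by auto
    qed
    then show ?thesis unfolding h by simp
  qed
  have h1: "0 \<le> ?h w" for w unfolding h using a by (intro sum_nonneg) auto
  have fin\<tau>: "finite \<tau>" using fin by (simp add: \<tau>_def)
  have inner: "(\<Sum>w\<in>\<tau>. (if f x = w then t x - ?a x else 0) + (if g x = w then ?a x else 0)) = t x" if x: "x \<in> \<sigma>" for x
  proof -
    have 1: "(\<Sum>w\<in>\<tau>. if f x = w then t x - ?a x else 0) = t x - ?a x"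
    proof (cases "f x \<in> \<tau>")
      case False
      then have "\<not> t x - ?a x > 0" using x by (auto simp: \<tau>_def)
      then show ?thesis using a[of x] False fin\<tau> by auto
    qed (use fin\<tau> in auto)
    have 2: "(\<Sum>w\<in>\<tau>. if g x = w then ?a x else 0) = ?a x"
    proof (cases "g x \<in> \<tau>")
      case False
      then have "\<not> ?a x > 0" using x by (auto simp: \<tau>_def)
      then show ?thesis using a[of x] False fin\<tau> by auto
    qed (use fin\<tau> in auto)
    show ?thesis using 1 2 by (simp add: sum.distrib)
  qed
  have sum1: "sum ?h \<tau> = 1"
  proof -
    have "sum ?h \<tau> = (\<Sum>x\<in>\<sigma>. \<Sum>w\<in>\<tau>. (if f x = w then t x - ?a x else 0) + (if g x = w then ?a x else 0))"
      unfolding h by (rule sum.swap)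
    also have "\<dots> = sum t \<sigma>" using inner by (intro sum.cong) auto
    finally show ?thesis using closed_simplexD(3)[OF t] by simp
  qed
  then have "\<tau> \<noteq> {}" by auto
  then have "is_chain R' (f ` \<sigma> \<union> g ` \<sigma>) \<tau>"
    using tot fin\<tau> unfolding is_chain_def by (auto simp: \<tau>_def)
  moreover have "?h \<in> closed_simplex \<tau>" using h0 h1 sum1 by (auto simp: closed_simplex_def)
  ultimately show ?thesis unfolding realization_points_def by blast
qed

lemma continuous_on_coord: "continuous_on S (\<lambda>z::real \<times> ('v => real). snd z v)"
proof -
  have "continuous_on UNIV (\<lambda>t::'v=>real. t v)" by simp
  then show ?thesis using continuous_on_compose2[OF _ continuous_on_snd[OF continuous_on_id]] by blast
qed

lemma continuous_on_if_const:
  "(b ==> continuous_on S f) ==> (\<not> b ==> continuous_on S g) ==> continuous_on S (\<lambda>z. if b then f z else g z)"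
  by (cases b) auto

lemma order_homotopy_step_imp_homotopic:
  assumes po: "porder R P" and po': "porder R' Q" and f: "poset_map R P R' Q f" and g: "poset_map R P R' Q g"
    and fg: "\<And>x. x \<in> P ==> R' (f x) (g x)"
  shows "homotopic_with (\<lambda>_. True) (realization R P) (realization R' Q) (realization_map f) (realization_map g)"
proof -
  let ?H = "order_homotopy R f g"
  have cont: "continuous_map (prod_topology (top_of_set {0..1}) (realization R P)) (realization R' Q) ?H"
  proof (rule continuous_map_prod_realization_into)
    fix \<sigma> assume \<sigma>: "is_chain R P \<sigma>"
    then have "finite (f ` \<sigma> \<union> g ` \<sigma>)" "f ` \<sigma> \<union> g ` \<sigma> \<subseteq> Q" using f g by (auto simp: is_chain_def poset_map_def)
    then show "\<exists>Q0. finite Q0 \<and> Q0 \<subseteq> Q \<and> (\<forall>s\<in>{0..1}. \<forall>t\<in>closed_simplex \<sigma>. ?H (s, t) \<in> realization_points R' Q0)"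
      using order_homotopy_in_points[OF po po' f g fg \<sigma>] by (intro exI[of _ "f ` \<sigma> \<union> g ` \<sigma>"]) simp
    have fin: "finite \<sigma>" using \<sigma> by (auto simp: is_chain_def)
    have m: "continuous_on ({0..1} \<times> closed_simplex \<sigma>) (\<lambda>z. moved_mass R (fst z) (snd z) x)" for x
    proof -
      have "continuous_on ({0..1} \<times> closed_simplex \<sigma>)
         (\<lambda>z. max 0 (min (snd z x) (fst z - (\<Sum>y\<in>\<sigma>. if R x y \<and> y \<noteq> x then snd z y else 0))))"
        by (intro continuous_on_max continuous_on_min continuous_on_diff continuous_on_sum
            continuous_on_if_const continuous_on_coord continuous_on_const continuous_on_fst continuous_on_id)
      then show ?thesis
        by (rule continuous_on_eq) (auto simp: moved_mass_simplex[OF fin] cong: if_cong)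
    qed
    show "continuous_on ({0..1} \<times> closed_simplex \<sigma>) ?H"
    proof (rule continuous_on_coordinatewise_then_product)
      fix w
      have "continuous_on ({0..1} \<times> closed_simplex \<sigma>)
        (\<lambda>z. \<Sum>x\<in>\<sigma>. (if f x = w then snd z x - moved_mass R (fst z) (snd z) x else 0)
            + (if g x = w then moved_mass R (fst z) (snd z) x else 0))"
      proof (rule continuous_on_sum)
        fix x
        show "continuous_on ({0..1} \<times> closed_simplex \<sigma>)
          (\<lambda>z. (if f x = w then snd z x - moved_mass R (fst z) (snd z) x else 0)
            + (if g x = w then moved_mass R (fst z) (snd z) x else 0))"
          by (intro continuous_on_add continuous_on_diff continuous_on_if_const m continuous_on_coord continuous_on_const)
      qed
      then show "continuous_on ({0..1} \<times> closed_simplex \<sigma>) (\<lambda>z. ?H z w)"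
        by (rule continuous_on_eq) (auto simp: order_homotopy_simplex[OF fin] cong: if_cong)
    qed
  qed
  have ends: "?H (0, t) = realization_map f t \<and> ?H (1, t) = realization_map g t" if t: "t \<in> realization_points R P" for t
  proof -
    obtain \<sigma> where "is_chain R P \<sigma>" "t \<in> closed_simplex \<sigma>" using t unfolding realization_points_def by auto
    then show ?thesis using order_homotopy_0 order_homotopy_1 by metis
  qed
  show ?thesis
  proof (subst homotopic_with)
    show "\<exists>h. continuous_map (prod_topology (top_of_set {0..1::real}) (realization R P)) (realization R' Q) h \<and>
        (\<forall>x\<in>topspace (realization R P). h (0, x) = realization_map f x) \<and>
        (\<forall>x\<in>topspace (realization R P). h (1, x) = realization_map g x) \<and> (\<forall>t\<in>{0..1}. True)"
      using cont ends by (intro exI[of _ ?H]) simp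
  qed simp
qed

lemma order_homotopic_imp_homotopic:
  assumes po: "porder R P" and "poset_map R P R P f" and "(order_homotopy_step R P R P)\<^sup>*\<^sup>* f g"
  shows "homotopic_with (\<lambda>_. True) (realization R P) (realization R P) (realization_map f) (realization_map g)"
  using assms(3)
proof (induction rule: rtranclp_induct)
  case base
  have "R (f x) (f x)" if "x \<in> P" for x using assms(2) po that unfolding porder_def poset_map_def Pi_iff by blast
  then show ?case by (rule order_homotopy_step_imp_homotopic[OF po po assms(2,2)])
next
  case (step y z)
  have "homotopic_with (\<lambda>_. True) (realization R P) (realization R P) (realization_map y) (realization_map z)"
  proof -
    have yz: "poset_map R P R P y" "poset_map R P R P z" using step(2) by (auto simp: order_homotopy_step_def)
    consider "\<forall>x\<in>P. R (y x) (z x)" | "\<forall>x\<in>P. R (z x) (y x)" using step(2) by (auto simp: order_homotopy_step_def)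
    then show ?thesis
    proof cases
      case 1 then show ?thesis by (intro order_homotopy_step_imp_homotopic[OF po po yz]) simp
    next
      case 2 then show ?thesis
        by (intro homotopic_with_symD[OF order_homotopy_step_imp_homotopic[OF po po yz(2,1)]]) simp
    qed
  qed
  with step(3) show ?case by (rule homotopic_with_trans)
qed

lemma order_contractible_imp_contractible:
  assumes po: "porder R P" and "order_contractible R P"
  shows "contractible_space (realization R P)"
proof -
  obtain p where p: "p \<in> P" "(order_homotopy_step R P R P)\<^sup>*\<^sup>* id (\<lambda>_. p)"
    using assms(2) by (auto simp: order_contractible_def)
  have hom: "homotopic_with (\<lambda>_. True) (realization R P) (realization R P) (realization_map id) (realization_map (\<lambda>_. p))"
    by (rule order_homotopic_imp_homotopic[OF po poset_map_id p(2)])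
  have i: "realization_map id t = id t" "realization_map (\<lambda>_. p) t = (\<lambda>w. if w = p then 1 else 0)"
    if "t \<in> realization_points R P" for t
  proof -
    obtain \<sigma> where \<sigma>: "is_chain R P \<sigma>" "t \<in> closed_simplex \<sigma>" using \<open>t \<in> _\<close> by (auto simp: realization_points_def)
    then have fin: "finite \<sigma>" by (simp add: is_chain_def)
    show "realization_map id t = id t"
    proof
      fix w show "realization_map id t w = id t w"
        using closed_simplexD(2)[OF \<sigma>(2), of w] fin by (simp add: realization_map_simplex[OF fin \<sigma>(2)])
    qed
    show "realization_map (\<lambda>_. p) t = (\<lambda>w. if w = p then 1 else 0)"
      using closed_simplexD(3)[OF \<sigma>(2)] by (auto simp: realization_map_simplex[OF fin \<sigma>(2)])
  qed
  have "homotopic_with (\<lambda>_. True) (realization R P) (realization R P) id (\<lambda>t w. if w = p then 1 else 0)"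
    by (rule homotopic_with_eq[OF hom]) (use i in auto)
  then show ?thesis unfolding contractible_space_def by blast
qed

section \<open>Deformation of a cone into the link of its apex\<close>

lemma realization_points_simplex_nonneg:
  assumes "t \<in> realization_points R P"
  shows "0 \<le> t v" "t v \<le> 1" "v \<notin> P ==> t v = 0"
proof -
  obtain \<sigma> where \<sigma>: "is_chain R P \<sigma>" "t \<in> closed_simplex \<sigma>" using assms by (auto simp: realization_points_def)
  then have fin: "finite \<sigma>" "\<sigma> \<subseteq> P" by (auto simp: is_chain_def)
  show "0 \<le> t v" "v \<notin> P ==> t v = 0" using \<sigma> fin by (auto simp: closed_simplex_def)
  show "t v \<le> 1"
  proof (cases "v \<in> \<sigma>")
    case True
    then have "t v \<le> sum t \<sigma>" using fin closed_simplexD(1)[OF \<sigma>(2)] by (intro member_le_sum) auto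
    then show ?thesis using closed_simplexD(3)[OF \<sigma>(2)] by simp
  qed (use closed_simplexD(2)[OF \<sigma>(2)] in auto)
qed

text \<open>Pushing the cone with apex \<open>p\<close> over the link of \<open>p\<close> into the link, along a contraction \<open>h\<close> of the link
  to \<open>c\<close>: while the coordinate of \<open>p\<close> shrinks to \<open>0\<close>, the remaining part moves along \<open>h\<close>, all
  the way to \<open>c\<close> near the apex.\<close>

definition cone_time :: "'v => real => ('v => real) => real" where
  "cone_time p s t = 2 * (t p * s) / (1 - t p * (1 - s))"

definition link_part :: "'v => ('v => real) => 'v => real" where
  "link_part p t = (\<lambda>v. if v = p then 0 else t v / (1 - t p))"

definition cone_base :: "'v => (real \<times> ('v => real) => 'v => real) => ('v => real) => real => ('v => real) => 'v => real" where
  "cone_base p h c s t = (if cone_time p s t \<ge> 1 then c else h (cone_time p s t, link_part p t))"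

definition cone_push :: "'v => (real \<times> ('v => real) => 'v => real) => ('v => real) => real \<times> ('v => real) => 'v => real" where
  "cone_push p h c = (\<lambda>(s, t) v. if v = p then t p * (1 - s) else (1 - t p * (1 - s)) * cone_base p h c s t v)"

text \<open>Continuity of \<open>h\<close> is asked for in the product topology. This is what a
  finite link provides, as the two topologies agree on its realization.\<close>

locale cone_contraction =
  fixes R :: "'v => 'v => bool" and p :: 'v and Lk :: "'v set" and h :: "real \<times> ('v => real) => 'v => real" and c :: "'v => real"
  assumes Rpp: "R p p" and pLk: "p \<notin> Lk" and comp: "\<And>q. q \<in> Lk ==> R q p \<or> R p q"
    and cont: "continuous_on ({0..1} \<times> realization_points R Lk) h"
    and into: "\<And>s t. s \<in> {0..1} ==> t \<in> realization_points R Lk ==> h (s, t) \<in> realization_points R Lk"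
    and h0: "\<And>t. t \<in> realization_points R Lk ==> h (0, t) = t"
    and h1: "\<And>t. t \<in> realization_points R Lk ==> h (1, t) = c"
    and c: "c \<in> realization_points R Lk"
begin

context
  fixes \<sigma> :: "'v set"
  assumes \<sigma>: "is_chain R (insert p Lk) \<sigma>" and p\<sigma>: "p \<in> \<sigma>"
begin

lemma \<sigma>_facts: "finite \<sigma>" "\<sigma> \<subseteq> insert p Lk" using \<sigma> by (auto simp: is_chain_def)

lemma apex_le1: assumes "t \<in> closed_simplex \<sigma>" shows "0 \<le> t p" "t p \<le> 1"
  using realization_points_simplex_nonneg(1,2)[of t R "insert p Lk" p] assms \<sigma> by (auto simp: realization_points_def)

lemma apex_1: assumes "t \<in> closed_simplex \<sigma>" "t p = 1" "v \<noteq> p" shows "t v = 0"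
proof -
  have "sum t \<sigma> = t p + sum t (\<sigma> - {p})" using \<sigma>_facts(1) p\<sigma> by (rule sum.remove)
  then have "sum t (\<sigma> - {p}) = 0" using closed_simplexD(3)[OF assms(1)] assms(2) by simp
  then have "\<forall>x\<in>\<sigma> - {p}. t x = 0"
    using closed_simplexD(1)[OF assms(1)] \<sigma>_facts(1) by (subst (asm) sum_nonneg_eq_0_iff) auto
  then show ?thesis using assms closed_simplexD(2)[OF assms(1)] by blast
qed

lemma link_part_in:
  assumes t: "t \<in> closed_simplex \<sigma>" and "t p < 1"
  shows "link_part p t \<in> realization_points R Lk"
proof -
  have "sum t \<sigma> = t p + sum t (\<sigma> - {p})" using \<sigma>_facts(1) p\<sigma> by (rule sum.remove)
  then have s: "sum t (\<sigma> - {p}) = 1 - t p" using closed_simplexD(3)[OF t] by simp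
  then have ne: "\<sigma> - {p} \<noteq> {}" using assms(2) by (metis diff_gt_0_iff_gt less_irrefl sum.empty)
  have "sum (link_part p t) (\<sigma> - {p}) = (\<Sum>v\<in>\<sigma> - {p}. t v / (1 - t p))"
    by (intro sum.cong) (auto simp: link_part_def)
  also have "\<dots> = 1" using s assms(2) by (simp flip: sum_divide_distrib)
  finally have "link_part p t \<in> closed_simplex (\<sigma> - {p})"
    using closed_simplexD(1,2)[OF t] assms(2) by (auto simp: closed_simplex_def link_part_def)
  moreover have "is_chain R Lk (\<sigma> - {p})" using \<sigma> ne by (auto simp: is_chain_def)
  ultimately show ?thesis by (auto simp: realization_points_def)
qed

lemma cone_time_nonneg: assumes t: "t \<in> closed_simplex \<sigma>" "s \<in> {0..1}" shows "0 \<le> cone_time p s t"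
proof -
  have "t p * (1 - s) \<le> 1" using apex_le1[OF t(1)] t(2) by (simp add: mult_le_one)
  then show ?thesis using apex_le1[OF t(1)] t(2) by (auto simp: cone_time_def)
qed

lemma cone_base_in:
  assumes t: "t \<in> closed_simplex \<sigma>" and s: "s \<in> {0..1}" and ne: "t p < 1 \<or> s > 0"
  shows "cone_base p h c s t \<in> realization_points R Lk"
proof (cases "cone_time p s t \<ge> 1")
  case False
  have "t p < 1"
  proof (rule ccontr)
    assume "\<not> t p < 1"
    then have "t p = 1" using apex_le1[OF t] by simp
    then show False using False ne s by (auto simp: cone_time_def)
  qed
  then show ?thesis using False cone_time_nonneg[OF t s] link_part_in[OF t]
    by (auto simp: cone_base_def intro!: into)
qed (auto simp: cone_base_def c)

lemma cone_push_in:
  assumes t: "t \<in> closed_simplex \<sigma>" and s: "s \<in> {0..1}"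
  shows "cone_push p h c (s, t) \<in> realization_points R (insert p Lk)"
proof (cases "t p < 1 \<or> s > 0")
  case True
  let ?a = "t p * (1 - s)"
  obtain \<rho> where \<rho>: "is_chain R Lk \<rho>" "cone_base p h c s t \<in> closed_simplex \<rho>"
    using cone_base_in[OF t s True] by (auto simp: realization_points_def)
  have p\<rho>: "p \<notin> \<rho>" and fin: "finite \<rho>" using \<rho>(1) pLk by (auto simp: is_chain_def)
  have a: "0 \<le> ?a" "?a \<le> 1" using apex_le1[OF t] s by (auto simp: mult_le_one)
  have "sum (cone_push p h c (s, t)) (insert p \<rho>) = ?a + (\<Sum>v\<in>\<rho>. (1 - ?a) * cone_base p h c s t v)"
    using p\<rho> fin by (subst sum.insert) (auto simp: cone_push_def intro!: sum.cong)
  also have "\<dots> = 1" using closed_simplexD(3)[OF \<rho>(2)] by (simp flip: sum_distrib_left)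
  finally have "cone_push p h c (s, t) \<in> closed_simplex (insert p \<rho>)"
    using a closed_simplexD(1,2)[OF \<rho>(2)] by (auto simp: closed_simplex_def cone_push_def)
  moreover have "is_chain R (insert p Lk) (insert p \<rho>)"
    using \<rho>(1) Rpp comp unfolding is_chain_def by (auto; blast)
  ultimately show ?thesis by (auto simp: realization_points_def)
next
  case False
  then have tp: "t p = 1" "s = 0" using apex_le1[OF t] s by auto
  then have "cone_push p h c (s, t) = (\<lambda>v. if v = p then 1 else 0)" by (auto simp: cone_push_def)
  moreover have "(\<lambda>v. if v = p then 1 else 0) \<in> closed_simplex {p}" by (auto simp: closed_simplex_def)
  moreover have "is_chain R (insert p Lk) {p}" using Rpp by (auto simp: is_chain_def)
  ultimately show ?thesis by (auto simp: realization_points_def)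
qed

lemma cone_push_0: assumes t: "t \<in> closed_simplex \<sigma>" shows "cone_push p h c (0, t) = t"
proof
  fix v
  show "cone_push p h c (0, t) v = t v"
  proof (cases "v = p \<or> t p = 1")
    case True
    then show ?thesis using apex_1[OF t] by (auto simp: cone_push_def)
  next
    case False
    then have "t p < 1" using apex_le1[OF t] by simp
    then show ?thesis using False link_part_in[OF t] h0
      by (simp add: cone_push_def cone_base_def cone_time_def link_part_def)
  qed
qed

lemma cone_push_1: assumes t: "t \<in> closed_simplex \<sigma>" shows "cone_push p h c (1, t) \<in> realization_points R Lk"
proof -
  have b: "cone_base p h c 1 t \<in> realization_points R Lk" using cone_base_in[OF t] by simp
  have "cone_push p h c (1, t) = cone_base p h c 1 t"
    using realization_points_simplex_nonneg(3)[OF b pLk] by (auto simp: cone_push_def)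
  then show ?thesis using b by simp
qed

text \<open>This makes the push agree with the identity on the rest of the complex, so that the
  pushes of different cones fit together.\<close>

lemma cone_push_apex_0:
  assumes t: "t \<in> closed_simplex \<sigma>" and "t p = 0" shows "cone_push p h c (s, t) = t"
proof
  fix v
  have "link_part p t = t" using assms(2) by (auto simp: link_part_def)
  then show "cone_push p h c (s, t) v = t v" using assms(2) link_part_in[OF t] h0
    by (simp add: cone_push_def cone_base_def cone_time_def)
qed

text \<open>The formula degenerates at \<open>t p = 1\<close>, where the link part has no meaning.
  For positive \<open>s\<close> the factor 2 in \<open>cone_time\<close> makes the base constantly
  \<open>c\<close> near such points; for \<open>s = 0\<close> the base is bounded and multiplied by
  a factor tending to 0.\<close>

lemma continuous_on_cone_push: "continuous_on ({0..1} \<times> closed_simplex \<sigma>) (cone_push p h c)"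
proof (rule continuous_on_coordinatewise_then_product)
  fix v
  let ?S = "{0..1::real} \<times> closed_simplex \<sigma>"
  let ?a = "\<lambda>z::real \<times> ('v => real). snd z p * (1 - fst z)"
  have ca: "continuous_on A ?a" for A
    by (intro continuous_on_mult continuous_on_coord continuous_on_diff continuous_on_const continuous_on_fst continuous_on_id)
  have cas: "continuous_on A (\<lambda>z::real \<times> ('v => real). snd z p * fst z)" for A
    by (intro continuous_on_mult continuous_on_coord continuous_on_fst continuous_on_id)
  show "continuous_on ?S (\<lambda>z. cone_push p h c z v)"
  proof (cases "v = p")
    case True
    then show ?thesis using ca[of ?S] by (simp add: cone_push_def split_def)
  next
    case False
    let ?F = "\<lambda>z. (1 - ?a z) * cone_base p h c (fst z) (snd z) v"
    have F: "cone_push p h c z v = ?F z" for z using False by (simp add: cone_push_def split_def)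
    have "(?F \<longlongrightarrow> ?F z) (at z within ?S)" if z: "z \<in> ?S" for z
    proof -
      obtain s t where st: "z = (s, t)" "s \<in> {0..1}" "t \<in> closed_simplex \<sigma>" using z by auto
      have local: "(?F \<longlongrightarrow> ?F z) (at z within ?S)"
        if U: "open U" "z \<in> U" and cU: "continuous_on (?S \<inter> U) f" and eq: "\<And>y. y \<in> ?S \<inter> U ==> f y = ?F y" for U f
      proof -
        have "continuous_on (?S \<inter> U) ?F" using cU eq by (rule continuous_on_eq)
        then have "(?F \<longlongrightarrow> ?F z) (at z within (?S \<inter> U))"
          using z U unfolding continuous_on_def by blast
        moreover have "at z within (?S \<inter> U) = at z within ?S"
          using U by (intro at_within_nhd[of z U]) auto
        ultimately show ?thesis by simp
      qed
      consider "t p < 1" | "t p = 1" "s > 0" | "t p = 1" "s = 0"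
        using apex_le1[OF st(3)] st(2) by (fastforce simp: less_le)
      then show ?thesis
      proof cases
        case 1
        let ?U = "{z::real \<times> ('v => real). snd z p < 1}"
        show ?thesis
        proof (rule local)
          show "open ?U" by (intro open_Collect_less continuous_on_coord continuous_on_const)
          show "z \<in> ?U" using 1 st by simp
          \<comment> \<open>Cutting the time off at 1 absorbs the case distinction in
            \<open>cone_base\<close>, because \<open>h\<close> ends at \<open>c\<close>.\<close>
          let ?f = "\<lambda>z. (1 - ?a z) * h (min 1 (cone_time p (fst z) (snd z)), link_part p (snd z)) v"
          have pos: "1 - ?a y > 0" if "y \<in> ?S \<inter> ?U" for y
          proof -
            have "0 \<le> snd y p" "snd y p < 1" "0 \<le> fst y" using that apex_le1 by auto
            then have "?a y \<le> snd y p * 1" by (intro mult_left_mono) auto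
            then show ?thesis using \<open>snd y p < 1\<close> by simp
          qed
          have m: "(min 1 (cone_time p (fst y) (snd y)), link_part p (snd y)) \<in> {0..1} \<times> realization_points R Lk" if "y \<in> ?S \<inter> ?U" for y
            using that cone_time_nonneg[of "snd y" "fst y"] link_part_in[of "snd y"] by auto
          have ct: "continuous_on (?S \<inter> ?U) (\<lambda>z. cone_time p (fst z) (snd z))"
            unfolding cone_time_def using pos
            by (intro continuous_on_divide continuous_on_mult cas continuous_on_const continuous_on_diff ca) force+
          have cl: "continuous_on (?S \<inter> ?U) (\<lambda>z. link_part p (snd z))"
          proof (rule continuous_on_coordinatewise_then_product)
            fix w show "continuous_on (?S \<inter> ?U) (\<lambda>z. link_part p (snd z) w)"
              unfolding link_part_def
              by (intro continuous_on_if_const continuous_on_const continuous_on_divide continuous_on_coord continuous_on_diff) auto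
          qed
          have "continuous_on (?S \<inter> ?U) (\<lambda>z. h (min 1 (cone_time p (fst z) (snd z)), link_part p (snd z)))"
            using m by (intro continuous_on_compose2[OF cont continuous_on_Pair[OF continuous_on_min[OF continuous_on_const ct] cl]]) blast
          then have "continuous_on (?S \<inter> ?U) (\<lambda>z. h (min 1 (cone_time p (fst z) (snd z)), link_part p (snd z)) v)"
            by (rule continuous_on_product_then_coordinatewise)
          then show "continuous_on (?S \<inter> ?U) ?f" by (intro continuous_on_mult continuous_on_diff continuous_on_const ca)
          fix y assume y: "y \<in> ?S \<inter> ?U"
          then have "link_part p (snd y) \<in> realization_points R Lk" by (auto intro: link_part_in)
          then show "?f y = ?F y" using h1 by (auto simp: cone_base_def min_def)
        qed
      next
        case 2
        \<comment> \<open>On this set the numerator of \<open>cone_time\<close> is at least its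
          denominator, so the base is \<open>c\<close> throughout.\<close>
        let ?U = "{z::real \<times> ('v => real). 1 - snd z p < snd z p * fst z}"
        show ?thesis
        proof (rule local)
          show "open ?U" by (intro open_Collect_less cas continuous_on_diff continuous_on_coord continuous_on_const)
          show "z \<in> ?U" using 2 st by simp
          show "continuous_on (?S \<inter> ?U) (\<lambda>z. (1 - ?a z) * c v)"
            by (intro continuous_on_mult continuous_on_diff continuous_on_const ca)
          fix y assume y: "y \<in> ?S \<inter> ?U"
          have "1 - snd y p \<ge> 0" "1 - snd y p < snd y p * fst y" using y apex_le1[of "snd y"] by auto
          then have "1 - ?a y > 0" "1 - ?a y \<le> 2 * (snd y p * fst y)" by (auto simp: algebra_simps)
          then have "cone_time p (fst y) (snd y) \<ge> 1" by (simp add: cone_time_def)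
          then show "(1 - ?a y) * c v = ?F y" by (simp add: cone_base_def)
        qed
      next
        case 3
        have z0: "?F z = 0" using 3 st by simp
        have bd: "norm (?F y) \<le> 1 - ?a y" if "y \<in> ?S" for y
        proof (cases "snd y p < 1 \<or> fst y > 0")
          case True
          have y: "snd y \<in> closed_simplex \<sigma>" "fst y \<in> {0..1}" using \<open>y \<in> ?S\<close> by auto
          have "cone_base p h c (fst y) (snd y) \<in> realization_points R Lk" by (rule cone_base_in[OF y True])
          note b = realization_points_simplex_nonneg(1,2)[OF this, of v]
          have "?a y \<le> 1" using apex_le1[OF y(1)] y(2) by (simp add: mult_le_one)
          then show ?thesis using b by (simp add: abs_mult mult_left_le)
        next
          case False
          have "snd y p = 1" "fst y = 0" using False \<open>y \<in> ?S\<close> apex_le1[of "snd y"] by auto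
          then show ?thesis by simp
        qed
        have "((\<lambda>y. 1 - ?a y) \<longlongrightarrow> 1 - ?a z) (at z within ?S)"
        proof -
          have "continuous_on ?S (\<lambda>y. 1 - ?a y)" by (intro continuous_on_diff continuous_on_const ca)
          then show ?thesis using z unfolding continuous_on_def by blast
        qed
        then have "((\<lambda>y. 1 - ?a y) \<longlongrightarrow> 0) (at z within ?S)" using 3 st by simp
        moreover have "eventually (\<lambda>y. norm (?F y) \<le> 1 - ?a y) (at z within ?S)"
          using bd by (auto simp: eventually_at_filter)
        ultimately have "(?F \<longlongrightarrow> 0) (at z within ?S)" by (rule Lim_null_comparison[rotated])
        then show ?thesis unfolding z0 .
      qed
    qed
    then show ?thesis unfolding F continuous_on_def by blast
  qed
qed

end

end

lemma contraction_of_finite_realization: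
  assumes fin: "finite L" and con: "contractible_space (realization R L)" and ne: "realization_points R L \<noteq> {}"
  shows "\<exists>h c. continuous_on ({0..1::real} \<times> realization_points R L) h
    \<and> (\<forall>s\<in>{0..1}. \<forall>t\<in>realization_points R L. h (s, t) \<in> realization_points R L)
    \<and> (\<forall>t\<in>realization_points R L. h (0, t) = t \<and> h (1, t) = c) \<and> c \<in> realization_points R L"
proof -
  let ?K = "realization_points R L"
  obtain c where "homotopic_with (\<lambda>_. True) (top_of_set ?K) (top_of_set ?K) id (\<lambda>_. c)"
    using con unfolding realization_finite[OF fin] contractible_space_def by blast
  then obtain h where h: "continuous_map (prod_topology (top_of_set {0..1::real}) (top_of_set ?K)) (top_of_set ?K) h"
    "\<forall>x. h (0, x) = id x" "\<forall>x. h (1, x) = c"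
    unfolding homotopic_with_def by blast
  have 1: "continuous_on ({0..1} \<times> ?K) h" "h ` ({0..1} \<times> ?K) \<subseteq> ?K"
    using h(1) by (auto simp: prod_topology_subtopology_eu subtopology_subtopology continuous_map_subtopology_eu)
  obtain x where "x \<in> ?K" using ne by blast
  then have "h (1, x) \<in> ?K" using 1(2) by auto
  then have "c \<in> ?K" using h(3) by simp
  then show ?thesis using 1 h(2,3) by (intro exI[of _ h] exI[of _ c]) auto
qed

lemma vertex_in_realization_points:
  assumes "p \<in> P" "R p p" shows "(\<lambda>v. if v = p then 1 else 0) \<in> realization_points R P"
proof -
  have "is_chain R P {p}" using assms by (auto simp: is_chain_def)
  moreover have "(\<lambda>v. if v = p then 1 else 0) \<in> closed_simplex {p}" by (auto simp: closed_simplex_def)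
  ultimately show ?thesis by (auto simp: realization_points_def)
qed

text \<open>The elements of \<open>T\<close> are pairwise incomparable, so a chain contains at most
  one of them and all cones can be pushed at the same time. The deformation is stationary on
  \<open>P0\<close>, which later allows infinitely many of them to be put together.\<close>

lemma attach_cones:
  fixes R :: "'v => 'v => bool"
  assumes po: "porder R P" and P: "P = P0 \<union> T" and disj: "P0 \<inter> T = {}"
    and anti: "\<And>p q. p \<in> T ==> q \<in> T ==> R p q ==> p = q"
    and link: "\<And>p. p \<in> T ==> finite {q \<in> P0. R q p \<or> R p q} \<and> {q \<in> P0. R q p \<or> R p q} \<noteq> {} \<and>
       contractible_space (realization R {q \<in> P0. R q p \<or> R p q})"
  shows "\<exists>K. continuous_map (prod_topology (top_of_set {0..1::real}) (realization R P)) (realization R P) K \<and>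
     (\<forall>t\<in>realization_points R P. K (0, t) = t \<and> K (1, t) \<in> realization_points R P0) \<and>
     (\<forall>s. \<forall>t\<in>realization_points R P0. K (s, t) = t)"
proof -
  define Lk where "Lk = (\<lambda>p. {q \<in> P0. R q p \<or> R p q})"
  have refl: "R p p" if "p \<in> P" for p using po that by (auto simp: porder_def)
  have "\<exists>h c. cone_contraction R p (Lk p) h c" if p: "p \<in> T" for p
  proof -
    obtain q where "q \<in> Lk p" "R q q" using link[OF p] refl P unfolding Lk_def by blast
    then have "realization_points R (Lk p) \<noteq> {}" using vertex_in_realization_points by fastforce
    moreover have "finite (Lk p)" "contractible_space (realization R (Lk p))" using link[OF p] by (auto simp: Lk_def)
    ultimately obtain h c where "continuous_on ({0..1::real} \<times> realization_points R (Lk p)) h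
        \<and> (\<forall>s\<in>{0..1}. \<forall>t\<in>realization_points R (Lk p). h (s, t) \<in> realization_points R (Lk p))
        \<and> (\<forall>t\<in>realization_points R (Lk p). h (0, t) = t \<and> h (1, t) = c) \<and> c \<in> realization_points R (Lk p)"
      using contraction_of_finite_realization by metis
    then have "cone_contraction R p (Lk p) h c"
      using p P disj refl[of p] unfolding cone_contraction_def Lk_def by auto
    then show ?thesis by blast
  qed
  then obtain h c where hc: "\<And>p. p \<in> T ==> cone_contraction R p (Lk p) (h p) (c p)" by metis
  \<comment> \<open>The apex is recovered from the point itself, as the only element of
    \<open>T\<close> with nonzero coordinate.\<close>
  define K where "K = (\<lambda>(s, t). if \<exists>p\<in>T. t p \<noteq> 0 then let p = SOME p. p \<in> T \<and> t p \<noteq> 0 in cone_push p (h p) (c p) (s, t) else t)"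
  have K0: "K (s, t) = t" if "is_chain R P \<sigma>" "\<sigma> \<inter> T = {}" "t \<in> closed_simplex \<sigma>" for \<sigma> s t
    using closed_simplexD(2)[OF that(3)] that(2) unfolding K_def by fastforce
  have chain: "is_chain R (insert p (Lk p)) \<sigma>" if \<sigma>: "is_chain R P \<sigma>" and p: "p \<in> T" "p \<in> \<sigma>" for \<sigma> p
    using \<sigma> p anti P unfolding is_chain_def Lk_def by blast
  have K1: "K (s, t) = cone_push p (h p) (c p) (s, t)"
    if \<sigma>: "is_chain R P \<sigma>" and p: "p \<in> T" "p \<in> \<sigma>" and t: "t \<in> closed_simplex \<sigma>" for \<sigma> s t p
  proof -
    have uniq: "q = p" if "q \<in> T" "t q \<noteq> 0" for q
    proof -
      have "q \<in> \<sigma>" using closed_simplexD(2)[OF t] that by blast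
      then show ?thesis using \<sigma> p anti[of p q] anti[of q p] \<open>q \<in> T\<close> unfolding is_chain_def by metis
    qed
    show ?thesis
    proof (cases "t p = 0")
      case True
      then have "\<not> (\<exists>p\<in>T. t p \<noteq> 0)" using uniq by blast
      then have "K (s, t) = t" by (simp add: K_def)
      then show ?thesis
        using cone_contraction.cone_push_apex_0[OF hc[OF p(1)] chain[OF \<sigma> p] p(2) t True] by simp
    next
      case False
      then have "(SOME p. p \<in> T \<and> t p \<noteq> 0) = p" using p(1) by (intro some_equality) (simp, use uniq in blast)
      then show ?thesis using False p by (auto simp: K_def Let_def)
    qed
  qed
  have subL: "insert p (Lk p) \<subseteq> P" "Lk p \<subseteq> P0" if "p \<in> T" for p using that P by (auto simp: Lk_def)
  have "continuous_map (prod_topology (top_of_set {0..1::real}) (realization R P)) (realization R P) K"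
  proof (rule continuous_map_prod_realization_into)
    fix \<sigma> assume \<sigma>: "is_chain R P \<sigma>"
    show "\<exists>Q0. finite Q0 \<and> Q0 \<subseteq> P \<and> (\<forall>s\<in>{0..1}. \<forall>t\<in>closed_simplex \<sigma>. K (s, t) \<in> realization_points R Q0)"
    proof (cases "\<sigma> \<inter> T = {}")
      case True
      have "is_chain R \<sigma> \<sigma>" using \<sigma> by (auto simp: is_chain_def)
      then show ?thesis using K0[OF \<sigma> True] \<sigma>
        by (intro exI[of _ \<sigma>]) (auto simp: is_chain_def realization_points_def)
    next
      case False
      then obtain p where p: "p \<in> T" "p \<in> \<sigma>" by blast
      have "finite (insert p (Lk p))" using link[OF p(1)] by (auto simp: Lk_def)
      then show ?thesis using K1[OF \<sigma> p] cone_contraction.cone_push_in[OF hc[OF p(1)] chain[OF \<sigma> p] p(2)] subL[OF p(1)]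
        by (intro exI[of _ "insert p (Lk p)"]) auto
    qed
    show "continuous_on ({0..1} \<times> closed_simplex \<sigma>) K"
    proof (cases "\<sigma> \<inter> T = {}")
      case True
      have "continuous_on ({0..1} \<times> closed_simplex \<sigma>) snd" by (intro continuous_intros)
      then show ?thesis by (rule continuous_on_eq) (use K0[OF \<sigma> True] in auto)
    next
      case False
      then obtain p where p: "p \<in> T" "p \<in> \<sigma>" by blast
      show ?thesis
        by (rule continuous_on_eq[OF cone_contraction.continuous_on_cone_push[OF hc[OF p(1)] chain[OF \<sigma> p] p(2)]])
           (use K1[OF \<sigma> p] in auto)
    qed
  qed
  moreover have "K (0, t) = t \<and> K (1, t) \<in> realization_points R P0" if t: "t \<in> realization_points R P" for t
  proof -
    obtain \<sigma> where \<sigma>: "is_chain R P \<sigma>" "t \<in> closed_simplex \<sigma>" using t by (auto simp: realization_points_def)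
    show ?thesis
    proof (cases "\<sigma> \<inter> T = {}")
      case True
      then have "is_chain R P0 \<sigma>" using \<sigma>(1) P by (auto simp: is_chain_def)
      then show ?thesis using K0[OF \<sigma>(1) True \<sigma>(2)] \<sigma>(2) by (auto simp: realization_points_def)
    next
      case False
      then obtain p where p: "p \<in> T" "p \<in> \<sigma>" by blast
      note cc = hc[OF p(1)] chain[OF \<sigma>(1) p] p(2) \<sigma>(2)
      have "K (1, t) \<in> realization_points R (Lk p)"
        using K1[OF \<sigma>(1) p \<sigma>(2)] cone_contraction.cone_push_1[OF cc] by simp
      then show ?thesis using K1[OF \<sigma>(1) p \<sigma>(2)] cone_contraction.cone_push_0[OF cc]
          realization_points_mono[OF subL(2)[OF p(1)]] by auto
    qed
  qed
  moreover have "K (s, t) = t" if t: "t \<in> realization_points R P0" for s t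
  proof -
    obtain \<sigma> where \<sigma>: "is_chain R P0 \<sigma>" "t \<in> closed_simplex \<sigma>" using t by (auto simp: realization_points_def)
    then show ?thesis using K0[of \<sigma> t s] disj P by (auto simp: is_chain_def)
  qed
  ultimately show ?thesis by blast
qed

section \<open>Contraction along an infinite filtration by rank\<close>

lemma continuous_map_realization_inclusion:
  assumes "P' \<subseteq> P" shows "continuous_map (realization R P') (realization R P) id"
  using continuous_map_from_subtopology[OF continuous_map_id, of "realization R P" "realization_points R P'"]
  unfolding subtopology_realization[OF assms] .

lemma continuous_map_into_subrealization:
  assumes "P' \<subseteq> P" "continuous_map X (realization R P) f" "f ` topspace X \<subseteq> realization_points R P'"
  shows "continuous_map X (realization R P') f"
  using assms(2,3) unfolding subtopology_realization[OF assms(1), symmetric]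
  by (intro continuous_map_into_subtopology) auto

text \<open>The step from \<open>X i\<close> to \<open>X (Suc i)\<close> is carried out during the time interval
  between \<open>2 powr -(i+2)\<close> and \<open>2 powr -(i+1)\<close>, so that the homotopies
  for all \<open>i\<close> fit together.\<close>

primrec telescope :: "(real \<times> 'x => 'x) => (nat => real \<times> 'x => 'x) => nat => real \<times> 'x => 'x" where
  "telescope c K 0 = (\<lambda>(s, t). c (max 0 (2 * s - 1), t))"
| "telescope c K (Suc i) = (\<lambda>(s, t). if s \<le> (1/2)^Suc i then K i (max 0 (2^(i+2) * s - 1), t)
      else telescope c K i (s, K i (1, t)))"

text \<open>The next stage of the filtration arises by attaching cones over the lower links, and
  each such step can be undone by a deformation. A chain has bounded rank, so on each simplex only
  finitely many of these deformations act, which suffices for continuity in the weak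
  topology.\<close>

theorem morse_contractible:
  fixes R :: "'v => 'v => bool" and r :: "'v => nat"
  assumes po: "porder R P"
    and base: "contractible_space (realization R {p \<in> P. r p = 0})" "{p \<in> P. r p = 0} \<noteq> {}"
    and anti: "\<And>p q. p \<in> P ==> q \<in> P ==> R p q ==> r p = r q ==> r p > 0 ==> p = q"
    and link: "\<And>p. p \<in> P ==> r p > 0 ==> finite {q \<in> P. r q < r p \<and> (R q p \<or> R p q)} \<and>
       order_contractible R {q \<in> P. r q < r p \<and> (R q p \<or> R p q)}"
  shows "contractible_space (realization R P)"
proof -
  define X where "X = (\<lambda>i. {p \<in> P. r p \<le> i})"
  have XP: "X i \<subseteq> P" for i by (auto simp: X_def)
  have XS: "X i \<subseteq> X (Suc i)" for i by (auto simp: X_def)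
  have "\<exists>K. continuous_map (prod_topology (top_of_set {0..1::real}) (realization R (X (Suc i)))) (realization R (X (Suc i))) K \<and>
     (\<forall>t\<in>realization_points R (X (Suc i)). K (0, t) = t \<and> K (1, t) \<in> realization_points R (X i)) \<and>
     (\<forall>s. \<forall>t\<in>realization_points R (X i). K (s, t) = t)" for i
  proof (rule attach_cones[where T = "{p \<in> P. r p = Suc i}"])
    show "porder R (X (Suc i))" by (rule porder_subset[OF po XP])
    show "X (Suc i) = X i \<union> {p \<in> P. r p = Suc i}" by (auto simp: X_def)
    show "X i \<inter> {p \<in> P. r p = Suc i} = {}" by (auto simp: X_def)
    show "p = q" if "p \<in> {p \<in> P. r p = Suc i}" "q \<in> {p \<in> P. r p = Suc i}" "R p q" for p q
      using anti that by auto
    fix p assume p: "p \<in> {p \<in> P. r p = Suc i}"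
    have eq: "{q \<in> X i. R q p \<or> R p q} = {q \<in> P. r q < r p \<and> (R q p \<or> R p q)}" using p by (auto simp: X_def)
    have oc: "finite {q \<in> X i. R q p \<or> R p q}" "order_contractible R {q \<in> X i. R q p \<or> R p q}"
      using link[of p] p unfolding eq by auto
    have "porder R {q \<in> X i. R q p \<or> R p q}" by (rule porder_subset[OF po]) (auto simp: X_def)
    then show "finite {q \<in> X i. R q p \<or> R p q} \<and> {q \<in> X i. R q p \<or> R p q} \<noteq> {} \<and>
         contractible_space (realization R {q \<in> X i. R q p \<or> R p q})"
      using oc order_contractible_imp_contractible order_contractible_nonempty by blast
  qed
  then obtain K where K: "\<And>i. continuous_map (prod_topology (top_of_set {0..1::real}) (realization R (X (Suc i)))) (realization R (X (Suc i))) (K i)"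
    and K01: "\<And>i t. t \<in> realization_points R (X (Suc i)) ==> K i (0, t) = t \<and> K i (1, t) \<in> realization_points R (X i)"
    and Kst: "\<And>i s t. t \<in> realization_points R (X i) ==> K i (s, t) = t"
    by metis
  have X0: "X 0 = {p \<in> P. r p = 0}" by (auto simp: X_def)
  obtain b where "homotopic_with (\<lambda>_. True) (realization R (X 0)) (realization R (X 0)) id (\<lambda>_. b)"
    using base(1) unfolding X0 contractible_space_def by blast
  then obtain c where c: "continuous_map (prod_topology (top_of_set {0..1::real}) (realization R (X 0))) (realization R (X 0)) c"
    "\<And>x. c (0, x) = x" "\<And>x. c (1, x) = b"
    unfolding homotopic_with_def by auto
  define F where "F = telescope c K"
  let ?I = "top_of_set {0..1::real}"
  have F1: "F i (1, t) = b" for i t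
  proof (induction i arbitrary: t)
    case (Suc i)
    have "\<not> 1 \<le> (1/2::real)^Suc i" using power_Suc_less_one[of "1/2::real" i] by simp
    then show ?case using Suc by (simp add: F_def del: power_Suc)
  qed (simp add: F_def c)
  \<comment> \<open>Before this time only steps of larger index are scheduled. The identity makes
    the two branches of the next stage agree at the break point and gives the correct value at time
    0.\<close>
  have Fst: "F i (s, t) = t" if "t \<in> realization_points R (X i)" "s \<in> {0..1}" "s \<le> (1/2)^Suc i" for i s t
  proof (cases i)
    case 0
    then have "max 0 (2 * s - 1) = 0" using that by auto
    then show ?thesis using 0 by (simp add: F_def c)
  next
    case (Suc j)
    have "2^(j+2) * s \<le> 2^(j+2) * (1/2)^Suc i" using that by (intro mult_left_mono) auto
    also have "\<dots> = 1" using Suc by (simp add: power_one_over field_simps)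
    finally have "max 0 (2^(j+2) * s - 1) = 0" by simp
    moreover have "s \<le> (1/2)^Suc j"
      using that Suc by (auto intro: order_trans[OF _ power_decreasing[of "Suc j" "Suc i" "1/2::real"]])
    ultimately show ?thesis using Suc K01[of t j] that by (simp add: F_def)
  qed
  have Fcont: "continuous_map (prod_topology ?I (realization R (X i))) (realization R (X i)) (F i)" for i
  proof (induction i)
    case 0
    have "continuous_map (prod_topology ?I (realization R (X 0))) (prod_topology ?I (realization R (X 0))) (\<lambda>z. (max 0 (2 * fst z - 1), snd z))"
    proof (intro continuous_map_pairedI continuous_map_into_subtopology continuous_map_snd)
      show "continuous_map (prod_topology ?I (realization R (X 0))) euclideanreal (\<lambda>z. max 0 (2 * fst z - 1))"
        using continuous_map_into_fulltopology[OF continuous_map_fst]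
        by (intro continuous_map_real_max continuous_map_real_mult continuous_map_diff continuous_map_canonical_const) auto
    qed auto
    then have "continuous_map (prod_topology ?I (realization R (X 0))) (realization R (X 0)) (c \<circ> (\<lambda>z. (max 0 (2 * fst z - 1), snd z)))"
      using c(1) continuous_map_compose by blast
    then show ?case by (simp add: F_def o_def split_def)
  next
    case (Suc i)
    let ?X = "prod_topology ?I (realization R (X (Suc i)))"
    have fstc: "continuous_map ?X euclideanreal fst"
      by (rule continuous_map_into_fulltopology[OF continuous_map_fst])
    have "continuous_map ?X (realization R (X (Suc i)))
       (\<lambda>z. if fst z \<le> (1/2)^Suc i then K i (max 0 (2^(i+2) * fst z - 1), snd z) else F i (fst z, K i (1, snd z)))"
    proof (rule continuous_map_cases_le[OF fstc continuous_map_canonical_const])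
      let ?Y = "subtopology ?X {x \<in> topspace ?X. fst x \<le> (1/2)^Suc i}"
      have "continuous_map ?Y ?X (\<lambda>z. (max 0 (2^(i+2) * fst z - 1), snd z))"
      proof (intro continuous_map_pairedI continuous_map_into_subtopology)
        show "continuous_map ?Y euclideanreal (\<lambda>z. max 0 (2^(i+2) * fst z - 1))"
          using continuous_map_from_subtopology[OF fstc]
          by (intro continuous_map_real_max continuous_map_real_mult continuous_map_diff continuous_map_canonical_const) auto
        show "continuous_map ?Y (realization R (X (Suc i))) snd"
          by (intro continuous_map_from_subtopology continuous_map_snd)
        show "(\<lambda>z. max 0 (2^(i+2) * fst z - 1)) \<in> topspace ?Y \<rightarrow> {0..1}"
        proof
          fix z assume "z \<in> topspace ?Y"
          then have "fst z \<le> (1/2)^Suc i" by auto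
          then have "2^(i+2) * fst z \<le> 2^(i+2) * (1/2)^Suc i" by (intro mult_left_mono) auto
          also have "\<dots> = 2" by (simp add: power_one_over field_simps)
          finally show "max 0 (2^(i+2) * fst z - 1) \<in> {0..1}" by simp
        qed
      qed
      from continuous_map_compose[OF this K[of i]]
      show "continuous_map ?Y (realization R (X (Suc i))) (\<lambda>z. K i (max 0 (2^(i+2) * fst z - 1), snd z))"
        by (simp add: o_def)
    next
      have k1: "continuous_map (realization R (X (Suc i))) (realization R (X i)) (\<lambda>t. K i (1, t))"
      proof (rule continuous_map_into_subrealization[OF XS])
        have "continuous_map (realization R (X (Suc i))) ?X (\<lambda>t. (1, t))"
          by (intro continuous_map_pairedI continuous_map_id[unfolded id_def] continuous_map_const[THEN iffD2]) auto
        from continuous_map_compose[OF this K[of i]]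
        show "continuous_map (realization R (X (Suc i))) (realization R (X (Suc i))) (\<lambda>t. K i (1, t))"
          by (simp add: o_def)
        show "(\<lambda>t. K i (1, t)) ` topspace (realization R (X (Suc i))) \<subseteq> realization_points R (X i)"
          using K01 by auto
      qed
      have "continuous_map ?X (prod_topology ?I (realization R (X i))) (\<lambda>z. (fst z, K i (1, snd z)))"
        using continuous_map_compose[OF continuous_map_snd k1]
        by (intro continuous_map_pairedI continuous_map_fst) (simp add: o_def)
      from continuous_map_compose[OF this Suc.IH]
      have "continuous_map ?X (realization R (X i)) (\<lambda>z. F i (fst z, K i (1, snd z)))" by (simp add: o_def)
      from continuous_map_compose[OF this continuous_map_realization_inclusion[OF XS]]
      have "continuous_map ?X (realization R (X (Suc i))) (\<lambda>z. F i (fst z, K i (1, snd z)))" by (simp add: o_def)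
      then show "continuous_map (subtopology ?X {x \<in> topspace ?X. (1/2)^Suc i \<le> fst x}) (realization R (X (Suc i))) (\<lambda>z. F i (fst z, K i (1, snd z)))"
        by (rule continuous_map_from_subtopology)
    next
      fix z assume z: "z \<in> topspace ?X" "fst z = (1/2)^Suc i"
      have e: "2^(i+2) * (1/2)^Suc i = (2::real)" by (simp add: power_one_over field_simps)
      have "max 0 (2^(i+2) * fst z - 1) = 1" unfolding z(2) e by simp
      moreover have "K i (1, snd z) \<in> realization_points R (X i)" using K01 z by auto
      then have "F i (fst z, K i (1, snd z)) = K i (1, snd z)" using z by (intro Fst) auto
      ultimately show "K i (max 0 (2^(i+2) * fst z - 1), snd z) = F i (fst z, K i (1, snd z))" by simp
    qed
    then show ?case unfolding F_def telescope.simps split_def .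
  qed
  \<comment> \<open>Step \<open>i\<close> does not move the points of \<open>X i\<close>, so the
    later stage restricts to the earlier one.\<close>
  have FSuc: "F (Suc i) (s, t) = F i (s, t)" if "t \<in> realization_points R (X i)" "s \<in> {0..1}" for i s t
    using that Kst[OF that(1)] Fst[OF that] by (auto simp: F_def)
  have Fge: "F j (s, t) = F i (s, t)" if "i \<le> j" "t \<in> realization_points R (X i)" "s \<in> {0..1}" for i j s t
    using that(1)
  proof (induction rule: dec_induct)
    case (step k)
    have "X i \<subseteq> X k" using step(1) by (auto simp: X_def)
    then have "t \<in> realization_points R (X k)" using that(2) realization_points_mono by blast
    then show ?case using FSuc[OF _ that(3)] step by simp
  qed simp
  \<comment> \<open>Any stage containing the point gives the same value; taking the least one only
    serves to have a definition.\<close>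
  define H where "H = (\<lambda>(s, t). F (LEAST i. t \<in> realization_points R (X i)) (s, t))"
  have HF: "H (s, t) = F i (s, t)" if "t \<in> realization_points R (X i)" "s \<in> {0..1}" for i s t
  proof -
    let ?m = "LEAST i. t \<in> realization_points R (X i)"
    have "?m \<le> i" by (rule Least_le) fact
    moreover have "t \<in> realization_points R (X ?m)" by (rule LeastI) fact
    ultimately show ?thesis using Fge[of ?m i t s] that by (simp add: H_def)
  qed
  have ex: "\<exists>i. is_chain R (X i) \<sigma>" if "is_chain R P \<sigma>" for \<sigma>
    using that by (intro exI[of _ "Max (r ` \<sigma>)"]) (auto simp: is_chain_def X_def)
  have "continuous_map (prod_topology ?I (realization R P)) (realization R P) H"
  proof (rule continuous_map_prod_realization)
    fix \<sigma> assume "is_chain R P \<sigma>"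
    then obtain i where i: "is_chain R (X i) \<sigma>" using ex by blast
    then have sub: "closed_simplex \<sigma> \<subseteq> realization_points R (X i)" by (rule closed_simplex_subset_points)
    have "is_chain R \<sigma> \<sigma>" "finite \<sigma>" "\<sigma> \<subseteq> X i" using i by (auto simp: is_chain_def)
    then have "continuous_map (top_of_set (closed_simplex \<sigma>)) (realization R (X i)) id"
      by (intro continuous_map_into_realization[of \<sigma>]) (auto simp: realization_points_def)
    from continuous_map_compose[OF continuous_map_snd this, of ?I]
    have "continuous_map (prod_topology ?I (top_of_set (closed_simplex \<sigma>))) (realization R (X i)) snd"
      unfolding id_comp .
    then have "continuous_map (prod_topology ?I (top_of_set (closed_simplex \<sigma>))) (prod_topology ?I (realization R (X i))) (\<lambda>z. (fst z, snd z))"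
      by (intro continuous_map_pairedI continuous_map_fst)
    from continuous_map_compose[OF continuous_map_compose[OF this Fcont[of i]] continuous_map_realization_inclusion[OF XP]]
    have "continuous_map (prod_topology ?I (top_of_set (closed_simplex \<sigma>))) (realization R P) (id \<circ> (F i \<circ> (\<lambda>z. (fst z, snd z))))" .
    then have "continuous_map (top_of_set ({0..1} \<times> closed_simplex \<sigma>)) (realization R P) (F i)"
      by (simp add: o_def prod_topology_subtopology_eu)
    then show "continuous_map (top_of_set ({0..1} \<times> closed_simplex \<sigma>)) (realization R P) H"
      by (rule continuous_map_eq) (use HF sub in auto)
  qed
  moreover have "H (0, t) = t \<and> H (1, t) = b" if t: "t \<in> realization_points R P" for t
  proof -
    obtain \<sigma> where "is_chain R P \<sigma>" and \<sigma>: "t \<in> closed_simplex \<sigma>" using t by (auto simp: realization_points_def)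
    then obtain i where "is_chain R (X i) \<sigma>" using ex by blast
    with \<sigma> have "t \<in> realization_points R (X i)" by (auto simp: realization_points_def)
    then show ?thesis using HF[of t i 0] HF[of t i 1] Fst[of t i 0] F1 by simp
  qed
  ultimately have "homotopic_with (\<lambda>_. True) (realization R P) (realization R P) id (\<lambda>_. b)"
    by (subst homotopic_with) (simp, intro exI[of _ H], simp)
  then show ?thesis unfolding contractible_space_def by blast
qed

section \<open>Flag complexes of moves\<close>

text \<open>Ordered by inclusion, this is for finite \<open>V\<close> the face poset of a clique
  complex, whose realization is the barycentric subdivision.\<close>

definition flag :: "'v set => ('v => 'v => bool) => 'v set set" where
  "flag V E = {\<sigma>. \<sigma> \<subseteq> V \<and> \<sigma> \<noteq> {} \<and> (\<forall>u\<in>\<sigma>. \<forall>v\<in>\<sigma>. E u v)}"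

lemma porder_subset_order: "porder (\<subseteq>) P"
  by (auto simp: porder_def)

lemma flag_cone:
  assumes "c \<in> V" "\<And>u. u \<in> V ==> E u c \<and> E c u"
  shows "order_contractible (\<subseteq>) (flag V E)"
proof (rule order_contractible_cone_up[where p = "{c}" and f = "insert c", OF porder_subset_order])
  show "{c} \<in> flag V E" using assms by (auto simp: flag_def)
  show "poset_map (\<subseteq>) (flag V E) (\<subseteq>) (flag V E) (insert c)"
    using assms unfolding flag_def poset_map_def by auto
qed auto

text \<open>The vertex \<open>v\<close> is dominated by \<open>v'\<close>: its neighbours are
  neighbours of \<open>v'\<close>. Adding \<open>v'\<close> to the cliques that contain
  \<open>v\<close>, and then deleting \<open>v\<close>, are two retractions comparable with the
  identity.\<close>

lemma flag_remove:
  assumes v': "v' \<in> V" "v' \<noteq> v" "E v' v'" and sym: "\<And>u w. E u w ==> E w u"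
    and dom: "\<And>u. u \<in> V ==> E u v ==> E u v'"
    and oc: "order_contractible (\<subseteq>) (flag (V - {v}) E)"
  shows "order_contractible (\<subseteq>) (flag V E)"
proof -
  let ?Q = "{\<sigma> \<in> flag V E. v \<in> \<sigma> --> v' \<in> \<sigma>}"
  have Q: "order_contractible (\<subseteq>) ?Q"
  proof (rule order_contractible_retract[OF porder_subset_order _ _ oc])
    show "poset_map (\<subseteq>) ?Q (\<subseteq>) (flag (V - {v}) E) (\<lambda>\<sigma>. \<sigma> - {v})"
      using v'(2) by (auto simp: poset_map_def flag_def)
    show "poset_map (\<subseteq>) (flag (V - {v}) E) (\<subseteq>) ?Q id"
      by (auto simp: poset_map_def flag_def)
  qed auto
  have ins: "insert v' \<sigma> \<in> flag V E" if \<sigma>: "\<sigma> \<in> flag V E" "v \<in> \<sigma>" for \<sigma>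
  proof -
    have "E u v'" "E v' u" if "u \<in> \<sigma>" for u
      using dom[of u] sym[of u v'] \<sigma> that by (auto simp: flag_def)
    then show ?thesis using \<sigma> v' by (auto simp: flag_def)
  qed
  show ?thesis
  proof (rule order_contractible_retract[OF porder_subset_order _ _ Q])
    show "poset_map (\<subseteq>) (flag V E) (\<subseteq>) ?Q (\<lambda>\<sigma>. if v \<in> \<sigma> then insert v' \<sigma> else \<sigma>)"
      using ins v'(2) by (auto simp: poset_map_def)
    show "poset_map (\<subseteq>) ?Q (\<subseteq>) (flag V E) id" by (auto simp: poset_map_def)
  qed auto
qed

text \<open>Vertices outside \<open>G\<close> are removed in the order of increasing
  \<open>f\<close>. When the turn of \<open>v\<close> comes, all remaining vertices outside
  \<open>G\<close> have at least the value \<open>f v\<close>, so domination need only be known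
  against those and against \<open>G\<close>.\<close>

lemma flag_dismantle:
  fixes f :: "'v => nat"
  assumes "finite V" "G \<subseteq> V" and sym: "\<And>u w. E u w ==> E w u" and rfl: "\<And>u. E u u"
    and dom: "\<And>v. v \<in> V - G ==> \<exists>v'\<in>G. \<forall>u\<in>V. E u v --> u \<in> G \<or> f v \<le> f u --> E u v'"
    and oc: "order_contractible (\<subseteq>) (flag G E)"
  shows "order_contractible (\<subseteq>) (flag V E)"
  using assms(1,2) dom
proof (induction "card (V - G)" arbitrary: V)
  case 0
  then have "V = G" by auto
  then show ?case using oc by simp
next
  case (Suc k)
  then have ne: "V - G \<noteq> {}" by auto
  obtain v where v: "v \<in> V - G" "\<And>u. u \<in> V - G ==> f v \<le> f u"
    using ex_has_least_nat[of "\<lambda>v. v \<in> V - G" _ f] ne by blast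
  obtain v' where v': "v' \<in> G" "\<And>u. u \<in> V ==> E u v ==> u \<in> G \<or> f v \<le> f u ==> E u v'"
    using Suc.prems(3)[OF v(1)] by blast
  have "order_contractible (\<subseteq>) (flag (V - {v}) E)"
  proof (rule Suc.hyps(1))
    have "V - {v} - G = (V - G) - {v}" by auto
    then show "k = card (V - {v} - G)" using Suc.hyps(2) v(1) Suc.prems(1) by simp
    show "\<exists>v'\<in>G. \<forall>u\<in>V - {v}. E u w --> u \<in> G \<or> f w \<le> f u --> E u v'" if "w \<in> V - {v} - G" for w
      using Suc.prems(3)[of w] that by blast
  qed (use Suc.prems v in auto)
  then show ?case
    using flag_remove[of v' V v E] v' v Suc.prems(2) sym rfl by blast
qed

text \<open>A move at \<open>x\<close> is a labelling \<open>m\<close> of \<open>{0..n} - {x}\<close>; two moves cross at the labels \<open>s\<close> which both of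
  them separate from the base label of the other one.\<close>

definition crossing :: "nat => nat => (nat => 'a) => nat => (nat => 'a) => nat set" where
  "crossing n x m y k = {s. s \<le> n \<and> s \<noteq> x \<and> s \<noteq> y \<and> m s \<noteq> m y \<and> k s \<noteq> k x}"

text \<open>With \<open>Z\<close> the crossing set this is the analogue of uncrossing two cuts in a
  submodular problem: the disputed labels are given back to the block of \<open>y\<close>.\<close>

definition uncross :: "(nat => 'a) => nat set => nat => nat => 'a" where
  "uncross m Z y = (\<lambda>s. if s \<in> Z then m y else m s)"

text \<open>The blocks of \<open>m\<close> involved in the crossing, taken as a whole. Their size
  fixes the order in which moves are dismantled: uncrossing can spoil the compatibility with a third
  move only if that move has smaller blocks.\<close>

definition crossing_blocks :: "nat => nat => (nat => 'a) => nat => (nat => 'a) => nat set" where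
  "crossing_blocks n x m y k = {t. t \<le> n \<and> t \<noteq> x \<and> m t \<in> m ` crossing n x m y k}"

lemma crossing_commute: "crossing n x m y k = crossing n y k x m"
  by (auto simp: crossing_def)

lemma crossing_uncross: "crossing n x (uncross m (crossing n x m y k) y) y k = {}"
  by (auto simp: crossing_def uncross_def)

text \<open>At a new crossing \<open>s\<close> one has \<open>m s = m w\<close>, while only one of
  \<open>s\<close> and \<open>w\<close> lies in the crossing set. As \<open>m w\<close> differs from
  \<open>m y\<close>, the moves at \<open>x\<close> and \<open>w\<close> do not cross at
  \<open>y\<close>, so \<open>k y = k x\<close>; then \<open>k\<close> and \<open>l\<close> not
  crossing at \<open>s\<close> gives \<open>l s = l w\<close>, and the two labels lie both inside or
  both outside.\<close>

lemma crossing_uncross_third: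
  assumes "x \<noteq> y" "w \<noteq> x" "x \<le> n" "y \<le> n" "w \<le> n" "crossing n x m w k = {}" "w = y \<or> crossing n w k y l = {}"
  shows "crossing n x (uncross m (crossing n x m y l) y) w k = {}"
proof (rule ccontr)
  let ?Z = "crossing n x m y l"
  assume "crossing n x (uncross m ?Z y) w k \<noteq> {}"
  then obtain s where s: "s \<le> n" "s \<noteq> x" "s \<noteq> w" "uncross m ?Z y s \<noteq> uncross m ?Z y w" "k s \<noteq> k x"
    by (auto simp: crossing_def)
  have ms: "m s = m w" using s assms(6) by (auto simp: crossing_def)
  have yZ: "y \<notin> ?Z" by (auto simp: crossing_def)
  have wy: "w \<noteq> y" using s(4) ms yZ by (auto simp: uncross_def split: if_splits)
  have nc: "crossing n w k y l = {}" using wy assms(7) by blast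
  have neq: "m w \<noteq> m y" using s(4) ms by (auto simp: uncross_def crossing_def split: if_splits)
  have ky: "k y = k x" using neq wy assms(1,4,6) by (auto simp: crossing_def)
  have "s \<noteq> y" using ms neq by auto
  then have "l s = l w" using nc s ky by (auto simp: crossing_def)
  then have "s \<in> ?Z \<longleftrightarrow> w \<in> ?Z" using s ms wy \<open>s \<noteq> y\<close> assms by (auto simp: crossing_def)
  then show False using s(4) ms by (auto simp: uncross_def)
qed

text \<open>A new crossing forces \<open>w\<close> into an involved block of \<open>m\<close>. Every
  block of \<open>k\<close> that crosses \<open>l\<close> is separated by \<open>k\<close> from
  \<open>x\<close>, and since \<open>m\<close> and \<open>k\<close> do not cross it lies in that
  same block of \<open>m\<close>. The inclusion is proper because \<open>w\<close> itself belongs to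
  the larger set only.\<close>

lemma crossing_blocks_decrease:
  assumes "x \<noteq> y" "w \<noteq> x" "w \<noteq> y" "x \<le> n" "y \<le> n" "w \<le> n" "crossing n x m w k = {}"
    and "crossing n x (uncross m (crossing n x m y l) y) w k \<noteq> {}"
  shows "crossing_blocks n w k y l \<subset> crossing_blocks n x m y l"
proof -
  let ?Z = "crossing n x m y l"
  obtain s where s: "s \<le> n" "s \<noteq> x" "s \<noteq> w" "uncross m ?Z y s \<noteq> uncross m ?Z y w" "k s \<noteq> k x"
    using assms(8) by (auto simp: crossing_def)
  have ms: "m s = m w" using s assms(7) by (auto simp: crossing_def)
  have neq: "m w \<noteq> m y" using s(4) ms by (auto simp: uncross_def crossing_def split: if_splits)
  have ky: "k y = k x" using neq assms(1,3,5,7) by (auto simp: crossing_def)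
  have "s \<in> ?Z \<or> w \<in> ?Z" using s(4) ms by (auto simp: uncross_def split: if_splits)
  then have "m w \<in> m ` ?Z" using ms by (metis imageI)
  then have w: "w \<in> crossing_blocks n x m y l" using assms by (auto simp: crossing_blocks_def)
  have "t \<in> crossing_blocks n x m y l" if t: "t \<in> crossing_blocks n w k y l" for t
  proof -
    obtain z where z: "t \<le> n" "t \<noteq> w" "k t = k z" "z \<in> crossing n w k y l" using t by (auto simp: crossing_blocks_def)
    then have kt: "k t \<noteq> k x" using ky by (auto simp: crossing_def)
    then have "m t = m w" using z assms(7) by (auto simp: crossing_def)
    then show ?thesis using z kt w by (auto simp: crossing_blocks_def)
  qed
  moreover have "w \<notin> crossing_blocks n w k y l" by (auto simp: crossing_blocks_def)
  ultimately show ?thesis using w by blast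
qed

section \<open>Trees as compatible families of partitions\<close>

definition same_petal :: "(nat => nat set set) => nat => nat => nat => bool" where
  "same_petal A k s t \<longleftrightarrow> (\<exists>P\<in>A k. s \<in> P \<and> t \<in> P)"

text \<open>The last clause reflects that a path from \<open>s\<close> meets one of \<open>i\<close>
  and \<open>j\<close> first: if it is \<open>j\<close>, then \<open>s\<close> and \<open>j\<close>
  stay together when \<open>i\<close> is removed. The value at 0 encodes that the base label is a
  leaf, and the empty families beyond \<open>n\<close> make the representation unique.\<close>

definition compatible :: "nat => (nat => nat set set) => bool" where
  "compatible n A \<longleftrightarrow> (\<forall>k>n. A k = {}) \<and> (\<forall>k\<le>n. partition_on ({0..n} - {k}) (A k)) \<and>
     A 0 = {{1..n}} \<and>
     (\<forall>i\<le>n. \<forall>j\<le>n. \<forall>s\<le>n. i \<noteq> j --> s \<noteq> i --> s \<noteq> j --> same_petal A i s j \<or> same_petal A j s i)"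

definition constant_on_petals :: "(nat => nat set set) => nat => (nat => 'a) => bool" where
  "constant_on_petals A k m \<longleftrightarrow> (\<forall>s t. same_petal A k s t --> m s = m t)"

text \<open>At each label this is the coarsest partition on which all given moves are constant, that
  is, the least tree carrying them, provided that it is a tree.\<close>

definition generated_tree :: "nat => (nat \<times> (nat => 'a)) set => nat => nat set set" where
  "generated_tree n \<sigma> = (\<lambda>k. if k \<le> n then
     ({0..n} - {k}) // {(s, t). s \<in> {0..n} - {k} \<and> t \<in> {0..n} - {k} \<and> (\<forall>m. (k, m) \<in> \<sigma> --> m s = m t)} else {})"

definition moves_compatible :: "nat => nat \<times> (nat => 'a) => nat \<times> (nat => 'a) => bool" where
  "moves_compatible n u v \<longleftrightarrow> fst u = fst v \<or> crossing n (fst u) (snd u) (fst v) (snd v) = {}"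

lemma moves_compatible_sym: "moves_compatible n u v ==> moves_compatible n v u"
  unfolding moves_compatible_def using crossing_commute[of n "fst u" "snd u" "fst v" "snd v"] by auto

lemma compatibleD:
  assumes "compatible n A"
  shows "k > n ==> A k = {}" "k \<le> n ==> partition_on ({0..n} - {k}) (A k)" "A 0 = {{1..n}}"
    "i \<le> n ==> j \<le> n ==> s \<le> n ==> i \<noteq> j ==> s \<noteq> i ==> s \<noteq> j ==> same_petal A i s j \<or> same_petal A j s i"
  using assms unfolding compatible_def by simp_all

lemma same_petal_range:
  assumes A: "compatible n A" and st: "same_petal A k s t"
  shows "k \<le> n \<and> s \<le> n \<and> t \<le> n \<and> s \<noteq> k \<and> t \<noteq> k"
proof -
  obtain P where P: "P \<in> A k" "s \<in> P" "t \<in> P" using st by (auto simp: same_petal_def)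
  have k: "k \<le> n" using P(1) compatibleD(1)[OF A, of k] by (cases "k \<le> n") auto
  then have "\<Union>(A k) = {0..n} - {k}" using compatibleD(2)[OF A] by (simp add: partition_on_def)
  then have "s \<in> {0..n} - {k}" "t \<in> {0..n} - {k}" using P by blast+
  then show ?thesis using k by auto
qed

lemma same_petal_refl:
  assumes A: "compatible n A" and "k \<le> n" "s \<le> n" "s \<noteq> k" shows "same_petal A k s s"
proof -
  have "\<Union>(A k) = {0..n} - {k}" using compatibleD(2)[OF A assms(2)] by (simp add: partition_on_def)
  then have "s \<in> \<Union>(A k)" using assms by simp
  then show ?thesis by (auto simp: same_petal_def)
qed

lemma same_petal_sym: "same_petal A k s t ==> same_petal A k t s"
  by (auto simp: same_petal_def)

lemma same_petal_trans:
  assumes A: "compatible n A" and "same_petal A k s t" "same_petal A k t u" shows "same_petal A k s u"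
proof -
  have "partition_on ({0..n} - {k}) (A k)"
    using same_petal_range[OF assms(1,2)] compatibleD(2)[OF A] by blast
  then have "disjoint (A k)" by (simp add: partition_on_def)
  then show ?thesis using assms(2,3) unfolding same_petal_def disjoint_def by blast
qed

lemma petal_eq:
  assumes A: "compatible n A" and "P \<in> A k" "s \<in> P" shows "P = {t. same_petal A k s t}"
proof -
  have "k \<le> n" using assms compatibleD(1)[OF A] by (metis empty_iff not_le)
  then have "disjoint (A k)" using compatibleD(2)[OF A] by (simp add: partition_on_def)
  then show ?thesis using assms(2,3) unfolding same_petal_def disjoint_def by blast
qed

lemma petal_nonempty:
  assumes A: "compatible n A" and "P \<in> A k" shows "P \<noteq> {}" "k \<le> n"
proof -
  show "k \<le> n" using assms compatibleD(1)[OF A] by (metis empty_iff not_le)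
  then show "P \<noteq> {}" using compatibleD(2)[OF A] assms(2) by (auto simp: partition_on_def)
qed

text \<open>The order is reversed inclusion of the relations \<open>same_petal\<close>; from here on
  petals are handled through these relations.\<close>

lemma tree_le_iff:
  assumes A: "compatible n A" and B: "compatible n B"
  shows "tree_le A B \<longleftrightarrow> (\<forall>k s t. same_petal B k s t --> same_petal A k s t)"
proof
  assume le: "tree_le A B"
  show "\<forall>k s t. same_petal B k s t --> same_petal A k s t"
  proof (intro allI impI)
    fix k s t assume st: "same_petal B k s t"
    then have "k \<le> n" "s \<le> n" "s \<noteq> k" using same_petal_range[OF B] by blast+
    then obtain P where P: "P \<in> A k" "s \<in> P" using same_petal_refl[OF A] by (auto simp: same_petal_def)
    from le[unfolded tree_le_def, rule_format, OF P(1)] obtain Q where Q: "Q \<subseteq> B k" "P = \<Union>Q" by auto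
    then obtain S where S: "S \<in> Q" "s \<in> S" using P by blast
    then have "t \<in> S" using st petal_eq[OF B, of S k s] Q by auto
    then show "same_petal A k s t" using P Q S by (auto simp: same_petal_def)
  qed
next
  assume *: "\<forall>k s t. same_petal B k s t --> same_petal A k s t"
  show "tree_le A B" unfolding tree_le_def
  proof (intro allI ballI)
    fix k P assume P: "P \<in> A k"
    let ?Q = "{S \<in> B k. S \<inter> P \<noteq> {}}"
    have "S \<subseteq> P" if "S \<in> B k" "s \<in> S" "s \<in> P" for S s
    proof
      fix t assume "t \<in> S"
      then have "same_petal B k s t" using that by (auto simp: same_petal_def)
      then show "t \<in> P" using * petal_eq[OF A P \<open>s \<in> P\<close>] by auto
    qed
    moreover have "\<exists>S\<in>B k. s \<in> S" if "s \<in> P" for s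
    proof -
      have "same_petal A k s s" using P that by (auto simp: same_petal_def)
      then have "same_petal B k s s" using same_petal_refl[OF B] same_petal_range[OF A] by simp
      then show ?thesis by (auto simp: same_petal_def)
    qed
    moreover from this have "P \<subseteq> \<Union>?Q" by fast
    ultimately have "P = \<Union>?Q" by (intro subset_antisym) auto
    moreover have "?Q \<subseteq> B k" by auto
    ultimately show "\<exists>Q\<subseteq>B k. P = \<Union>Q" by (intro exI[of _ ?Q]) simp
  qed
qed

lemma compatible_eqI:
  assumes A: "compatible n A" and B: "compatible n B"
    and "\<And>k s t. same_petal A k s t = same_petal B k s t"
  shows "A = B"
proof -
  have sub: "A' k \<subseteq> B' k" if A': "compatible n A'" and B': "compatible n B'"
    and eq: "\<And>k s t. same_petal A' k s t = same_petal B' k s t" for A' B' k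
  proof
    fix P assume P: "P \<in> A' k"
    obtain s where s: "s \<in> P" using petal_nonempty[OF A' P] by auto
    have "same_petal A' k s s" using P s by (auto simp: same_petal_def)
    then have "same_petal B' k s s" using eq by blast
    then obtain S where S: "S \<in> B' k" "s \<in> S" by (auto simp: same_petal_def)
    have "P = S" using petal_eq[OF A' P s] petal_eq[OF B' S] eq by simp
    then show "P \<in> B' k" using S by simp
  qed
  show ?thesis using sub[OF A B] sub[OF B A] assms(3) by (intro ext) (simp add: subset_antisym)
qed

lemma tree_le_antisym:
  assumes "compatible n A" "compatible n B" "tree_le A B" "tree_le B A" shows "A = B"
proof (rule compatible_eqI[OF assms(1,2)])
  fix k s t
  show "same_petal A k s t = same_petal B k s t"
    using tree_le_iff[OF assms(1,2), THEN iffD1, OF assms(3), rule_format, of k s t]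
      tree_le_iff[OF assms(2,1), THEN iffD1, OF assms(4), rule_format, of k s t] by (rule iffI[rotated])
qed

lemma porder_tree_le:
  assumes T: "\<And>A. A \<in> T ==> compatible n A" shows "porder tree_le T"
  unfolding porder_def
proof (intro conjI ballI impI)
  fix A assume "A \<in> T"
  then show "tree_le A A" using tree_le_iff[OF T T, of A A] by simp
next
  fix A B assume "A \<in> T" "B \<in> T" "tree_le A B" "tree_le B A"
  then show "A = B" using tree_le_antisym[OF T T, of A B] by simp
next
  fix A B C assume "A \<in> T" "B \<in> T" "C \<in> T" "tree_le A B" "tree_le B C"
  then show "tree_le A C"
    using tree_le_iff[OF T T, of A B] tree_le_iff[OF T T, of B C] by (subst tree_le_iff[OF T T]) simp_all
qed

lemma constant_on_petals_mono:
  assumes "compatible n A" "compatible n B" "tree_le A B" "constant_on_petals A k m"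
  shows "constant_on_petals B k m"
  using tree_le_iff[OF assms(1,2)] assms(3,4) unfolding constant_on_petals_def by simp

lemma quotient_common_class:
  assumes "equiv S r" shows "(\<exists>P\<in>S // r. s \<in> P \<and> t \<in> P) \<longleftrightarrow> (s, t) \<in> r"
proof
  assume "\<exists>P\<in>S // r. s \<in> P \<and> t \<in> P"
  then obtain P where "P \<in> S // r" "{s, t} \<subseteq> P" by auto
  then show "(s, t) \<in> r" by (rule in_quotient_imp_in_rel[OF assms])
next
  assume st: "(s, t) \<in> r"
  then have "s \<in> S" using assms by (auto simp: equiv_def refl_on_def)
  then have "r `` {s} \<in> S // r" "s \<in> r `` {s}" "t \<in> r `` {s}"
    using st equiv_class_self[OF assms] by (auto intro: quotientI)
  then show "\<exists>P\<in>S // r. s \<in> P \<and> t \<in> P" by blast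
qed

lemma equiv_generated:
  "equiv S {(s, t). s \<in> S \<and> t \<in> S \<and> (\<forall>m. (k, m) \<in> \<sigma> --> m s = m t)}"
  by (rule equivI) (auto simp: refl_on_def sym_def trans_def)

lemma same_petal_generated:
  "same_petal (generated_tree n \<sigma>) k s t \<longleftrightarrow> k \<le> n \<and> s \<le> n \<and> t \<le> n \<and> s \<noteq> k \<and> t \<noteq> k \<and> (\<forall>m. (k, m) \<in> \<sigma> --> m s = m t)"
  using quotient_common_class[OF equiv_generated[of "{0..n} - {k}" k \<sigma>], of s t]
  by (auto simp: same_petal_def generated_tree_def)

text \<open>If both alternatives of the tree axiom fail at \<open>i\<close>, \<open>j\<close>,
  \<open>s\<close>, there are a move at \<open>i\<close> and a move at \<open>j\<close> that witness
  the failure, and these two cross at \<open>s\<close>. So pairwise compatibility is enough, and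
  sets of moves form a flag complex.\<close>

lemma compatible_generated_tree:
  assumes n: "n \<ge> 1" and comp: "\<And>u v. u \<in> \<sigma> ==> v \<in> \<sigma> ==> moves_compatible n u v" and fst0: "\<And>m. (0, m) \<notin> \<sigma>"
  shows "compatible n (generated_tree n \<sigma>)"
  unfolding compatible_def
proof (intro conjI allI impI)
  fix k assume "k \<le> n"
  then show "partition_on ({0..n} - {k}) (generated_tree n \<sigma> k)"
    using partition_on_quotient[OF equiv_generated[of "{0..n} - {k}" k \<sigma>]] unfolding generated_tree_def by simp
next
  have "{(s, t). s \<in> {0..n} - {0} \<and> t \<in> {0..n} - {0} \<and> (\<forall>m. (0, m) \<in> \<sigma> --> m s = m t)} = {1..n} \<times> {1..n}"
    using fst0 by auto
  moreover have "{0..n} - {0::nat} = {1..n}" by auto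
  moreover have "{1..n} // ({1..n} \<times> {1..n}) = {{1..n}}" using n unfolding quotient_def by force
  ultimately show "generated_tree n \<sigma> 0 = {{1..n}}" by (simp add: generated_tree_def)
next
  fix i j s assume "i \<le> n" "j \<le> n" "s \<le> n" "i \<noteq> j" "s \<noteq> i" "s \<noteq> j"
  moreover have "m s = m j \<or> k s = k i" if "(i, m) \<in> \<sigma>" "(j, k) \<in> \<sigma>" for m k
    using comp[OF that] \<open>s \<le> n\<close> \<open>i \<noteq> j\<close> \<open>s \<noteq> i\<close> \<open>s \<noteq> j\<close> by (auto simp: moves_compatible_def crossing_def)
  ultimately show "same_petal (generated_tree n \<sigma>) i s j \<or> same_petal (generated_tree n \<sigma>) j s i"
    unfolding same_petal_generated by blast
qed (simp add: generated_tree_def)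

lemma moves_compatible_tree:
  assumes A: "compatible n A" and "x \<le> n" "y \<le> n"
    "constant_on_petals A x m" "constant_on_petals A y k"
  shows "moves_compatible n (x, m) (y, k)"
proof -
  have "m s = m y \<or> k s = k x" if "x \<noteq> y" "s \<le> n" "s \<noteq> x" "s \<noteq> y" for s
    using compatibleD(4)[OF A assms(2,3) that(2,1,3,4)]
  proof
    assume "same_petal A x s y" then show ?thesis using assms(4) by (simp add: constant_on_petals_def)
  next
    assume "same_petal A y s x" then show ?thesis using assms(5) by (simp add: constant_on_petals_def)
  qed
  then show ?thesis unfolding moves_compatible_def crossing_def by auto
qed

lemma generated_tree_le:
  assumes A: "compatible n A" and g: "compatible n (generated_tree n \<sigma>)"
    and "\<And>k m. (k, m) \<in> \<sigma> ==> constant_on_petals A k m"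
  shows "tree_le (generated_tree n \<sigma>) A"
  unfolding tree_le_iff[OF g A] same_petal_generated
  using assms(3) same_petal_range[OF A] by (auto simp: constant_on_petals_def)

lemma generated_tree_constant: "(k, m) \<in> \<sigma> ==> constant_on_petals (generated_tree n \<sigma>) k m"
  by (auto simp: constant_on_petals_def same_petal_generated)

section \<open>Submodular costs of moves\<close>

locale move_costs =
  fixes n :: nat and Hs :: "nat => 'a set" and cost :: "nat => (nat => 'a) => nat" and base :: "nat => nat"
  assumes n1: "n \<ge> 1" and fin: "\<And>k. k \<in> {1..n} ==> finite (Hs k)"
    and two: "\<And>k. k \<in> {1..n} ==> \<exists>a b. a \<in> Hs k \<and> b \<in> Hs k \<and> a \<noteq> b"
    and uncrossing: "\<And>x y m k. [|x \<in> {1..n}; y \<in> {1..n}; x \<noteq> y; m \<in> {0..n} \<rightarrow>\<^sub>E Hs x; k \<in> {0..n} \<rightarrow>\<^sub>E Hs y|] ==>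
       cost x (uncross m (crossing n x m y k) y) + cost y (uncross k (crossing n x m y k) x) \<le> cost x m + cost y k"
begin

text \<open>The value at the base label is free, because uncrossing may change it. Division by this
  value is postponed to \<open>normalise\<close>, where moves are turned into automorphisms.\<close>

definition moves :: "(nat \<times> (nat => 'a)) set" where
  "moves = {(x, m). x \<in> {1..n} \<and> m \<in> {0..n} \<rightarrow>\<^sub>E Hs x}"

definition carried :: "(nat => nat set set) => (nat \<times> (nat => 'a)) set" where
  "carried A = {(x, m) \<in> moves. constant_on_petals A x m}"

definition reductive :: "(nat \<times> (nat => 'a)) set" where
  "reductive = {(x, m) \<in> moves. cost x m < base x}"

definition reductive_trees :: "(nat => nat set set) => (nat => nat set set) set" where
  "reductive_trees A = {B. compatible n B \<and> tree_le A B \<and> carried B \<inter> reductive \<noteq> {}}"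

lemma finite_moves: "finite moves"
proof (rule finite_subset)
  show "moves \<subseteq> (SIGMA x:{1..n}. {0..n} \<rightarrow>\<^sub>E Hs x)" by (auto simp: moves_def)
  show "finite (SIGMA x:{1..n}. {0..n} \<rightarrow>\<^sub>E Hs x)" using fin by (intro finite_SigmaI finite_PiE) auto
qed

lemma movesD: "(x, m) \<in> moves ==> x \<in> {1..n} \<and> x \<le> n \<and> m \<in> {0..n} \<rightarrow>\<^sub>E Hs x"
  by (auto simp: moves_def)

lemma uncross_moves: "(x, m) \<in> moves ==> y \<le> n ==> (x, uncross m (crossing n x m y k) y) \<in> moves"
  by (auto simp: moves_def uncross_def crossing_def PiE_iff extensional_def)

lemma uncross_moves': "(y, k) \<in> moves ==> x \<le> n ==> (y, uncross k (crossing n x m y k) x) \<in> moves"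
  using uncross_moves[of y k x m] by (simp add: crossing_commute)

lemma carried_mono:
  assumes "compatible n A" "compatible n B" "tree_le A B"
  shows "carried A \<subseteq> carried B"
  using constant_on_petals_mono[OF assms] by (auto simp: carried_def)

lemma carried_compatible:
  assumes A: "compatible n A" and "u \<in> carried A" "v \<in> carried A" shows "moves_compatible n u v"
  using assms moves_compatible_tree[OF A] by (cases u; cases v) (auto simp: carried_def moves_def)

text \<open>Two different elements of the factor give a two-valued move that singles out the petal
  of \<open>s\<close>, so the carried moves see every petal. At label 0 there are no moves, but also
  only one petal.\<close>

lemma generated_tree_carried:
  assumes A: "compatible n A" shows "generated_tree n (carried A) = A"
proof (rule compatible_eqI[OF _ A])
  show "compatible n (generated_tree n (carried A))"
    using n1 carried_compatible[OF A] by (intro compatible_generated_tree) (auto simp: carried_def moves_def)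
  fix k s t
  show "same_petal (generated_tree n (carried A)) k s t = same_petal A k s t"
  proof
    assume "same_petal A k s t"
    then show "same_petal (generated_tree n (carried A)) k s t"
      using same_petal_range[OF A] by (auto simp: same_petal_generated carried_def constant_on_petals_def)
  next
    assume g: "same_petal (generated_tree n (carried A)) k s t"
    then have r: "k \<le> n" "s \<le> n" "t \<le> n" "s \<noteq> k" "t \<noteq> k" by (auto simp: same_petal_generated)
    show "same_petal A k s t"
    proof (cases "k = 0")
      case True
      then show ?thesis using r compatibleD(3)[OF A] by (auto simp: same_petal_def)
    next
      case False
      then have k: "k \<in> {1..n}" using r by auto
      obtain a b where ab: "a \<in> Hs k" "b \<in> Hs k" "a \<noteq> b" using two[OF k] by blast
      let ?m = "\<lambda>u. if u \<le> n then if same_petal A k s u then a else b else undefined"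
      have "constant_on_petals A k ?m"
        using same_petal_trans[OF A] same_petal_sym same_petal_range[OF A]
        unfolding constant_on_petals_def by (smt (verit, best))
      moreover have "(k, ?m) \<in> moves" using k ab by (auto simp: moves_def PiE_iff extensional_def)
      ultimately have "?m s = ?m t" using g by (auto simp: same_petal_generated carried_def)
      then show ?thesis using same_petal_refl[OF A r(1,2,4)] r ab by (auto split: if_splits)
    qed
  qed
qed

lemma generated_tree_extend:
  assumes A: "compatible n A" and \<sigma>: "\<sigma> \<subseteq> moves" "\<And>u v. u \<in> \<sigma> ==> v \<in> \<sigma> ==> moves_compatible n u v"
    "\<And>u v. u \<in> carried A ==> v \<in> \<sigma> ==> moves_compatible n u v"
  shows "compatible n (generated_tree n (carried A \<union> \<sigma>))" "tree_le A (generated_tree n (carried A \<union> \<sigma>))"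
    "\<sigma> \<subseteq> carried (generated_tree n (carried A \<union> \<sigma>))"
proof -
  have "moves_compatible n u v" if "u \<in> carried A \<union> \<sigma>" "v \<in> carried A \<union> \<sigma>" for u v
    using that \<sigma>(2,3) carried_compatible[OF A] moves_compatible_sym by blast
  then show c: "compatible n (generated_tree n (carried A \<union> \<sigma>))"
    using n1 \<sigma>(1) by (intro compatible_generated_tree) (auto simp: carried_def moves_def)
  have "same_petal A k s t" if "same_petal (generated_tree n (carried A \<union> \<sigma>)) k s t" for k s t
  proof -
    have "same_petal (generated_tree n (carried A)) k s t" using that by (auto simp: same_petal_generated)
    then show ?thesis by (simp add: generated_tree_carried[OF A])
  qed
  then show "tree_le A (generated_tree n (carried A \<union> \<sigma>))" by (simp add: tree_le_iff[OF A c])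
  show "\<sigma> \<subseteq> carried (generated_tree n (carried A \<union> \<sigma>))"
    using \<sigma>(1) generated_tree_constant[of _ _ "carried A \<union> \<sigma>" n] by (auto simp: carried_def)
qed

lemma finite_crossing_blocks: "finite (crossing_blocks n x m y k)"
  by (rule finite_subset[of _ "{..n}"]) (auto simp: crossing_blocks_def)

lemma compatible_uncross:
  assumes "(x, m) \<in> moves" "(y, l) \<in> moves" "(w, k) \<in> moves" "x \<noteq> y"
    and "moves_compatible n (w, k) (x, m)" "w = y \<or> moves_compatible n (w, k) (y, l)"
  shows "moves_compatible n (w, k) (x, uncross m (crossing n x m y l) y)"
proof (cases "w = x")
  case False
  have 1: "crossing n x m w k = {}" using assms(5) False crossing_commute[of n w k x m] by (simp add: moves_compatible_def)
  have 2: "w = y \<or> crossing n w k y l = {}" using assms(6) by (auto simp: moves_compatible_def)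
  have "x \<le> n" "y \<le> n" "w \<le> n" using assms(1,2,3) movesD by blast+
  from crossing_uncross_third[OF assms(4) False this 1 2] show ?thesis
    using crossing_commute[of n w k x "uncross m (crossing n x m y l) y"] by (simp add: moves_compatible_def)
qed (simp add: moves_compatible_def)

lemma compatible_uncross':
  assumes "(x, m) \<in> moves" "(y, l) \<in> moves" "(w, k) \<in> moves" "x \<noteq> y"
    and "moves_compatible n (w, k) (y, l)" "w = x \<or> moves_compatible n (w, k) (x, m)"
  shows "moves_compatible n (w, k) (y, uncross l (crossing n x m y l) x)"
  using compatible_uncross[OF assms(2,1,3) _ assms(5,6)] assms(4) by (simp add: crossing_commute)

lemma compatible_uncross_blocks:
  assumes "(x, m) \<in> moves" "(y, l) \<in> moves" "(w, k) \<in> moves" "x \<noteq> y"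
    and "moves_compatible n (w, k) (x, m)" "card (crossing_blocks n x m y l) \<le> card (crossing_blocks n w k y l)"
  shows "moves_compatible n (w, k) (x, uncross m (crossing n x m y l) y)"
proof (cases "w = x \<or> w = y")
  case True
  then show ?thesis using compatible_uncross[OF assms(1-5)] by (auto simp: moves_compatible_def)
next
  case False
  have 1: "crossing n x m w k = {}" using assms(5) False crossing_commute[of n w k x m] by (simp add: moves_compatible_def)
  have r: "x \<le> n" "y \<le> n" "w \<le> n" using assms(1,2,3) movesD by blast+
  have "crossing n x (uncross m (crossing n x m y l) y) w k = {}"
  proof (rule ccontr)
    assume "crossing n x (uncross m (crossing n x m y l) y) w k \<noteq> {}"
    then have "crossing_blocks n w k y l \<subset> crossing_blocks n x m y l"
      using crossing_blocks_decrease[of x y w n m k l] assms(4) False r 1 by blast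
    then show False using psubset_card_mono[OF finite_crossing_blocks] assms(6) by (meson not_le)
  qed
  then show ?thesis
    using crossing_commute[of n w k x "uncross m (crossing n x m y l) y"] by (simp add: moves_compatible_def)
qed

text \<open>Among the moves at some factor \<open>y\<close> compatible with \<open>A\<close>, fix a
  cheapest one, \<open>l\<close>. Uncrossing a reductive \<open>m\<close> with \<open>l\<close>
  cannot make \<open>l\<close> cheaper, so by submodularity it does not make \<open>m\<close>
  dearer: the new move is reductive, compatible with \<open>l\<close>, and dominates
  \<open>m\<close>. Dismantling leaves the moves compatible with \<open>l\<close>, which form a cone
  with apex \<open>(y, l)\<close>.\<close>

lemma reductive_flag_contractible:
  assumes A: "compatible n A"
    and V: "V = {v \<in> reductive. \<forall>u\<in>carried A. moves_compatible n u v}" and "V \<noteq> {}"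
  shows "order_contractible (\<subseteq>) (flag V (moves_compatible n))"
proof -
  obtain y m0 where m0: "(y, m0) \<in> V" using \<open>V \<noteq> {}\<close> by auto
  let ?C = "\<lambda>l. (y, l) \<in> moves \<and> (\<forall>u\<in>carried A. moves_compatible n u (y, l))"
  have "?C m0" using m0 V by (auto simp: reductive_def)
  then obtain l where l: "?C l" and lmin: "\<And>k. ?C k ==> cost y l \<le> cost y k"
    using ex_has_least_nat[of ?C m0 "cost y"] by blast
  have "cost y l < base y" using lmin[OF \<open>?C m0\<close>] m0 V by (auto simp: reductive_def)
  then have lV: "(y, l) \<in> V" using l V by (auto simp: reductive_def)
  have Vm: "v \<in> moves" if "v \<in> V" for v using that V by (auto simp: reductive_def)
  have cm: "u \<in> moves" if "u \<in> carried A" for u using that by (auto simp: carried_def)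
  let ?f = "\<lambda>v. card (crossing_blocks n (fst v) (snd v) y l)"
  let ?G = "{v \<in> V. moves_compatible n v (y, l)}"
  show ?thesis
  proof (rule flag_dismantle[where G = ?G and f = ?f])
    show "finite V" by (rule finite_subset[OF _ finite_moves]) (use Vm in auto)
    show "order_contractible (\<subseteq>) (flag ?G (moves_compatible n))"
    proof (rule flag_cone[of "(y, l)"])
      show "(y, l) \<in> ?G" using lV by (simp add: moves_compatible_def)
      show "moves_compatible n u (y, l) \<and> moves_compatible n (y, l) u" if "u \<in> ?G" for u
        using that moves_compatible_sym by blast
    qed
    fix v assume v: "v \<in> V - ?G"
    obtain x m where xm: "v = (x, m)" by (cases v)
    have vV: "(x, m) \<in> V" and nc: "\<not> moves_compatible n (x, m) (y, l)" using v xm by blast+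
    have mv: "(x, m) \<in> moves" "(y, l) \<in> moves" using Vm[OF vV] l by simp_all
    have ne: "x \<noteq> y" using nc by (auto simp: moves_compatible_def)
    let ?Z = "crossing n x m y l"
    let ?m = "uncross m ?Z y" and ?l = "uncross l ?Z x"
    have r: "x \<in> {1..n}" "y \<in> {1..n}" "x \<le> n" "y \<le> n" using mv movesD by blast+
    have mv': "(x, ?m) \<in> moves" "(y, ?l) \<in> moves"
      using uncross_moves[OF mv(1) r(4)] uncross_moves'[OF mv(2) r(3)] by simp_all
    have vc: "moves_compatible n u (x, m)" "moves_compatible n u (y, l)" if "u \<in> carried A" for u
      using that vV lV unfolding V by blast+
    have c1: "moves_compatible n u (x, ?m)" if "u \<in> carried A" for u
      using compatible_uncross[OF mv, of "fst u" "snd u"] vc[OF that] cm[OF that] ne by simp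
    have c2: "moves_compatible n u (y, ?l)" if "u \<in> carried A" for u
      using compatible_uncross'[OF mv, of "fst u" "snd u"] vc[OF that] cm[OF that] ne by simp
    have "cost y l \<le> cost y ?l" using lmin mv'(2) c2 by blast
    moreover have "cost x ?m + cost y ?l \<le> cost x m + cost y l"
      using uncrossing[OF r(1,2) ne] mv movesD by blast
    moreover have "cost x m < base x" using vV unfolding V by (simp add: reductive_def)
    ultimately have "cost x ?m < base x" by linarith
    then have "(x, ?m) \<in> V" using mv' c1 unfolding V by (simp add: reductive_def)
    moreover have "moves_compatible n (x, ?m) (y, l)" by (simp add: moves_compatible_def crossing_uncross)
    ultimately have "(x, ?m) \<in> ?G" by simp
    \<comment> \<open>A remaining \<open>u\<close> either is compatible with \<open>l\<close>, or
      has crossing blocks at least as large as those of \<open>v\<close>; in both cases uncrossing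
      keeps it compatible.\<close>
    moreover have "moves_compatible n u (x, ?m)"
      if u: "u \<in> V" "moves_compatible n u v" "u \<in> ?G \<or> ?f v \<le> ?f u" for u
      using u(3)
    proof
      assume "u \<in> ?G"
      then show ?thesis using compatible_uncross[OF mv, of "fst u" "snd u"] u(2) Vm[OF u(1)] xm ne by simp
    next
      assume "?f v \<le> ?f u"
      then show ?thesis using compatible_uncross_blocks[OF mv, of "fst u" "snd u"] u(2) Vm[OF u(1)] xm ne by simp
    qed
    ultimately show "\<exists>v'\<in>?G. \<forall>u\<in>V. moves_compatible n u v --> u \<in> ?G \<or> ?f v \<le> ?f u --> moves_compatible n u v'"
      by blast
  next
    show "moves_compatible n u u" for u by (simp add: moves_compatible_def)
  qed (blast intro: moves_compatible_sym)+
qed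

text \<open>A tree yields the clique of its reductive moves; a clique yields the tree it generates
  together with the moves carried by \<open>A\<close>. Both maps are monotone, and the round trip
  starting from a tree can only go down.\<close>

theorem reductive_trees_contractible:
  assumes A: "compatible n A" and ne: "reductive_trees A \<noteq> {}"
  shows "order_contractible tree_le (reductive_trees A)"
proof -
  define V where "V = {v \<in> reductive. \<forall>u\<in>carried A. moves_compatible n u v}"
  have sub: "carried B \<inter> reductive \<subseteq> V" if "B \<in> reductive_trees A" for B
  proof -
    have B: "compatible n B" "tree_le A B" using that by (auto simp: reductive_trees_def)
    show ?thesis using carried_mono[OF A B] carried_compatible[OF B(1)] by (auto simp: V_def)
  qed
  obtain B0 where B0: "B0 \<in> reductive_trees A" using ne by blast
  then have "carried B0 \<inter> reductive \<noteq> {}" by (simp add: reductive_trees_def)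
  then have "V \<noteq> {}" using sub[OF B0] by blast
  from reductive_flag_contractible[OF A V_def this]
  have oc: "order_contractible (\<subseteq>) (flag V (moves_compatible n))" .
  have ext: "compatible n (generated_tree n (carried A \<union> \<sigma>))" "tree_le A (generated_tree n (carried A \<union> \<sigma>))"
    "\<sigma> \<subseteq> carried (generated_tree n (carried A \<union> \<sigma>))" if "\<sigma> \<in> flag V (moves_compatible n)" for \<sigma>
    using generated_tree_extend[OF A, of \<sigma>] that by (auto simp: flag_def V_def reductive_def)
  show ?thesis
  proof (rule order_contractible_retract[OF _ _ _ oc])
    show "porder tree_le (reductive_trees A)" by (rule porder_tree_le[of _ n]) (auto simp: reductive_trees_def)
    show "poset_map tree_le (reductive_trees A) (\<subseteq>) (flag V (moves_compatible n)) (\<lambda>B. carried B \<inter> reductive)"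
      unfolding poset_map_def
    proof (intro conjI ballI impI Pi_I)
      fix B assume B: "B \<in> reductive_trees A"
      then show "carried B \<inter> reductive \<in> flag V (moves_compatible n)"
        using sub[OF B] carried_compatible[of B] unfolding flag_def by (auto simp: reductive_trees_def)
    next
      fix B B' assume "B \<in> reductive_trees A" "B' \<in> reductive_trees A" "tree_le B B'"
      then show "carried B \<inter> reductive \<subseteq> carried B' \<inter> reductive"
        using carried_mono by (auto simp: reductive_trees_def)
    qed
    show "poset_map (\<subseteq>) (flag V (moves_compatible n)) tree_le (reductive_trees A) (\<lambda>\<sigma>. generated_tree n (carried A \<union> \<sigma>))"
      unfolding poset_map_def
    proof (intro conjI ballI impI Pi_I)
      fix \<sigma> assume \<sigma>: "\<sigma> \<in> flag V (moves_compatible n)"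
      have "\<sigma> \<noteq> {}" "\<sigma> \<subseteq> reductive" using \<sigma> by (auto simp: flag_def V_def)
      then show "generated_tree n (carried A \<union> \<sigma>) \<in> reductive_trees A"
        using ext[OF \<sigma>] unfolding reductive_trees_def by blast
    next
      fix \<sigma> \<tau> assume \<sigma>: "\<sigma> \<in> flag V (moves_compatible n)" and \<tau>: "\<tau> \<in> flag V (moves_compatible n)" and "\<sigma> \<subseteq> \<tau>"
      then show "tree_le (generated_tree n (carried A \<union> \<sigma>)) (generated_tree n (carried A \<union> \<tau>))"
        unfolding tree_le_iff[OF ext(1)[OF \<sigma>] ext(1)[OF \<tau>]] same_petal_generated by blast
    qed
    have "tree_le (generated_tree n (carried A \<union> (carried B \<inter> reductive))) B" if B: "B \<in> reductive_trees A" for B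
    proof -
      have B': "compatible n B" "tree_le A B" using B by (auto simp: reductive_trees_def)
      have "carried B \<inter> reductive \<in> flag V (moves_compatible n)"
        using sub[OF B] B carried_compatible[OF B'(1)] unfolding flag_def by (auto simp: reductive_trees_def)
      from ext(1)[OF this] show ?thesis
        using carried_mono[OF A B'] by (intro generated_tree_le[OF B'(1)]) (auto simp: carried_def)
    qed
    then show "(\<forall>B\<in>reductive_trees A. tree_le (generated_tree n (carried A \<union> (carried B \<inter> reductive))) B)
        \<or> (\<forall>B\<in>reductive_trees A. tree_le B (generated_tree n (carried A \<union> (carried B \<inter> reductive))))" by blast
  qed
qed

text \<open>Call a carried move neutral if its cost equals the base value. Among the reductive moves
  take one that is incompatible with the fewest neutral moves, and among those incompatible ones one
  with the smallest crossing blocks. Uncrossing this pair produces a reductive move with fewer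
  incompatibilities, so there were none. Since the neutral moves generate \<open>A\<close>, the
  reductive move can be added to \<open>A\<close>.\<close>

theorem reductive_trees_nonempty:
  assumes A: "compatible n A"
    and gen: "A = generated_tree n {(x, m) \<in> carried A. cost x m = base x}" and "reductive \<noteq> {}"
  shows "reductive_trees A \<noteq> {}"
proof -
  define E where "E = {(x, m) \<in> carried A. cost x m = base x}"
  let ?inc = "\<lambda>v. {u \<in> E. \<not> moves_compatible n u v}"
  obtain v where v: "v \<in> reductive" and vmin: "\<And>w. w \<in> reductive ==> card (?inc v) \<le> card (?inc w)"
    using ex_has_least_nat[of "\<lambda>v. v \<in> reductive" _ "\<lambda>v. card (?inc v)"] assms(3) by blast
  obtain y l where yl: "v = (y, l)" by (cases v)
  have E: "u \<in> moves" "u \<in> carried A" if "u \<in> E" for u using that by (auto simp: E_def carried_def)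
  have finE: "finite E" by (rule finite_subset[OF _ finite_moves]) (use E in auto)
  have lm: "(y, l) \<in> moves" "cost y l < base y" using v yl by (auto simp: reductive_def)
  have "?inc v = {}"
  proof (rule ccontr)
    assume "?inc v \<noteq> {}"
    then obtain u0 where u0: "u0 \<in> ?inc v" and u0min: "\<And>u. u \<in> ?inc v ==>
        card (crossing_blocks n (fst u0) (snd u0) y l) \<le> card (crossing_blocks n (fst u) (snd u) y l)"
      using ex_has_least_nat[of "\<lambda>u. u \<in> ?inc v" _ "\<lambda>u. card (crossing_blocks n (fst u) (snd u) y l)"] by blast
    obtain x m where xm: "u0 = (x, m)" by (cases u0)
    have xE: "(x, m) \<in> E" and nc: "\<not> moves_compatible n (x, m) (y, l)" using u0 xm yl by auto
    have mm: "(x, m) \<in> moves" "cost x m = base x" using E(1)[OF xE] xE by (simp_all add: E_def)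
    have ne: "x \<noteq> y" using nc by (auto simp: moves_compatible_def)
    let ?Z = "crossing n x m y l"
    let ?m = "uncross m ?Z y" and ?l = "uncross l ?Z x"
    have r: "x \<in> {1..n}" "y \<in> {1..n}" "x \<le> n" "y \<le> n" using mm(1) lm(1) movesD by blast+
    have mv': "(x, ?m) \<in> moves" "(y, ?l) \<in> moves"
      using uncross_moves[OF mm(1) r(4)] uncross_moves'[OF lm(1) r(3)] by simp_all
    have le: "cost x ?m + cost y ?l \<le> cost x m + cost y l"
      using uncrossing[OF r(1,2) ne] mm lm movesD by blast
    have EE: "moves_compatible n u (x, m)" if "u \<in> E" for u
      using carried_compatible[OF A] E(2) that xE by blast
    \<comment> \<open>The total cost does not increase and \<open>m\<close> costs exactly the base
      value. So either the uncrossed \<open>m\<close> becomes reductive, or the uncrossed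
      \<open>l\<close> costs no more than \<open>l\<close> did and remains reductive.\<close>
    show False
    proof (cases "cost x ?m < base x")
      case True
      have "moves_compatible n u (x, ?m)" if u: "u \<in> E" for u
      proof (cases "moves_compatible n u (y, l)")
        case True
        then show ?thesis using compatible_uncross[OF mm(1) lm(1), of "fst u" "snd u"] E(1)[OF u] EE[OF u] ne by simp
      next
        case False
        then have "u \<in> ?inc v" using u yl by auto
        from u0min[OF this] show ?thesis
          using compatible_uncross_blocks[OF mm(1) lm(1), of "fst u" "snd u"] E(1)[OF u] EE[OF u] ne xm by simp
      qed
      then have e: "?inc (x, ?m) = {}" by blast
      have "(x, ?m) \<in> reductive" using True mv' by (simp add: reductive_def)
      from vmin[OF this, unfolded e] have "card (?inc v) \<le> 0" by simp
      moreover have "finite (?inc v)" by (rule finite_subset[OF _ finE]) auto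
      then have "card (?inc v) > 0" using u0 card_gt_0_iff by blast
      ultimately show False by linarith
    next
      case False
      then have "cost y ?l < base y" using le mm(2) lm(2) by linarith
      then have red: "(y, ?l) \<in> reductive" using mv' by (simp add: reductive_def)
      have "moves_compatible n u (y, ?l)" if u: "u \<in> E" "moves_compatible n u v" for u
        using compatible_uncross'[OF mm(1) lm(1), of "fst u" "snd u"] E(1)[OF u(1)] EE[OF u(1)] ne u(2) yl by simp
      moreover have "moves_compatible n (x, m) (y, ?l)"
        using crossing_uncross[of n y l x m] crossing_commute[of n x m y ?l] crossing_commute[of n x m y l]
        by (simp add: moves_compatible_def)
      ultimately have "?inc (y, ?l) \<subset> ?inc v" using u0 xm by blast
      then have "card (?inc (y, ?l)) < card (?inc v)" using finE by (intro psubset_card_mono) auto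
      then show False using vmin[OF red] by simp
    qed
  qed
  \<comment> \<open>From neutral to arbitrary carried moves: if \<open>v\<close> separates
    \<open>s\<close> from \<open>x\<close>, then every neutral move at \<open>x\<close> agrees on
    \<open>s\<close> and \<open>y\<close>, so these lie in one petal of \<open>A\<close> and no
    carried move separates them.\<close>
  have "moves_compatible n u v" if u: "u \<in> carried A" for u
  proof -
    obtain x k where xk: "u = (x, k)" by (cases u)
    have xn: "x \<le> n" "y \<le> n" using u xk lm movesD by (auto simp: carried_def)
    have False if s: "x \<noteq> y" "s \<in> crossing n x k y l" for s
    proof -
      have s': "s \<le> n" "s \<noteq> x" "s \<noteq> y" "k s \<noteq> k y" "l s \<noteq> l x" using s(2) by (auto simp: crossing_def)
      have "m s = m y" if "(x, m) \<in> E" for m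
        using \<open>?inc v = {}\<close> that s' s(1) yl by (auto simp: moves_compatible_def crossing_def)
      then have "same_petal (generated_tree n E) x s y" using s' s(1) xn by (auto simp: same_petal_generated)
      then have "same_petal A x s y" using gen by (simp add: E_def)
      then show False using u xk s' by (auto simp: carried_def constant_on_petals_def)
    qed
    then show ?thesis using xk yl by (auto simp: moves_compatible_def)
  qed
  then have ext: "compatible n (generated_tree n (carried A \<union> {v}))"
    "tree_le A (generated_tree n (carried A \<union> {v}))" "{v} \<subseteq> carried (generated_tree n (carried A \<union> {v}))"
    using generated_tree_extend[OF A, of "{v}"] lm yl by (auto simp: moves_compatible_def)
  then show ?thesis using v unfolding reductive_trees_def by blast
qed

end

section \<open>Normal forms in free products\<close>

locale free_product = group G for G (structure) +
  fixes n :: nat and H :: "nat => 'a set"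
  assumes ifp: "internal_free_product G n H"

text \<open>In contrast to \<open>reduced_word\<close>, this admits the empty word, the normal form
  of the unit.\<close>

definition red_word :: "('a, 'b) monoid_scheme => nat => (nat => 'a set) => (nat \<times> 'a) list => bool" where
  "red_word G n H w \<longleftrightarrow> (\<forall>p\<in>set w. fst p \<in> {1..n} \<and> snd p \<in> H (fst p) \<and> snd p \<noteq> \<one>\<^bsub>G\<^esub>) \<and>
     successively (\<lambda>p q. fst p \<noteq> fst q) w"

definition nform :: "('a, 'b) monoid_scheme => nat => (nat => 'a set) => 'a => (nat \<times> 'a) list" where
  "nform G n H g = (THE w. red_word G n H w \<and> word_prod G w = g)"

definition syllables :: "('a, 'b) monoid_scheme => nat => (nat => 'a set) => nat => 'a => nat" where
  "syllables G n H k g = length (filter (\<lambda>p. fst p = k) (nform G n H g))"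

lemma word_prod_Nil [simp]: "word_prod G [] = \<one>\<^bsub>G\<^esub>"
  by (simp add: word_prod_def)

lemma word_prod_Cons [simp]: "word_prod G (p # w) = snd p \<otimes>\<^bsub>G\<^esub> word_prod G w"
  by (simp add: word_prod_def split_def)

lemma reduced_word_iff: "reduced_word G n H w \<longleftrightarrow> w \<noteq> [] \<and> red_word G n H w"
  unfolding reduced_word_def red_word_def successively_conv_nth by (auto simp: split_def)

lemma red_word_Nil [simp]: "red_word G n H []"
  by (simp add: red_word_def)

lemma red_word_Cons: "red_word G n H (p # w) \<longleftrightarrow> fst p \<in> {1..n} \<and> snd p \<in> H (fst p) \<and> snd p \<noteq> \<one>\<^bsub>G\<^esub> \<and>
    red_word G n H w \<and> (w = [] \<or> fst p \<noteq> fst (hd w))"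
  unfolding red_word_def by (auto simp: successively_Cons)

lemma red_word_append: "red_word G n H (u @ v) \<longleftrightarrow> red_word G n H u \<and> red_word G n H v \<and>
    (u = [] \<or> v = [] \<or> fst (last u) \<noteq> fst (hd v))"
  unfolding red_word_def by (auto simp: successively_append_iff)

context free_product
begin

lemma factor_subgroup: "i \<in> {1..n} ==> subgroup (H i) G"
  using ifp by (simp add: internal_free_product_def)

lemma factor_carrier: "i \<in> {1..n} ==> h \<in> H i ==> h \<in> carrier G"
  using factor_subgroup subgroup.mem_carrier by metis

lemma factor_closed: "i \<in> {1..n} ==> h \<in> H i ==> k \<in> H i ==> h \<otimes> k \<in> H i"
  using factor_subgroup subgroup.m_closed by metis

lemma factor_inv: "i \<in> {1..n} ==> h \<in> H i ==> inv h \<in> H i"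
  using factor_subgroup subgroup.m_inv_closed by metis

lemma factor_one: "i \<in> {1..n} ==> \<one> \<in> H i"
  using factor_subgroup subgroup.one_closed by metis

abbreviation "red \<equiv> red_word G n H"
abbreviation "wp \<equiv> word_prod G"
abbreviation "nf \<equiv> nform G n H"

lemma wp_closed: "\<forall>p\<in>set w. snd p \<in> carrier G ==> wp w \<in> carrier G"
  by (induction w) auto

lemma red_carrier: "red w ==> p \<in> set w ==> snd p \<in> carrier G"
  unfolding red_word_def using factor_carrier by blast

lemma red_wp_closed: "red w ==> wp w \<in> carrier G"
  by (rule wp_closed) (use red_carrier in blast)

lemma wp_append: "\<forall>p\<in>set u. snd p \<in> carrier G ==> \<forall>p\<in>set v. snd p \<in> carrier G ==> wp (u @ v) = wp u \<otimes> wp v"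
  by (induction u) (auto simp: wp_closed m_assoc)

definition winv :: "(nat \<times> 'a) list => (nat \<times> 'a) list" where
  "winv w = rev (map (\<lambda>p. (fst p, inv (snd p))) w)"

lemma winv_Cons: "winv (p # w) = winv w @ [(fst p, inv (snd p))]"
  by (simp add: winv_def)

lemma winv_Nil [simp]: "winv [] = []" by (simp add: winv_def)

lemma winv_eq_Nil [simp]: "winv w = [] \<longleftrightarrow> w = []" by (simp add: winv_def)

lemma winv_set: "p \<in> set (winv w) ==> \<exists>q\<in>set w. p = (fst q, inv (snd q))"
  by (auto simp: winv_def)

lemma last_winv: "w \<noteq> [] ==> fst (last (winv w)) = fst (hd w)"
  by (cases w) (auto simp: winv_Cons)

lemma wp_winv: "\<forall>p\<in>set w. snd p \<in> carrier G ==> wp (winv w) = inv (wp w)"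
proof (induction w)
  case (Cons p w)
  have c: "\<forall>p\<in>set (winv w). snd p \<in> carrier G" using Cons.prems winv_set by fastforce
  then have "wp (winv (p # w)) = wp (winv w) \<otimes> wp [(fst p, inv (snd p))]"
    unfolding winv_Cons using Cons.prems by (intro wp_append) auto
  also have "\<dots> = inv (wp w) \<otimes> inv (snd p)" using Cons by simp
  also have "\<dots> = inv (snd p \<otimes> wp w)" using Cons.prems by (simp add: inv_mult_group wp_closed)
  finally show ?case by simp
qed simp

lemma red_winv: "red w ==> red (winv w)"
proof (induction w)
  case (Cons p w)
  have p: "fst p \<in> {1..n}" "snd p \<in> H (fst p)" "snd p \<noteq> \<one>" "snd p \<in> carrier G"
    using Cons.prems factor_carrier by (auto simp: red_word_Cons)
  have "inv (snd p) \<noteq> \<one>" using p(3,4) by (metis inv_one inv_inv)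
  then show ?case using Cons p factor_inv last_winv[of w] unfolding winv_Cons
    by (auto simp: red_word_append red_word_Cons)
qed simp

lemma red_wp_neq_one: "red w ==> w \<noteq> [] ==> wp w \<noteq> \<one>"
  using ifp by (auto simp: internal_free_product_def reduced_word_iff)

text \<open>If two reduced words for one element differed in their first syllables, the inverse of
  one followed by the other would be a nonempty reduced word with product one, after merging the two
  syllables when they belong to the same factor.\<close>

lemma red_unique: "red u ==> red v ==> wp u = wp v ==> u = v"
proof (induction u arbitrary: v)
  case Nil
  then show ?case using red_wp_neq_one[of v] by (metis word_prod_Nil)
next
  case (Cons p u)
  show ?case
  proof (cases v)
    case Nil
    then show ?thesis using red_wp_neq_one[OF Cons.prems(1)] Cons.prems by simp
  next
    case (Cons q v')
    note v = Cons
    have ru: "red (p # u)" and rv: "red (q # v')" using Cons.prems v by auto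
    have rp: "fst p \<in> {1..n}" "snd p \<in> H (fst p)" "snd p \<noteq> \<one>" "red u" "u = [] \<or> fst p \<noteq> fst (hd u)"
      using ru by (auto simp: red_word_Cons)
    have rq: "fst q \<in> {1..n}" "snd q \<in> H (fst q)" "snd q \<noteq> \<one>" "red v'" "v' = [] \<or> fst q \<noteq> fst (hd v')"
      using rv by (auto simp: red_word_Cons)
    have cu: "\<forall>p\<in>set (p # u). snd p \<in> carrier G" and cv: "\<forall>p\<in>set (q # v'). snd p \<in> carrier G"
      using red_carrier[OF ru] red_carrier[OF rv] by blast+
    have ciu: "\<forall>p\<in>set (winv u). snd p \<in> carrier G" and cipu: "\<forall>p\<in>set (winv (p # u)). snd p \<in> carrier G"
      using cu winv_set by fastforce+
    have eq: "wp (p # u) = wp (q # v')" using Cons.prems v by simp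
    have fp: "fst p = fst q"
    proof (rule ccontr)
      assume "fst p \<noteq> fst q"
      then have "red (winv (p # u) @ q # v')"
        using red_winv[OF ru] rv by (auto simp: red_word_append last_winv simp del: winv_eq_Nil)
      moreover have "wp (winv (p # u) @ q # v') = \<one>"
        using wp_append[OF cipu cv] wp_winv[OF cu] eq red_wp_closed[OF rv] by simp
      ultimately show False using red_wp_neq_one by blast
    qed
    have sp: "snd p = snd q"
    proof (rule ccontr)
      assume ne: "snd p \<noteq> snd q"
      let ?h = "inv (snd p) \<otimes> snd q"
      have ph: "snd p \<in> carrier G" "snd q \<in> carrier G" using cu cv by auto
      have h: "?h \<in> H (fst q)" using rp rq fp factor_inv factor_closed by simp
      have h1: "?h \<noteq> \<one>" using ne ph by (simp add: inv_solve_left')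
      have "red (winv u @ (fst q, ?h) # v')"
        using red_winv[OF rp(4)] rq h h1 rp(5) fp by (auto simp: red_word_append red_word_Cons last_winv)
      moreover have "wp (winv u @ (fst q, ?h) # v') = \<one>"
      proof -
        have "wp (winv u @ (fst q, ?h) # v') = wp (winv u) \<otimes> (?h \<otimes> wp v')"
          using wp_append[OF ciu, of "(fst q, ?h) # v'"] cv ph by simp
        also have "\<dots> = inv (wp u) \<otimes> (inv (snd p) \<otimes> (snd q \<otimes> wp v'))"
          using wp_winv[of u] cu cv ph wp_closed[of v'] by (simp add: m_assoc)
        also have "\<dots> = inv (wp u) \<otimes> (inv (snd p) \<otimes> (snd p \<otimes> wp u))" using eq by simp
        also have "inv (snd p) \<otimes> (snd p \<otimes> wp u) = wp u" using ph wp_closed[of u] cu by (simp add: m_assoc[symmetric])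
        also have "inv (wp u) \<otimes> wp u = \<one>" using wp_closed[of u] cu by simp
        finally show ?thesis .
      qed
      ultimately show False using red_wp_neq_one by blast
    qed
    have "wp u = wp v'" using eq sp cu cv wp_closed by simp
    then have "u = v'" using Cons.IH rp(4) rq(4) by blast
    then show ?thesis using v fp sp by (simp add: prod_eq_iff)
  qed
qed

section \<open>Multiplication of normal forms and the universal property\<close>

definition lmul :: "nat => 'a => (nat \<times> 'a) list => (nat \<times> 'a) list" where
  "lmul i h w = (if h = \<one> then w else case w of [] => [(i, h)]
     | q # w' => if fst q = i then (if h \<otimes> snd q = \<one> then w' else (i, h \<otimes> snd q) # w') else (i, h) # w)"

lemma lmul:
  assumes i: "i \<in> {1..n}" and h: "h \<in> H i" and w: "red w"
  shows "red (lmul i h w)" "wp (lmul i h w) = h \<otimes> wp w"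
proof -
  have hc: "h \<in> carrier G" using factor_carrier i h by blast
  have wc: "wp w \<in> carrier G" using red_wp_closed w by blast
  show "red (lmul i h w)"
  proof (cases w)
    case (Cons q w')
    then show ?thesis using i h w factor_closed[OF i h] by (auto simp: lmul_def red_word_Cons)
  qed (use i h in \<open>auto simp: lmul_def red_word_Cons\<close>)
  show "wp (lmul i h w) = h \<otimes> wp w"
  proof (cases w)
    case (Cons q w')
    have q: "snd q \<in> carrier G" "wp w' \<in> carrier G" using w Cons red_carrier red_wp_closed by (auto simp: red_word_Cons factor_carrier)
    have "h \<otimes> (snd q \<otimes> wp w') = (h \<otimes> snd q) \<otimes> wp w'" using hc q by (simp add: m_assoc)
    then show ?thesis using Cons q hc by (auto simp: lmul_def)
  qed (use hc in \<open>auto simp: lmul_def\<close>)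
qed

lemma red_exists: assumes g: "g \<in> carrier G" shows "\<exists>w. red w \<and> wp w = g"
proof -
  let ?S = "{wp w | w. red w}"
  have l: "h \<otimes> s \<in> ?S" if "i \<in> {1..n}" "h \<in> H i" "s \<in> ?S" for i h s
  proof -
    obtain w where "s = wp w" "red w" using \<open>s \<in> ?S\<close> by blast
    then show ?thesis using lmul[OF that(1,2), of w] by (intro CollectI exI[of _ "lmul i h w"]) simp
  qed
  have m: "wp u \<otimes> s \<in> ?S" if "red u" "s \<in> ?S" for u s
    using that
  proof (induction u arbitrary: s)
    case Nil
    then show ?case using red_wp_closed by auto
  next
    case (Cons p u)
    have "wp (p # u) \<otimes> s = snd p \<otimes> (wp u \<otimes> s)"
      using Cons.prems red_wp_closed[of u] red_wp_closed factor_carrier by (auto simp: red_word_Cons m_assoc)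
    then show ?case using Cons l[of "fst p" "snd p" "wp u \<otimes> s"] by (auto simp: red_word_Cons)
  qed
  have one: "\<one> \<in> ?S" by (rule CollectI, rule exI[of _ "[]"]) simp
  have inc: "h \<in> ?S" if "h \<in> (\<Union>i\<in>{1..n}. H i)" for h
    using that l[OF _ _ one] factor_carrier by fastforce
  have "g \<in> generate G (\<Union>i\<in>{1..n}. H i)" using g ifp by (simp add: internal_free_product_def)
  then have "g \<in> ?S"
  proof (induction rule: generate.induct)
    case (inv h)
    then have "inv h \<in> (\<Union>i\<in>{1..n}. H i)" using factor_inv by blast
    then show ?case by (rule inc)
  next
    case (eng h1 h2)
    then obtain u where "red u" "h1 = wp u" by auto
    then show ?case using m eng.IH(2) by simp
  qed (use one inc in blast)+
  then show ?thesis by auto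
qed

lemma nf: assumes "g \<in> carrier G" shows "red (nf g)" "wp (nf g) = g"
proof -
  have "\<exists>!w. red w \<and> wp w = g" using red_exists[OF assms] red_unique by blast
  then have "red (nf g) \<and> wp (nf g) = g" unfolding nform_def by (rule theI')
  then show "red (nf g)" "wp (nf g) = g" by auto
qed

lemma nf_wp: assumes "red w" shows "nf (wp w) = w"
  using nf[OF red_wp_closed[OF assms]] red_unique assms by blast

lemma nf_lmul: "i \<in> {1..n} ==> h \<in> H i ==> g \<in> carrier G ==> nf (h \<otimes> g) = lmul i h (nf g)"
  using lmul[of i h "nf g"] nf[of g] nf_wp by metis

lemma nf_one [simp]: "nf \<one> = []"
  using nf_wp[of "[]"] by simp

lemma nf_factor: "i \<in> {1..n} ==> h \<in> H i ==> h \<noteq> \<one> ==> nf h = [(i, h)]"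
  using nf_wp[of "[(i, h)]"] factor_carrier by (simp add: red_word_Cons)

lemma length_nf: "g \<in> carrier G ==> length (nf g) = (\<Sum>k\<in>{1..n}. syllables G n H k g)"
proof -
  have "length w = (\<Sum>k\<in>{1..n}. length (filter (\<lambda>p. fst p = k) w))" if "\<forall>p\<in>set w. fst p \<in> {1..n}" for w :: "(nat \<times> 'a) list"
    using that
  proof (induction w)
    case (Cons p w)
    have "(\<Sum>k\<in>{1..n}. length (filter (\<lambda>q. fst q = k) (p # w)))
        = (\<Sum>k\<in>{1..n}. (if fst p = k then 1 else 0) + length (filter (\<lambda>q. fst q = k) w))"
      by (intro sum.cong) auto
    also have "\<dots> = 1 + length w" using Cons by (simp add: sum.distrib)
    finally show ?case by simp
  qed simp
  then show "g \<in> carrier G ==> ?thesis" using nf(1)[of g] unfolding syllables_def red_word_def by blast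
qed

text \<open>The universal property of the free product: homomorphisms on the factors are extended by
  evaluating them along the normal form. The restriction to the carrier is what membership in
  \<open>auto\<close> requires.\<close>

definition endo :: "(nat => 'a => 'a) => 'a => 'a" where
  "endo f = (\<lambda>g\<in>carrier G. wp (map (\<lambda>p. (fst p, f (fst p) (snd p))) (nf g)))"

lemma endo:
  assumes f: "\<And>i h. i \<in> {1..n} ==> h \<in> H i ==> f i h \<in> carrier G"
    and fm: "\<And>i h k. i \<in> {1..n} ==> h \<in> H i ==> k \<in> H i ==> f i (h \<otimes> k) = f i h \<otimes> f i k"
  shows "endo f \<in> hom G G" "\<And>i h. i \<in> {1..n} ==> h \<in> H i ==> endo f h = f i h"
proof -
  let ?F = "\<lambda>w. wp (map (\<lambda>p. (fst p, f (fst p) (snd p))) w)"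
  have f1: "f i \<one> = \<one>" if "i \<in> {1..n}" for i
    using fm[OF that factor_one[OF that] factor_one[OF that]] f[OF that factor_one[OF that]] by simp
  have Fc: "?F w \<in> carrier G" if "red w" for w
    using that f by (intro wp_closed) (auto simp: red_word_def)
  \<comment> \<open>Multiplicativity is reduced to left multiplication by an element of one factor,
    where \<open>lmul\<close> describes the change of the normal form.\<close>
  have Fl: "?F (lmul i h w) = f i h \<otimes> ?F w" if i: "i \<in> {1..n}" and h: "h \<in> H i" and w: "red w" for i h w
  proof (cases w)
    case Nil
    then show ?thesis using f1[OF i] f[OF i h] by (simp add: lmul_def)
  next
    case (Cons q w')
    have q: "fst q \<in> {1..n}" "snd q \<in> H (fst q)" "red w'" using w Cons by (auto simp: red_word_Cons)
    have e: "f i (h \<otimes> snd q) \<otimes> ?F w' = f i h \<otimes> (f i (snd q) \<otimes> ?F w')" if "fst q = i"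
      using fm[OF i h] q that f[OF i] h Fc[OF q(3)] by (simp add: m_assoc)
    show ?thesis using Cons q f1[OF i] f[OF i h] f[OF q(1,2)] Fc[OF q(3)] e by (auto simp: lmul_def)
  qed
  have el: "endo f (h \<otimes> g) = f i h \<otimes> endo f g" if "i \<in> {1..n}" "h \<in> H i" "g \<in> carrier G" for i h g
    using that Fl[OF that(1,2) nf(1)[OF that(3)]] nf_lmul[OF that] factor_carrier[OF that(1,2)] by (simp add: endo_def)
  have ec: "endo f g \<in> carrier G" if "g \<in> carrier G" for g using that Fc nf(1) by (simp add: endo_def)
  show ef: "endo f h = f i h" if "i \<in> {1..n}" "h \<in> H i" for i h
    using el[OF that, of \<one>] f[OF that] factor_carrier[OF that] by (simp add: endo_def)
  have em: "endo f (wp w \<otimes> g) = endo f (wp w) \<otimes> endo f g" if "red w" "g \<in> carrier G" for w g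
    using that
  proof (induction w)
    case Nil
    then show ?case using ec[of g] by (simp add: endo_def)
  next
    case (Cons p w)
    have p: "fst p \<in> {1..n}" "snd p \<in> H (fst p)" "red w" "snd p \<in> carrier G" "wp w \<in> carrier G"
      using Cons.prems red_wp_closed by (auto simp: red_word_Cons factor_carrier)
    have "endo f (wp (p # w) \<otimes> g) = endo f (snd p \<otimes> (wp w \<otimes> g))" using p Cons.prems by (simp add: m_assoc)
    also have "\<dots> = f (fst p) (snd p) \<otimes> (endo f (wp w) \<otimes> endo f g)"
      using el[OF p(1,2), of "wp w \<otimes> g"] p Cons by simp
    also have "\<dots> = endo f (wp (p # w)) \<otimes> endo f g"
      using el[OF p(1,2) p(5)] f[OF p(1,2)] ec p Cons.prems by (simp add: m_assoc)
    finally show ?case .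
  qed
  show "endo f \<in> hom G G"
  proof (rule homI)
    fix x y assume "x \<in> carrier G" "y \<in> carrier G"
    then show "endo f (x \<otimes> y) = endo f x \<otimes> endo f y" using em[OF nf(1)[of x], of y] nf(2)[of x] by simp
  qed (use ec in auto)
qed

lemma hom_eqI:
  assumes "\<phi> \<in> hom G G" "\<psi> \<in> hom G G" "\<And>i h. i \<in> {1..n} ==> h \<in> H i ==> \<phi> h = \<psi> h" "g \<in> carrier G"
  shows "\<phi> g = \<psi> g"
proof -
  have "\<phi> (wp w) = \<psi> (wp w)" if "red w" for w
    using that
  proof (induction w)
    case Nil
    then show ?case using hom_one[OF assms(1)] hom_one[OF assms(2)] is_group by simp
  next
    case (Cons p w)
    have p: "fst p \<in> {1..n}" "snd p \<in> H (fst p)" "red w" "snd p \<in> carrier G" "wp w \<in> carrier G"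
      using Cons.prems red_wp_closed by (auto simp: red_word_Cons factor_carrier)
    then show ?case using Cons.IH assms(3)[OF p(1,2)] hom_mult[OF assms(1)] hom_mult[OF assms(2)] by simp
  qed
  then show ?thesis using nf[OF assms(4)] by metis
qed

lemma automorphismI:
  assumes "\<phi> \<in> hom G G" "\<psi> \<in> hom G G" "\<phi> \<in> extensional (carrier G)"
    and "\<And>i h. i \<in> {1..n} ==> h \<in> H i ==> \<psi> (\<phi> h) = h" "\<And>i h. i \<in> {1..n} ==> h \<in> H i ==> \<phi> (\<psi> h) = h"
  shows "\<phi> \<in> auto G" "\<And>g. g \<in> carrier G ==> \<psi> (\<phi> g) = g" "\<And>g. g \<in> carrier G ==> \<phi> (\<psi> g) = g"
proof -
  have c: "\<phi> g \<in> carrier G" "\<psi> g \<in> carrier G" if "g \<in> carrier G" for g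
    using that assms(1,2) hom_in_carrier by metis+
  have hid: "(\<lambda>g. g) \<in> hom G G" by (auto intro: homI)
  have h1: "(\<lambda>g. \<psi> (\<phi> g)) \<in> hom G G"
    by (rule homI) (use c hom_mult[OF assms(1)] hom_mult[OF assms(2)] in simp_all)
  have h2: "(\<lambda>g. \<phi> (\<psi> g)) \<in> hom G G"
    by (rule homI) (use c hom_mult[OF assms(1)] hom_mult[OF assms(2)] in simp_all)
  show a: "\<psi> (\<phi> g) = g" if "g \<in> carrier G" for g using hom_eqI[OF h1 hid _ that] assms(4) by simp
  show b: "\<phi> (\<psi> g) = g" if "g \<in> carrier G" for g using hom_eqI[OF h2 hid _ that] assms(5) by simp
  have "bij_betw \<phi> (carrier G) (carrier G)" by (rule bij_betwI[of _ _ _ \<psi>]) (use c a b in auto)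
  then show "\<phi> \<in> auto G" using assms(1,3) by (simp add: auto_def Bij_def)
qed

end

lemma autoD:
  assumes "\<phi> \<in> auto G" shows "\<phi> \<in> hom G G" "bij_betw \<phi> (carrier G) (carrier G)" "\<phi> \<in> extensional (carrier G)"
  using assms by (auto simp: auto_def Bij_def)

context free_product
begin

lemma auto_inverse:
  assumes "\<phi> \<in> auto G"
  obtains \<psi> where "\<psi> \<in> auto G" "\<And>g. g \<in> carrier G ==> \<psi> (\<phi> g) = g" "\<And>g. g \<in> carrier G ==> \<phi> (\<psi> g) = g"
proof -
  let ?\<psi> = "restrict (inv_into (carrier G) \<phi>) (carrier G)"
  have b: "bij_betw \<phi> (carrier G) (carrier G)" by (rule autoD(2)[OF assms])
  have 1: "?\<psi> (\<phi> g) = g" "\<phi> (?\<psi> g) = g" if "g \<in> carrier G" for g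
    using that b by (auto simp: bij_betw_inv_into_left bij_betw_inv_into_right bij_betwE)
  have "?\<psi> \<in> auto G"
    using restrict_inv_into_hom[of \<phi>] autoD(1)[OF assms] b restrict_inv_into_Bij[of \<phi> "carrier G"] autoD(3)[OF assms]
    by (auto simp: auto_def Bij_def)
  then show thesis using that 1 by blast
qed

text \<open>This trades a change of basis for a change of element: counting syllables in the image
  basis is counting those of the preimage in the old basis.\<close>

lemma free_product_image:
  assumes \<phi>: "\<phi> \<in> auto G"
  shows "free_product G n (\<lambda>i. \<phi> ` H i)"
    "\<And>g. g \<in> carrier G ==> nform G n (\<lambda>i. \<phi> ` H i) (\<phi> g) = map (\<lambda>p. (fst p, \<phi> (snd p))) (nf g)"
    "\<And>k g. g \<in> carrier G ==> syllables G n (\<lambda>i. \<phi> ` H i) k (\<phi> g) = syllables G n H k g"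
proof -
  obtain \<psi> where \<psi>: "\<psi> \<in> auto G" "\<And>g. g \<in> carrier G ==> \<psi> (\<phi> g) = g" "\<And>g. g \<in> carrier G ==> \<phi> (\<psi> g) = g"
    using auto_inverse[OF \<phi>] by blast
  have h: "\<phi> \<in> hom G G" "\<psi> \<in> hom G G" using autoD(1) \<phi> \<psi>(1) by blast+
  interpret gh: group_hom G G \<phi> by (unfold_locales) (rule h(1))
  have wpm: "wp (map (\<lambda>p. (fst p, \<phi> (snd p))) w) = \<phi> (wp w)" if "\<forall>p\<in>set w. snd p \<in> carrier G" for w
    using that by (induction w) (auto simp: wp_closed)
  have inj: "\<phi> x = \<one> \<longleftrightarrow> x = \<one>" if "x \<in> carrier G" for x
    using \<psi>(2)[OF that] \<psi>(2)[of \<one>] gh.hom_one by (metis one_closed)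
  have redm: "red_word G n (\<lambda>i. \<phi> ` H i) (map (\<lambda>p. (fst p, \<phi> (snd p))) w)" if "red w" for w
    using that inj red_carrier[OF that] by (auto simp: red_word_def successively_map)
  have redb: "\<exists>v. red v \<and> w = map (\<lambda>p. (fst p, \<phi> (snd p))) v" if w: "red_word G n (\<lambda>i. \<phi> ` H i) w" for w
  proof (intro exI conjI)
    let ?v = "map (\<lambda>p. (fst p, \<psi> (snd p))) w"
    have *: "fst p \<in> {1..n} \<and> \<psi> (snd p) \<in> H (fst p) \<and> \<psi> (snd p) \<noteq> \<one> \<and> \<phi> (\<psi> (snd p)) = snd p" if p: "p \<in> set w" for p
    proof -
      have q: "fst p \<in> {1..n}" "snd p \<in> \<phi> ` H (fst p)" "snd p \<noteq> \<one>" using w p by (auto simp: red_word_def)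
      then obtain h where h: "h \<in> H (fst p)" "snd p = \<phi> h" by blast
      have "h \<in> carrier G" using factor_carrier q h by blast
      then show ?thesis using q h \<psi>(2) gh.hom_one by auto
    qed
    have "successively (\<lambda>p q. fst p \<noteq> fst q) w" using w by (simp add: red_word_def)
    then show "red ?v" using * by (simp add: red_word_def successively_map)
    have "map (\<lambda>p. (fst p, \<phi> (snd p))) ?v = w" unfolding map_map o_def
      by (rule map_idI) (use * in simp)
    then show "w = map (\<lambda>p. (fst p, \<phi> (snd p))) ?v" by simp
  qed
  have sub: "subgroup (\<phi> ` H i) G" if "i \<in> {1..n}" for i
    using gh.subgroup_img_is_subgroup[OF factor_subgroup[OF that]] .
  have gen: "generate G (\<Union>i\<in>{1..n}. \<phi> ` H i) = carrier G"
  proof -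
    have "(\<Union>i\<in>{1..n}. \<phi> ` H i) = \<phi> ` (\<Union>i\<in>{1..n}. H i)" by auto
    moreover have "(\<Union>i\<in>{1..n}. H i) \<subseteq> carrier G" using factor_carrier by blast
    ultimately have "generate G (\<Union>i\<in>{1..n}. \<phi> ` H i) = \<phi> ` generate G (\<Union>i\<in>{1..n}. H i)"
      using gh.generate_img[of "\<Union>i\<in>{1..n}. H i"] by simp
    also have "\<dots> = carrier G" using ifp autoD(2)[OF \<phi>] by (simp add: internal_free_product_def bij_betw_imp_surj_on)
    finally show ?thesis .
  qed
  have "word_prod G w \<noteq> \<one>" if "reduced_word G n (\<lambda>i. \<phi> ` H i) w" for w
  proof -
    obtain v where v: "red v" "w = map (\<lambda>p. (fst p, \<phi> (snd p))) v" "w \<noteq> []" using \<open>reduced_word G n _ w\<close> redb by (auto simp: reduced_word_iff)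
    then have "wp v \<noteq> \<one>" using red_wp_neq_one by auto
    then show ?thesis using v wpm red_carrier[OF v(1)] inj red_wp_closed[OF v(1)] by simp
  qed
  then have "internal_free_product G n (\<lambda>i. \<phi> ` H i)" using sub gen by (simp add: internal_free_product_def)
  then show fp: "free_product G n (\<lambda>i. \<phi> ` H i)"
    using is_group by (simp add: free_product_def free_product_axioms_def)
  show nfm: "nform G n (\<lambda>i. \<phi> ` H i) (\<phi> g) = map (\<lambda>p. (fst p, \<phi> (snd p))) (nf g)" if g: "g \<in> carrier G" for g
    using free_product.nf_wp[OF fp redm[OF nf(1)[OF g]]] wpm red_carrier[OF nf(1)[OF g]] nf(2)[OF g] by simp
  show "syllables G n (\<lambda>i. \<phi> ` H i) k (\<phi> g) = syllables G n H k g" if g: "g \<in> carrier G" for k g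
    unfolding syllables_def nfm[OF g] by (simp add: filter_map o_def)
qed

end

section \<open>Whitehead automorphisms and syllable counts\<close>

text \<open>The number of \<open>k\<close>-syllables of the image of a word under the inverse of the Whitehead
  automorphism with multipliers \<open>m\<close>; \<open>a\<close> is the element of the \<open>k\<close>-th factor
  accumulated since the last syllable with a different label.\<close>

primrec turn_count :: "('a, 'b) monoid_scheme => nat => (nat => 'a) => 'a => (nat \<times> 'a) list => nat" where
  "turn_count G k m a [] = (if a = m 0 then 0 else 1)"
| "turn_count G k m a (p # w) = (if fst p = k then turn_count G k m (a \<otimes>\<^bsub>G\<^esub> snd p) w
     else (if a = m (fst p) then 0 else 1) + turn_count G k m (m (fst p)) w)"

text \<open>The induction needs all states after a syllable. After a label other than
  \<open>x\<close> and \<open>y\<close> both accumulators have the values of that label; after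
  \<open>x\<close> the accumulator of the move at \<open>x\<close> is arbitrary and may differ
  between the old and the new count, and symmetrically after \<open>y\<close>. A difference is
  charged with one turn, which is the turn saved by the other move on entering this state.\<close>

lemma turn_count_uncross_aux:
  assumes xy: "x \<noteq> y" "x \<noteq> 0" "y \<noteq> 0" and Z: "Z = crossing n x m y l"
    and m': "m' = uncross m Z y" and l': "l' = uncross l Z x"
    and w: "\<forall>p\<in>set w. fst p \<le> n"
  shows "(\<forall>s\<le>n. s \<noteq> x --> s \<noteq> y --> turn_count G x m' (m' s) w + turn_count G y l' (l' s) w
      \<le> turn_count G x m (m s) w + turn_count G y l (l s) w) \<and>
    (\<forall>a a'. turn_count G x m' a' w + turn_count G y l' (l x) w
      \<le> turn_count G x m a w + turn_count G y l (l x) w + (if a' = a then 0 else 1)) \<and>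
    (\<forall>b b'. turn_count G x m' (m y) w + turn_count G y l' b' w
      \<le> turn_count G x m (m y) w + turn_count G y l b w + (if b' = b then 0 else 1))"
  using w
proof (induction w)
  case Nil
  have t: "0 \<in> Z \<and> m' 0 = m y \<and> l' 0 = l x \<and> m 0 \<noteq> m y \<and> l 0 \<noteq> l x \<or> m' 0 = m 0 \<and> l' 0 = l 0 \<and> (m 0 = m y \<or> l 0 = l x)"
    using xy unfolding m' l' Z by (auto simp: uncross_def crossing_def)
  have s: "m' s = m y \<and> l' s = l x \<and> m s \<noteq> m y \<and> l s \<noteq> l x \<or> m' s = m s \<and> l' s = l s \<and> (m s = m y \<or> l s = l x)"
    if "s \<le> n" "s \<noteq> x" "s \<noteq> y" for s
    using that unfolding m' l' Z by (auto simp: uncross_def crossing_def)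
  show ?case
  proof (intro conjI allI impI)
    fix s' assume s': "s' \<le> n" "s' \<noteq> x" "s' \<noteq> y"
    show "turn_count G x m' (m' s') [] + turn_count G y l' (l' s') [] \<le> turn_count G x m (m s') [] + turn_count G y l (l s') []"
      using t s[OF s'] by (elim disjE conjE) auto
  next
    fix a a'
    show "turn_count G x m' a' [] + turn_count G y l' (l x) []
      \<le> turn_count G x m a [] + turn_count G y l (l x) [] + (if a' = a then 0 else 1)"
      using t by (elim disjE conjE) auto
  next
    fix b b'
    show "turn_count G x m' (m y) [] + turn_count G y l' b' []
      \<le> turn_count G x m (m y) [] + turn_count G y l b [] + (if b' = b then 0 else 1)"
      using t by (elim disjE conjE) auto
  qed
next
  case (Cons p w)
  define t where "t = fst p"
  have tn: "t \<le> n" using Cons.prems by (simp add: t_def)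
  have my: "m' y = m y" "l' x = l x" unfolding m' l' Z by (auto simp: uncross_def crossing_def)
  have s: "m' s = m y \<and> l' s = l x \<and> m s \<noteq> m y \<and> l s \<noteq> l x \<or> m' s = m s \<and> l' s = l s \<and> (m s = m y \<or> l s = l x)"
    if "s \<le> n" "s \<noteq> x" "s \<noteq> y" for s
    using that unfolding m' l' Z by (auto simp: uncross_def crossing_def)
  have S: "turn_count G x m' (m' s) w + turn_count G y l' (l' s) w
      \<le> turn_count G x m (m s) w + turn_count G y l (l s) w" if "s \<le> n" "s \<noteq> x" "s \<noteq> y" for s
    using Cons that by simp
  have X: "turn_count G x m' a' w + turn_count G y l' (l x) w
      \<le> turn_count G x m a w + turn_count G y l (l x) w + (if a' = a then 0 else 1)" for a a'
    using Cons by simp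
  have Y: "turn_count G x m' (m y) w + turn_count G y l' b' w
      \<le> turn_count G x m (m y) w + turn_count G y l b w + (if b' = b then 0 else 1)" for b b'
    using Cons by simp
  consider (x) "t = x" | (y) "t = y" | (o) "t \<noteq> x" "t \<noteq> y" by blast
  then show ?case
  proof cases
    case x
    have 1: "fst p = x" "fst p \<noteq> y" "m' (fst p) = m' x" "l' (fst p) = l x" "l (fst p) = l x"
      using x xy my by (auto simp: t_def)
    show ?thesis
    proof (intro conjI allI impI)
      fix s assume "s \<le> n" "s \<noteq> x" "s \<noteq> y"
      then show "turn_count G x m' (m' s) (p # w) + turn_count G y l' (l' s) (p # w)
          \<le> turn_count G x m (m s) (p # w) + turn_count G y l (l s) (p # w)"
        using s[OF \<open>s \<le> n\<close> \<open>s \<noteq> x\<close> \<open>s \<noteq> y\<close>] 1 X[of "m' s \<otimes>\<^bsub>G\<^esub> snd p" "m s \<otimes>\<^bsub>G\<^esub> snd p"] by (elim disjE conjE) (auto split: if_splits)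
    next
      fix a a'
      show "turn_count G x m' a' (p # w) + turn_count G y l' (l x) (p # w)
          \<le> turn_count G x m a (p # w) + turn_count G y l (l x) (p # w) + (if a' = a then 0 else 1)"
        using 1 X[of "a' \<otimes>\<^bsub>G\<^esub> snd p" "a \<otimes>\<^bsub>G\<^esub> snd p"] by (auto split: if_splits)
    next
      fix b b'
      show "turn_count G x m' (m y) (p # w) + turn_count G y l' b' (p # w)
          \<le> turn_count G x m (m y) (p # w) + turn_count G y l b (p # w) + (if b' = b then 0 else 1)"
        using 1 X[of "m y \<otimes>\<^bsub>G\<^esub> snd p" "m y \<otimes>\<^bsub>G\<^esub> snd p"] by (auto split: if_splits)
    qed
  next
    case y
    have 1: "fst p = y" "fst p \<noteq> x" "l' (fst p) = l' y" "m' (fst p) = m y" "m (fst p) = m y"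
      using y xy my by (auto simp: t_def)
    show ?thesis
    proof (intro conjI allI impI)
      fix s assume "s \<le> n" "s \<noteq> x" "s \<noteq> y"
      then show "turn_count G x m' (m' s) (p # w) + turn_count G y l' (l' s) (p # w)
          \<le> turn_count G x m (m s) (p # w) + turn_count G y l (l s) (p # w)"
        using s[OF \<open>s \<le> n\<close> \<open>s \<noteq> x\<close> \<open>s \<noteq> y\<close>] 1 Y[of "l' s \<otimes>\<^bsub>G\<^esub> snd p" "l s \<otimes>\<^bsub>G\<^esub> snd p"] by (elim disjE conjE) (auto split: if_splits)
    next
      fix a a'
      show "turn_count G x m' a' (p # w) + turn_count G y l' (l x) (p # w)
          \<le> turn_count G x m a (p # w) + turn_count G y l (l x) (p # w) + (if a' = a then 0 else 1)"
        using 1 Y[of "l x \<otimes>\<^bsub>G\<^esub> snd p" "l x \<otimes>\<^bsub>G\<^esub> snd p"] by (auto split: if_splits)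
    next
      fix b b'
      show "turn_count G x m' (m y) (p # w) + turn_count G y l' b' (p # w)
          \<le> turn_count G x m (m y) (p # w) + turn_count G y l b (p # w) + (if b' = b then 0 else 1)"
        using 1 Y[of "b' \<otimes>\<^bsub>G\<^esub> snd p" "b \<otimes>\<^bsub>G\<^esub> snd p"] by (auto split: if_splits)
    qed
  next
    case o
    note T = S[OF tn o]
    have 1: "fst p = t" "t \<noteq> x" "t \<noteq> y" using o by (auto simp: t_def)
    note st = s[OF tn o]
    show ?thesis
    proof (intro conjI allI impI)
      fix s' assume s': "s' \<le> n" "s' \<noteq> x" "s' \<noteq> y"
      have "(if m' s' = m' t then 0 else 1) + (if l' s' = l' t then 0 else (1::nat))
          \<le> (if m s' = m t then 0 else 1) + (if l s' = l t then 0 else 1)"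
        using st s[OF s'] by (elim disjE conjE) auto
      then show "turn_count G x m' (m' s') (p # w) + turn_count G y l' (l' s') (p # w)
          \<le> turn_count G x m (m s') (p # w) + turn_count G y l (l s') (p # w)"
        using T 1 by simp
    next
      fix a a'
      have "(if a' = m' t then 0 else 1) + (if l x = l' t then 0 else (1::nat))
          \<le> (if a = m t then 0 else 1) + (if l x = l t then 0 else 1) + (if a' = a then 0 else 1)"
        using st by (elim disjE conjE) auto
      then show "turn_count G x m' a' (p # w) + turn_count G y l' (l x) (p # w)
          \<le> turn_count G x m a (p # w) + turn_count G y l (l x) (p # w) + (if a' = a then 0 else 1)"
        using T 1 by simp
    next
      fix b b'
      have "(if m y = m' t then 0 else 1) + (if b' = l' t then 0 else (1::nat))
          \<le> (if m y = m t then 0 else 1) + (if b = l t then 0 else 1) + (if b' = b then 0 else 1)"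
        using st by (elim disjE conjE) auto
      then show "turn_count G x m' (m y) (p # w) + turn_count G y l' b' (p # w)
          \<le> turn_count G x m (m y) (p # w) + turn_count G y l b (p # w) + (if b' = b then 0 else 1)"
        using T 1 by simp
    qed
  qed
qed

lemma turn_count_uncross:
  assumes "x \<noteq> y" "x \<noteq> 0" "y \<noteq> 0" "\<forall>p\<in>set w. fst p \<le> n"
  shows "turn_count G x (uncross m (crossing n x m y l) y) (uncross m (crossing n x m y l) y 0) w
      + turn_count G y (uncross l (crossing n x m y l) x) (uncross l (crossing n x m y l) x 0) w
      \<le> turn_count G x m (m 0) w + turn_count G y l (l 0) w"
  using turn_count_uncross_aux[where m = m and l = l and G = G, OF assms(1-3) refl refl refl assms(4)] assms(2,3) by simp

text \<open>Between two visits to a crossing label \<open>s\<close>, a syllable of label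
  \<open>y\<close> costs the old move at \<open>x\<close> two turns and the new one none, while the
  move at \<open>y\<close> makes one turn in both cases, since \<open>h\<close> changes its
  accumulator. For \<open>s = 0\<close> the two ends of the word act as the visits. This is where
  the length bound 3 for the test words comes from.\<close>

lemma turn_count_uncross_strict:
  assumes xy: "x \<noteq> y" "x \<noteq> 0" "y \<noteq> 0" and s: "s \<in> crossing n x m y l"
    and h: "l s \<otimes>\<^bsub>G\<^esub> h \<noteq> l s" "l x \<otimes>\<^bsub>G\<^esub> h \<noteq> l x"
    and w: "w = (if s = 0 then [(y, h)] else [(s, a), (y, h), (s, a)])"
  shows "turn_count G x (uncross m (crossing n x m y l) y) (uncross m (crossing n x m y l) y 0) w
      + turn_count G y (uncross l (crossing n x m y l) x) (uncross l (crossing n x m y l) x 0) w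
      < turn_count G x m (m 0) w + turn_count G y l (l 0) w"
proof -
  define Z where "Z = crossing n x m y l"
  define m' where "m' = uncross m Z y"
  define l' where "l' = uncross l Z x"
  have sZ: "m' s = m y" "l' s = l x" "m s \<noteq> m y" "l s \<noteq> l x" "s \<noteq> x" "s \<noteq> y"
    using s unfolding m'_def l'_def Z_def by (auto simp: uncross_def crossing_def)
  have my: "m' y = m y" "l' x = l x" unfolding m'_def l'_def Z_def by (auto simp: uncross_def crossing_def)
  have z: "m' 0 = m y \<and> l' 0 = l x \<or> m' 0 = m 0 \<and> l' 0 = l 0 \<and> (m 0 = m y \<or> l 0 = l x)"
    using xy unfolding m'_def l'_def Z_def by (auto simp: uncross_def crossing_def)
  have "turn_count G x m' (m' 0) w + turn_count G y l' (l' 0) w < turn_count G x m (m 0) w + turn_count G y l (l 0) w"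
  proof (cases "s = 0")
    case True
    then have "w = [(y, h)]" using w by simp
    then show ?thesis using sZ my xy h True by simp
  next
    case False
    then have "w = [(s, a), (y, h), (s, a)]" using w by simp
    then show ?thesis using z sZ my xy h by (elim disjE conjE) simp_all
  qed
  then show ?thesis by (simp add: m'_def l'_def Z_def)
qed

text \<open>Turns are comparisons of accumulators, and a left translation commutes with the right
  multiplications between them. This permits dividing a move by its value at the base label.\<close>

lemma (in group) turn_count_translate:
  assumes "c \<in> carrier G" "a \<in> carrier G" "\<And>j. j \<le> n ==> m j \<in> carrier G \<or> j = k" "k \<noteq> 0"
    "\<forall>p\<in>set w. fst p \<le> n \<and> snd p \<in> carrier G"
    and "\<And>j. j \<le> n ==> j \<noteq> k ==> m' j = c \<otimes> m j"
  shows "turn_count G k m' (c \<otimes> a) w = turn_count G k m a w"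
  using assms(2,5)
proof (induction w arbitrary: a)
  case Nil
  then show ?case using assms(1,4) assms(3)[of 0] assms(6)[of 0] by auto
next
  case (Cons p w)
  show ?case
  proof (cases "fst p = k")
    case True
    then show ?thesis using Cons assms(1) by (simp add: m_assoc)
  next
    case False
    then have "m (fst p) \<in> carrier G" using assms(3) Cons.prems by auto
    then show ?thesis using Cons False assms(1,6) by auto
  qed
qed

section \<open>Symmetric Whitehead automorphisms and their effect on normal forms\<close>

context free_product
begin

definition nmove :: "nat => (nat => 'a) => bool" where
  "nmove k m \<longleftrightarrow> k \<in> {1..n} \<and> m 0 = \<one> \<and> m k = \<one> \<and> (\<forall>j\<in>{1..n}. m j \<in> H k)"

definition whitehead :: "(nat => 'a) => 'a => 'a" where
  "whitehead m = endo (\<lambda>j h. m j \<otimes> h \<otimes> inv (m j))"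

lemma nmoveD: assumes "nmove k m" shows "k \<in> {1..n}" "m 0 = \<one>" "m k = \<one>" "j \<in> {1..n} ==> m j \<in> H k"
    "j \<in> {1..n} ==> m j \<in> carrier G" "k \<le> n" "k \<noteq> 0"
  using assms factor_carrier[of k] by (auto simp: nmove_def)

lemma whitehead:
  assumes m: "nmove k m"
  shows "whitehead m \<in> hom G G" "\<And>j h. j \<in> {1..n} ==> h \<in> H j ==> whitehead m h = m j \<otimes> h \<otimes> inv (m j)"
    "\<And>h. h \<in> H k ==> whitehead m h = h"
proof -
  have c: "m j \<otimes> h \<otimes> inv (m j) \<in> carrier G" if "j \<in> {1..n}" "h \<in> H j" for j h
    using that nmoveD(5)[OF m] factor_carrier by simp
  have mult: "m j \<otimes> (h \<otimes> h') \<otimes> inv (m j) = m j \<otimes> h \<otimes> inv (m j) \<otimes> (m j \<otimes> h' \<otimes> inv (m j))"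
    if "j \<in> {1..n}" "h \<in> H j" "h' \<in> H j" for j h h'
  proof -
    have "m j \<in> carrier G" "h \<in> carrier G" "h' \<in> carrier G" using that nmoveD(5)[OF m] factor_carrier by auto
    then show ?thesis by (simp add: m_assoc inv_solve_left)
  qed
  show "whitehead m \<in> hom G G" unfolding whitehead_def by (rule endo(1)) (use c mult in auto)
  show w: "whitehead m h = m j \<otimes> h \<otimes> inv (m j)" if "j \<in> {1..n}" "h \<in> H j" for j h
    unfolding whitehead_def by (rule endo(2)[OF _ _ that]) (use c mult in auto)
  show "whitehead m h = h" if "h \<in> H k" for h
    using w[OF nmoveD(1)[OF m] that] nmoveD(3)[OF m] factor_carrier[OF nmoveD(1)[OF m] that] by simp
qed

lemma whitehead_closed: "nmove k m ==> g \<in> carrier G ==> whitehead m g \<in> carrier G"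
  using whitehead(1) hom_in_carrier by metis

lemma whitehead_ext: "whitehead m \<in> extensional (carrier G)"
  by (simp add: whitehead_def endo_def)

lemma hom_compose': "\<phi> \<in> hom G G ==> \<psi> \<in> hom G G ==> (\<lambda>g. \<phi> (\<psi> g)) \<in> hom G G"
  by (rule homI) (simp_all add: hom_in_carrier hom_mult[of \<phi>] hom_mult[of \<psi>])

lemma conj_conj: "a \<in> carrier G ==> b \<in> carrier G ==> h \<in> carrier G ==>
   a \<otimes> (b \<otimes> h \<otimes> inv b) \<otimes> inv a = (a \<otimes> b) \<otimes> h \<otimes> inv (a \<otimes> b)"
  by (simp add: inv_mult_group m_assoc)

lemma hom_conj: "\<phi> \<in> hom G G ==> a \<in> carrier G ==> h \<in> carrier G ==> \<phi> (a \<otimes> h \<otimes> inv a) = \<phi> a \<otimes> \<phi> h \<otimes> inv (\<phi> a)"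
proof -
  assume a: "\<phi> \<in> hom G G" "a \<in> carrier G" "h \<in> carrier G"
  interpret group_hom G G \<phi> by unfold_locales (rule a(1))
  show ?thesis using a(2,3) by simp
qed

lemma nmove_mult: "nmove k m ==> nmove k m' ==> nmove k (\<lambda>j. m j \<otimes> m' j)"
  using factor_closed by (auto simp: nmove_def)

lemma nmove_inv: "nmove k m ==> nmove k (\<lambda>j. inv (m j))"
  using factor_inv by (auto simp: nmove_def)

lemma nmove_one: "k \<in> {1..n} ==> nmove k (\<lambda>_. \<one>)"
  using factor_one by (auto simp: nmove_def)

text \<open>The multipliers appear in reversed order because the outer automorphism fixes
  \<open>H k\<close>, and with it the inner multipliers, pointwise.\<close>

lemma whitehead_comp:
  assumes m: "nmove k m" and m': "nmove k m'" and g: "g \<in> carrier G"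
  shows "whitehead m (whitehead m' g) = whitehead (\<lambda>j. m' j \<otimes> m j) g"
proof (rule hom_eqI[OF hom_compose'[OF whitehead(1)[OF m] whitehead(1)[OF m']] whitehead(1)[OF nmove_mult[OF m' m]] _ g])
  fix j h assume j: "j \<in> {1..n}" "h \<in> H j"
  have c: "m j \<in> carrier G" "m' j \<in> carrier G" "h \<in> carrier G" using nmoveD(5) m m' j factor_carrier by blast+
  have "whitehead m (whitehead m' h) = whitehead m (m' j \<otimes> h \<otimes> inv (m' j))" using whitehead(2)[OF m' j] by simp
  also have "\<dots> = m' j \<otimes> (m j \<otimes> h \<otimes> inv (m j)) \<otimes> inv (m' j)"
    using hom_conj[OF whitehead(1)[OF m] c(2,3)] whitehead(3)[OF m nmoveD(4)[OF m' j(1)]] whitehead(2)[OF m j] by simp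
  also have "\<dots> = whitehead (\<lambda>j. m' j \<otimes> m j) h" using conj_conj[OF c(2,1,3)] whitehead(2)[OF nmove_mult[OF m' m] j] by simp
  finally show "whitehead m (whitehead m' h) = whitehead (\<lambda>j. m' j \<otimes> m j) h" .
qed

lemma whitehead_one: "k \<in> {1..n} ==> g \<in> carrier G ==> whitehead (\<lambda>_. \<one>) g = g"
proof -
  assume k: "k \<in> {1..n}" and g: "g \<in> carrier G"
  have "(\<lambda>g. g) \<in> hom G G" by (auto intro: homI)
  from hom_eqI[OF whitehead(1)[OF nmove_one[OF k]] this _ g]
  show ?thesis using whitehead(2)[OF nmove_one[OF k]] factor_carrier by simp
qed

lemma whitehead_cong:
  assumes "nmove k m" "nmove k m'" "\<And>j. j \<in> {1..n} ==> m j = m' j" shows "whitehead m = whitehead m'"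
proof (rule extensionalityI[OF whitehead_ext whitehead_ext])
  fix g assume g: "g \<in> carrier G"
  show "whitehead m g = whitehead m' g"
  proof (rule hom_eqI[OF whitehead(1)[OF assms(1)] whitehead(1)[OF assms(2)] _ g])
    fix i h assume "i \<in> {1..n}" "h \<in> H i"
    then show "whitehead m h = whitehead m' h"
      using whitehead(2)[OF assms(1)] whitehead(2)[OF assms(2)] assms(3) by simp
  qed
qed

lemma whitehead_inverse:
  assumes m: "nmove k m" and g: "g \<in> carrier G"
  shows "whitehead (\<lambda>j. inv (m j)) (whitehead m g) = g" "whitehead m (whitehead (\<lambda>j. inv (m j)) g) = g"
proof -
  have k: "k \<in> {1..n}" by (rule nmoveD(1)[OF m])
  have 1: "whitehead (\<lambda>j. m j \<otimes> inv (m j)) = whitehead (\<lambda>_. \<one>)"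
    by (rule whitehead_cong[OF nmove_mult[OF m nmove_inv[OF m]] nmove_one[OF k]]) (use nmoveD(5)[OF m] in simp)
  have 2: "whitehead (\<lambda>j. inv (m j) \<otimes> m j) = whitehead (\<lambda>_. \<one>)"
    by (rule whitehead_cong[OF nmove_mult[OF nmove_inv[OF m] m] nmove_one[OF k]]) (use nmoveD(5)[OF m] in simp)
  show "whitehead (\<lambda>j. inv (m j)) (whitehead m g) = g"
    using whitehead_comp[OF nmove_inv[OF m] m g] 1 whitehead_one[OF k g] by simp
  show "whitehead m (whitehead (\<lambda>j. inv (m j)) g) = g"
    using whitehead_comp[OF m nmove_inv[OF m] g] 2 whitehead_one[OF k g] by simp
qed

lemma whitehead_auto: assumes m: "nmove k m" shows "whitehead m \<in> auto G"
  by (rule automorphismI(1)[OF whitehead(1)[OF m] whitehead(1)[OF nmove_inv[OF m]] whitehead_ext])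
     (use whitehead_inverse[OF m] factor_carrier in auto)

text \<open>No crossing at 0 means that one of the two moves is trivial on the operative factor of
  the other. No crossing at \<open>j\<close> means that at \<open>j\<close> one of the moves takes
  the same value as at the operative factor of the other. In every combination, and for
  \<open>j\<close> operative itself, both compositions conjugate \<open>H j\<close> by the same
  element.\<close>

lemma whitehead_commute:
  assumes m: "nmove k m" and m': "nmove k' m'" and ne: "k \<noteq> k'" and cr: "crossing n k m k' m' = {}" and g: "g \<in> carrier G"
  shows "whitehead m (whitehead m' g) = whitehead m' (whitehead m g)"
proof (rule hom_eqI[OF hom_compose'[OF whitehead(1)[OF m] whitehead(1)[OF m']] hom_compose'[OF whitehead(1)[OF m'] whitehead(1)[OF m]] _ g])
  fix j h assume j: "j \<in> {1..n}" "h \<in> H j"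
  note K = nmoveD[OF m] and K' = nmoveD[OF m']
  have c: "m j \<in> carrier G" "m' j \<in> carrier G" "h \<in> carrier G" "m k' \<in> carrier G" "m' k \<in> carrier G"
    using K(5)[OF j(1)] K'(5)[OF j(1)] factor_carrier[OF j] K(5)[OF K'(1)] K'(5)[OF K(1)] by auto
  have 0: "m k' = \<one> \<or> m' k = \<one>"
    using cr K(2,6,7) K'(2,6,7) ne unfolding crossing_def by auto
  have sep: "m j = m k' \<or> m' j = m' k \<or> j = k \<or> j = k'" using cr j(1) by (auto simp: crossing_def)
  have L: "whitehead m (whitehead m' h) = (m k' \<otimes> m' j \<otimes> inv (m k') \<otimes> m j) \<otimes> h \<otimes> inv (m k' \<otimes> m' j \<otimes> inv (m k') \<otimes> m j)"
  proof -
    have "whitehead m (whitehead m' h) = whitehead m (m' j) \<otimes> whitehead m h \<otimes> inv (whitehead m (m' j))"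
      using whitehead(2)[OF m' j] hom_conj[OF whitehead(1)[OF m] c(2,3)] by simp
    also have "whitehead m (m' j) = m k' \<otimes> m' j \<otimes> inv (m k')" using whitehead(2)[OF m K'(1) K'(4)[OF j(1)]] .
    also have "whitehead m h = m j \<otimes> h \<otimes> inv (m j)" using whitehead(2)[OF m j] .
    finally show ?thesis using c by (simp add: conj_conj)
  qed
  have R: "whitehead m' (whitehead m h) = (m' k \<otimes> m j \<otimes> inv (m' k) \<otimes> m' j) \<otimes> h \<otimes> inv (m' k \<otimes> m j \<otimes> inv (m' k) \<otimes> m' j)"
  proof -
    have "whitehead m' (whitehead m h) = whitehead m' (m j) \<otimes> whitehead m' h \<otimes> inv (whitehead m' (m j))"
      using whitehead(2)[OF m j] hom_conj[OF whitehead(1)[OF m'] c(1,3)] by simp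
    also have "whitehead m' (m j) = m' k \<otimes> m j \<otimes> inv (m' k)" using whitehead(2)[OF m' K(1) K(4)[OF j(1)]] .
    also have "whitehead m' h = m' j \<otimes> h \<otimes> inv (m' j)" using whitehead(2)[OF m' j] .
    finally show ?thesis using c by (simp add: conj_conj)
  qed
  have e: "inv a \<otimes> a = \<one>" "a \<otimes> inv a = \<one>" if "a \<in> carrier G" for a using that by auto
  have "m k' \<otimes> m' j \<otimes> inv (m k') \<otimes> m j = m' k \<otimes> m j \<otimes> inv (m' k) \<otimes> m' j"
    using 0 sep
  proof (elim disjE)
    assume "m k' = \<one>" "m j = m k'" then show ?thesis using c by (simp add: m_assoc)
  next
    assume "m k' = \<one>" "m' j = m' k" then show ?thesis using c by (simp add: m_assoc)
  next
    assume "m k' = \<one>" "j = k" then show ?thesis using c K(3) by (simp add: m_assoc)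
  next
    assume "m k' = \<one>" "j = k'" then show ?thesis using c K'(3) by (simp add: m_assoc)
  next
    assume "m' k = \<one>" "m j = m k'" then show ?thesis using c by (simp add: m_assoc)
  next
    assume "m' k = \<one>" "m' j = m' k" then show ?thesis using c by (simp add: m_assoc)
  next
    assume "m' k = \<one>" "j = k" then show ?thesis using c K(3) by (simp add: m_assoc)
  next
    assume "m' k = \<one>" "j = k'" then show ?thesis using c K'(3) by (simp add: m_assoc)
  qed
  then show "whitehead m (whitehead m' h) = whitehead m' (whitehead m h)" using L R by simp
qed

text \<open>Conjugating each syllable of label \<open>j\<close> by \<open>inv (m j)\<close> puts
  elements of the \<open>k\<close>-th factor between neighbours; they are collected into one
  syllable, and \<open>a\<close> is the part not yet written. The syllables of label
  \<open>k\<close> written here are exactly those counted by \<open>turn_count\<close>.\<close>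

primrec wh_word :: "nat => (nat => 'a) => 'a => (nat \<times> 'a) list => (nat \<times> 'a) list" where
  "wh_word k m a [] = (if a = m 0 then [] else [(k, a)])"
| "wh_word k m a (p # w) = (if fst p = k then wh_word k m (a \<otimes> snd p) w
     else (if a = m (fst p) then [] else [(k, a \<otimes> inv (m (fst p)))]) @ p # wh_word k m (m (fst p)) w)"

lemma wh_word_counts:
  "length (filter (\<lambda>p. fst p = k) (wh_word k m a w)) = turn_count G k m a w"
  "j \<noteq> k ==> length (filter (\<lambda>p. fst p = j) (wh_word k m a w)) = length (filter (\<lambda>p. fst p = j) w)"
  by (induction w arbitrary: a) auto

lemma wh_word_prod:
  assumes m: "nmove k m" and a: "a \<in> H k" and w: "red w"
  shows "wp (wh_word k m a w) = a \<otimes> whitehead (\<lambda>j. inv (m j)) (wp w) \<and> (\<forall>p\<in>set (wh_word k m a w). snd p \<in> carrier G)"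
  using a w
proof (induction w arbitrary: a)
  case Nil
  have "whitehead (\<lambda>j. inv (m j)) \<one> = \<one>" using hom_one[OF whitehead(1)[OF nmove_inv[OF m]]] is_group by simp
  then show ?case using nmoveD(2)[OF m] factor_carrier[OF nmoveD(1)[OF m] Nil(1)] by auto
next
  case (Cons p w)
  let ?W = "whitehead (\<lambda>j. inv (m j))"
  have p: "fst p \<in> {1..n}" "snd p \<in> H (fst p)" "red w" "snd p \<in> carrier G" "wp w \<in> carrier G"
    using Cons.prems red_wp_closed by (auto simp: red_word_Cons factor_carrier)
  have ac: "a \<in> carrier G" using Cons.prems nmoveD(1)[OF m] factor_carrier by blast
  have Wc: "?W (wp w) \<in> carrier G" using whitehead_closed[OF nmove_inv[OF m] p(5)] .
  have Wm: "?W (wp (p # w)) = ?W (snd p) \<otimes> ?W (wp w)"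
    using hom_mult[OF whitehead(1)[OF nmove_inv[OF m]] p(4,5)] by simp
  show ?case
  proof (cases "fst p = k")
    case True
    have "?W (snd p) = snd p" using whitehead(3)[OF nmove_inv[OF m]] p(2) True by simp
    moreover have "a \<otimes> snd p \<in> H k" using factor_closed[OF nmoveD(1)[OF m]] Cons.prems(1) p(2) True by simp
    ultimately show ?thesis using Cons.IH[OF _ p(3)] True Wm ac p(4) Wc by (simp add: m_assoc)
  next
    case False
    let ?x = "m (fst p)"
    have x: "?x \<in> carrier G" "?x \<in> H k" using nmoveD(4,5)[OF m p(1)] by auto
    have IH: "wp (wh_word k m ?x w) = ?x \<otimes> ?W (wp w)" "\<forall>p\<in>set (wh_word k m ?x w). snd p \<in> carrier G"
      using Cons.IH[OF x(2) p(3)] by auto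
    have Wp: "?W (snd p) = inv ?x \<otimes> snd p \<otimes> ?x" using whitehead(2)[OF nmove_inv[OF m] p(1,2)] x by simp
    have "a \<otimes> ?W (wp (p # w)) = a \<otimes> inv ?x \<otimes> (snd p \<otimes> (?x \<otimes> ?W (wp w)))"
      unfolding Wm Wp using x ac p Wc by (simp add: m_assoc)
    then have e: "a \<otimes> ?W (wp (p # w)) = a \<otimes> inv ?x \<otimes> (snd p \<otimes> wp (wh_word k m ?x w))" using IH by simp
    have cc: "snd p \<otimes> wp (wh_word k m ?x w) \<in> carrier G" using IH x p Wc by simp
    show ?thesis
    proof (cases "a = ?x")
      case True
      have "a \<otimes> inv ?x = \<one>" using True x by simp
      then have "a \<otimes> ?W (wp (p # w)) = snd p \<otimes> wp (wh_word k m ?x w)" using e cc by simp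
      moreover have "wh_word k m a (p # w) = p # wh_word k m ?x w" using True False by simp
      ultimately show ?thesis using IH(2) p(4) by simp
    next
      case ne: False
      have "wh_word k m a (p # w) = (k, a \<otimes> inv ?x) # p # wh_word k m ?x w" using ne False by simp
      then show ?thesis using e IH(2) p(4) x ac by simp
    qed
  qed
qed

text \<open>Equal neighbouring labels could only arise if a \<open>k\<close>-syllable between two
  syllables of the same factor disappeared. Then multiplying the accumulator
  \<open>m (fst p)\<close> by \<open>snd q\<close> would leave it unchanged, although
  \<open>snd q\<close> is not the unit.\<close>

lemma red_wh_word:
  assumes m: "nmove k m" and a: "a \<in> H k" and w: "red w"
  shows "red (wh_word k m a w)"
  using a w
proof (induction w arbitrary: a)
  case Nil
  then show ?case using nmoveD[OF m] by (auto simp: red_word_Cons)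
next
  case (Cons p w)
  note K = nmoveD[OF m]
  have p: "fst p \<in> {1..n}" "snd p \<in> H (fst p)" "red w" "snd p \<in> carrier G" "snd p \<noteq> \<one>"
    using Cons.prems by (auto simp: red_word_Cons factor_carrier)
  show ?case
  proof (cases "fst p = k")
    case True
    then show ?thesis using Cons.IH[OF _ p(3)] factor_closed[OF K(1) Cons.prems(1)] p(2) by simp
  next
    case False
    let ?x = "m (fst p)"
    have x: "?x \<in> carrier G" "?x \<in> H k" using K(4,5)[OF p(1)] by auto
    have ac: "a \<in> carrier G" using Cons.prems K(1) factor_carrier by blast
    have r: "red (wh_word k m ?x w)" by (rule Cons.IH[OF x(2) p(3)])
    have hd1: "wh_word k m b u = [] \<or> fst (hd (wh_word k m b u)) = k \<or> (u \<noteq> [] \<and> fst (hd u) \<noteq> k \<and> b = m (fst (hd u)) \<and> fst (hd (wh_word k m b u)) = fst (hd u))"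
      if "u = [] \<or> fst (hd u) \<noteq> k" for u b
      using that by (cases u) auto
    have "wh_word k m ?x w = [] \<or> fst (hd (wh_word k m ?x w)) \<noteq> fst p"
    proof (cases w)
      case Nil
      then show ?thesis using False by auto
    next
      case (Cons q u)
      have q: "fst q \<noteq> fst p" "snd q \<noteq> \<one>" "snd q \<in> H (fst q)" "fst q \<in> {1..n}" "u = [] \<or> fst (hd u) \<noteq> fst q" "red u"
        using \<open>red (p # w)\<close> Cons by (auto simp: red_word_Cons)
      show ?thesis
      proof (cases "fst q = k")
        case True
        have "fst p \<noteq> fst (hd u)" if "?x \<otimes> snd q = m (fst (hd u))"
        proof
          assume "fst p = fst (hd u)"
          then have "?x \<otimes> snd q = ?x" using that by simp
          then show False using x(1) q factor_carrier by (metis l_cancel_one' )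
        qed
        then show ?thesis using hd1[of u "?x \<otimes> snd q"] q(5) True Cons False by auto
      next
        case False
        then show ?thesis using hd1[of w ?x] Cons q(1) \<open>fst p \<noteq> k\<close> by auto
      qed
    qed
    moreover have "a \<otimes> inv ?x \<noteq> \<one>" if "a \<noteq> ?x" using that ac x(1) by (metis inv_equality inv_inv inv_closed)
    moreover have "a \<otimes> inv ?x \<in> H k" using factor_closed[OF K(1)] factor_inv[OF K(1)] Cons.prems(1) x(2) by simp
    ultimately show ?thesis using False r p K(1) by (auto simp: red_word_Cons red_word_append)
  qed
qed

text \<open>The inverse occurs because the syllables of \<open>g\<close> relative to the moved basis
  are those of its preimage relative to \<open>H\<close>. Only the count at the operative factor
  changes.\<close>

lemma syllables_whitehead_inv:
  assumes m: "nmove k m" and g: "g \<in> carrier G"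
  shows "syllables G n H k (whitehead (\<lambda>j. inv (m j)) g) = turn_count G k m \<one> (nf g)"
    "j \<noteq> k ==> syllables G n H j (whitehead (\<lambda>j. inv (m j)) g) = syllables G n H j g"
proof -
  have o: "\<one> \<in> H k" using factor_one nmoveD(1)[OF m] by blast
  let ?w = "wh_word k m \<one> (nf g)"
  have "wp ?w = whitehead (\<lambda>j. inv (m j)) g"
    using wh_word_prod[OF m o nf(1)[OF g]] nf(2)[OF g] whitehead_closed[OF nmove_inv[OF m] g] by simp
  then have "nf (whitehead (\<lambda>j. inv (m j)) g) = ?w" using nf_wp[OF red_wh_word[OF m o nf(1)[OF g]]] by simp
  then show "syllables G n H k (whitehead (\<lambda>j. inv (m j)) g) = turn_count G k m \<one> (nf g)"
    "j \<noteq> k ==> syllables G n H j (whitehead (\<lambda>j. inv (m j)) g) = syllables G n H j g"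
    using wh_word_counts by (simp_all add: syllables_def)
qed

lemma syllables_whitehead:
  assumes m: "nmove k m" and g: "g \<in> carrier G"
  shows "syllables G n H k g = turn_count G k m \<one> (nf (whitehead m g))"
    "j \<noteq> k ==> syllables G n H j (whitehead m g) = syllables G n H j g"
proof -
  have c: "whitehead m g \<in> carrier G" by (rule whitehead_closed[OF m g])
  show "syllables G n H k g = turn_count G k m \<one> (nf (whitehead m g))"
    using syllables_whitehead_inv(1)[OF m c] whitehead_inverse(1)[OF m g] by simp
  show "j \<noteq> k ==> syllables G n H j (whitehead m g) = syllables G n H j g"
    using syllables_whitehead_inv(2)[OF m c, of j] whitehead_inverse(1)[OF m g] by simp
qed

end

lemma turn_count_cong:
  assumes "\<And>j. j \<le> n ==> j \<noteq> k ==> m j = m' j" "k \<noteq> 0" "\<forall>p\<in>set w. fst p \<le> n"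
  shows "turn_count G k m a w = turn_count G k m' a w"
  using assms(3)
proof (induction w arbitrary: a)
  case Nil
  then show ?case using assms(1)[of 0] assms(2) by simp
next
  case (Cons p w)
  then show ?case using assms(1)[of "fst p"] by simp
qed

section \<open>Products of compatible moves\<close>

context free_product
begin

definition system :: "(nat => nat set set) => (nat => nat => 'a) => bool" where
  "system A M \<longleftrightarrow> (\<forall>k\<in>{1..n}. nmove k (M k) \<and> constant_on_petals A k (M k))"

primrec move_product :: "nat list => (nat => nat => 'a) => 'a => 'a" where
  "move_product [] M = (\<lambda>g\<in>carrier G. g)"
| "move_product (k # ks) M = compose (carrier G) (whitehead (M k)) (move_product ks M)"

lemma auto_ext_eqI:
  assumes "\<phi> \<in> auto G" "\<psi> \<in> hom G G" "\<psi> \<in> extensional (carrier G)" "\<And>i h. i \<in> {1..n} ==> h \<in> H i ==> \<phi> h = \<psi> h"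
  shows "\<phi> = \<psi>"
  by (rule extensionalityI[OF autoD(3)[OF assms(1)] assms(3)]) (rule hom_eqI[OF autoD(1)[OF assms(1)] assms(2,4)])

lemma auto_compose:
  assumes \<phi>: "\<phi> \<in> auto G" and \<psi>: "\<psi> \<in> auto G" shows "compose (carrier G) \<phi> \<psi> \<in> auto G"
proof -
  have h: "\<phi> \<in> hom G G" "\<psi> \<in> hom G G" using \<phi> \<psi> autoD(1) by blast+
  have cl: "\<phi> g \<in> carrier G" "\<psi> g \<in> carrier G" if "g \<in> carrier G" for g
    using that hom_in_carrier[OF h(1)] hom_in_carrier[OF h(2)] by auto
  have "bij_betw (\<phi> \<circ> \<psi>) (carrier G) (carrier G)" by (rule bij_betw_trans[OF autoD(2)[OF \<psi>] autoD(2)[OF \<phi>]])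
  moreover have "(\<phi> \<circ> \<psi>) g = compose (carrier G) \<phi> \<psi> g" if "g \<in> carrier G" for g using that by (simp add: compose_eq)
  ultimately have "bij_betw (compose (carrier G) \<phi> \<psi>) (carrier G) (carrier G)" by (metis (no_types, lifting) bij_betw_cong)
  moreover have "compose (carrier G) \<phi> \<psi> \<in> hom G G"
    by (rule homI) (use cl hom_mult[OF h(1)] hom_mult[OF h(2)] in \<open>simp_all add: compose_eq\<close>)
  moreover have "compose (carrier G) \<phi> \<psi> \<in> extensional (carrier G)" unfolding compose_def by (rule restrict_extensional)
  ultimately show ?thesis by (simp add: auto_def Bij_def)
qed

lemma carried_by_auto: "carried_by G n H A \<phi> ==> \<phi> \<in> auto G"
  unfolding carried_by_def sym_whitehead_def by (elim exE conjE)

lemma carried_products_auto: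
  assumes "\<phi> \<in> carried_products G n H A" shows "\<phi> \<in> auto G"
  using assms
proof (induction rule: carried_products.induct)
  case cp_id
  show ?case by (rule id_in_auto)
next
  case (cp_step \<phi> \<psi>)
  then show ?case using auto_compose carried_by_auto by blast
qed

lemma auto_closed: "\<phi> \<in> auto G ==> g \<in> carrier G ==> \<phi> g \<in> carrier G"
  by (rule hom_in_carrier[OF autoD(1)])

lemma carried_by_iff:
  assumes A: "compatible n A"
  shows "carried_by G n H A \<phi> \<longleftrightarrow> (\<exists>k m. nmove k m \<and> constant_on_petals A k m \<and> \<phi> = whitehead m)"
proof
  assume "carried_by G n H A \<phi>"
  then obtain k x where w: "sym_whitehead G n H k x \<phi>"
    and c1: "\<forall>P\<in>A k. \<forall>i\<in>P. \<forall>j\<in>P. i \<in> {1..n} --> j \<in> {1..n} --> x i = x j"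
    and c2: "\<forall>P\<in>A k. 0 \<in> P --> (\<forall>j\<in>P. j \<in> {1..n} --> x j = \<one>)"
    unfolding carried_by_def by (elim exE conjE)
  let ?m = "x(0 := \<one>)"
  have m: "nmove k ?m" using w unfolding sym_whitehead_def nmove_def by auto
  have "?m s = ?m t" if st: "same_petal A k s t" for s t
  proof -
    obtain P where P: "P \<in> A k" "s \<in> P" "t \<in> P" using st by (auto simp: same_petal_def)
    have r: "s \<le> n" "t \<le> n" using same_petal_range[OF A st] by auto
    show ?thesis
    proof (cases "s = 0 \<or> t = 0")
      case True
      then have "0 \<in> P" using P by auto
      then have "j \<in> {1..n} --> x j = \<one>" if "j \<in> P" for j using c2 P(1) that by blast
      then show ?thesis using P r by (cases "s = 0"; cases "t = 0") auto
    next
      case False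
      then have "s \<in> {1..n}" "t \<in> {1..n}" using r by auto
      then have "x s = x t" using c1 P by blast
      then show ?thesis using False by simp
    qed
  qed
  then have c: "constant_on_petals A k ?m" unfolding constant_on_petals_def by blast
  have "\<phi> = whitehead ?m"
  proof (rule auto_ext_eqI[OF _ whitehead(1)[OF m] whitehead_ext])
    show "\<phi> \<in> auto G" using w by (simp add: sym_whitehead_def)
    fix i h assume i: "i \<in> {1..n}" "h \<in> H i"
    then have "\<phi> h = x i \<otimes> h \<otimes> inv (x i)" using w by (simp add: sym_whitehead_def)
    then show "\<phi> h = whitehead ?m h" using whitehead(2)[OF m i] i by auto
  qed
  then show "\<exists>k m. nmove k m \<and> constant_on_petals A k m \<and> \<phi> = whitehead m" using m c by blast
next
  assume "\<exists>k m. nmove k m \<and> constant_on_petals A k m \<and> \<phi> = whitehead m"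
  then obtain k m where m: "nmove k m" "constant_on_petals A k m" "\<phi> = whitehead m" by blast
  have "sym_whitehead G n H k m \<phi>"
    unfolding sym_whitehead_def using nmoveD[OF m(1)] whitehead(2)[OF m(1)] whitehead_auto[OF m(1)] m(3) by simp
  moreover have "m i = m j" if "P \<in> A k" "i \<in> P" "j \<in> P" for P i j
    using m(2) that unfolding constant_on_petals_def same_petal_def by blast
  moreover have "m j = \<one>" if "P \<in> A k" "0 \<in> P" "j \<in> P" for P j
  proof -
    have "same_petal A k j 0" using that by (auto simp: same_petal_def)
    then show ?thesis using m(2) nmoveD(2)[OF m(1)] unfolding constant_on_petals_def by metis
  qed
  ultimately show "carried_by G n H A \<phi>" unfolding carried_by_def by (intro exI[of _ k] exI[of _ m]) blast
qed

lemma system_nmove: "system A M ==> k \<in> {1..n} ==> nmove k (M k)"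
  by (simp add: system_def)

lemma system_crossing:
  assumes A: "compatible n A" and "nmove j l" "constant_on_petals A j l" "nmove k m" "constant_on_petals A k m" "j \<noteq> k"
  shows "crossing n j l k m = {}"
  using moves_compatible_tree[OF A _ _ assms(3,5)] nmoveD(6)[OF assms(2)] nmoveD(6)[OF assms(4)] assms(6)
  by (simp add: moves_compatible_def)

lemma move_product_closed:
  assumes M: "system A M" and ks: "set ks \<subseteq> {1..n}" and g: "g \<in> carrier G"
  shows "move_product ks M g \<in> carrier G"
  using ks
proof (induction ks)
  case (Cons k ks)
  then show ?case using whitehead_closed[OF system_nmove[OF M, of k]] g by (simp add: compose_eq)
qed (use g in simp)

lemma move_product_ext: "move_product ks M \<in> extensional (carrier G)"
  by (cases ks) (simp_all add: compose_def restrict_extensional)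

text \<open>The new automorphism commutes with those at the other factors, as all are carried by one
  tree, until it meets the one at \<open>k\<close>, with which it merges.\<close>

lemma move_product_insert:
  assumes A: "compatible n A" and M: "system A M" and x: "nmove k x" "constant_on_petals A k x"
    and ks: "k \<in> set ks" "distinct ks" "set ks \<subseteq> {1..n}"
  shows "compose (carrier G) (whitehead x) (move_product ks M) = move_product ks (M(k := \<lambda>j. M k j \<otimes> x j))"
  using ks
proof (induction ks)
  case (Cons j ks)
  let ?M = "M(k := \<lambda>j. M k j \<otimes> x j)"
  have ks': "set ks \<subseteq> {1..n}" "j \<in> {1..n}" "j \<notin> set ks" "distinct ks" using Cons.prems by auto
  have same: "move_product ls ?M = move_product ls M" if "k \<notin> set ls" for ls
    using that by (induction ls) auto
  show ?case
  proof (rule extensionalityI[of _ "carrier G"])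
    show "compose (carrier G) (whitehead x) (move_product (j # ks) M) \<in> extensional (carrier G)"
      unfolding compose_def by (rule restrict_extensional)
    show "move_product (j # ks) ?M \<in> extensional (carrier G)" by (rule move_product_ext)
    fix g assume g: "g \<in> carrier G"
    have c: "move_product ks M g \<in> carrier G" by (rule move_product_closed[OF M ks'(1) g])
    show "compose (carrier G) (whitehead x) (move_product (j # ks) M) g = move_product (j # ks) ?M g"
    proof (cases "j = k")
      case True
      have "whitehead x (whitehead (M k) (move_product ks M g)) = whitehead (\<lambda>j. M k j \<otimes> x j) (move_product ks M g)"
        using whitehead_comp[OF x(1) system_nmove[OF M nmoveD(1)[OF x(1)]] c] .
      then show ?thesis using True g same[of ks] ks'(3) by (simp add: compose_eq)
    next
      case False
      have k: "k \<in> set ks" using Cons.prems False by auto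
      have Mj: "nmove j (M j)" "constant_on_petals A j (M j)" using M ks'(2) by (auto simp: system_def)
      have "whitehead x (whitehead (M j) (move_product ks M g)) = whitehead (M j) (whitehead x (move_product ks M g))"
        using whitehead_commute[OF x(1) Mj(1) _ system_crossing[OF A x Mj] c] False by simp
      also have "whitehead x (move_product ks M g) = move_product ks ?M g"
        using Cons.IH[OF k ks'(4,1)] g by (metis compose_eq)
      finally show ?thesis using False g by (simp add: compose_eq)
    qed
  qed
qed simp

lemma set_upt_Suc: "set [1..<Suc n] = {1..n}" by auto

lemma system_one: "system A (\<lambda>_ _. \<one>)"
  using nmove_one by (simp add: system_def constant_on_petals_def)

lemma move_product_one: "set ks \<subseteq> {1..n} ==> move_product ks (\<lambda>_ _. \<one>) = (\<lambda>g\<in>carrier G. g)"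
proof (induction ks)
  case (Cons k ks)
  then show ?case using whitehead_one[of k] by (auto simp: compose_def intro!: restrict_ext)
qed simp

text \<open>A normal form for carried products: one move for each operative factor, in a fixed
  order. All moves refer to the same basis \<open>H\<close>, not to successively moved ones, and
  this makes the reordering possible.\<close>

lemma carried_products_eq:
  assumes A: "compatible n A"
  shows "carried_products G n H A = {move_product [1..<Suc n] M | M. system A M}"
proof (rule equalityI; rule subsetI)
  fix \<rho> assume "\<rho> \<in> carried_products G n H A"
  then show "\<rho> \<in> {move_product [1..<Suc n] M | M. system A M}"
  proof (induction rule: carried_products.induct)
    case cp_id
    then show ?case using system_one move_product_one[of "[1..<Suc n]"] set_upt_Suc by force
  next
    case (cp_step \<phi> \<psi>)
    obtain M where M: "system A M" "\<psi> = move_product [1..<Suc n] M" using cp_step by blast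
    obtain k x where x: "nmove k x" "constant_on_petals A k x" "\<phi> = whitehead x"
      using cp_step(1) carried_by_iff[OF A] by blast
    have k: "k \<in> {1..n}" by (rule nmoveD(1)[OF x(1)])
    have "compose (carrier G) \<phi> \<psi> = move_product [1..<Suc n] (M(k := \<lambda>j. M k j \<otimes> x j))"
      unfolding x(3) M(2) using k set_upt_Suc by (intro move_product_insert[OF A M(1) x(1,2)]) auto
    moreover have "system A (M(k := \<lambda>j. M k j \<otimes> x j))"
      using M(1) x nmove_mult unfolding system_def constant_on_petals_def by auto
    ultimately show ?case by blast
  qed
next
  fix \<rho> assume "\<rho> \<in> {move_product [1..<Suc n] M | M. system A M}"
  then obtain M where M: "system A M" "\<rho> = move_product [1..<Suc n] M" by blast
  have "move_product ks M \<in> carried_products G n H A" if "set ks \<subseteq> {1..n}" for ks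
    using that
  proof (induction ks)
    case (Cons k ks)
    have "carried_by G n H A (whitehead (M k))"
    proof -
      have "nmove k (M k) \<and> constant_on_petals A k (M k)" using M(1) Cons.prems by (simp add: system_def)
      then show ?thesis unfolding carried_by_iff[OF A] by blast
    qed
    moreover have "move_product ks M \<in> carried_products G n H A" using Cons by simp
    ultimately show ?case unfolding move_product.simps by (rule carried_products.cp_step)
  qed (simp add: carried_products.cp_id)
  then show "\<rho> \<in> carried_products G n H A" using M(2) set_upt_Suc by blast
qed

text \<open>A move at another factor does not change the number of \<open>k\<close>-syllables and
  commutes with the move at \<open>k\<close>, so the count depends on \<open>M k\<close> alone. This
  is why the norm of a moved basis is a sum over the operative factors.\<close>

lemma syllables_move_product:
  assumes A: "compatible n A" and M: "system A M" and ks: "distinct ks" "set ks \<subseteq> {1..n}" and u: "u \<in> carrier G"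
  shows "(\<forall>k\<in>set ks. syllables G n H k u = turn_count G k (M k) \<one> (nf (move_product ks M u))) \<and>
    (\<forall>k. k \<notin> set ks --> syllables G n H k (move_product ks M u) = syllables G n H k u)"
  using ks
proof (induction ks)
  case (Cons j ks)
  let ?v = "move_product ks M u"
  have ks': "set ks \<subseteq> {1..n}" "j \<in> {1..n}" "j \<notin> set ks" "distinct ks" using Cons.prems by auto
  have v: "?v \<in> carrier G" by (rule move_product_closed[OF M ks'(1) u])
  have Mj: "nmove j (M j)" "constant_on_petals A j (M j)" using M ks'(2) by (auto simp: system_def)
  have e: "move_product (j # ks) M u = whitehead (M j) ?v" using u by (simp add: compose_eq)
  have IH: "\<forall>k\<in>set ks. syllables G n H k u = turn_count G k (M k) \<one> (nf ?v)"
    "\<forall>k. k \<notin> set ks --> syllables G n H k ?v = syllables G n H k u"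
    using Cons.IH[OF ks'(4,1)] by auto
  show ?case unfolding e
  proof (intro conjI ballI allI impI)
    fix k assume k: "k \<in> set (j # ks)"
    show "syllables G n H k u = turn_count G k (M k) \<one> (nf (whitehead (M j) ?v))"
    proof (cases "k = j")
      case True
      then show ?thesis using syllables_whitehead(1)[OF Mj(1) v] IH(2) ks'(3) by simp
    next
      case False
      then have k': "k \<in> set ks" "k \<in> {1..n}" using k ks' by auto
      have Mk: "nmove k (M k)" "constant_on_petals A k (M k)" using M k'(2) by (auto simp: system_def)
      let ?W = "whitehead (\<lambda>j. inv (M k j))"
      have ci: "constant_on_petals A k (\<lambda>j. inv (M k j))" using Mk(2) unfolding constant_on_petals_def by metis
      have wv: "whitehead (M j) ?v \<in> carrier G" by (rule whitehead_closed[OF Mj(1) v])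
      have "turn_count G k (M k) \<one> (nf (whitehead (M j) ?v)) = syllables G n H k (?W (whitehead (M j) ?v))"
        using syllables_whitehead_inv(1)[OF Mk(1) wv] by simp
      also have "?W (whitehead (M j) ?v) = whitehead (M j) (?W ?v)"
        using whitehead_commute[OF nmove_inv[OF Mk(1)] Mj(1) False system_crossing[OF A nmove_inv[OF Mk(1)] ci Mj False] v] .
      also have "syllables G n H k \<dots> = syllables G n H k (?W ?v)"
        using syllables_whitehead(2)[OF Mj(1) whitehead_closed[OF nmove_inv[OF Mk(1)] v] False] .
      also have "\<dots> = turn_count G k (M k) \<one> (nf ?v)" using syllables_whitehead_inv(1)[OF Mk(1) v] .
      finally show ?thesis using IH(1) k'(1) by simp
    qed
  next
    fix k assume "k \<notin> set (j # ks)"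
    then show "syllables G n H k (whitehead (M j) ?v) = syllables G n H k u"
      using syllables_whitehead(2)[OF Mj(1) v, of k] IH(2) by simp
  qed
qed (use u in simp)

lemma carried_products_comp:
  assumes "\<phi> \<in> carried_products G n H A" "\<psi> \<in> carried_products G n H A"
  shows "compose (carrier G) \<phi> \<psi> \<in> carried_products G n H A"
proof -
  have a: "\<psi> \<in> auto G" by (rule carried_products_auto[OF assms(2)])
  have cl: "\<psi> g \<in> carrier G" if "g \<in> carrier G" for g by (rule auto_closed[OF a that])
  show ?thesis using assms(1)
  proof (induction rule: carried_products.induct)
    case cp_id
    have e: "compose (carrier G) (\<lambda>x\<in>carrier G. x) \<psi> = \<psi>"
      by (rule extensionalityI[of _ "carrier G"])
         (use autoD(3)[OF a] cl in \<open>simp_all add: compose_def restrict_extensional\<close>)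
    show ?case unfolding e by (rule assms(2))
  next
    case (cp_step \<phi> \<xi>)
    have "compose (carrier G) (compose (carrier G) \<phi> \<xi>) \<psi> = compose (carrier G) \<phi> (compose (carrier G) \<xi> \<psi>)"
      by (rule compose_assoc[symmetric]) (use cl in simp)
    then show ?case using carried_products.cp_step[OF cp_step(1,3)] by simp
  qed
qed

lemma carried_by_inverse:
  assumes A: "compatible n A" and "carried_by G n H A \<phi>"
  obtains \<psi> where "carried_by G n H A \<psi>" "\<And>g. g \<in> carrier G ==> \<psi> (\<phi> g) = g" "\<And>g. g \<in> carrier G ==> \<phi> (\<psi> g) = g"
proof -
  obtain k m where m: "nmove k m" "constant_on_petals A k m" "\<phi> = whitehead m" using assms carried_by_iff by blast
  have "carried_by G n H A (whitehead (\<lambda>j. inv (m j)))"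
    unfolding carried_by_iff[OF A] using nmove_inv[OF m(1)] m(2) unfolding constant_on_petals_def by metis
  then show thesis using that whitehead_inverse[OF m(1)] m(3) by blast
qed

lemma carried_products_inverse:
  assumes A: "compatible n A" and "\<phi> \<in> carried_products G n H A"
  shows "\<exists>\<psi>\<in>carried_products G n H A. \<forall>g\<in>carrier G. \<psi> (\<phi> g) = g \<and> \<phi> (\<psi> g) = g"
  using assms(2)
proof (induction rule: carried_products.induct)
  case cp_id
  then show ?case by (intro bexI[of _ "\<lambda>x\<in>carrier G. x"]) (auto intro: carried_products.cp_id)
next
  case (cp_step \<phi> \<xi>)
  obtain \<psi> where \<psi>: "\<psi> \<in> carried_products G n H A" "\<forall>g\<in>carrier G. \<psi> (\<xi> g) = g \<and> \<xi> (\<psi> g) = g" using cp_step by blast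
  obtain \<theta> where \<theta>: "carried_by G n H A \<theta>" "\<And>g. g \<in> carrier G ==> \<theta> (\<phi> g) = g" "\<And>g. g \<in> carrier G ==> \<phi> (\<theta> g) = g"
    using carried_by_inverse[OF A cp_step(1)] by blast
  have \<theta>': "\<theta> \<in> carried_products G n H A"
  proof -
    have "compose (carrier G) \<theta> (\<lambda>x\<in>carrier G. x) = \<theta>"
      by (rule extensionalityI[of _ "carrier G"])
         (use autoD(3)[OF carried_by_auto[OF \<theta>(1)]] in \<open>simp_all add: compose_def restrict_extensional\<close>)
    then show ?thesis using carried_products.cp_step[OF \<theta>(1) carried_products.cp_id] by simp
  qed
  have cl: "\<xi> g \<in> carrier G" "\<psi> g \<in> carrier G" "\<theta> g \<in> carrier G" "\<phi> g \<in> carrier G" if "g \<in> carrier G" for g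
    using that auto_closed[OF carried_products_auto[OF \<psi>(1)]] auto_closed[OF carried_products_auto[OF cp_step(2)]]
      auto_closed[OF carried_by_auto[OF \<theta>(1)]] auto_closed[OF carried_by_auto[OF cp_step(1)]] by auto
  show ?case
    using carried_products_comp[OF \<psi>(1) \<theta>'] \<psi>(2) \<theta> cl
    by (intro bexI[of _ "compose (carrier G) \<psi> \<theta>"]) (auto simp: compose_eq)
qed

text \<open>Conjugation by \<open>\<theta>\<close> pulls the multipliers back from the moved basis
  to \<open>H\<close> and keeps the labels, hence the tree. It is the substitute for comparing moves
  relative to different bases.\<close>

lemma carried_by_conj:
  assumes \<theta>: "\<theta> \<in> auto G" and c: "carried_by G n (\<lambda>i. \<theta> ` H i) A \<phi>"
  shows "\<exists>\<phi>'. carried_by G n H A \<phi>' \<and> (\<forall>g\<in>carrier G. \<phi> (\<theta> g) = \<theta> (\<phi>' g))"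
proof -
  obtain \<eta> where \<eta>: "\<eta> \<in> auto G" "\<And>g. g \<in> carrier G ==> \<eta> (\<theta> g) = g" "\<And>g. g \<in> carrier G ==> \<theta> (\<eta> g) = g"
    using auto_inverse[OF \<theta>] by blast
  obtain k x where w: "sym_whitehead G n (\<lambda>i. \<theta> ` H i) k x \<phi>"
    and c1: "\<forall>P\<in>A k. \<forall>i\<in>P. \<forall>j\<in>P. i \<in> {1..n} --> j \<in> {1..n} --> x i = x j"
    and c2: "\<forall>P\<in>A k. 0 \<in> P --> (\<forall>j\<in>P. j \<in> {1..n} --> x j = \<one>)"
    using c unfolding carried_by_def by (elim exE conjE)
  have h: "\<theta> \<in> hom G G" "\<eta> \<in> hom G G" using \<theta> \<eta>(1) autoD(1) by blast+
  have \<phi>: "\<phi> \<in> auto G" "\<phi> \<in> hom G G" using w autoD(1) by (auto simp: sym_whitehead_def)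
  have cl: "\<theta> g \<in> carrier G" "\<eta> g \<in> carrier G" "\<phi> g \<in> carrier G" if "g \<in> carrier G" for g
    using that h \<phi>(2) hom_in_carrier by metis+
  have k: "k \<in> {1..n}" "x k = \<one>" "\<And>j. j \<in> {1..n} ==> x j \<in> \<theta> ` H k" using w by (auto simp: sym_whitehead_def)
  have \<eta>1: "\<eta> \<one> = \<one>" using hom_one[OF h(2)] is_group by simp
  have xc: "x j \<in> carrier G" "\<eta> (x j) \<in> H k" if "j \<in> {1..n}" for j
    using k(3)[OF that] factor_carrier[OF k(1)] cl \<eta>(2) by auto
  let ?\<phi> = "compose (carrier G) \<eta> (compose (carrier G) \<phi> \<theta>)"
  have e: "?\<phi> g = \<eta> (\<phi> (\<theta> g))" if "g \<in> carrier G" for g using that by (simp add: compose_eq)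
  have \<phi>': "?\<phi> \<in> auto G" by (rule auto_compose[OF \<eta>(1) auto_compose[OF \<phi>(1) \<theta>]])
  have act: "?\<phi> u = \<eta> (x j) \<otimes> u \<otimes> inv (\<eta> (x j))" if j: "j \<in> {1..n}" "u \<in> H j" for j u
  proof -
    have u: "u \<in> carrier G" by (rule factor_carrier[OF j])
    have "\<phi> (\<theta> u) = x j \<otimes> \<theta> u \<otimes> inv (x j)" using w j by (simp add: sym_whitehead_def)
    then show ?thesis using e[OF u] hom_conj[OF h(2) xc(1)[OF j(1)] cl(1)[OF u]] \<eta>(2)[OF u] by simp
  qed
  have "sym_whitehead G n H k (\<lambda>j. \<eta> (x j)) ?\<phi>"
    unfolding sym_whitehead_def using k \<eta>1 xc \<phi>' act by simp
  then have "carried_by G n H A ?\<phi>"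
    unfolding carried_by_def using c1 c2 \<eta>1 by (intro exI[of _ k] exI[of _ "\<lambda>j. \<eta> (x j)"]) metis
  moreover have "\<phi> (\<theta> g) = \<theta> (?\<phi> g)" if "g \<in> carrier G" for g using that e \<eta>(3) cl by simp
  ultimately show ?thesis by blast
qed

lemma carried_products_conj:
  assumes \<theta>: "\<theta> \<in> auto G" and c: "\<phi> \<in> carried_products G n (\<lambda>i. \<theta> ` H i) A"
  shows "\<exists>\<phi>'\<in>carried_products G n H A. \<forall>g\<in>carrier G. \<phi> (\<theta> g) = \<theta> (\<phi>' g)"
  using c
proof (induction rule: carried_products.induct)
  case cp_id
  have "\<theta> g \<in> carrier G" if "g \<in> carrier G" for g using that hom_in_carrier autoD(1)[OF \<theta>] by metis
  then show ?case by (intro bexI[of _ "\<lambda>x\<in>carrier G. x"]) (auto intro: carried_products.cp_id)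
next
  case (cp_step \<phi> \<psi>)
  obtain \<psi>' where \<psi>': "\<psi>' \<in> carried_products G n H A" "\<forall>g\<in>carrier G. \<psi> (\<theta> g) = \<theta> (\<psi>' g)" using cp_step by blast
  obtain \<phi>' where \<phi>': "carried_by G n H A \<phi>'" "\<forall>g\<in>carrier G. \<phi> (\<theta> g) = \<theta> (\<phi>' g)"
    using carried_by_conj[OF \<theta> cp_step(1)] by blast
  have cl: "\<theta> g \<in> carrier G" "\<psi>' g \<in> carrier G" if "g \<in> carrier G" for g
    using that hom_in_carrier autoD(1)[OF \<theta>] autoD(1)[OF carried_products_auto[OF \<psi>'(1)]] by metis+
  show ?case
    using carried_products.cp_step[OF \<phi>'(1) \<psi>'(1)] \<phi>'(2) \<psi>'(2) cl
    by (intro bexI[of _ "compose (carrier G) \<phi>' \<psi>'"]) (auto simp: compose_eq)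
qed

end

section \<open>Petal families of pointed labelled trees\<close>

definition avoid :: "(nat + nat) set set => nat => nat + nat => nat + nat => bool" where
  "avoid E k = (\<lambda>a b. {a, b} \<in> E \<and> a \<noteq> Inl k \<and> b \<noteq> Inl k)"

lemma avoid_sym: "(avoid E k)\<^sup>*\<^sup>* u v ==> (avoid E k)\<^sup>*\<^sup>* v u"
  by (rule sympD[OF symp_rtranclp]) (auto simp: symp_def avoid_def insert_commute)

lemma avoid_end: "(avoid E k)\<^sup>*\<^sup>* u v ==> u \<noteq> Inl k ==> v \<noteq> Inl k"
  by (induction rule: rtranclp_induct) (auto simp: avoid_def)

lemma petals_avoid: "petals V E k = {{l. Inl l \<in> V \<and> (avoid E k)\<^sup>*\<^sup>* u (Inl l)} | u. u \<in> V - {Inl k}} - {{}}"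
  unfolding petals_def avoid_def ..

lemma same_petal_petal_family:
  assumes V: "\<And>l. Inl l \<in> V \<longleftrightarrow> l \<le> n"
  shows "same_petal (petal_family n V E) k s t \<longleftrightarrow>
    k \<le> n \<and> s \<le> n \<and> t \<le> n \<and> s \<noteq> k \<and> t \<noteq> k \<and> (avoid E k)\<^sup>*\<^sup>* (Inl s) (Inl t)"
proof
  assume "same_petal (petal_family n V E) k s t"
  then obtain P where k: "k \<le> n" and P: "P \<in> petals V E k" "s \<in> P" "t \<in> P"
    by (auto simp: same_petal_def petal_family_def split: if_splits)
  then obtain u where u: "u \<noteq> Inl k" "P = {l. Inl l \<in> V \<and> (avoid E k)\<^sup>*\<^sup>* u (Inl l)}" by (auto simp: petals_avoid)
  have "(avoid E k)\<^sup>*\<^sup>* u (Inl s)" "(avoid E k)\<^sup>*\<^sup>* u (Inl t)" "s \<le> n" "t \<le> n" using P u V by auto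
  then show "k \<le> n \<and> s \<le> n \<and> t \<le> n \<and> s \<noteq> k \<and> t \<noteq> k \<and> (avoid E k)\<^sup>*\<^sup>* (Inl s) (Inl t)"
    using k u(1) avoid_end avoid_sym rtranclp_trans[of "avoid E k" "Inl s" u "Inl t"] by blast
next
  assume a: "k \<le> n \<and> s \<le> n \<and> t \<le> n \<and> s \<noteq> k \<and> t \<noteq> k \<and> (avoid E k)\<^sup>*\<^sup>* (Inl s) (Inl t)"
  let ?P = "{l. Inl l \<in> V \<and> (avoid E k)\<^sup>*\<^sup>* (Inl s) (Inl l)}"
  have "s \<in> ?P" "t \<in> ?P" using a V by auto
  moreover have "Inl s \<in> V - {Inl k}" using a V by auto
  ultimately have "?P \<in> petals V E k" unfolding petals_avoid by blast
  then have PA: "?P \<in> petal_family n V E k" using a by (simp add: petal_family_def)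
  have "s \<in> ?P \<and> t \<in> ?P" by (rule conjI) fact+
  then show "same_petal (petal_family n V E) k s t" unfolding same_petal_def using PA by (rule bexI)
qed

lemma rtranclp_first_hit:
  assumes "r\<^sup>*\<^sup>* u v" "v \<in> S" "u \<notin> S"
  shows "\<exists>w\<in>S. (\<lambda>a b. r a b \<and> a \<notin> S)\<^sup>*\<^sup>* u w"
  using assms
proof (induction rule: converse_rtranclp_induct)
  case (step y z)
  show ?case
  proof (cases "z \<in> S")
    case True
    then show ?thesis using step by (intro bexI[of _ z]) auto
  next
    case False
    then obtain w where "w \<in> S" "(\<lambda>a b. r a b \<and> a \<notin> S)\<^sup>*\<^sup>* z w" using step by blast
    then show ?thesis using step by (intro bexI[of _ w]) (auto intro: converse_rtranclp_into_rtranclp)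
  qed
qed simp

text \<open>A path from \<open>s\<close> to \<open>i\<close> is stopped at its first visit to
  \<open>i\<close> or \<open>j\<close>; the initial piece then avoids the other of the two. At the
  base label there is a single petal because that label is a leaf.\<close>

lemma compatible_petal_family:
  assumes T: "pointed_labelled_tree n V E" and n: "n \<ge> 1"
  shows "compatible n (petal_family n V E)"
proof -
  have V: "\<And>l. Inl l \<in> V \<longleftrightarrow> l \<le> n" and conn: "\<And>u v. u \<in> V ==> v \<in> V ==> (tree_adj E)\<^sup>*\<^sup>* u v"
    and EV: "\<And>e. e \<in> E ==> e \<subseteq> V \<and> (\<exists>l m. e = {Inl l, Inr m})"
    and leaf: "card {e \<in> E. Inl 0 \<in> e} = 1"
    using T unfolding pointed_labelled_tree_def by auto
  let ?A = "petal_family n V E"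
  note sp = same_petal_petal_family[OF V, of E]
  have part: "partition_on ({0..n} - {k}) (?A k)" if k: "k \<le> n" for k
    unfolding partition_on_def
  proof (intro conjI)
    show "\<Union>(?A k) = {0..n} - {k}"
    proof (rule equalityI; rule subsetI)
      fix s assume "s \<in> \<Union>(?A k)"
      then have "same_petal ?A k s s" by (auto simp: same_petal_def)
      then show "s \<in> {0..n} - {k}" using sp by auto
    next
      fix s assume "s \<in> {0..n} - {k}"
      then have "same_petal ?A k s s" using sp k by auto
      then show "s \<in> \<Union>(?A k)" by (auto simp: same_petal_def)
    qed
    show "{} \<notin> ?A k" using k by (simp add: petal_family_def petals_avoid)
    have sub: "p \<subseteq> q" if pq: "p \<in> ?A k" "q \<in> ?A k" and s: "s \<in> p" "s \<in> q" for p q s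
    proof
      fix t assume t: "t \<in> p"
      have "q \<in> petals V E k" using pq(2) k by (simp add: petal_family_def)
      then obtain u where u: "q = {l. Inl l \<in> V \<and> (avoid E k)\<^sup>*\<^sup>* u (Inl l)}" unfolding petals_avoid by blast
      have "same_petal ?A k s t" using pq(1) s(1) t by (auto simp: same_petal_def)
      then have "(avoid E k)\<^sup>*\<^sup>* (Inl s) (Inl t)" "t \<le> n" using sp by auto
      moreover have "(avoid E k)\<^sup>*\<^sup>* u (Inl s)" using s(2) u by auto
      ultimately show "t \<in> q" using u V rtranclp_trans[of "avoid E k" u "Inl s" "Inl t"] by simp
    qed
    have "p \<inter> q = {}" if "p \<in> ?A k" "q \<in> ?A k" "p \<noteq> q" for p q
      using sub[OF that(1,2)] sub[OF that(2,1)] that(3) by blast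
    then show "disjoint (?A k)" unfolding disjoint_def by blast
  qed
  have comp: "same_petal ?A i s j \<or> same_petal ?A j s i" if ij: "i \<le> n" "j \<le> n" "s \<le> n" "i \<noteq> j" "s \<noteq> i" "s \<noteq> j" for i j s
  proof -
    have "(tree_adj E)\<^sup>*\<^sup>* (Inl s) (Inl i)" using conn V ij by simp
    then obtain w where w: "w \<in> {Inl i, Inl j}" "(\<lambda>a b. tree_adj E a b \<and> a \<notin> {Inl i, Inl j})\<^sup>*\<^sup>* (Inl s) w"
      using rtranclp_first_hit[of "tree_adj E" "Inl s" "Inl i" "{Inl i, Inl j}"] ij by auto
    have av: "(\<lambda>a b. tree_adj E a b \<and> a \<notin> {Inl i, Inl j})\<^sup>*\<^sup>* (Inl s) v ==> v \<noteq> Inl x ==> (avoid E x)\<^sup>*\<^sup>* (Inl s) v"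
      if "x = i \<or> x = j" for x v
    proof (induction rule: rtranclp_induct)
      case (step y z)
      then have "avoid E x y z" using that by (auto simp: avoid_def tree_adj_def)
      moreover have "(avoid E x)\<^sup>*\<^sup>* (Inl s) y" using step that by auto
      ultimately show ?case by (meson rtranclp.rtrancl_into_rtrancl)
    qed simp
    show ?thesis
    proof (cases "w = Inl i")
      case True
      then have "(avoid E j)\<^sup>*\<^sup>* (Inl s) (Inl i)" using av[of j w] w ij by auto
      then show ?thesis using sp ij by auto
    next
      case False
      then have "(avoid E i)\<^sup>*\<^sup>* (Inl s) (Inl j)" using av[of i w] w ij by auto
      then show ?thesis using sp ij by auto
    qed
  qed
  obtain e0 where e0: "{e \<in> E. Inl 0 \<in> e} = {e0}" using leaf card_1_singletonE by blast
  have "e0 \<in> {e \<in> E. Inl 0 \<in> e}" unfolding e0 by simp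
  then have e0E: "e0 \<in> E" "Inl 0 \<in> e0" by simp_all
  obtain l m0 where "e0 = {Inl l, Inr m0}" using EV[OF e0E(1)] by (elim conjE exE)
  then have m0: "e0 = {Inl 0, Inr m0}" using e0E(2) by simp
  have nb: "b = Inr m0" if "{Inl 0, b} \<in> E" for b
  proof -
    have "{Inl 0, b} \<in> {e \<in> E. Inl 0 \<in> e}" using that by simp
    then have "{Inl 0, b} = e0" unfolding e0 by simp
    then show ?thesis using m0 EV[OF that] by (auto simp: doubleton_eq_iff)
  qed
  \<comment> \<open>A path through the leaf 0 comes from its only neighbour and returns to it, so
    such visits can be cut out.\<close>
  have av0: "(tree_adj E)\<^sup>*\<^sup>* u v ==> u \<noteq> Inl 0 ==> (v \<noteq> Inl 0 --> (avoid E 0)\<^sup>*\<^sup>* u v) \<and> (v = Inl 0 --> (avoid E 0)\<^sup>*\<^sup>* u (Inr m0))" for u v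
  proof (induction rule: rtranclp_induct)
    case (step y z)
    have yz: "{y, z} \<in> E" using step by (simp add: tree_adj_def)
    show ?case
    proof (cases "y = Inl 0")
      case True
      then have "z = Inr m0" using nb yz by simp
      then show ?thesis using step True by simp
    next
      case y: False
      then have uy: "(avoid E 0)\<^sup>*\<^sup>* u y" using step by simp
      show ?thesis
      proof (cases "z = Inl 0")
        case True
        then have "y = Inr m0" using nb[of y] yz by (simp add: insert_commute)
        then show ?thesis using uy True by simp
      next
        case False
        then have "avoid E 0 y z" using y yz by (simp add: avoid_def)
        then show ?thesis using uy False by (meson rtranclp.rtrancl_into_rtrancl)
      qed
    qed
  qed simp
  have "same_petal ?A 0 s t" if "s \<in> {1..n}" "t \<in> {1..n}" for s t
    using that av0[of "Inl s" "Inl t"] conn[of "Inl s" "Inl t"] V sp by auto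
  then have one: "\<exists>P\<in>?A 0. s \<in> P \<and> t \<in> P" if "s \<in> {1..n}" "t \<in> {1..n}" for s t using that by (simp add: same_petal_def)
  have p0: "partition_on {1..n} (?A 0)"
  proof -
    have "{0..n} - {0} = {1..n}" by auto
    then show ?thesis using part[of 0] by simp
  qed
  have "?A 0 = {{1..n}}"
  proof -
    have "P = {1..n}" if P: "P \<in> ?A 0" for P
    proof -
      have sub: "P \<subseteq> {1..n}" and ne: "P \<noteq> {}" using p0 P unfolding partition_on_def by blast+
      then obtain s where s: "s \<in> P" "s \<in> {1..n}" by blast
      have "t \<in> P" if t: "t \<in> {1..n}" for t
      proof -
        obtain Q where Q: "Q \<in> ?A 0" "s \<in> Q" "t \<in> Q" using one[OF s(2) t] by blast
        have "disjoint (?A 0)" using p0 by (simp add: partition_on_def)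
        then have "Q = P" using Q P s(1) unfolding disjoint_def by blast
        then show ?thesis using Q by simp
      qed
      then show ?thesis using sub by blast
    qed
    moreover have "?A 0 \<noteq> {}" using one[of 1 1] n by auto
    ultimately show ?thesis by blast
  qed
  then show ?thesis unfolding compatible_def using part comp by (auto simp: petal_family_def)
qed

section \<open>From compatible partitions back to trees\<close>

locale tree_from_partitions =
  fixes n :: nat and A :: "nat => nat set set"
  assumes A: "compatible n A" and n: "n \<ge> 1"
begin

text \<open>When the tree is rooted at the base label, an unlabelled vertex is determined by its
  parent \<open>k\<close> and the petal \<open>P\<close> of \<open>k\<close> behind it. Petals
  containing 0 point towards the root and contribute no vertex.\<close>

definition D :: "(nat \<times> nat set) set" where
  "D = {(k, P). k \<le> n \<and> P \<in> A k \<and> 0 \<notin> P}"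

definition below :: "nat => (nat \<times> nat set) set" where
  "below j = {d \<in> D. j \<in> snd d}"

lemma petal_sub: "P \<in> A k ==> k \<le> n ==> P \<subseteq> {0..n} - {k}"
  using compatibleD(2)[OF A] unfolding partition_on_def by blast

lemma finite_D: "finite D"
proof (rule finite_subset)
  show "D \<subseteq> {0..n} \<times> Pow {0..n}" unfolding D_def using petal_sub by fastforce
qed simp

lemma finite_below: "finite (below j)" using finite_D by (simp add: below_def)

lemma finite_petal: "P \<in> A k ==> k \<le> n ==> finite P"
  using petal_sub finite_subset by blast

lemma same_petalI: "P \<in> A k ==> s \<in> P ==> t \<in> P ==> same_petal A k s t"
  by (auto simp: same_petal_def)

lemma petalD: "P \<in> A k ==> s \<in> P ==> same_petal A k s t ==> t \<in> P"
  using petal_eq[OF A, of P k s] by blast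

text \<open>The ancestors of a label form a chain: the petal at the vertex nearer to the root
  contains the other vertex together with its petal.\<close>

lemma nested:
  assumes d: "(k, P) \<in> D" "(k', P') \<in> D" "k \<noteq> k'" "j \<in> P" "j \<in> P'"
  shows "k' \<in> P \<and> P' \<subseteq> P \<or> k \<in> P' \<and> P \<subseteq> P'"
proof -
  have D: "k \<le> n" "P \<in> A k" "0 \<notin> P" "k' \<le> n" "P' \<in> A k'" "0 \<notin> P'" using d by (auto simp: D_def)
  have step: "i' \<in> Q \<and> Q' \<subseteq> Q" if q: "i \<le> n" "Q \<in> A i" "0 \<notin> Q" "i' \<le> n" "Q' \<in> A i'" "0 \<notin> Q'" "i \<noteq> i'" "j \<in> Q" "j \<in> Q'"
    and top: "i = 0 \<or> same_petal A i' 0 i" for i Q i' Q'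
  proof -
    have r: "j \<le> n" "j \<noteq> i" "j \<noteq> i'" using petal_sub[OF q(2,1)] petal_sub[OF q(5,4)] q by auto
    have no: "\<not> same_petal A i' s i" if s: "s \<in> Q'" for s
    proof
      assume si: "same_petal A i' s i"
      then have "same_petal A i' s 0"
        using top same_petal_trans[OF A si] same_petal_sym by (cases "i = 0") auto
      then show False using petalD[OF q(5) s] q(6) by blast
    qed
    have "same_petal A i j i'"
      using compatibleD(4)[OF A q(1,4) r(1) q(7) r(2,3)] no[OF q(9)] by blast
    then have i': "i' \<in> Q" using petalD[OF q(2,8)] by blast
    moreover have "Q' \<subseteq> Q"
    proof
      fix s assume s: "s \<in> Q'"
      have sr: "s \<le> n" "s \<noteq> i'" using petal_sub[OF q(5,4)] s by auto
      show "s \<in> Q"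
      proof (cases "s = i")
        case True
        have "same_petal A i' s i" using True s q(5) by (auto simp: same_petal_def)
        then show ?thesis using no[OF s] by blast
      next
        case False
        then have "same_petal A i s i'" using compatibleD(4)[OF A q(1,4) sr(1) q(7) False sr(2)] no[OF s] by blast
        then show ?thesis using petalD[OF q(2) i'] same_petal_sym by blast
      qed
    qed
    ultimately show ?thesis by blast
  qed
  show ?thesis
  proof (cases "k = 0 \<or> same_petal A k' 0 k")
    case True
    then show ?thesis using step[of k P k' P'] D d by blast
  next
    case False
    have "k' = 0 \<or> same_petal A k 0 k'"
      using compatibleD(4)[OF A D(1,4), of 0] d(3) False by auto
    then show ?thesis using step[of k' P' k P] D d by blast
  qed
qed

lemma below_nonempty: "j \<in> {1..n} ==> below j \<noteq> {}"
  using compatibleD(3)[OF A] by (auto simp: below_def D_def)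

text \<open>The future parent of \<open>j\<close> in the rooted tree: by nesting, the smallest petal
  belongs to the nearest ancestor.\<close>

definition up :: "nat => nat \<times> nat set" where
  "up j = arg_min_on (card \<circ> snd) (below j)"

lemma up: assumes j: "j \<in> {1..n}"
  shows "up j \<in> below j" "\<And>d. d \<in> below j ==> card (snd (up j)) \<le> card (snd d)"
  using arg_min_if_finite[OF finite_below below_nonempty[OF j], of "card \<circ> snd"]
  unfolding up_def by (auto simp: not_less)

lemma up_D: assumes "j \<in> {1..n}" "up j = (i, Q)" shows "i \<le> n" "Q \<in> A i" "0 \<notin> Q" "j \<in> Q" "(i, Q) \<in> D" "j \<noteq> i"
proof -
  have "(i, Q) \<in> below j" using up(1)[OF assms(1)] assms(2) by simp
  then show 1: "i \<le> n" "Q \<in> A i" "0 \<notin> Q" "j \<in> Q" "(i, Q) \<in> D" by (auto simp: below_def D_def)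
  show "j \<noteq> i" using petal_sub[OF 1(2,1)] 1(4) by auto
qed

lemma up_minimal:
  assumes j: "j \<in> {1..n}" "up j = (i, Q)" and d: "(k, P) \<in> below j" "k \<noteq> i"
  shows "i \<in> P \<and> Q \<subseteq> P"
proof -
  note u = up_D[OF j]
  have P: "(k, P) \<in> D" "j \<in> P" "P \<in> A k" "k \<le> n" using d by (auto simp: below_def D_def)
  have "\<not> (k \<in> Q \<and> P \<subseteq> Q)"
  proof
    assume a: "k \<in> Q \<and> P \<subseteq> Q"
    have "k \<notin> P" using petal_sub[OF P(3,4)] by auto
    then have "P \<subset> Q" using a by blast
    then have "card P < card Q" using finite_petal[OF u(2,1)] psubset_card_mono by blast
    then show False using up(2)[OF j(1) d(1)] j(2) by simp
  qed
  then show ?thesis using nested[OF P(1) u(5) d(2) P(2) u(4)] by blast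
qed

text \<open>All ancestors of \<open>i\<close> are ancestors of \<open>j\<close>, and
  \<open>(i, Q)\<close> is one more. So the number of ancestors measures the depth, and it drives
  the inductions along paths to the root.\<close>

lemma below_less:
  assumes "(i, Q) \<in> below j" shows "card (below i) < card (below j)"
proof -
  have q: "(i, Q) \<in> D" "j \<in> Q" "Q \<in> A i" "i \<le> n" using assms by (auto simp: below_def D_def)
  have iQ: "i \<notin> Q" using petal_sub[OF q(3,4)] by auto
  have "d \<in> below j" if d: "d \<in> below i" for d
  proof -
    obtain k P where kP: "d = (k, P)" by (cases d)
    have P: "(k, P) \<in> D" "i \<in> P" "P \<in> A k" "k \<le> n" "0 \<notin> P" using d kP by (auto simp: below_def D_def)
    have ki: "k \<noteq> i" using petal_sub[OF P(3,4)] P(2) by auto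
    have "j \<in> P"
    proof (rule ccontr)
      assume jP: "j \<notin> P"
      have jn: "j \<le> n" "j \<noteq> i" using petal_sub[OF q(3,4)] q(2) by auto
      have "same_petal A i j k"
      proof (cases "j = k")
        case True
        then show ?thesis using same_petalI[OF q(3,2,2)] by simp
      next
        case False
        have "\<not> same_petal A k j i" using petalD[OF P(3,2)] jP same_petal_sym by blast
        then show ?thesis using compatibleD(4)[OF A P(4) q(4) jn(1) ki False jn(2)] by blast
      qed
      then have kQ: "k \<in> Q" using petalD[OF q(3,2)] by blast
      have "0 \<notin> Q" using q(1) by (simp add: D_def)
      then have k0: "k \<noteq> 0" using kQ by metis
      have i0: "i \<noteq> 0" using P(2,5) by metis
      have "\<not> same_petal A i 0 k" using petalD[OF q(3) kQ] \<open>0 \<notin> Q\<close> same_petal_sym by blast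
      moreover have "\<not> same_petal A k 0 i" using petalD[OF P(3,2)] P(5) same_petal_sym by blast
      ultimately show False using compatibleD(4)[OF A P(4) q(4), of 0] ki k0 i0 by auto
    qed
    then show ?thesis using P kP by (simp add: below_def)
  qed
  moreover have "(i, Q) \<notin> below i" using iQ by (simp add: below_def)
  ultimately have "below i \<subset> below j" using assms by blast
  then show ?thesis by (rule psubset_card_mono[OF finite_below])
qed

text \<open>If \<open>k\<close> separated \<open>j\<close> from \<open>i\<close>, then the petal of
  \<open>j\<close> at \<open>k\<close> would avoid 0 and be an ancestor of \<open>j\<close> that
  misses \<open>i\<close>, against the minimality of \<open>up j\<close>.\<close>

lemma up_constant:
  assumes j: "j \<in> {1..n}" "up j = (i, Q)" and k: "k \<le> n" "k \<noteq> j" "k \<noteq> i"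
  shows "same_petal A k j i"
proof (rule ccontr)
  assume no: "\<not> same_petal A k j i"
  note u = up_D[OF j]
  have jn: "j \<le> n" using j by auto
  have "same_petal A i j k" using compatibleD(4)[OF A k(1) u(1) jn k(3)] no k u(6) by auto
  then have kQ: "k \<in> Q" using petalD[OF u(2,4)] by blast
  obtain P where P: "P \<in> A k" "j \<in> P" using same_petal_refl[OF A k(1) jn] k(2) by (auto simp: same_petal_def)
  have "0 \<notin> P"
  proof
    assume 0: "0 \<in> P"
    have i0: "i \<noteq> 0" using same_petalI[OF P(1,2) 0] no by metis
    have k0: "k \<noteq> 0" using kQ u(3) by metis
    have "same_petal A k 0 i \<or> same_petal A i 0 k" using compatibleD(4)[OF A k(1) u(1), of 0] k(3) i0 k0 by auto
    moreover have "\<not> same_petal A i 0 k" using petalD[OF u(2) kQ] u(3) same_petal_sym by blast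
    ultimately have "same_petal A k 0 i" by blast
    then have "i \<in> P" using petalD[OF P(1) 0] by blast
    then show False using no same_petalI[OF P(1,2)] by blast
  qed
  then have "(k, P) \<in> below j" using P k(1) by (simp add: below_def D_def)
  then have "i \<in> P" using up_minimal[OF j _ k(3)] by blast
  then show False using no same_petalI[OF P(1,2)] by blast
qed

text \<open>An element of \<open>P\<close> of least depth is a child of this vertex. Hence
  unlabelled vertices have valence at least 2.\<close>

lemma exists_child:
  assumes d: "(k, P) \<in> D" shows "\<exists>j\<in>P. j \<in> {1..n} \<and> up j = (k, P)"
proof -
  have P: "k \<le> n" "P \<in> A k" "0 \<notin> P" using d by (auto simp: D_def)
  have Pn: "P \<subseteq> {1..n}" using petal_sub[OF P(2,1)] P(3) by (fastforce simp: Suc_le_eq)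
  obtain j where j: "j \<in> P" "\<And>i. i \<in> P ==> card (below j) \<le> card (below i)"
    using ex_has_least_nat[of "\<lambda>j. j \<in> P" _ "\<lambda>j. card (below j)"] petal_nonempty(1)[OF A P(2)] by blast
  have jn: "j \<in> {1..n}" using j(1) Pn by blast
  obtain i Q where u: "up j = (i, Q)" by (cases "up j")
  note ud = up_D[OF jn u]
  have dj: "(k, P) \<in> below j" using d j(1) by (simp add: below_def)
  have "i = k"
  proof (rule ccontr)
    assume "i \<noteq> k"
    then have "i \<in> P" using up_minimal[OF jn u dj] by blast
    moreover have "(i, Q) \<in> below j" using up(1)[OF jn] u by simp
    ultimately show False using below_less j(2) by (meson not_le)
  qed
  then have "Q = P" using petal_eq[OF A ud(2,4)] petal_eq[OF A P(2) j(1)] by simp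
  then show ?thesis using j(1) jn u \<open>i = k\<close> by blast
qed

text \<open>Each nonzero label is joined to its parent in \<open>D\<close>, and each element of
  \<open>D\<close>, coded by \<open>c\<close>, to its own parent label. This gives
  \<open>n + card D\<close> edges, one less than the number of vertices, and everything is connected
  to the root.\<close>

lemma exists_tree: "\<exists>V E. pointed_labelled_tree n V E \<and> petal_family n V E = A"
proof -
  obtain c :: "nat \<times> nat set => nat" where c: "inj_on c D" using finite_imp_inj_to_nat_seg[OF finite_D] by blast
  define V where "V = Inl ` {0..n} \<union> Inr ` c ` D"
  define E1 where "E1 = (\<lambda>j. {Inl j, Inr (c (up j))}) ` {1..n}"
  define E2 where "E2 = (\<lambda>d. {Inl (fst d), Inr (c d)}) ` D"
  define E where "E = E1 \<union> E2"
  have upD: "up j \<in> D" if "j \<in> {1..n}" for j using up(1)[OF that] by (simp add: below_def)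
  have Vl: "Inl l \<in> V \<longleftrightarrow> l \<le> n" for l by (auto simp: V_def)
  have cardE1: "card E1 = n" unfolding E1_def by (subst card_image) (auto simp: inj_on_def doubleton_eq_iff)
  have cardE2: "card E2 = card D" unfolding E2_def using c by (subst card_image) (auto simp: inj_on_def doubleton_eq_iff)
  have disjE: "E1 \<inter> E2 = {}"
  proof -
    have False if j: "j \<in> {1..n}" and d: "d \<in> D" and eq: "{Inl j, Inr (c (up j))} = {Inl (fst d), Inr (c d)}" for j d
    proof -
      have "j = fst d" "c (up j) = c d" using eq by (auto simp: doubleton_eq_iff)
      then have "up j = d" using c upD[OF j] d by (simp add: inj_on_def)
      then show False using up_D(6)[OF j, of "fst d" "snd d"] \<open>j = fst d\<close> by simp
    qed
    then show ?thesis unfolding E1_def E2_def by blast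
  qed
  have finE: "finite E1" "finite E2" using finite_D by (auto simp: E1_def E2_def)
  have cardE: "card E = n + card D" unfolding E_def using card_Un_disjoint[OF finE disjE] cardE1 cardE2 by simp
  have cardV: "card V = n + 1 + card D"
  proof -
    have "card (Inl ` {0..n} :: (nat + nat) set) = n + 1" by (subst card_image) auto
    moreover have "card (Inr ` c ` D :: (nat + nat) set) = card D" using c by (simp add: card_image)
    ultimately show ?thesis unfolding V_def using finite_D by (subst card_Un_disjoint) auto
  qed
  have step: "{Inl j, Inr (c (up j))} \<in> E" "{Inr (c (up j)), Inl (fst (up j))} \<in> E" if "j \<in> {1..n}" for j
    using that upD[OF that] unfolding E_def E1_def E2_def by (auto simp: insert_commute)
  have le: "fst (up j) \<le> n" "card (below (fst (up j))) < card (below j)" if j: "j \<in> {1..n}" for j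
  proof -
    show "fst (up j) \<le> n" using upD[OF j] by (auto simp: D_def)
    have "(fst (up j), snd (up j)) \<in> below j" using up(1)[OF j] by simp
    then show "card (below (fst (up j))) < card (below j)" by (rule below_less)
  qed
  have toroot: "j \<le> n ==> (tree_adj E)\<^sup>*\<^sup>* (Inl j) (Inl 0)" for j
  proof (induction "card (below j)" arbitrary: j rule: less_induct)
    case less
    show ?case
    proof (cases "j = 0")
      case False
      then have j: "j \<in> {1..n}" using less.prems by auto
      have "tree_adj E (Inl j) (Inr (c (up j)))" "tree_adj E (Inr (c (up j))) (Inl (fst (up j)))"
        using step[OF j] by (auto simp: tree_adj_def)
      moreover have "(tree_adj E)\<^sup>*\<^sup>* (Inl (fst (up j))) (Inl 0)" using less.hyps le[OF j] by blast
      ultimately show ?thesis by (meson converse_rtranclp_into_rtranclp)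
    qed simp
  qed
  have symE: "symp (tree_adj E)" by (auto simp: symp_def tree_adj_def insert_commute)
  have root: "(tree_adj E)\<^sup>*\<^sup>* u (Inl 0)" if u: "u \<in> V" for u
  proof (cases u)
    case (Inl l)
    then show ?thesis using toroot u Vl by simp
  next
    case (Inr m)
    then obtain d where d: "d \<in> D" "m = c d" using u by (auto simp: V_def)
    have "tree_adj E u (Inl (fst d))" using d Inr unfolding tree_adj_def E_def E2_def by (auto simp: insert_commute)
    moreover have "fst d \<le> n" using d by (auto simp: D_def)
    ultimately show ?thesis using toroot by (meson converse_rtranclp_into_rtranclp)
  qed
  have conn: "(tree_adj E)\<^sup>*\<^sup>* u v" if "u \<in> V" "v \<in> V" for u v
    using root[OF that(1)] sympD[OF symp_rtranclp[OF symE] root[OF that(2)]] by (rule rtranclp_trans)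
  have valence: "card {e \<in> E. Inr m \<in> e} \<ge> 2" if m: "Inr m \<in> V" for m
  proof -
    obtain d where d: "d \<in> D" "m = c d" using m by (auto simp: V_def)
    obtain j where j: "j \<in> {1..n}" "up j = d" using exists_child[of "fst d" "snd d"] d(1) by auto
    have "{{Inl j, Inr m}, {Inl (fst d), Inr m}} \<subseteq> {e \<in> E. Inr m \<in> e}"
      using step[OF j(1)] j(2) d by (auto simp: insert_commute)
    then have sub: "card {{Inl j, Inr m}, {Inl (fst d), Inr m}} \<le> card {e \<in> E. Inr m \<in> e}"
      using finE by (intro card_mono) (simp_all add: E_def)
    have "j \<noteq> fst d" using up_D(6)[OF j(1), of "fst d" "snd d"] j(2) by simp
    then have "card {{Inl j, Inr m}, {Inl (fst d), Inr m}} = 2" by (simp add: doubleton_eq_iff)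
    then show ?thesis using sub by simp
  qed
  have "{e \<in> E. Inl 0 \<in> e} = {{Inl 0, Inr (c (0, {1..n}))}}"
  proof -
    have d0: "d = (0, {1..n})" if "d \<in> D" "fst d = 0" for d
      using that compatibleD(3)[OF A] by (auto simp: D_def)
    have dD: "(0, {1..n}) \<in> D" using compatibleD(3)[OF A] by (simp add: D_def)
    have only: "e = {Inl 0, Inr (c (0, {1..n}))}" if e: "e \<in> E" "Inl 0 \<in> e" for e
    proof -
      have "e \<notin> E1" using e(2) by (auto simp: E1_def)
      then obtain d where d: "d \<in> D" "e = {Inl (fst d), Inr (c d)}" using e(1) by (auto simp: E_def E2_def)
      then have "fst d = 0" using e(2) by auto
      then show ?thesis using d0[OF d(1)] d(2) by simp
    qed
    have mem: "{Inl 0, Inr (c (0, {1..n}))} \<in> E"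
      unfolding E_def E2_def by (rule UnI2, rule image_eqI[OF _ dD]) simp
    show ?thesis
    proof (rule equalityI; rule subsetI)
      fix e assume "e \<in> {e \<in> E. Inl 0 \<in> e}"
      then have "e \<in> E" "Inl 0 \<in> e" by simp_all
      from only[OF this] show "e \<in> {{Inl 0, Inr (c (0, {1..n}))}}" by (rule ssubst) simp
    next
      fix e :: "(nat + nat) set" assume "e \<in> {{Inl 0, Inr (c (0, {1..n}))}}"
      then have "e = {Inl 0, Inr (c (0, {1..n}))}" by simp
      then show "e \<in> {e \<in> E. Inl 0 \<in> e}" using mem by simp
    qed
  qed
  then have leaf: "card {e \<in> E. Inl 0 \<in> e} = 1" by simp
  have edges: "e \<subseteq> V \<and> (\<exists>l m. e = {Inl l, Inr m})" if eE: "e \<in> E" for e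
  proof -
    have "\<exists>l d. e = {Inl l, Inr (c d)} \<and> l \<le> n \<and> d \<in> D"
    proof (cases "e \<in> E1")
      case True
      then obtain j where "j \<in> {1..n}" "e = {Inl j, Inr (c (up j))}" by (auto simp: E1_def)
      then show ?thesis using upD by (intro exI[of _ j] exI[of _ "up j"]) auto
    next
      case False
      then obtain d where "d \<in> D" "e = {Inl (fst d), Inr (c d)}" using eE False by (auto simp: E_def E2_def)
      then show ?thesis by (intro exI[of _ "fst d"] exI[of _ d]) (auto simp: D_def)
    qed
    then obtain l d where "e = {Inl l, Inr (c d)}" "l \<le> n" "d \<in> D" by (elim exE conjE)
    then show ?thesis by (auto simp: V_def)
  qed
  have finV: "finite V" using finite_D by (simp add: V_def)
  have tree: "pointed_labelled_tree n V E"
    unfolding pointed_labelled_tree_def using finV Vl edges conn cardE cardV valence leaf by simp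
  have B: "compatible n (petal_family n V E)" by (rule compatible_petal_family[OF tree n])
  \<comment> \<open>For fixed \<open>k\<close>, a vertex is sent to the petal of \<open>A k\<close>
    behind which it lies. This is constant along edges avoiding \<open>k\<close>, so labels
    connected without \<open>k\<close> share a petal.\<close>
  define lab where "lab = (\<lambda>k u. case u of Inl s => {t. same_petal A k s t}
      | Inr m => (let d = inv_into D c m in if fst d = k then snd d else {t. same_petal A k (fst d) t}))"
  have inv: "inv_into D c (c d) = d" if "d \<in> D" for d using c that by simp
  have cls: "{t. same_petal A k s t} = {t. same_petal A k s' t}" if "same_petal A k s s'" for k s s'
    using same_petal_trans[OF A that] same_petal_trans[OF A same_petal_sym[OF that]] by (intro Collect_cong iffI)
  have labE: "lab k a = lab k b" if k: "k \<le> n" and ab: "avoid E k a b" for k a b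
  proof -
    have e: "{a, b} \<in> E" "a \<noteq> Inl k" "b \<noteq> Inl k" using ab by (auto simp: avoid_def)
    have main: "lab k (Inl s) = lab k (Inr (c d))" if "d \<in> D" and sd: "s \<noteq> k" "s \<in> {1..n} \<and> d = up s \<or> s = fst d" for s d
      using sd(2)
    proof
      assume s: "s \<in> {1..n} \<and> d = up s"
      then have u: "s \<in> {1..n}" "up s = (fst d, snd d)" by auto
      show ?thesis
      proof (cases "fst d = k")
        case True
        have "snd d = {t. same_petal A k s t}" using petal_eq[OF A, of "snd d" k s] up_D[OF u] True by simp
        then show ?thesis using True inv[OF \<open>d \<in> D\<close>] by (simp add: lab_def)
      next
        case False
        have "same_petal A k s (fst d)" using up_constant[OF u k] sd(1) False by auto
        then show ?thesis using False inv[OF \<open>d \<in> D\<close>] cls by (simp add: lab_def)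
      qed
    next
      assume "s = fst d"
      then show ?thesis using sd(1) inv[OF \<open>d \<in> D\<close>] by (simp add: lab_def)
    qed
    obtain s d where sd: "{a, b} = {Inl s, Inr (c d)}" "d \<in> D" "s \<in> {1..n} \<and> d = up s \<or> s = fst d"
    proof (cases "{a, b} \<in> E1")
      case True
      then obtain j where "j \<in> {1..n}" "{a, b} = {Inl j, Inr (c (up j))}" by (auto simp: E1_def)
      then show ?thesis using upD by (intro that[of j "up j"]) auto
    next
      case False
      then obtain d where "d \<in> D" "{a, b} = {Inl (fst d), Inr (c d)}" using e(1) by (auto simp: E_def E2_def)
      then show ?thesis by (intro that[of "fst d" d]) auto
    qed
    then have "s \<noteq> k" using e by (auto simp: doubleton_eq_iff)
    then have "lab k (Inl s) = lab k (Inr (c d))" using main sd by blast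
    then show ?thesis using sd(1) by (auto simp: doubleton_eq_iff)
  qed
  \<comment> \<open>The converse inclusion: labels in a petal \<open>P\<close> of \<open>k\<close>
    without 0 climb to the vertex \<open>(k, P)\<close> without meeting \<open>k\<close>; those in
    the petal of 0 climb to the root, as shown afterwards.\<close>
  have down: "k \<le> n ==> (k, P) \<in> below j ==> (avoid E k)\<^sup>*\<^sup>* (Inl j) (Inr (c (k, P)))" for k P j
  proof (induction "card (below j)" arbitrary: j rule: less_induct)
    case less
    have P: "P \<in> A k" "0 \<notin> P" "j \<in> P" "(k, P) \<in> D" using less.prems by (auto simp: below_def D_def)
    have j: "j \<in> {1..n}" "j \<noteq> k" using petal_sub[OF P(1) less.prems(1)] P(2,3) by (auto simp: Suc_le_eq intro!: Nat.gr0I)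
    have first: "avoid E k (Inl j) (Inr (c (up j)))" using step[OF j(1)] j(2) by (simp add: avoid_def)
    show ?case
    proof (cases "fst (up j) = k")
      case True
      have u: "up j = (fst (up j), snd (up j))" by simp
      have "snd (up j) = P" using petal_eq[OF A P(1,3)] petal_eq[OF A up_D(2)[OF j(1) u] up_D(4)[OF j(1) u]] True by simp
      then have "up j = (k, P)" using True by (simp add: prod_eq_iff)
      then show ?thesis using first by auto
    next
      case False
      have "fst (up j) \<in> P" using up_minimal[OF j(1) _ less.prems(2), of "fst (up j)" "snd (up j)"] False by auto
      then have "(k, P) \<in> below (fst (up j))" using P by (simp add: below_def)
      then have "(avoid E k)\<^sup>*\<^sup>* (Inl (fst (up j))) (Inr (c (k, P)))" using less.hyps le[OF j(1)] less.prems(1) by blast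
      moreover have "avoid E k (Inr (c (up j))) (Inl (fst (up j)))" using step[OF j(1)] False by (simp add: avoid_def)
      ultimately show ?thesis using first by (meson converse_rtranclp_into_rtranclp)
    qed
  qed
  have top: "k \<le> n ==> same_petal A k j 0 ==> (avoid E k)\<^sup>*\<^sup>* (Inl j) (Inl 0)" for k j
  proof (induction "card (below j)" arbitrary: j rule: less_induct)
    case less
    have r: "j \<le> n" "j \<noteq> k" "k \<noteq> 0" using same_petal_range[OF A less.prems(2)] by auto
    show ?case
    proof (cases "j = 0")
      case False
      then have j: "j \<in> {1..n}" using r by auto
      have u: "up j = (fst (up j), snd (up j))" by simp
      note ud = up_D[OF j u]
      have nk: "fst (up j) \<noteq> k"
      proof
        assume "fst (up j) = k"
        then have "0 \<in> snd (up j)" using petalD[OF ud(2,4)] less.prems(2) by simp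
        then show False using ud(3) by simp
      qed
      have "same_petal A k j (fst (up j))" using up_constant[OF j u less.prems(1)] nk r(2) by auto
      then have "same_petal A k (fst (up j)) 0" using same_petal_trans[OF A] same_petal_sym less.prems(2) by blast
      then have "(avoid E k)\<^sup>*\<^sup>* (Inl (fst (up j))) (Inl 0)" using less.hyps le[OF j] less.prems(1) by blast
      moreover have "avoid E k (Inl j) (Inr (c (up j)))" "avoid E k (Inr (c (up j))) (Inl (fst (up j)))"
        using step[OF j] r nk by (auto simp: avoid_def)
      ultimately show ?thesis by (meson converse_rtranclp_into_rtranclp)
    qed simp
  qed
  have "petal_family n V E = A"
  proof (rule compatible_eqI[OF B A])
    fix k s t
    show "same_petal (petal_family n V E) k s t = same_petal A k s t"
    proof
      assume "same_petal (petal_family n V E) k s t"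
      then have r: "k \<le> n" "s \<le> n" "t \<le> n" "s \<noteq> k" "t \<noteq> k" "(avoid E k)\<^sup>*\<^sup>* (Inl s) (Inl t)"
        using same_petal_petal_family[OF Vl] by auto
      have "lab k (Inl s) = lab k (Inl t)" using r(6) by (induction rule: rtranclp_induct) (use labE[OF r(1)] in auto)
      moreover have "same_petal A k t t" using same_petal_refl[OF A] r by blast
      ultimately show "same_petal A k s t" by (auto simp: lab_def)
    next
      assume st: "same_petal A k s t"
      then have r: "k \<le> n" "s \<le> n" "t \<le> n" "s \<noteq> k" "t \<noteq> k" using same_petal_range[OF A] by blast+
      obtain P where P: "P \<in> A k" "s \<in> P" "t \<in> P" using st by (auto simp: same_petal_def)
      have "(avoid E k)\<^sup>*\<^sup>* (Inl s) (Inl t)"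
      proof (cases "0 \<in> P")
        case True
        then have "(avoid E k)\<^sup>*\<^sup>* (Inl s) (Inl 0)" "(avoid E k)\<^sup>*\<^sup>* (Inl t) (Inl 0)"
          using top[OF r(1)] same_petalI[OF P(1)] P by blast+
        then show ?thesis using avoid_sym rtranclp_trans[of "avoid E k"] by metis
      next
        case False
        then have "(k, P) \<in> below s" "(k, P) \<in> below t" using P r by (auto simp: below_def D_def)
        then have "(avoid E k)\<^sup>*\<^sup>* (Inl s) (Inr (c (k, P)))" "(avoid E k)\<^sup>*\<^sup>* (Inl t) (Inr (c (k, P)))"
          using down[OF r(1)] by blast+
        then show ?thesis using avoid_sym rtranclp_trans[of "avoid E k"] by metis
      qed
      then show "same_petal (petal_family n V E) k s t" using same_petal_petal_family[OF Vl] r by auto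
    qed
  qed
  then show ?thesis using tree by blast
qed

end

theorem trees_eq_compatible:
  assumes "n \<ge> 1" shows "trees n = {A. compatible n A}"
proof (rule equalityI; rule subsetI)
  fix A assume "A \<in> trees n"
  then show "A \<in> {A. compatible n A}" unfolding trees_def using compatible_petal_family assms by blast
next
  fix A assume "A \<in> {A. compatible n A}"
  then have "tree_from_partitions n A" using assms by (simp add: tree_from_partitions_def)
  from tree_from_partitions.exists_tree[OF this] show "A \<in> trees n" unfolding trees_def by blast
qed

section \<open>Reduction systems\<close>

definition pair_le :: "('t => 't => bool) => ('h \<times> 't) set => ('h \<times> 't) set => bool" where
  "pair_le tle C D \<longleftrightarrow> (\<exists>H A B. (H, A) \<in> C \<and> (H, B) \<in> D \<and> tle A B)"

lemma order_homotopy_connected: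
  assumes "(order_homotopy_step R P R P)\<^sup>*\<^sup>* f g" "x \<in> P"
  shows "(\<lambda>a b. a \<in> P \<and> b \<in> P \<and> (R a b \<or> R b a))\<^sup>*\<^sup>* (f x) (g x)"
  using assms(1)
proof (induction rule: rtranclp_induct)
  case (step g h)
  have "(\<lambda>a b. a \<in> P \<and> b \<in> P \<and> (R a b \<or> R b a)) (g x) (h x)"
    using step(2) assms(2) unfolding order_homotopy_step_def poset_map_def by blast
  with step(3) show ?case by (rule rtranclp.rtrancl_into_rtrancl)
qed simp

lemma order_contractible_connected:
  assumes oc: "order_contractible R P" and x: "x \<in> P" "y \<in> P"
  shows "(\<lambda>a b. a \<in> P \<and> b \<in> P \<and> (R a b \<or> R b a))\<^sup>*\<^sup>* x y"
proof -
  let ?Q = "\<lambda>a b. a \<in> P \<and> b \<in> P \<and> (R a b \<or> R b a)"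
  obtain p where p: "(order_homotopy_step R P R P)\<^sup>*\<^sup>* id (\<lambda>_. p)"
    using oc by (auto simp: order_contractible_def)
  have "?Q\<^sup>*\<^sup>* x p" "?Q\<^sup>*\<^sup>* y p" using order_homotopy_connected[OF p] x by fastforce+
  moreover have "symp ?Q" by (auto simp: symp_def)
  ultimately show ?thesis using sympD[OF symp_rtranclp, of ?Q y p] rtranclp_trans[of ?Q x p y] by simp
qed

text \<open>Here \<open>T\<close> stands for the trees, \<open>Bs\<close> for the bases, \<open>E A H K\<close> says that \<open>(H, A)\<close> and \<open>(K, A)\<close> are the same
  vertex, and \<open>\<nu>\<close> is a norm on bases.\<close>

locale reduction_system =
  fixes Bs :: "'h set" and E :: "'t => 'h => 'h => bool" and T :: "'t set" and tle :: "'t => 't => bool" and \<nu> :: "'h => nat"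
  assumes finite_T: "finite T" and po_T: "porder tle T" and Bs_nonempty: "Bs \<noteq> {}"
    and E_Bs: "E A H K ==> H \<in> Bs \<and> K \<in> Bs"
    and E_refl: "A \<in> T ==> H \<in> Bs ==> E A H H"
    and E_sym: "A \<in> T ==> E A H K ==> E A K H"
    and E_trans: "A \<in> T ==> E A H K ==> E A K K' ==> E A H K'"
    and E_mono: "A \<in> T ==> B \<in> T ==> tle A B ==> E A H K ==> E B H K"
    and bottom: "\<exists>A0\<in>T. (\<forall>B\<in>T. tle A0 B) \<and> (\<forall>H K. E A0 H K --> K = H)"
    and finite_class: "A \<in> T ==> finite {K. E A H K}"
    and descending_trees: "A \<in> T ==> H \<in> Bs ==> \<forall>K. E A H K --> \<nu> H \<le> \<nu> K ==>
      {B \<in> T. tle A B \<and> (\<exists>K. E B H K \<and> \<nu> K < \<nu> H)} \<noteq> {} ==>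
      order_contractible tle {B \<in> T. tle A B \<and> (\<exists>K. E B H K \<and> \<nu> K < \<nu> H)}"
    and minimal_tree: "A \<in> T ==> H \<in> Bs ==> \<forall>K. E A H K --> \<nu> H \<le> \<nu> K ==>
      \<exists>j\<in>T. \<forall>B\<in>T. (\<forall>K. E A H K \<and> \<nu> K = \<nu> H --> E B H K) \<longleftrightarrow> tle j B"
    and descent: "A \<in> T ==> H \<in> Bs ==> \<forall>K. E A H K --> \<nu> H \<le> \<nu> K ==>
      \<forall>B\<in>T. (\<forall>K. E A H K \<and> \<nu> K = \<nu> H --> E B H K) --> tle A B ==>
      B' \<in> T ==> E B' H K' ==> \<nu> K' < \<nu> H ==> \<exists>B\<in>T. tle A B \<and> (\<exists>K. E B H K \<and> \<nu> K < \<nu> H)"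
    and connected: "H \<in> Bs ==> K \<in> Bs ==> (\<lambda>H K. \<exists>A\<in>T. E A H K)\<^sup>*\<^sup>* H K"
    and plateau: "H \<in> Bs ==> \<forall>K\<in>Bs. \<nu> H \<le> \<nu> K ==>
      \<exists>A0\<in>T. \<forall>A\<in>T. \<forall>K. E A H K \<and> \<nu> K = \<nu> H --> E A0 H K"
begin

section \<open>Confluence of norm reduction\<close>

definition nbr :: "'h => 'h => bool" where
  "nbr H K \<longleftrightarrow> (\<exists>A\<in>T. E A H K)"

definition irreducible :: "'h => bool" where
  "irreducible H \<longleftrightarrow> H \<in> Bs \<and> (\<forall>K. nbr H K --> \<nu> H \<le> \<nu> K)"

lemma nbr_sym: "nbr H K ==> nbr K H"
  unfolding nbr_def using E_sym by blast

lemma nbr_Bs: "nbr H K ==> H \<in> Bs \<and> K \<in> Bs"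
  unfolding nbr_def using E_Bs by blast

lemma le_refl: "A \<in> T ==> tle A A"
  using po_T by (simp add: porder_def)

lemma le_trans: "A \<in> T ==> B \<in> T ==> C \<in> T ==> tle A B ==> tle B C ==> tle A C"
  using po_T unfolding porder_def by blast

lemma le_antisym: "A \<in> T ==> B \<in> T ==> tle A B ==> tle B A ==> A = B"
  using po_T unfolding porder_def by blast

text \<open>Above the least tree, whose classes are single bases, the trees with a reduction of
  \<open>H\<close> form a contractible, hence connected, poset. Along a walk in it, consecutive
  trees are comparable, so their reduced bases are neighbours.\<close>

lemma peak:
  assumes "nbr H K1" "nbr H K2" "\<nu> K1 < \<nu> H" "\<nu> K2 < \<nu> H"
  shows "(\<lambda>a b. nbr a b \<and> \<nu> a < \<nu> H \<and> \<nu> b < \<nu> H)\<^sup>*\<^sup>* K1 K2"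
proof -
  let ?S = "\<lambda>a b. nbr a b \<and> \<nu> a < \<nu> H \<and> \<nu> b < \<nu> H"
  have H: "H \<in> Bs" using assms nbr_Bs by blast
  obtain A0 where A0: "A0 \<in> T" "\<forall>B\<in>T. tle A0 B" "\<forall>H K. E A0 H K --> K = H" using bottom by (elim bexE conjE)
  obtain A1 A2 where A12: "A1 \<in> T" "E A1 H K1" "A2 \<in> T" "E A2 H K2" using assms unfolding nbr_def by blast
  let ?D = "{B \<in> T. tle A0 B \<and> (\<exists>K. E B H K \<and> \<nu> K < \<nu> H)}"
  have in12: "A1 \<in> ?D" "A2 \<in> ?D" using A12 A0(2) assms by auto
  have "order_contractible tle ?D" using descending_trees[OF A0(1) H] A0(3) in12 by blast
  from order_contractible_connected[OF this in12]
  have "\<forall>K. E A2 H K --> \<nu> K < \<nu> H --> ?S\<^sup>*\<^sup>* K1 K"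
  proof (induction rule: rtranclp_induct)
    case base
    have "nbr K1 K" if "E A1 H K" for K using that A12 E_sym E_trans unfolding nbr_def by blast
    then show ?case using assms by auto
  next
    case (step B C)
    then have BC: "B \<in> T" "C \<in> T" "tle B C \<or> tle C B" by auto
    obtain L where L: "E B H L" "\<nu> L < \<nu> H" using step.hyps by auto
    have rL: "?S\<^sup>*\<^sup>* K1 L" using step.IH L by blast
    have "nbr L K" if K: "E C H K" for K
    proof (cases "tle B C")
      case True
      then have "E C H L" using E_mono BC L by blast
      then show ?thesis unfolding nbr_def using E_sym E_trans BC K by blast
    next
      case False
      then have "E B H K" using E_mono BC K by blast
      then show ?thesis unfolding nbr_def using E_sym E_trans BC L by blast
    qed
    then show ?case using L(2) by (intro allI impI rtranclp.rtrancl_into_rtrancl[of ?S, OF rL]) simp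
  qed
  then show ?thesis using A12(4) assms(4) by blast
qed

lemma minimal_tree_le:
  assumes A: "A \<in> T" "H \<in> Bs" "\<forall>K. E A H K --> \<nu> H \<le> \<nu> K"
  obtains j where "j \<in> T" "tle j A" "\<And>K. E A H K ==> \<nu> K = \<nu> H ==> E j H K"
    "\<And>B. B \<in> T ==> (\<And>K. E A H K ==> \<nu> K = \<nu> H ==> E B H K) ==> tle j B"
proof -
  obtain j where j: "j \<in> T" "\<forall>B\<in>T. (\<forall>K. E A H K \<and> \<nu> K = \<nu> H --> E B H K) \<longleftrightarrow> tle j B"
    using minimal_tree[OF A] by blast
  have "tle j A" using j A by blast
  moreover have "E j H K" if "E A H K" "\<nu> K = \<nu> H" for K using j le_refl that by blast
  moreover have "tle j B" if "B \<in> T" "\<And>K. E A H K ==> \<nu> K = \<nu> H ==> E B H K" for B using j that by blast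
  ultimately show ?thesis using that j(1) by blast
qed

text \<open>The tree relating \<open>H\<close> and \<open>H'\<close> is shrunk to the least tree
  \<open>j\<close> carrying the norm-preserving changes of \<open>H\<close>. It still relates the
  two, and \<open>descent\<close> enlarges it to a tree with a reduction, whose class contains
  \<open>H\<close>, \<open>H'\<close> and a smaller basis.\<close>

lemma common_descent:
  assumes HH: "nbr H H'" "\<nu> H = \<nu> H'" and red: "nbr H K'" "\<nu> K' < \<nu> H"
  shows "\<exists>K. nbr H K \<and> nbr H' K \<and> \<nu> K < \<nu> H"
proof -
  have H: "H \<in> Bs" using HH nbr_Bs by blast
  obtain A where A: "A \<in> T" "E A H H'" using HH unfolding nbr_def by blast
  show ?thesis
  proof (cases "\<forall>K. E A H K --> \<nu> H \<le> \<nu> K")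
    case False
    then obtain K where K: "E A H K" "\<nu> K < \<nu> H" by (auto simp: not_le)
    then have "nbr H K" "nbr H' K" using A E_sym E_trans unfolding nbr_def by blast+
    then show ?thesis using K by blast
  next
    case True
    obtain j where j: "j \<in> T" "tle j A" "\<And>K. E A H K ==> \<nu> K = \<nu> H ==> E j H K"
      "\<And>B. B \<in> T ==> (\<And>K. E A H K ==> \<nu> K = \<nu> H ==> E B H K) ==> tle j B"
      using minimal_tree_le[OF A(1) H True] by blast
    have jA: "E A H K" if "E j H K" for K using E_mono[OF j(1) A(1) j(2) that] .
    have jmin: "\<forall>K. E j H K --> \<nu> H \<le> \<nu> K" using jA True by blast
    obtain B' where B': "B' \<in> T" "E B' H K'" using red unfolding nbr_def by blast
    have "\<exists>B\<in>T. tle j B \<and> (\<exists>K. E B H K \<and> \<nu> K < \<nu> H)"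
    proof (rule descent[OF j(1) H jmin _ B' red(2)], intro ballI impI)
      fix B assume B: "B \<in> T" "\<forall>K. E j H K \<and> \<nu> K = \<nu> H --> E B H K"
      show "tle j B" by (rule j(4)[OF B(1)]) (use B(2) j(3) in blast)
    qed
    then obtain B K where B: "B \<in> T" "tle j B" "E B H K" "\<nu> K < \<nu> H" by blast
    have "E B H H'" using E_mono[OF j(1) B(1,2)] j(3) A(2) HH(2) by simp
    then have "nbr H K" "nbr H' K" using B E_sym E_trans unfolding nbr_def by blast+
    then show ?thesis using B by blast
  qed
qed

definition descends :: "'h => 'h => bool" where
  "descends H K \<longleftrightarrow> nbr H K \<and> (\<nu> K < \<nu> H \<or> \<nu> K = \<nu> H \<and> irreducible H \<and> irreducible K)"

definition ends :: "'h => 'h set" where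
  "ends H = {X. descends\<^sup>*\<^sup>* H X \<and> irreducible X}"

lemma ends_step: "descends H K ==> ends K \<subseteq> ends H"
  unfolding ends_def by (auto intro: converse_rtranclp_into_rtranclp)

lemma ends_cases:
  assumes "X \<in> ends H" "\<not> irreducible H"
  obtains K where "nbr H K" "\<nu> K < \<nu> H" "X \<in> ends K"
proof -
  have X: "descends\<^sup>*\<^sup>* H X" "irreducible X" using assms by (auto simp: ends_def)
  then have "H \<noteq> X" using assms(2) by blast
  then obtain K where "descends H K" "descends\<^sup>*\<^sup>* K X" using X(1) by (metis converse_rtranclpE)
  then show ?thesis using that assms X by (auto simp: descends_def ends_def)
qed

text \<open>Confluence as in Newman's lemma, by induction on the norm: \<open>peak\<close> resolves
  two reductions strictly below the top. For equal norms either both bases are irreducible and reach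
  each other, or \<open>common_descent\<close> gives a common smaller neighbour.\<close>

lemma ends_nbr: "nbr H K ==> \<nu> H \<le> v ==> \<nu> K \<le> v ==> ends H = ends K"
proof (induction v arbitrary: H K rule: less_induct)
  case (less v)
  have path: "ends a = ends b" if "(\<lambda>a b. nbr a b \<and> \<nu> a < w \<and> \<nu> b < w)\<^sup>*\<^sup>* a b" "w \<le> v" for a b w
    using that(1)
  proof (induction rule: rtranclp_induct)
    case (step b c)
    have bc: "nbr b c" "\<nu> b \<le> w - 1" "\<nu> c \<le> w - 1" "w - 1 < v" using step.hyps(2) that(2) by auto
    have "ends b = ends c" by (rule less.IH[OF bc(4,1,2,3)])
    then show ?case using step.IH by simp
  qed simp
  have down: "ends a = ends b" if ab: "nbr a b" "\<nu> b < \<nu> a" "\<nu> a \<le> v" for a b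
  proof
    show "ends b \<subseteq> ends a" by (rule ends_step) (use ab in \<open>simp add: descends_def\<close>)
    show "ends a \<subseteq> ends b"
    proof
      fix X assume X: "X \<in> ends a"
      have "\<not> irreducible a" using ab by (auto simp: irreducible_def not_le)
      then obtain c where c: "nbr a c" "\<nu> c < \<nu> a" "X \<in> ends c" using ends_cases[OF X] by blast
      then show "X \<in> ends b" using path[OF peak[OF c(1) ab(1) c(2) ab(2)] ab(3)] by simp
    qed
  qed
  consider "\<nu> K < \<nu> H" | "\<nu> H < \<nu> K" | "\<nu> H = \<nu> K" by linarith
  then show ?case
  proof cases
    case 1
    then show ?thesis using down less.prems by blast
  next
    case 2
    then show ?thesis using down[of K H] less.prems nbr_sym by blast
  next
    case 3
    show ?thesis
    proof (cases "irreducible H \<and> irreducible K")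
      case True
      then have "descends H K" "descends K H" using 3 less.prems nbr_sym by (auto simp: descends_def)
      then show ?thesis using ends_step by blast
    next
      case False
      have "\<exists>L. nbr H L \<and> nbr K L \<and> \<nu> L < \<nu> H"
      proof (cases "irreducible H")
        case False
        then obtain K' where "nbr H K'" "\<nu> K' < \<nu> H" using nbr_Bs[OF less.prems(1)] by (auto simp: irreducible_def not_le)
        then show ?thesis using common_descent[OF less.prems(1) 3] by blast
      next
        case True
        then have "\<not> irreducible K" using \<open>\<not> (irreducible H \<and> irreducible K)\<close> by blast
        then obtain K' where "nbr K K'" "\<nu> K' < \<nu> K" using nbr_Bs[OF less.prems(1)] by (auto simp: irreducible_def not_le)
        then show ?thesis using common_descent[OF nbr_sym[OF less.prems(1)] 3[symmetric]] 3 by auto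
      qed
      then obtain L where L: "nbr H L" "nbr K L" "\<nu> L < \<nu> H" by blast
      then show ?thesis using down[OF L(1,3)] down[OF L(2)] 3 less.prems by simp
    qed
  qed
qed

text \<open>From a global minimiser \<open>H0\<close> every descending step stays among minimisers,
  and \<open>plateau\<close> places all of them under one tree. As all bases are connected, each
  irreducible basis is an end of \<open>H0\<close> and therefore lies in this one class.\<close>

lemma minimisers:
  obtains H0 A0 where "H0 \<in> Bs" "A0 \<in> T" "\<And>K. K \<in> Bs ==> \<nu> H0 \<le> \<nu> K" "\<And>K. irreducible K ==> E A0 H0 K \<and> \<nu> K = \<nu> H0"
proof -
  obtain H0 where H0: "H0 \<in> Bs" "\<And>K. K \<in> Bs ==> \<nu> H0 \<le> \<nu> K"
    using ex_has_least_nat[of "\<lambda>H. H \<in> Bs" _ \<nu>] Bs_nonempty by blast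
  have glob: "\<exists>A0\<in>T. \<forall>K'. nbr K K' \<and> \<nu> K' = \<nu> K --> E A0 K K'" if "K \<in> Bs" "\<nu> K = \<nu> H0" for K
    using plateau[of K] that H0(2) unfolding nbr_def by simp metis
  obtain A0 where A0: "A0 \<in> T" "\<forall>K. nbr H0 K \<and> \<nu> K = \<nu> H0 --> E A0 H0 K" using glob H0 by blast
  have irr0: "irreducible H0" unfolding irreducible_def using H0 nbr_Bs by blast
  have reach: "E A0 H0 X \<and> \<nu> X = \<nu> H0" if "descends\<^sup>*\<^sup>* H0 X" for X
    using that
  proof (induction rule: rtranclp_induct)
    case base
    then show ?case using E_refl A0 H0 by blast
  next
    case (step X Y)
    have X: "X \<in> Bs" "\<nu> X = \<nu> H0" using step.IH E_Bs by blast+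
    have XY: "nbr X Y" "\<nu> Y \<le> \<nu> X" using step.hyps(2) by (auto simp: descends_def)
    have Y: "\<nu> Y = \<nu> H0" using H0(2)[of Y] nbr_Bs[OF XY(1)] XY(2) X(2) by simp
    obtain AX where AX: "AX \<in> T" "\<forall>K'. nbr X K' \<and> \<nu> K' = \<nu> X --> E AX X K'" using glob[OF X] by blast
    have "nbr X H0" using step.IH A0(1) nbr_sym unfolding nbr_def by blast
    then have "E AX X H0" "E AX X Y" using AX XY X Y by auto
    then have "nbr H0 Y" unfolding nbr_def using AX(1) E_sym E_trans by blast
    then show ?case using A0(2) Y by blast
  qed
  have "ends K = ends H0" if "K \<in> Bs" for K
  proof -
    have "(\<lambda>H K. \<exists>A\<in>T. E A H K)\<^sup>*\<^sup>* K H0" by (rule connected[OF that H0(1)])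
    then have "nbr\<^sup>*\<^sup>* K H0" by (simp add: nbr_def[abs_def])
    then show ?thesis
    proof (induction rule: rtranclp_induct)
      case (step X Y)
      then show ?case using ends_nbr[of X Y "max (\<nu> X) (\<nu> Y)"] by simp
    qed simp
  qed
  note eq = this
  have "E A0 H0 X \<and> \<nu> X = \<nu> H0" if X: "irreducible X" for X
  proof -
    have "X \<in> ends X" using X by (simp add: ends_def)
    then have "X \<in> ends H0" using eq[of X] X by (simp add: irreducible_def)
    then show ?thesis using reach[of X] by (simp add: ends_def)
  qed
  note irr = this
  show ?thesis by (rule that[OF H0(1) A0(1)]) (fact H0(2), fact irr)
qed

end

section \<open>Rank function and links in the poset of fixed vertices\<close>

locale reduction_action = reduction_system Bs E T tle \<nu>
  for Bs :: "'h set" and E :: "'t => 'h => 'h => bool" and T tle \<nu> +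
  fixes Fs :: "('h => 'h) set"
  assumes act_Bs: "f \<in> Fs ==> H \<in> Bs ==> f H \<in> Bs"
    and act_nu: "f \<in> Fs ==> H \<in> Bs ==> \<nu> (f H) = \<nu> H"
    and act_E: "f \<in> Fs ==> A \<in> T ==> E A H K ==> E A (f H) (f K)"
begin

definition vx :: "'h => 't => ('h \<times> 't) set" where
  "vx H A = {(K, A) | K. E A H K}"

definition fixed_vertices :: "('h \<times> 't) set set" where
  "fixed_vertices = {vx H A | H A. H \<in> Bs \<and> A \<in> T \<and> (\<forall>f\<in>Fs. E A H (f H))}"

definition tr :: "('h \<times> 't) set => 't" where
  "tr C = (SOME A. \<exists>H. (H, A) \<in> C)"

definition rep :: "('h \<times> 't) set => 'h" where
  "rep C = (SOME H. H \<in> fst ` C \<and> (\<forall>K\<in>fst ` C. \<nu> H \<le> \<nu> K))"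

lemma vx_eqI: "A \<in> T ==> E A H K ==> vx H A = vx K A"
  unfolding vx_def using E_sym E_trans by blast

lemma tr_vx: assumes "A \<in> T" "H \<in> Bs" shows "tr (vx H A) = A"
proof -
  have "(\<exists>K. (K, B) \<in> vx H A) \<longleftrightarrow> B = A" for B using E_refl[OF assms] unfolding vx_def by blast
  then show ?thesis unfolding tr_def by simp
qed

lemma fst_vx: "fst ` vx H A = {K. E A H K}"
  unfolding vx_def by force

lemma rep_vx: assumes "A \<in> T" "H \<in> Bs" shows "E A H (rep (vx H A))" "E A H K ==> \<nu> (rep (vx H A)) \<le> \<nu> K"
proof -
  obtain L where "E A H L" "\<forall>K. E A H K --> \<nu> L \<le> \<nu> K"
    using ex_has_least_nat[of "E A H" H \<nu>] E_refl[OF assms] by blast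
  then have "\<exists>L. L \<in> fst ` vx H A \<and> (\<forall>K\<in>fst ` vx H A. \<nu> L \<le> \<nu> K)" unfolding fst_vx by blast
  then have "rep (vx H A) \<in> fst ` vx H A \<and> (\<forall>K\<in>fst ` vx H A. \<nu> (rep (vx H A)) \<le> \<nu> K)" unfolding rep_def by (rule someI_ex)
  then show "E A H (rep (vx H A))" "E A H K ==> \<nu> (rep (vx H A)) \<le> \<nu> K" unfolding fst_vx by auto
qed

lemma vertex:
  assumes "C \<in> fixed_vertices"
  shows "rep C \<in> Bs" "tr C \<in> T" "vx (rep C) (tr C) = C" "\<forall>K. E (tr C) (rep C) K --> \<nu> (rep C) \<le> \<nu> K"
    "f \<in> Fs ==> E (tr C) (rep C) (f (rep C))"
proof -
  obtain H A where H: "C = vx H A" "H \<in> Bs" "A \<in> T" "\<forall>f\<in>Fs. E A H (f H)"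
    using assms unfolding fixed_vertices_def by blast
  have t: "tr C = A" using tr_vx H by simp
  have r: "E A H (rep C)" "\<And>K. E A H K ==> \<nu> (rep C) \<le> \<nu> K" using rep_vx[OF H(3,2)] H(1) by simp_all
  show "rep C \<in> Bs" "tr C \<in> T" using E_Bs r t H by simp_all
  show "vx (rep C) (tr C) = C" using vx_eqI[OF H(3) r(1)] t H(1) by simp
  show "\<forall>K. E (tr C) (rep C) K --> \<nu> (rep C) \<le> \<nu> K" using r E_trans[OF H(3) r(1)] t by simp
  show "E (tr C) (rep C) (f (rep C))" if f: "f \<in> Fs"
  proof -
    have "E A (f H) (f (rep C))" by (rule act_E[OF f H(3) r(1)])
    then have "E A H (f (rep C))" using E_trans[OF H(3)] H(4) f by blast
    then show ?thesis using E_trans[OF H(3) E_sym[OF H(3) r(1)]] t by simp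
  qed
qed

lemma fixed_verticesI: "H \<in> Bs ==> A \<in> T ==> (\<And>f. f \<in> Fs ==> E A H (f H)) ==> vx H A \<in> fixed_vertices"
  unfolding fixed_vertices_def by blast

abbreviation vle :: "('h \<times> 't) set => ('h \<times> 't) set => bool" where
  "vle \<equiv> pair_le tle"

lemma vle_vx:
  assumes "A \<in> T" "B \<in> T" "H \<in> Bs" "K \<in> Bs"
  shows "vle (vx H A) (vx K B) \<longleftrightarrow> tle A B \<and> E B K H"
proof
  assume "vle (vx H A) (vx K B)"
  then obtain L where L: "E A H L" "E B K L" "tle A B" unfolding pair_le_def vx_def by blast
  then have "E B H L" using E_mono[OF assms(1,2)] by blast
  then show "tle A B \<and> E B K H" using L E_trans[OF assms(2)] E_sym[OF assms(2)] by blast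
next
  assume "tle A B \<and> E B K H"
  then show "vle (vx H A) (vx K B)" unfolding pair_le_def vx_def using E_refl[OF assms(1,3)] by blast
qed

lemma vle_iff:
  assumes "C \<in> fixed_vertices" "D \<in> fixed_vertices"
  shows "vle C D \<longleftrightarrow> tle (tr C) (tr D) \<and> E (tr D) (rep D) (rep C)"
  using vle_vx[OF vertex(2)[OF assms(1)] vertex(2)[OF assms(2)] vertex(1)[OF assms(1)] vertex(1)[OF assms(2)]]
  by (simp add: vertex(3) assms)

lemma vle_nu: "C \<in> fixed_vertices ==> D \<in> fixed_vertices ==> vle C D ==> \<nu> (rep D) \<le> \<nu> (rep C)"
  using vle_iff vertex(4) by blast

lemma vle_tr_eq: "C \<in> fixed_vertices ==> D \<in> fixed_vertices ==> vle C D ==> tr C = tr D ==> C = D"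
  using vle_iff[of C D] vertex(2,3) vx_eqI by metis

lemma porder_vertices: "porder vle fixed_vertices"
  unfolding porder_def
proof (intro conjI ballI impI)
  fix C assume C: "C \<in> fixed_vertices"
  then show "vle C C" using vle_iff[OF C C] le_refl E_refl vertex(1,2)[OF C] by blast
next
  fix C D assume C: "C \<in> fixed_vertices" "D \<in> fixed_vertices" "vle C D" "vle D C"
  then have "tr C = tr D" using vle_iff le_antisym vertex(2) by meson
  then show "C = D" using vle_tr_eq C by blast
next
  fix C D X assume C: "C \<in> fixed_vertices" "D \<in> fixed_vertices" "X \<in> fixed_vertices" "vle C D" "vle D X"
  have 1: "tle (tr C) (tr D)" "E (tr D) (rep D) (rep C)" "tle (tr D) (tr X)" "E (tr X) (rep X) (rep D)"
    using C vle_iff by blast+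
  have "E (tr X) (rep D) (rep C)" by (rule E_mono[OF _ _ 1(3,2)]) (use vertex(2) C in blast)+
  then have "E (tr X) (rep X) (rep C)" using E_trans[OF _ 1(4)] vertex(2) C by blast
  moreover have "tle (tr C) (tr X)" using le_trans 1 vertex(2) C by blast
  ultimately show "vle C X" using vle_iff C by blast
qed

text \<open>The least tree carrying all changes within the class that preserve the least norm. An
  element of \<open>Fs\<close> changes \<open>rep C\<close> in just this way, so the vertex
  \<open>core C\<close> is fixed again.\<close>

definition core_tree :: "('h \<times> 't) set => 't" where
  "core_tree C = (SOME j. j \<in> T \<and> (\<forall>B\<in>T. (\<forall>K. E (tr C) (rep C) K \<and> \<nu> K = \<nu> (rep C) --> E B (rep C) K) \<longleftrightarrow> tle j B))"

definition core :: "('h \<times> 't) set => ('h \<times> 't) set" where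
  "core C = vx (rep C) (core_tree C)"

lemma core_tree:
  assumes "C \<in> fixed_vertices"
  shows "core_tree C \<in> T"
    "B \<in> T ==> (\<forall>K. E (tr C) (rep C) K \<and> \<nu> K = \<nu> (rep C) --> E B (rep C) K) \<longleftrightarrow> tle (core_tree C) B"
proof -
  have "\<exists>j. j \<in> T \<and> (\<forall>B\<in>T. (\<forall>K. E (tr C) (rep C) K \<and> \<nu> K = \<nu> (rep C) --> E B (rep C) K) \<longleftrightarrow> tle j B)"
    using minimal_tree[OF vertex(2,1,4)[OF assms]] by blast
  from someI_ex[OF this, folded core_tree_def]
  show "core_tree C \<in> T" "B \<in> T ==> (\<forall>K. E (tr C) (rep C) K \<and> \<nu> K = \<nu> (rep C) --> E B (rep C) K) \<longleftrightarrow> tle (core_tree C) B"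
    by simp_all
qed

lemma core_tree_le: "C \<in> fixed_vertices ==> tle (core_tree C) (tr C)"
  using core_tree(2)[OF _ vertex(2), of C] by blast

lemma core_tree_min: "C \<in> fixed_vertices ==> E (tr C) (rep C) K ==> \<nu> K = \<nu> (rep C) ==> E (core_tree C) (rep C) K"
  using core_tree(2)[OF _ core_tree(1), of C] le_refl core_tree(1) by blast

lemma core:
  assumes C: "C \<in> fixed_vertices"
  shows "core C \<in> fixed_vertices" "tr (core C) = core_tree C" "\<nu> (rep (core C)) = \<nu> (rep C)" "vle (core C) C"
    "E (core_tree C) (rep C) (rep (core C))"
proof -
  note v = vertex[OF C] and j = core_tree(1)[OF C]
  show P: "core C \<in> fixed_vertices" unfolding core_def
  proof (rule fixed_verticesI[OF v(1) j])
    fix f assume "f \<in> Fs"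
    then show "E (core_tree C) (rep C) (f (rep C))" using core_tree_min[OF C v(5)] act_nu v(1) by blast
  qed
  show t: "tr (core C) = core_tree C" unfolding core_def by (rule tr_vx[OF j v(1)])
  have r: "E (core_tree C) (rep C) (rep (core C))" unfolding core_def by (rule rep_vx(1)[OF j v(1)])
  then show "E (core_tree C) (rep C) (rep (core C))" .
  have le: "vle (vx (rep C) (core_tree C)) (vx (rep C) (tr C))"
    using vle_vx[OF j v(2,1,1)] core_tree_le[OF C] E_refl[OF v(2,1)] by blast
  then show "vle (core C) C" by (simp add: core_def v(3))
  then have "\<nu> (rep C) \<le> \<nu> (rep (core C))" using vle_nu P C by blast
  moreover have "\<nu> (rep (core C)) \<le> \<nu> (rep C)" using vertex(4)[OF P] t E_sym[OF j r] by simp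
  ultimately show "\<nu> (rep (core C)) = \<nu> (rep C)" by simp
qed

lemma core_le:
  assumes C: "C \<in> fixed_vertices" and B: "B \<in> T" "K \<in> Bs"
    and all: "\<And>L. E (tr C) (rep C) L ==> \<nu> L = \<nu> (rep C) ==> E B K L"
  shows "vle (core C) (vx K B)"
proof -
  have K: "E B K (rep C)" by (rule all) (use E_refl vertex(1,2)[OF C] in simp_all)
  have "E B (rep C) L" if "E (tr C) (rep C) L" "\<nu> L = \<nu> (rep C)" for L
    using all[OF that] E_trans[OF B(1) E_sym[OF B(1) K]] by blast
  then have "tle (core_tree C) B" using core_tree(2)[OF C B(1)] by blast
  then show ?thesis unfolding core_def using vle_vx[OF core_tree(1)[OF C] B(1) vertex(1)[OF C] B(2)] K by blast
qed

text \<open>Changes preserving the least norm inside \<open>C\<close> remain such changes inside the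
  larger class \<open>D\<close>, provided that the least norms agree.\<close>

lemma core_mono:
  assumes C: "C \<in> fixed_vertices" "D \<in> fixed_vertices" "vle C D" "\<nu> (rep C) = \<nu> (rep D)"
  shows "vle (core C) (core D)"
proof -
  have CD: "tle (tr C) (tr D)" "E (tr D) (rep D) (rep C)" using vle_iff[OF C(1,2)] C(3) by blast+
  have "E (core_tree D) (rep D) L" if L: "E (tr C) (rep C) L" "\<nu> L = \<nu> (rep C)" for L
  proof -
    have "E (tr D) (rep C) L" by (rule E_mono[OF vertex(2)[OF C(1)] vertex(2)[OF C(2)] CD(1) L(1)])
    then have "E (tr D) (rep D) L" by (rule E_trans[OF vertex(2)[OF C(2)] CD(2)])
    then show ?thesis using core_tree_min[OF C(2)] L(2) C(4) by simp
  qed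
  then show ?thesis unfolding core_def[of D]
    using core_le[OF C(1) core_tree(1)[OF C(2)] vertex(1)[OF C(2)]] by blast
qed

definition height :: "'t => nat" where
  "height A = card {B \<in> T. tle B A}"

lemma height_less: assumes "A \<in> T" "B \<in> T" "tle A B" "A \<noteq> B" shows "height A < height B"
  unfolding height_def
proof (rule psubset_card_mono)
  show "finite {C \<in> T. tle C B}" using finite_T by simp
  have "{C \<in> T. tle C A} \<subseteq> {C \<in> T. tle C B}" using le_trans assms by blast
  moreover have "B \<notin> {C \<in> T. tle C A}" using le_antisym assms by blast
  moreover have "B \<in> {C \<in> T. tle C B}" using le_refl assms by blast
  ultimately show "{C \<in> T. tle C A} \<subset> {C \<in> T. tle C B}" by blast
qed

lemma height_pos: "A \<in> T ==> 0 < height A"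
  unfolding height_def using finite_T le_refl by (auto simp: card_gt_0_iff)

lemma height_le: "height A \<le> card T"
  unfolding height_def by (rule card_mono[OF finite_T]) blast

theorem contractible_fixed_vertices:
  "fixed_vertices \<noteq> {}" "contractible_space (realization vle fixed_vertices)"
proof -
  obtain H0 A0 where H0: "H0 \<in> Bs" "A0 \<in> T" "\<And>K. K \<in> Bs ==> \<nu> H0 \<le> \<nu> K"
    and irr: "\<And>K. irreducible K ==> E A0 H0 K \<and> \<nu> K = \<nu> H0"
    using minimisers by metis
  define m0 where "m0 = \<nu> H0"
  have glob: "E A0 H0 K" if "K \<in> Bs" "\<nu> K = m0" for K
  proof -
    have "irreducible K" unfolding irreducible_def using that H0(3) nbr_Bs m0_def by auto
    then show ?thesis using irr by blast
  qed
  define P where "P = fixed_vertices"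
  define V where "V = (\<lambda>C. \<nu> (rep C))"
  define J0 where "J0 = vx H0 A0"
  have J0: "J0 \<in> P" unfolding J0_def P_def
    by (rule fixed_verticesI[OF H0(1,2)]) (use glob act_Bs act_nu H0(1) m0_def in simp)
  have Vm: "m0 \<le> V C" if "C \<in> P" for C using that vertex(1) H0(3) by (simp add: P_def V_def m0_def)
  have VJ0: "V J0 = m0"
  proof -
    have "V J0 \<le> m0" unfolding V_def J0_def m0_def by (rule rep_vx(2)[OF H0(2,1) E_refl[OF H0(2,1)]])
    then show ?thesis using Vm[OF J0] by simp
  qed
  define b where "b = card T"
  \<comment> \<open>Norm and tree height in lexicographic order, packed into one number; heights are
    at most \<open>b\<close>. All vertices of least norm receive rank 0, so that they are contracted
    as a whole.\<close>
  define r where "r = (\<lambda>C. if V C = m0 then 0 else (V C - m0) * (b + 1) + height (tr C))"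
  have po: "porder vle P" unfolding P_def by (rule porder_vertices)
  have r0: "r C = 0 \<longleftrightarrow> V C = m0" if "C \<in> P" for C
    unfolding r_def using height_pos vertex(2) that P_def by auto
  have r0D: "V C = m0" if "C \<in> P" "r C = 0" for C using r0[OF that(1)] that(2) by simp
  have rank: "V C < V D \<or> V C = V D \<and> height (tr C) < height (tr D)" if "C \<in> P" "D \<in> P" "r C < r D" for C D
  proof (rule ccontr)
    assume "\<not> ?thesis"
    then have c: "V D < V C \<or> V C = V D \<and> height (tr D) \<le> height (tr C)" by auto
    have D0: "V D \<noteq> m0" using that(3) by (auto simp: r_def)
    have rD: "r D = (V D - m0) * (b + 1) + height (tr D)" using D0 by (simp add: r_def)
    have C0: "V C \<noteq> m0" using c D0 Vm[OF that(2)] by auto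
    have rC: "r C = (V C - m0) * (b + 1) + height (tr C)" using C0 by (simp add: r_def)
    show False using c
    proof
      assume "V D < V C"
      then have "V D - m0 + 1 \<le> V C - m0" using Vm[OF that(2)] by simp
      then have "(V D - m0 + 1) * (b + 1) \<le> (V C - m0) * (b + 1)" by (rule mult_le_mono1)
      moreover have "height (tr D) \<le> b" using height_le b_def by simp
      ultimately have "r D \<le> r C" using rC rD by (simp add: algebra_simps)
      then show False using that(3) by simp
    next
      assume "V C = V D \<and> height (tr D) \<le> height (tr C)"
      then show False using rC rD that(3) by simp
    qed
  qed
  have rankI: "r C < r D" if "C \<in> P" "D \<in> P" "V C < V D \<or> V C = V D \<and> V C \<noteq> m0 \<and> height (tr C) < height (tr D)" for C D
    using that(3)
  proof
    assume VCD: "V C < V D"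
    then have D0: "V D \<noteq> m0" using Vm[OF that(1)] by simp
    then have rD: "r D = (V D - m0) * (b + 1) + height (tr D)" by (simp add: r_def)
    have "V C - m0 + 1 \<le> V D - m0" using VCD Vm[OF that(1)] by simp
    then have "(V C - m0 + 1) * (b + 1) \<le> (V D - m0) * (b + 1)" by (rule mult_le_mono1)
    moreover have "height (tr C) \<le> b" using height_le b_def by simp
    moreover have "r C \<le> (V C - m0) * (b + 1) + height (tr C)" by (simp add: r_def)
    moreover have "0 < height (tr D)" using height_pos vertex(2) that(2) P_def by blast
    ultimately show ?thesis using rD by (simp add: algebra_simps)
  qed (simp add: r_def)
  have same: "r C = r D ==> r C > 0 ==> vle C D ==> C = D" if CD: "C \<in> P" "D \<in> P" for C D
  proof (rule ccontr)
    assume a: "r C = r D" "r C > 0" "vle C D" "C \<noteq> D"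
    have ne: "V C \<noteq> m0" "V D \<noteq> m0" using r0[OF CD(1)] r0[OF CD(2)] a(1,2) by simp_all
    have "V D \<le> V C" using vle_nu CD a unfolding V_def P_def by blast
    moreover have "\<not> V D < V C" using rankI[OF CD(2,1)] a(1) by auto
    ultimately have eq: "V C = V D" by simp
    have le: "tle (tr C) (tr D)" using vle_iff CD a P_def by blast
    have "tr C \<noteq> tr D" using vle_tr_eq CD a P_def by blast
    then have "height (tr C) < height (tr D)" using height_less le vertex(2) CD P_def by blast
    then show False using rankI[OF CD] eq ne a by simp
  qed
  have coreP: "core C \<in> P" "V (core C) = V C" "vle (core C) C" if "C \<in> P" for C
    using core that unfolding P_def V_def by blast+
  \<comment> \<open>A vertex of least norm lies above its core, and every such core lies below
    \<open>J0\<close>, the vertex containing all minimisers.\<close>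
  have base: "order_contractible vle {C \<in> P. r C = 0}"
  proof (rule order_contractible_cone_down[where f = core and p = J0])
    show "porder vle {C \<in> P. r C = 0}" by (rule porder_subset[OF po]) blast
    show "J0 \<in> {C \<in> P. r C = 0}" using J0 VJ0 r0 by simp
    show "poset_map vle {C \<in> P. r C = 0} vle {C \<in> P. r C = 0} core"
      unfolding poset_map_def
    proof (intro conjI ballI impI)
      show "core \<in> {C \<in> P. r C = 0} \<rightarrow> {C \<in> P. r C = 0}" by (rule funcsetI) (use coreP r0 in auto)
      fix C D assume "C \<in> {C \<in> P. r C = 0}" "D \<in> {C \<in> P. r C = 0}" "vle C D"
      then have CD: "C \<in> P" "D \<in> P" "r C = 0" "r D = 0" "vle C D" by simp_all
      then have "V C = V D" using r0D by simp
      then show "vle (core C) (core D)" using core_mono[of C D] CD by (simp add: P_def V_def)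
    qed
    show "vle (core C) C" if "C \<in> {C \<in> P. r C = 0}" for C using that coreP by simp
    show "vle (core C) J0" if "C \<in> {C \<in> P. r C = 0}" for C unfolding J0_def
    proof (rule core_le[OF _ H0(2,1)])
      show C: "C \<in> fixed_vertices" using that by (simp add: P_def)
      have "V C = m0" using that r0D by simp
      then show "E A0 H0 L" if "E (tr C) (rep C) L" "\<nu> L = \<nu> (rep C)" for L using glob E_Bs that by (simp add: V_def)
    qed
  qed
  have link: "finite {D \<in> P. r D < r C \<and> (vle D C \<or> vle C D)} \<and>
       order_contractible vle {D \<in> P. r D < r C \<and> (vle D C \<or> vle C D)}" if C: "C \<in> P" "r C > 0" for C
  proof -
    let ?L = "{D \<in> P. r D < r C \<and> (vle D C \<or> vle C D)}"
    have CF: "C \<in> fixed_vertices" using C by (simp add: P_def)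
    note v = vertex[OF CF]
    define Low where "Low = {D \<in> P. vle D C \<and> D \<noteq> C \<and> V D = V C}"
    define Up where "Up = {D \<in> P. vle C D \<and> V D < V C}"
    have Cm: "V C \<noteq> m0" using C r0[OF C(1)] by simp
    \<comment> \<open>Going up cannot raise the norm, so a smaller rank below \<open>C\<close> comes
      from the tree alone and a smaller rank above \<open>C\<close> from the norm alone.\<close>
    have L: "?L = Low \<union> Up"
    proof (rule equalityI; rule subsetI)
      fix D assume D: "D \<in> ?L"
      then have DP: "D \<in> P" "D \<in> fixed_vertices" "r D < r C" by (auto simp: P_def)
      show "D \<in> Low \<union> Up"
      proof (cases "vle D C")
        case True
        then have "V C \<le> V D" using vle_nu[OF DP(2) CF] by (simp add: V_def)
        then have "V D = V C" using rank[OF DP(1) C(1) DP(3)] by auto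
        then show ?thesis using True DP by (auto simp: Low_def)
      next
        case False
        then have CD: "vle C D" "D \<noteq> C" using D DP by auto
        then have "V D \<le> V C" using vle_nu[OF CF DP(2)] by (simp add: V_def)
        moreover have "V D \<noteq> V C"
        proof
          assume eq: "V D = V C"
          have t: "tle (tr C) (tr D)" using vle_iff[OF CF DP(2)] CD by blast
          have "tr C \<noteq> tr D" using vle_tr_eq[OF CF DP(2)] CD by blast
          then have "height (tr C) < height (tr D)" using height_less[OF v(2) vertex(2)[OF DP(2)] t] by blast
          then show False using rank[OF DP(1) C(1) DP(3)] eq by simp
        qed
        ultimately show ?thesis using CD DP by (simp add: Up_def)
      qed
    next
      fix D assume "D \<in> Low \<union> Up"
      then consider "D \<in> Low" | "D \<in> Up" by blast
      then show "D \<in> ?L"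
      proof cases
        case 1
        then have D: "D \<in> P" "D \<in> fixed_vertices" "vle D C" "D \<noteq> C" "V D = V C" by (auto simp: Low_def P_def)
        have t: "tle (tr D) (tr C)" using vle_iff[OF D(2) CF] D by blast
        have "tr D \<noteq> tr C" using vle_tr_eq[OF D(2) CF] D by blast
        then have "height (tr D) < height (tr C)" using height_less[OF vertex(2)[OF D(2)] v(2) t] by blast
        then show ?thesis using rankI[OF D(1) C(1)] D Cm by simp
      next
        case 2
        then show ?thesis using rankI[of D C] C by (simp add: Up_def)
      qed
    qed
    have poL: "porder vle ?L" by (rule porder_subset[OF po]) blast
    have fin: "finite (Low \<union> Up)"
    proof -
      have "Low \<subseteq> (\<lambda>(K, B). vx K B) ` ({K. E (tr C) (rep C) K} \<times> T)"
      proof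
        fix D assume "D \<in> Low"
        then have D: "D \<in> fixed_vertices" "vle D C" by (auto simp: Low_def P_def)
        have "E (tr C) (rep C) (rep D)" using vle_iff[OF D(1) CF] D(2) by blast
        then show "D \<in> (\<lambda>(K, B). vx K B) ` ({K. E (tr C) (rep C) K} \<times> T)"
          by (intro image_eqI[of _ _ "(rep D, tr D)"]) (simp_all add: vertex[OF D(1)])
      qed
      moreover have "Up \<subseteq> vx (rep C) ` T"
      proof
        fix D assume "D \<in> Up"
        then have D: "D \<in> fixed_vertices" "vle C D" by (auto simp: Up_def P_def)
        have "E (tr D) (rep D) (rep C)" using vle_iff[OF CF D(1)] D(2) by blast
        then have "D = vx (rep C) (tr D)" using vx_eqI[OF vertex(2)[OF D(1)]] vertex(3)[OF D(1)] by simp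
        then show "D \<in> vx (rep C) ` T" using vertex(2)[OF D(1)] by blast
      qed
      ultimately show ?thesis using finite_class[OF v(2)] finite_T
        by (meson finite_SigmaI finite_UnI finite_imageI finite_subset)
    qed
    let ?D = "{B \<in> T. tle (tr C) B \<and> (\<exists>K. E B (rep C) K \<and> \<nu> K < \<nu> (rep C))}"
    \<comment> \<open>A vertex above \<open>C\<close> is the class of \<open>rep C\<close> for its
      own tree and is automatically fixed. So \<open>Up\<close> is isomorphic to the poset of trees
      above \<open>tr C\<close> with a reduction, in which the group no longer occurs.\<close>
    have Up_oc: "order_contractible vle Up" if ne: "?D \<noteq> {}"
    proof (rule order_contractible_retract[where f = tr and g = "vx (rep C)" and Q = ?D])
      have UpD: "D \<in> fixed_vertices" "tr D \<in> T" "rep D \<in> Bs" "tle (tr C) (tr D)" "E (tr D) (rep D) (rep C)" "\<nu> (rep D) < \<nu> (rep C)"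
        "vx (rep C) (tr D) = D" if "D \<in> Up" for D
      proof -
        show D: "D \<in> fixed_vertices" using that by (auto simp: Up_def P_def)
        show "tr D \<in> T" "rep D \<in> Bs" using vertex[OF D] by blast+
        have "vle C D" "\<nu> (rep D) < \<nu> (rep C)" using that by (auto simp: Up_def V_def)
        then show "tle (tr C) (tr D)" "E (tr D) (rep D) (rep C)" "\<nu> (rep D) < \<nu> (rep C)" using vle_iff[OF CF D] by blast+
        then show "vx (rep C) (tr D) = D" using vx_eqI[OF vertex(2)[OF D]] vertex(3)[OF D] by metis
      qed
      have gP: "vx (rep C) B \<in> Up" if BD: "B \<in> ?D" for B
      proof -
        have B: "B \<in> T" "tle (tr C) B" using BD by auto
        obtain K where K: "E B (rep C) K" "\<nu> K < \<nu> (rep C)" using BD by blast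
        have F: "vx (rep C) B \<in> fixed_vertices"
          by (rule fixed_verticesI[OF v(1) B(1)]) (use E_mono[OF v(2) B] v(5) in blast)
        have "vle C (vx (rep C) B)" using vle_vx[OF v(2) B(1) v(1,1)] B E_refl[OF B(1) v(1)] v(3) by simp
        moreover have "V (vx (rep C) B) < V C" using rep_vx(2)[OF B(1) v(1) K(1)] K(2) by (simp add: V_def)
        ultimately show ?thesis using F by (simp add: Up_def P_def)
      qed
      show "porder vle Up" by (rule porder_subset[OF po]) (auto simp: Up_def)
      show "poset_map vle Up tle ?D tr" unfolding poset_map_def
      proof (intro conjI ballI impI)
        show "tr \<in> Up \<rightarrow> ?D"
        proof
          fix D assume D: "D \<in> Up"
          have "E (tr D) (rep C) (rep D)" using E_sym UpD[OF D] by blast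
          then show "tr D \<in> ?D" using UpD[OF D] by blast
        qed
        fix D D' assume "D \<in> Up" "D' \<in> Up" "vle D D'"
        then show "tle (tr D) (tr D')" using vle_iff UpD(1) by blast
      qed
      show "poset_map tle ?D vle Up (vx (rep C))" unfolding poset_map_def
      proof (intro conjI ballI impI)
        show "vx (rep C) \<in> ?D \<rightarrow> Up" using gP by blast
        fix B B' assume "B \<in> ?D" "B' \<in> ?D" "tle B B'"
        then show "vle (vx (rep C) B) (vx (rep C) B')" using vle_vx[of B B'] v(1) E_refl by simp
      qed
      show "order_contractible tle ?D" by (rule descending_trees[OF v(2,1,4) ne])
      show "(\<forall>D\<in>Up. vle (vx (rep C) (tr D)) D) \<or> (\<forall>D\<in>Up. vle D (vx (rep C) (tr D)))"
        using UpD(1,7) porder_vertices by (simp add: porder_def)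
    qed
    have UpD: "?D \<noteq> {}" if "D \<in> Up" for D
    proof -
      have D: "D \<in> fixed_vertices" "vle C D" "\<nu> (rep D) < \<nu> (rep C)" using that by (auto simp: Up_def P_def V_def)
      have "tle (tr C) (tr D)" "E (tr D) (rep D) (rep C)" using vle_iff[OF CF D(1)] D(2) by blast+
      then have "tr D \<in> ?D" using D(3) vertex(2)[OF D(1)] E_sym by blast
      then show ?thesis by blast
    qed
    have "order_contractible vle (Low \<union> Up)"
    proof (cases "?D = {}")
      case False
      have less: "vle D D' \<and> D \<noteq> D'" if "D \<in> Low" "D' \<in> Up" for D D'
      proof -
        have "vle D C" "vle C D'" "D \<in> P" "D' \<in> P" "V D \<noteq> V D'" using that by (auto simp: Low_def Up_def)
        then show ?thesis using po C(1) unfolding porder_def by blast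
      qed
      show ?thesis
        by (rule order_contractible_join[of vle _ Low Up]) (use poL L less Up_oc[OF False] in simp_all)
    next
      case True
      then have U: "Up = {}" using UpD by blast
      \<comment> \<open>If \<open>C\<close> were its own core, \<open>descent\<close> would turn any
        reduction of \<open>rep C\<close> into one above \<open>C\<close>, against the emptiness of
        \<open>?D\<close>. Hence \<open>core C\<close> lies in \<open>Low\<close> and can serve as
        cone point.\<close>
      have neq: "core C \<noteq> C"
      proof
        assume cc: "core C = C"
        have ct: "core_tree C = tr C" using core(2)[OF CF] cc by simp
        have "\<not> irreducible (rep C)" using irr Cm by (auto simp: V_def m0_def)
        then obtain B' K' where red: "B' \<in> T" "E B' (rep C) K'" "\<nu> K' < \<nu> (rep C)"
          using v(1) unfolding irreducible_def nbr_def by (auto simp: not_le)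
        have "\<forall>B\<in>T. (\<forall>K. E (tr C) (rep C) K \<and> \<nu> K = \<nu> (rep C) --> E B (rep C) K) --> tle (tr C) B"
          using core_tree(2)[OF CF] ct by simp
        from descent[OF v(2,1,4) this red] show False using True by blast
      qed
      have coreLow: "core D \<in> Low" if "D \<in> P" "vle D C" "V D = V C" for D
      proof -
        have D: "core D \<in> P" "V (core D) = V C" "vle (core D) D" using coreP that by auto
        have "vle (core D) C" using D that C(1) po unfolding porder_def by blast
        moreover have "core D \<noteq> C"
        proof
          assume "core D = C"
          then have "vle C D" using D by simp
          then have "D = C" using that C(1) po unfolding porder_def by blast
          then show False using neq \<open>core D = C\<close> by simp
        qed
        ultimately show ?thesis using D by (simp add: Low_def)
      qed
      have refl: "vle C C" using C(1) po by (simp add: porder_def)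
      have "order_contractible vle Low"
      proof (rule order_contractible_cone_down[where f = core and p = "core C"])
        show "porder vle Low" by (rule porder_subset[OF po]) (auto simp: Low_def)
        show "core C \<in> Low" using coreLow[OF C(1) refl] by simp
        show "poset_map vle Low vle Low core" unfolding poset_map_def
        proof (intro conjI ballI impI)
          show "core \<in> Low \<rightarrow> Low" by (rule funcsetI, rule coreLow) (simp_all add: Low_def)
          fix D D' assume "D \<in> Low" "D' \<in> Low" "vle D D'"
          then show "vle (core D) (core D')" using core_mono[of D D'] by (simp add: Low_def P_def V_def)
        qed
        show "vle (core D) D" if "D \<in> Low" for D using that coreP by (simp add: Low_def)
        show "vle (core D) (core C)" if "D \<in> Low" for D using that core_mono[of D C] CF by (simp add: Low_def P_def V_def)
      qed
      then show ?thesis using U by simp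
    qed
    then show ?thesis using L fin by simp
  qed
  have 1: "contractible_space (realization vle {C \<in> P. r C = 0})"
    by (rule order_contractible_imp_contractible[OF porder_subset[OF po] base]) blast
  have 2: "{C \<in> P. r C = 0} \<noteq> {}" by (rule order_contractible_nonempty[OF base])
  have "contractible_space (realization vle P)"
    by (rule morse_contractible[OF po 1 2]) (use same link in blast)+
  then show "contractible_space (realization vle fixed_vertices)" by (simp add: P_def)
  show "fixed_vertices \<noteq> {}" using J0 by (auto simp: P_def)
qed

end

section \<open>Bases and vertices\<close>

definition img :: "('a => 'a) => (nat => 'a set) => nat => 'a set" where
  "img \<phi> H = (\<lambda>i. \<phi> ` H i)"

locale factored_group = group G for G (structure) +
  fixes n :: nat and Gi :: "nat => 'a set"
  assumes n1: "n \<ge> 1" and finite_Gi: "i \<in> {1..n} ==> finite (Gi i)" and Gi_neq: "i \<in> {1..n} ==> Gi i \<noteq> {\<one>}"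
    and ifp_Gi: "internal_free_product G n Gi"
begin

abbreviation basis :: "(nat => 'a set) => bool" where
  "basis \<equiv> is_basis G n Gi"

abbreviation Aut1 :: "('a => 'a) set" where
  "Aut1 \<equiv> SigmaAut1 G n Gi"

definition conjugate :: "'a set => 'a set => bool" where
  "conjugate X Y \<longleftrightarrow> (\<exists>g\<in>carrier G. Y = conj_set G g X)"

lemma conj_set_comp:
  assumes "a \<in> carrier G" "b \<in> carrier G" "X \<subseteq> carrier G"
  shows "conj_set G a (conj_set G b X) = conj_set G (a \<otimes> b) X"
proof -
  have "a \<otimes> (b \<otimes> h \<otimes> inv b) \<otimes> inv a = (a \<otimes> b) \<otimes> h \<otimes> inv (a \<otimes> b)" if "h \<in> X" for h
    using assms that by (auto simp: inv_mult_group m_assoc)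
  then show ?thesis unfolding conj_set_def image_image by (rule image_cong[OF refl])
qed

lemma conj_set_one: "X \<subseteq> carrier G ==> conj_set G \<one> X = X"
  unfolding conj_set_def by force

lemma conjugate_refl: "X \<subseteq> carrier G ==> conjugate X X"
  unfolding conjugate_def by (rule bexI[of _ \<one>]) (simp_all add: conj_set_one)

lemma conjugate_sym: "conjugate X Y ==> X \<subseteq> carrier G ==> conjugate Y X"
  unfolding conjugate_def
proof (elim bexE)
  fix g assume g: "g \<in> carrier G" "Y = conj_set G g X" "X \<subseteq> carrier G"
  then have "X = conj_set G (inv g) Y" by (simp add: conj_set_comp conj_set_one)
  then show "\<exists>g\<in>carrier G. X = conj_set G g Y" using g by blast
qed

lemma conjugate_trans: "conjugate X Y ==> conjugate Y Z ==> X \<subseteq> carrier G ==> conjugate X Z"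
  unfolding conjugate_def using conj_set_comp m_closed by metis

lemma conjugate_auto:
  assumes \<phi>: "\<phi> \<in> auto G" and "conjugate X Y" "X \<subseteq> carrier G"
  shows "conjugate (\<phi> ` X) (\<phi> ` Y)"
proof -
  obtain g where g: "g \<in> carrier G" "Y = conj_set G g X" using assms by (auto simp: conjugate_def)
  interpret group_hom G G \<phi> by unfold_locales (rule autoD(1)[OF \<phi>])
  have "\<phi> (g \<otimes> h \<otimes> inv g) = \<phi> g \<otimes> \<phi> h \<otimes> inv (\<phi> g)" if "h \<in> X" for h
    using g(1) assms(3) that by (auto simp: subset_iff)
  then have "\<phi> ` Y = conj_set G (\<phi> g) (\<phi> ` X)" unfolding g(2) conj_set_def image_image by (rule image_cong[OF refl])
  then show ?thesis unfolding conjugate_def using g(1) by (intro bexI[of _ "\<phi> g"]) simp_all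
qed

lemma basis_fp: "basis H ==> free_product G n H"
  by (simp add: is_basis_def free_product_def free_product_axioms_def is_group)

lemma Gi_fp: "free_product G n Gi"
  by (simp add: free_product_def free_product_axioms_def is_group ifp_Gi)

lemma Gi_carrier: "i \<in> {1..n} ==> Gi i \<subseteq> carrier G"
  using free_product.factor_carrier[OF Gi_fp] by blast

lemma basisD:
  assumes "basis H" shows "i \<notin> {1..n} ==> H i = {}" "i \<in> {1..n} ==> conjugate (Gi i) (H i)" "H i \<subseteq> carrier G"
proof -
  show 1: "i \<notin> {1..n} ==> H i = {}" "i \<in> {1..n} ==> conjugate (Gi i) (H i)" using assms by (auto simp: is_basis_def conjugate_def)
  show "H i \<subseteq> carrier G" using free_product.factor_carrier[OF basis_fp[OF assms], of i] 1(1) by (cases "i \<in> {1..n}") auto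
qed

lemma basis_finite: assumes "basis H" shows "finite (H i)"
proof (cases "i \<in> {1..n}")
  case True
  then show ?thesis using basisD(2)[OF assms True] finite_Gi by (auto simp: conjugate_def conj_set_def)
qed (simp add: basisD(1)[OF assms])

lemma Gi_nontrivial: assumes "i \<in> {1..n}" shows "\<exists>h\<in>Gi i. h \<noteq> \<one>"
  using Gi_neq[OF assms] free_product.factor_one[OF Gi_fp assms] by blast

lemma basis_nontrivial: assumes "basis H" "i \<in> {1..n}" shows "\<exists>h\<in>H i. h \<noteq> \<one>"
proof -
  obtain g where g: "g \<in> carrier G" "H i = conj_set G g (Gi i)" using basisD(2)[OF assms] by (auto simp: conjugate_def)
  obtain h where h: "h \<in> Gi i" "h \<noteq> \<one>" using Gi_nontrivial[OF assms(2)] by blast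
  have hc: "h \<in> carrier G" using Gi_carrier assms(2) h by blast
  have "g \<otimes> h \<otimes> inv g \<noteq> \<one>"
  proof
    assume "g \<otimes> h \<otimes> inv g = \<one>"
    then have "g \<otimes> h = g" using inv_solve_right[of \<one> "g \<otimes> h" g] g(1) hc by simp
    then show False using h(2) g(1) hc by simp
  qed
  moreover have "g \<otimes> h \<otimes> inv g \<in> H i" unfolding g(2) conj_set_def using h(1) by (rule imageI)
  ultimately show ?thesis by blast
qed

lemma is_basisI:
  assumes "free_product G n H" "\<And>i. i \<notin> {1..n} ==> H i = {}" "\<And>i. i \<in> {1..n} ==> conjugate (Gi i) (H i)"
  shows "basis H"
  using assms unfolding is_basis_def conjugate_def free_product_def free_product_axioms_def by blast

lemma Aut1_iff:
  assumes H: "basis H"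
  shows "\<phi> \<in> Aut1 \<longleftrightarrow> \<phi> \<in> auto G \<and> (\<forall>i\<in>{1..n}. conjugate (H i) (\<phi> ` H i))"
proof -
  have "conjugate (Gi i) (\<phi> ` Gi i) \<longleftrightarrow> conjugate (H i) (\<phi> ` H i)" if i: "i \<in> {1..n}" and \<phi>: "\<phi> \<in> auto G" for i
  proof -
    have c: "conjugate (Gi i) (H i)" "conjugate (\<phi> ` Gi i) (\<phi> ` H i)"
      using basisD(2)[OF H i] conjugate_auto[OF \<phi>] Gi_carrier[OF i] by blast+
    have s: "Gi i \<subseteq> carrier G" "H i \<subseteq> carrier G" "\<phi> ` Gi i \<subseteq> carrier G" "\<phi> ` H i \<subseteq> carrier G"
      using Gi_carrier[OF i] basisD(3)[OF H] autoD(1)[OF \<phi>] by (auto simp: hom_def)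
    show ?thesis using c s conjugate_trans conjugate_sym by meson
  qed
  then show ?thesis unfolding SigmaAut1_def conjugate_def[symmetric] by blast
qed

lemma Aut1_auto: "\<phi> \<in> Aut1 ==> \<phi> \<in> auto G"
  by (simp add: SigmaAut1_def)

lemma free_product_img: "free_product G n H ==> \<phi> \<in> auto G ==> free_product G n (img \<phi> H)"
  unfolding img_def by (rule free_product.free_product_image(1))

lemma img_basis: assumes H: "basis H" and \<phi>: "\<phi> \<in> Aut1" shows "basis (img \<phi> H)"
proof (rule is_basisI)
  show "free_product G n (img \<phi> H)" using free_product_img basis_fp[OF H] Aut1_auto[OF \<phi>] by blast
  show "img \<phi> H i = {}" if "i \<notin> {1..n}" for i using basisD(1)[OF H that] by (simp add: img_def)
  show "conjugate (Gi i) (img \<phi> H i)" if "i \<in> {1..n}" for i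
    using \<phi> Aut1_iff[OF H] basisD(2)[OF H that] Gi_carrier[OF that] conjugate_trans that unfolding img_def by blast
qed

lemma img_compose: "basis H ==> img (compose (carrier G) \<phi> \<psi>) H = img \<phi> (img \<psi> H)"
  unfolding img_def image_image using basisD(3) by (intro ext image_cong) (auto simp: compose_def)

lemma img_cong: "basis H ==> (\<And>g. g \<in> carrier G ==> \<phi> g = \<psi> g) ==> img \<phi> H = img \<psi> H"
  unfolding img_def using basisD(3) by (intro ext image_cong) auto

lemma img_id: "basis H ==> (\<And>g. g \<in> carrier G ==> \<phi> g = g) ==> img \<phi> H = H"
  using img_cong[of H \<phi> "\<lambda>g. g"] by (simp add: img_def)

lemma Aut1_compose: assumes "\<phi> \<in> Aut1" "\<psi> \<in> Aut1" shows "compose (carrier G) \<phi> \<psi> \<in> Aut1"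
proof -
  have a: "compose (carrier G) \<phi> \<psi> \<in> auto G"
    using free_product.auto_compose[OF Gi_fp] Aut1_auto assms by blast
  moreover have "conjugate (Gi i) (compose (carrier G) \<phi> \<psi> ` Gi i)" if i: "i \<in> {1..n}" for i
  proof -
    have 1: "conjugate (Gi i) (\<phi> ` Gi i)" "conjugate (Gi i) (\<psi> ` Gi i)" using assms i by (auto simp: SigmaAut1_def conjugate_def)
    have "compose (carrier G) \<phi> \<psi> ` Gi i = \<phi> ` \<psi> ` Gi i"
      unfolding image_image using Gi_carrier[OF i] by (intro image_cong) (auto simp: compose_def)
    moreover have "conjugate (\<phi> ` Gi i) (\<phi> ` \<psi> ` Gi i)" using conjugate_auto[OF Aut1_auto[OF assms(1)] 1(2) Gi_carrier[OF i]] .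
    ultimately show ?thesis using conjugate_trans[OF 1(1)] Gi_carrier[OF i] by simp
  qed
  ultimately show ?thesis by (simp add: SigmaAut1_def conjugate_def)
qed

lemma Aut1_inverse:
  assumes \<phi>: "\<phi> \<in> Aut1"
  obtains \<psi> where "\<psi> \<in> Aut1" "\<And>g. g \<in> carrier G ==> \<psi> (\<phi> g) = g" "\<And>g. g \<in> carrier G ==> \<phi> (\<psi> g) = g"
proof -
  obtain \<psi> where \<psi>: "\<psi> \<in> auto G" "\<And>g. g \<in> carrier G ==> \<psi> (\<phi> g) = g" "\<And>g. g \<in> carrier G ==> \<phi> (\<psi> g) = g"
    using free_product.auto_inverse[OF Gi_fp Aut1_auto[OF \<phi>]] by blast
  have "conjugate (Gi i) (\<psi> ` Gi i)" if i: "i \<in> {1..n}" for i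
  proof -
    have "conjugate (Gi i) (\<phi> ` Gi i)" using \<phi> i by (auto simp: SigmaAut1_def conjugate_def)
    then have "conjugate (\<psi> ` Gi i) (\<psi> ` \<phi> ` Gi i)" using conjugate_auto[OF \<psi>(1)] Gi_carrier[OF i] by blast
    moreover have "\<psi> ` \<phi> ` Gi i = (\<lambda>g. g) ` Gi i" unfolding image_image
      by (rule image_cong[OF refl]) (use \<psi>(2) Gi_carrier[OF i] in blast)
    moreover have "\<psi> ` Gi i \<subseteq> carrier G" using Gi_carrier[OF i] autoD(1)[OF \<psi>(1)] by (auto simp: hom_def)
    ultimately show ?thesis using conjugate_sym by simp
  qed
  then have "\<psi> \<in> Aut1" using \<psi>(1) by (simp add: SigmaAut1_def conjugate_def)
  then show ?thesis using that \<psi>(2,3) by blast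
qed

lemma id_Aut1: "(\<lambda>g\<in>carrier G. g) \<in> Aut1"
proof -
  have "(\<lambda>g\<in>carrier G. g) \<in> auto G" using free_product.carried_products_auto[OF Gi_fp carried_products.cp_id] .
  moreover have "(\<lambda>g\<in>carrier G. g) ` Gi i = Gi i" if "i \<in> {1..n}" for i
    using Gi_carrier[OF that] by (subst image_cong[OF refl, of _ _ "\<lambda>g. g"]) auto
  ultimately show ?thesis using conjugate_refl Gi_carrier by (simp add: SigmaAut1_def conjugate_def)
qed

lemma carried_products_Aut1:
  assumes H: "basis H" and "\<rho> \<in> carried_products G n H A" shows "\<rho> \<in> Aut1"
  using assms(2)
proof (induction rule: carried_products.induct)
  case cp_id
  then show ?case by (rule id_Aut1)
next
  case (cp_step \<phi> \<psi>)
  obtain k x where w: "sym_whitehead G n H k x \<phi>" using cp_step(1) unfolding carried_by_def by (elim exE conjE)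
  then have a: "\<phi> \<in> auto G" "k \<in> {1..n}" "\<And>j. j \<in> {1..n} ==> x j \<in> H k"
    "\<And>j h. j \<in> {1..n} ==> h \<in> H j ==> \<phi> h = x j \<otimes> h \<otimes> inv (x j)"
    by (auto simp: sym_whitehead_def)
  have "conjugate (H j) (\<phi> ` H j)" if j: "j \<in> {1..n}" for j
  proof -
    have "\<phi> ` H j = conj_set G (x j) (H j)" unfolding conj_set_def by (rule image_cong[OF refl a(4)[OF j]])
    moreover have "x j \<in> carrier G" using a(3)[OF j] basisD(3)[OF H] by blast
    ultimately show ?thesis unfolding conjugate_def by blast
  qed
  then have "\<phi> \<in> Aut1" using Aut1_iff[OF H] a(1) by blast
  then show ?case using Aut1_compose cp_step.IH by blast
qed

section \<open>The relation between bases under a fixed tree\<close>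

definition E :: "(nat => nat set set) => (nat => 'a set) => (nat => 'a set) => bool" where
  "E A H K \<longleftrightarrow> basis H \<and> (\<exists>\<rho>\<in>carried_products G n H A. K = img \<rho> H)"

lemma E_basis: "E A H K ==> basis H \<and> basis K"
  unfolding E_def using img_basis carried_products_Aut1 by blast

lemma E_refl: "basis H ==> E A H H"
  unfolding E_def using img_id[of H "\<lambda>g\<in>carrier G. g"] carried_products.cp_id[of G n H A] by force

text \<open>A product carried relative to the moved basis \<open>K\<close> is pulled back along
  \<open>\<rho>\<close>: applying \<open>\<sigma>\<close> after \<open>\<rho>\<close> is applying
  \<open>\<rho>\<close> after some \<open>\<sigma>'\<close> carried relative to
  \<open>H\<close>.\<close>

lemma E_trans: assumes "E A H K" "E A K K'" shows "E A H K'"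
proof -
  obtain \<rho> where H: "basis H" and \<rho>: "\<rho> \<in> carried_products G n H A" "K = img \<rho> H" using assms(1) by (auto simp: E_def)
  obtain \<sigma> where \<sigma>: "\<sigma> \<in> carried_products G n K A" "K' = img \<sigma> K" using assms(2) by (auto simp: E_def)
  interpret H: free_product G n H by (rule basis_fp[OF H])
  have \<rho>a: "\<rho> \<in> auto G" by (rule H.carried_products_auto[OF \<rho>(1)])
  obtain \<sigma>' where \<sigma>': "\<sigma>' \<in> carried_products G n H A" "\<And>g. g \<in> carrier G ==> \<sigma> (\<rho> g) = \<rho> (\<sigma>' g)"
    using H.carried_products_conj[OF \<rho>a, of \<sigma> A] \<sigma>(1) unfolding \<rho>(2) img_def by blast
  have "K' = img (compose (carrier G) \<sigma> \<rho>) H" using img_compose[OF H] \<rho>(2) \<sigma>(2) by simp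
  also have "\<dots> = img (compose (carrier G) \<rho> \<sigma>') H" by (rule img_cong[OF H]) (simp add: compose_def \<sigma>'(2))
  finally have "K' = img (compose (carrier G) \<rho> \<sigma>') H" .
  then show ?thesis unfolding E_def using H H.carried_products_comp[OF \<rho>(1) \<sigma>'(1)] by blast
qed

lemma E_sym: assumes A: "compatible n A" and "E A H K" shows "E A K H"
proof -
  obtain \<rho> where H: "basis H" and \<rho>: "\<rho> \<in> carried_products G n H A" "K = img \<rho> H" using assms(2) by (auto simp: E_def)
  interpret H: free_product G n H by (rule basis_fp[OF H])
  obtain \<psi> where \<psi>: "\<psi> \<in> carried_products G n H A" "\<And>g. g \<in> carrier G ==> \<psi> (\<rho> g) = g" "\<And>g. g \<in> carrier G ==> \<rho> (\<psi> g) = g"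
    using H.carried_products_inverse[OF A \<rho>(1)] by blast
  have K: "basis K" using E_basis assms(2) by blast
  interpret K: free_product G n K by (rule basis_fp[OF K])
  have HK: "H = img \<psi> K"
    using img_compose[OF H, of \<psi> \<rho>] img_id[OF H, of "compose (carrier G) \<psi> \<rho>"] \<psi>(2) \<rho>(2) by (simp add: compose_def)
  have \<psi>a: "\<psi> \<in> auto G" by (rule H.carried_products_auto[OF \<psi>(1)])
  \<comment> \<open>The conjugator is \<open>\<psi>\<close> itself. As \<open>\<psi>\<close> maps
    \<open>K\<close> to \<open>H\<close>, the pulled back product is \<open>\<psi>\<close> again,
    now carried relative to \<open>K\<close>.\<close>
  obtain \<phi>' where \<phi>': "\<phi>' \<in> carried_products G n K A" "\<And>g. g \<in> carrier G ==> \<psi> (\<psi> g) = \<psi> (\<phi>' g)"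
    using K.carried_products_conj[OF \<psi>a, of \<psi> A] \<psi>(1) HK unfolding img_def by auto
  have "\<phi>' g = \<psi> g" if g: "g \<in> carrier G" for g
  proof -
    have "\<phi>' g \<in> carrier G" "\<psi> g \<in> carrier G" using K.auto_closed K.carried_products_auto[OF \<phi>'(1)] \<psi>a g by blast+
    then show ?thesis using \<phi>'(2)[OF g] \<psi>(3)[of "\<phi>' g"] \<psi>(3)[of "\<psi> g"] by simp
  qed
  then have "img \<phi>' K = H" using img_cong[OF K, of \<phi>' \<psi>] HK by simp
  then show ?thesis unfolding E_def using K \<phi>'(1) by blast
qed

lemma E_mono:
  assumes A: "compatible n A" and B: "compatible n B" and le: "tree_le A B" and "E A H K"
  shows "E B H K"
proof -
  obtain \<rho> where H: "basis H" and \<rho>: "\<rho> \<in> carried_products G n H A" "K = img \<rho> H" using assms(4) by (auto simp: E_def)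
  interpret H: free_product G n H by (rule basis_fp[OF H])
  have sub: "carried_by G n H B \<phi>" if "carried_by G n H A \<phi>" for \<phi>
    using that unfolding H.carried_by_iff[OF A] H.carried_by_iff[OF B] using constant_on_petals_mono[OF A B le] by blast
  have "\<rho> \<in> carried_products G n H B" using \<rho>(1)
    by (induction rule: carried_products.induct) (rule carried_products.cp_id, blast intro: carried_products.cp_step sub)
  then show ?thesis unfolding E_def using H \<rho>(2) by blast
qed

lemma E_img:
  assumes \<phi>: "\<phi> \<in> Aut1" and "E A H K" shows "E A (img \<phi> H) (img \<phi> K)"
proof -
  obtain \<rho> where H: "basis H" and \<rho>: "\<rho> \<in> carried_products G n H A" "K = img \<rho> H" using assms(2) by (auto simp: E_def)
  have H': "basis (img \<phi> H)" by (rule img_basis[OF H \<phi>])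
  interpret H': free_product G n "img \<phi> H" by (rule basis_fp[OF H'])
  obtain \<psi> where \<psi>: "\<psi> \<in> Aut1" "\<And>g. g \<in> carrier G ==> \<psi> (\<phi> g) = g" "\<And>g. g \<in> carrier G ==> \<phi> (\<psi> g) = g"
    using Aut1_inverse[OF \<phi>] by blast
  have "img \<psi> (img \<phi> H) = H"
    using img_compose[OF H, of \<psi> \<phi>] img_id[OF H, of "compose (carrier G) \<psi> \<phi>"] \<psi>(2) by (simp add: compose_def)
  then have "\<rho> \<in> carried_products G n (\<lambda>i. \<psi> ` img \<phi> H i) A" using \<rho>(1) by (simp add: img_def)
  then obtain \<sigma> where \<sigma>: "\<sigma> \<in> carried_products G n (img \<phi> H) A" "\<And>g. g \<in> carrier G ==> \<rho> (\<psi> g) = \<psi> (\<sigma> g)"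
    using H'.carried_products_conj[OF Aut1_auto[OF \<psi>(1)]] by blast
  have cl: "\<phi> g \<in> carrier G" "\<sigma> g \<in> carrier G" if "g \<in> carrier G" for g
    using H'.auto_closed Aut1_auto[OF \<phi>] H'.carried_products_auto[OF \<sigma>(1)] that by blast+
  have "\<phi> (\<rho> g) = \<sigma> (\<phi> g)" if g: "g \<in> carrier G" for g
    using \<sigma>(2)[OF cl(1)[OF g]] \<psi>(2)[OF g] \<psi>(3)[OF cl(2)[OF cl(1)[OF g]]] by simp
  then have "img (compose (carrier G) \<phi> \<rho>) H = img (compose (carrier G) \<sigma> \<phi>) H"
    by (intro img_cong[OF H]) (simp add: compose_def)
  then have "img \<phi> K = img \<sigma> (img \<phi> H)" using img_compose[OF H] \<rho>(2) by simp
  then show ?thesis unfolding E_def using H' \<sigma>(1) by blast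
qed

lemma valid_pair_iff: "valid_pair G n Gi (H, A) \<longleftrightarrow> basis H \<and> compatible n A"
  by (simp add: valid_pair_def trees_eq_compatible[OF n1])

text \<open>On bases, \<open>E A\<close> is already an equivalence relation, so the generated
  equivalence collapses to a single step.\<close>

lemma vclass_eq:
  assumes H: "basis H" and A: "compatible n A"
  shows "vclass G n Gi (H, A) = {(K, A) | K. E A H K}"
proof (rule equalityI; rule subsetI)
  fix q assume "q \<in> vclass G n Gi (H, A)"
  then have "(symclp (pair_rel G n Gi))\<^sup>*\<^sup>* (H, A) q" by (simp add: vclass_def equivclp_def)
  then have "snd q = A \<and> E A H (fst q)"
  proof (induction rule: rtranclp_induct)
    case base
    then show ?case using E_refl[OF H] by simp
  next
    case (step p q)
    have p: "snd p = A" "E A H (fst p)" using step.IH by auto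
    from step.hyps(2) consider "pair_rel G n Gi p q" | "pair_rel G n Gi q p" by (auto simp: symclp_def)
    then show ?case
    proof cases
      case 1
      then have "snd q = A" "E A (fst p) (fst q)" using p E_basis[OF p(2)] unfolding pair_rel_def E_def img_def by simp_all
      then show ?thesis using E_trans p by blast
    next
      case 2
      then have "snd q = A" "E A (fst q) (fst p)" using p unfolding pair_rel_def E_def img_def valid_pair_def by simp_all
      then show ?thesis using E_trans[OF p(2)] E_sym[OF A] by blast
    qed
  qed
  then show "q \<in> {(K, A) | K. E A H K}" by (cases q) auto
next
  fix q assume "q \<in> {(K, A) | K. E A H K}"
  then obtain K where q: "q = (K, A)" "E A H K" by blast
  then have "pair_rel G n Gi (H, A) q" using H A by (simp add: pair_rel_def valid_pair_iff E_def img_def)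
  then show "q \<in> vclass G n Gi (H, A)" by (simp add: vclass_def r_into_equivclp)
qed

lemma L_vertices_eq: "L_vertices G n Gi = {{(K, A) | K. E A H K} | H A. basis H \<and> compatible n A}"
proof -
  have "L_vertices G n Gi = {vclass G n Gi (H, A) | H A. basis H \<and> compatible n A}"
    unfolding L_vertices_def using valid_pair_iff by (auto simp: split_paired_Ex)
  also have "\<dots> = {{(K, A) | K. E A H K} | H A. basis H \<and> compatible n A}"
    by (intro Collect_cong ex_cong1) (use vclass_eq in auto)
  finally show ?thesis .
qed

end

lemma L_le_eq: "L_le = pair_le tree_le"
  by (intro ext) (simp add: L_le_def pair_le_def)

section \<open>Norms of bases\<close>

context free_product
begin

definition normalise :: "nat => (nat => 'a) => nat => 'a" where
  "normalise k m = (\<lambda>j. if j = k then \<one> else inv (m 0) \<otimes> m j)"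

lemma nmove_normalise:
  assumes k: "k \<in> {1..n}" and m: "\<And>j. j \<le> n ==> m j \<in> H k" shows "nmove k (normalise k m)"
proof -
  have 0: "m 0 \<in> H k" "m 0 \<in> carrier G" using m[of 0] factor_carrier[OF k] by auto
  have "inv (m 0) \<otimes> m j \<in> H k" if "j \<in> {1..n}" for j
    using factor_closed[OF k factor_inv[OF k 0(1)] m] that by simp
  then show ?thesis unfolding nmove_def normalise_def using k 0 factor_one[OF k] by auto
qed

lemma turn_count_normalise:
  assumes k: "k \<in> {1..n}" and m: "\<And>j. j \<le> n ==> m j \<in> H k" and g: "g \<in> carrier G"
  shows "turn_count G k (normalise k m) \<one> (nf g) = turn_count G k m (m 0) (nf g)"
proof -
  have c: "m j \<in> carrier G" if "j \<le> n" for j using m[OF that] factor_carrier[OF k] by blast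
  have w: "\<forall>p\<in>set (nf g). fst p \<le> n \<and> snd p \<in> carrier G"
    using nf(1)[OF g] red_carrier[OF nf(1)[OF g]] by (auto simp: red_word_def)
  have "turn_count G k (normalise k m) (inv (m 0) \<otimes> m 0) (nf g) = turn_count G k m (m 0) (nf g)"
    by (rule turn_count_translate[OF _ _ _ _ w]) (use c k in \<open>auto simp: normalise_def\<close>)
  then show ?thesis using c[of 0] by simp
qed

lemma normalise_same:
  assumes "nmove k m" "j \<le> n" shows "normalise k m j = m j"
  using nmoveD[OF assms(1)] assms(2) by (cases "j = 0") (auto simp: normalise_def)

lemma constant_normalise:
  assumes A: "compatible n A" and "constant_on_petals A k m" shows "constant_on_petals A k (normalise k m)"
  using assms(2) same_petal_range[OF A] unfolding constant_on_petals_def normalise_def by auto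

lemma move_product_cong:
  "(\<And>k. k \<in> set ks ==> whitehead (M k) = whitehead (M' k)) ==> move_product ks M = move_product ks M'"
  by (induction ks) simp_all

text \<open>Short words detect equal multipliers. The word with the single syllable \<open>t\<close>
  compares \<open>t\<close> with 0, and repeating the two-syllable word \<open>s\<close>,
  \<open>t\<close> adds two turns exactly when the multipliers at \<open>s\<close> and
  \<open>t\<close> differ.\<close>

lemma turn_count_partition:
  assumes eq: "\<And>g. g \<in> carrier G ==> turn_count G k m (m 0) (nf g) = turn_count G k l (l 0) (nf g)"
    and k: "k \<in> {1..n}" and nontriv: "\<And>i. i \<in> {1..n} ==> \<exists>h\<in>H i. h \<noteq> \<one>"
    and st: "s \<le> n" "t \<le> n" "s \<noteq> k" "t \<noteq> k" "m s = m t"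
  shows "l s = l t"
proof -
  have eqw: "turn_count G k m (m 0) w = turn_count G k l (l 0) w" if "red w" for w
    using eq[OF red_wp_closed[OF that]] nf_wp[OF that] by simp
  have from0: "l 0 = l t" if t: "t \<le> n" "t \<noteq> k" "m 0 = m t" for t
  proof (cases "t = 0")
    case False
    then have tn: "t \<in> {1..n}" using t by simp
    obtain b where b: "b \<in> H t" "b \<noteq> \<one>" using nontriv[OF tn] by blast
    have "red [(t, b)]" using b tn by (simp add: red_word_Cons)
    then show ?thesis using eqw[of "[(t, b)]"] t by (simp split: if_splits)
  qed simp
  show ?thesis
  proof (cases "s = t \<or> s = 0 \<or> t = 0")
    case True
    then show ?thesis using from0[OF st(1,3)] from0[OF st(2,4)] st(5) by metis
  next
    case False
    then have n: "s \<in> {1..n}" "t \<in> {1..n}" "s \<noteq> t" using st by auto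
    obtain a where a: "a \<in> H s" "a \<noteq> \<one>" using nontriv[OF n(1)] by blast
    obtain b where b: "b \<in> H t" "b \<noteq> \<one>" using nontriv[OF n(2)] by blast
    have "red [(s, a), (t, b)]" "red [(s, a), (t, b), (s, a), (t, b)]" using a b n by (simp_all add: red_word_Cons)
    from eqw[OF this(1)] eqw[OF this(2)] show ?thesis using st by (simp split: if_splits)
  qed
qed

end

locale weighted_group = factored_group +
  fixes Q :: "'a set" and wt :: "'a => nat"
  assumes finite_Q: "finite Q" and Q_carrier: "Q \<subseteq> carrier G"
begin

definition nu :: "(nat => 'a set) => nat" where
  "nu H = (\<Sum>g\<in>Q. wt g * length (nform G n H g))"

definition cost :: "(nat => 'a set) => nat => (nat => 'a) => nat" where
  "cost H k m = (\<Sum>g\<in>Q. wt g * turn_count G k m (m 0) (nform G n H g))"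

definition bse :: "(nat => 'a set) => nat => nat" where
  "bse H k = (\<Sum>g\<in>Q. wt g * syllables G n H k g)"

lemma nu_sum: assumes "basis H" shows "nu H = (\<Sum>k\<in>{1..n}. bse H k)"
proof -
  have "nu H = (\<Sum>g\<in>Q. \<Sum>k\<in>{1..n}. wt g * syllables G n H k g)"
    unfolding nu_def using free_product.length_nf[OF basis_fp[OF assms]] Q_carrier
    by (intro sum.cong refl) (auto simp: sum_distrib_left)
  then show ?thesis unfolding bse_def by (simp add: sum.swap[of _ Q])
qed

lemma move_costs_basis: assumes H: "basis H" shows "move_costs n H (cost H)"
proof
  show "n \<ge> 1" by (rule n1)
  show "finite (H k)" if "k \<in> {1..n}" for k by (rule basis_finite[OF H])
  show "\<exists>a b. a \<in> H k \<and> b \<in> H k \<and> a \<noteq> b" if "k \<in> {1..n}" for k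
    using basis_nontrivial[OF H that] free_product.factor_one[OF basis_fp[OF H] that] by blast
  interpret H: free_product G n H by (rule basis_fp[OF H])
  fix x y and m l :: "nat => 'a" assume xy: "x \<in> {1..n}" "y \<in> {1..n}" "x \<noteq> y"
  let ?m = "uncross m (crossing n x m y l) y" and ?l = "uncross l (crossing n x m y l) x"
  have "turn_count G x ?m (?m 0) (H.nf g) + turn_count G y ?l (?l 0) (H.nf g)
      \<le> turn_count G x m (m 0) (H.nf g) + turn_count G y l (l 0) (H.nf g)" if "g \<in> Q" for g
  proof (rule turn_count_uncross)
    show "x \<noteq> y" "x \<noteq> 0" "y \<noteq> 0" using xy by auto
    show "\<forall>p\<in>set (H.nf g). fst p \<le> n" using H.nf(1)[of g] that Q_carrier by (auto simp: red_word_def)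
  qed
  then show "cost H x ?m + cost H y ?l \<le> cost H x m + cost H y l"
    unfolding cost_def sum.distrib[symmetric] by (intro sum_mono) (simp flip: distrib_left)
qed

lemma bse_img:
  assumes H: "basis H" and A: "compatible n A" and M: "free_product.system G n H A M" and k: "k \<in> {1..n}"
    and K: "K = img (free_product.move_product G n H [1..<Suc n] M) H"
  shows "g \<in> carrier G ==> syllables G n K k g = turn_count G k (M k) (M k 0) (nform G n H g)" "bse K k = cost H k (M k)"
proof -
  interpret H: free_product G n H by (rule basis_fp[OF H])
  define \<rho> where "\<rho> = H.move_product [1..<Suc n] M"
  have c: "\<rho> \<in> carried_products G n H A" unfolding H.carried_products_eq[OF A] \<rho>_def using M by blast
  have a: "\<rho> \<in> auto G" by (rule H.carried_products_auto[OF c])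
  obtain \<psi> where \<psi>: "\<psi> \<in> auto G" "\<And>g. g \<in> carrier G ==> \<psi> (\<rho> g) = g" "\<And>g. g \<in> carrier G ==> \<rho> (\<psi> g) = g"
    using H.auto_inverse[OF a] by blast
  have 0: "M k 0 = \<one>" using H.nmoveD(2) H.system_nmove[OF M k] by blast
  show 1: "syllables G n K k g = turn_count G k (M k) (M k 0) (nform G n H g)" if g: "g \<in> carrier G" for g
  proof -
    have u: "\<psi> g \<in> carrier G" by (rule H.auto_closed[OF \<psi>(1) g])
    have "syllables G n K k (\<rho> (\<psi> g)) = syllables G n H k (\<psi> g)"
      unfolding K img_def \<rho>_def[symmetric] by (rule H.free_product_image(3)[OF a u])
    also have "\<dots> = turn_count G k (M k) \<one> (nform G n H (\<rho> (\<psi> g)))"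
    proof -
      have ks: "distinct [1..<Suc n]" "set [1..<Suc n] \<subseteq> {1..n}" "k \<in> set [1..<Suc n]" using k by auto
      from H.syllables_move_product[OF A M ks(1,2) u] ks(3) show ?thesis unfolding \<rho>_def by blast
    qed
    finally show ?thesis using \<psi>(3)[OF g] 0 by simp
  qed
  show "bse K k = cost H k (M k)" unfolding bse_def cost_def using 1 Q_carrier by (intro sum.cong refl) auto
qed

text \<open>Normalising the move keeps its turn counts, and the identity at the other factors
  contributes the base values, so the norm changes by cost minus base.\<close>

lemma carried_move:
  assumes H: "basis H" and A: "compatible n A" and km: "(k, m) \<in> move_costs.carried n H A"
  shows "\<exists>K. E A H K \<and> nu K + bse H k = nu H + cost H k m \<and>
    (\<forall>g\<in>carrier G. syllables G n K k g = turn_count G k m (m 0) (nform G n H g))"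
proof -
  interpret H: free_product G n H by (rule basis_fp[OF H])
  interpret mc: move_costs n H "cost H" "bse H" by (rule move_costs_basis[OF H])
  have k: "k \<in> {1..n}" and m: "\<And>j. j \<le> n ==> m j \<in> H k" and cst: "constant_on_petals A k m"
    using km by (auto simp: mc.carried_def mc.moves_def PiE_iff)
  define M where "M = (\<lambda>i. if i = k then H.normalise k m else (\<lambda>_. \<one>))"
  have M: "H.system A M" unfolding H.system_def M_def
    using H.nmove_normalise[OF k m] H.constant_normalise[OF A cst] H.nmove_one by (auto simp: constant_on_petals_def)
  define K where "K = img (H.move_product [1..<Suc n] M) H"
  have one: "cost H i (\<lambda>_. \<one>) = bse H i" if i: "i \<in> {1..n}" for i
  proof -
    have "H = img (H.move_product [1..<Suc n] (\<lambda>_ _. \<one>)) H"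
      using img_id[OF H, of "\<lambda>g\<in>carrier G. g"] H.move_product_one[of "[1..<Suc n]"] H.set_upt_Suc by simp
    from bse_img(2)[OF H A H.system_one i this] show ?thesis by simp
  qed
  have nm: "turn_count G k (M k) (M k 0) (nform G n H g) = turn_count G k m (m 0) (nform G n H g)" if "g \<in> carrier G" for g
    using H.turn_count_normalise[OF k m that] H.nmoveD(2)[OF H.nmove_normalise[OF k m]] by (simp add: M_def)
  then have ck: "cost H k (M k) = cost H k m" unfolding cost_def using Q_carrier by (intro sum.cong refl) auto
  have E: "E A H K" unfolding E_def K_def H.carried_products_eq[OF A] using H M by blast
  have KB: "basis K" using E_basis[OF E] by blast
  have "nu K = (\<Sum>i\<in>{1..n}. cost H i (M i))" using nu_sum[OF KB] bse_img(2)[OF H A M _ K_def] by simp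
  also have "\<dots> = cost H k (M k) + (\<Sum>i\<in>{1..n} - {k}. cost H i (M i))" using k by (simp add: sum.remove)
  also have "(\<Sum>i\<in>{1..n} - {k}. cost H i (M i)) = (\<Sum>i\<in>{1..n} - {k}. bse H i)"
    by (intro sum.cong refl) (simp add: M_def one)
  finally have "nu K = cost H k m + (\<Sum>i\<in>{1..n} - {k}. bse H i)" using ck by simp
  moreover have "nu H = bse H k + (\<Sum>i\<in>{1..n} - {k}. bse H i)" using nu_sum[OF H] k by (simp add: sum.remove)
  ultimately have "nu K + bse H k = nu H + cost H k m" by simp
  then show ?thesis using E bse_img(1)[OF H A M k K_def] nm by (intro exI[of _ K]) simp
qed

text \<open>The converse decomposition: the components of a carried product are moves whose costs
  add up to the new norm, and any tree carrying all components relates the two bases. Restricting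
  the multipliers to \<open>{0..n}\<close> puts them in a finite function space, which bounds the
  class.\<close>

lemma E_moves:
  assumes A: "compatible n A" and "E A H K"
  shows "\<exists>M\<in>{1..n} \<rightarrow>\<^sub>E ({0..n} \<rightarrow>\<^sub>E \<Union>(range H)). (\<forall>k\<in>{1..n}. (k, M k) \<in> move_costs.carried n H A) \<and>
    nu K = (\<Sum>k\<in>{1..n}. cost H k (M k)) \<and>
    (\<forall>k\<in>{1..n}. \<forall>g\<in>carrier G. syllables G n K k g = turn_count G k (M k) (M k 0) (nform G n H g)) \<and>
    K = img (free_product.move_product G n H [1..<Suc n] (\<lambda>k. free_product.normalise G k (M k))) H \<and>
    (\<forall>B. compatible n B --> (\<forall>k\<in>{1..n}. constant_on_petals B k (M k)) --> E B H K)"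
proof -
  have H: "basis H" and KB: "basis K" using E_basis[OF assms(2)] by auto
  interpret H: free_product G n H by (rule basis_fp[OF H])
  interpret mc: move_costs n H "cost H" "bse H" by (rule move_costs_basis[OF H])
  obtain M0 where M0: "H.system A M0" "K = img (H.move_product [1..<Suc n] M0) H"
    using assms(2) unfolding E_def H.carried_products_eq[OF A] by blast
  have nm: "H.nmove k (M0 k)" "constant_on_petals A k (M0 k)" if "k \<in> {1..n}" for k
    using M0(1) that by (auto simp: H.system_def)
  define M where "M = (\<lambda>k\<in>{1..n}. \<lambda>j\<in>{0..n}. M0 k j)"
  have Mk: "M k j = M0 k j" if "k \<in> {1..n}" "j \<le> n" for k j using that by (simp add: M_def)
  have MH: "M k j \<in> H k" if k: "k \<in> {1..n}" "j \<le> n" for k j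
    using H.nmoveD(2,4)[OF nm(1)[OF k(1)]] Mk[OF k] H.factor_one[OF k(1)] k(2) by (cases "j = 0") auto
  have Mm: "M k \<in> {0..n} \<rightarrow>\<^sub>E H k" if "k \<in> {1..n}" for k using MH[OF that] that by (auto simp: M_def PiE_iff)
  have 1: "M \<in> {1..n} \<rightarrow>\<^sub>E ({0..n} \<rightarrow>\<^sub>E \<Union>(range H))"
  proof (rule PiE_I)
    fix k assume "k \<in> {1..n}"
    then show "M k \<in> {0..n} \<rightarrow>\<^sub>E \<Union>(range H)" using Mm by (auto simp: PiE_iff)
  qed (auto simp: M_def restrict_def)
  have tc: "turn_count G k (M k) a (nform G n H g) = turn_count G k (M0 k) a (nform G n H g)" if "k \<in> {1..n}" "g \<in> carrier G" for k g a
  proof -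
    have w: "\<forall>p\<in>set (nform G n H g). fst p \<le> n" using H.nf(1)[OF that(2)] by (auto simp: red_word_def)
    show ?thesis by (rule turn_count_cong[OF _ _ w]) (use Mk that in auto)
  qed
  have cB: "constant_on_petals B k (M0 k)" if "compatible n B" "k \<in> {1..n}" "constant_on_petals B k (M k)" for B k
    unfolding constant_on_petals_def
  proof (intro allI impI)
    fix s t assume st: "same_petal B k s t"
    then have "s \<le> n" "t \<le> n" using same_petal_range[OF that(1)] by blast+
    moreover have "M k s = M k t" using that(3) st unfolding constant_on_petals_def by blast
    ultimately show "M0 k s = M0 k t" using Mk[OF that(2)] by simp
  qed
  have 2: "(k, M k) \<in> mc.carried A" if k: "k \<in> {1..n}" for k
  proof -
    have "constant_on_petals A k (M k)" unfolding constant_on_petals_def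
    proof (intro allI impI)
      fix s t assume st: "same_petal A k s t"
      then have "s \<le> n" "t \<le> n" using same_petal_range[OF A] by blast+
      moreover have "M0 k s = M0 k t" using nm(2)[OF k] st unfolding constant_on_petals_def by blast
      ultimately show "M k s = M k t" using Mk[OF k] by simp
    qed
    then show ?thesis using k Mm[OF k] by (simp add: mc.carried_def mc.moves_def)
  qed
  have 4: "syllables G n K k g = turn_count G k (M k) (M k 0) (nform G n H g)" if "k \<in> {1..n}" "g \<in> carrier G" for k g
    using bse_img(1)[OF H A M0(1) that(1) M0(2) that(2)] tc[OF that] Mk[OF that(1), of 0] by simp
  have "bse K k = cost H k (M k)" if "k \<in> {1..n}" for k
    unfolding bse_def cost_def using 4[OF that] Q_carrier by (intro sum.cong refl) auto
  then have 3: "nu K = (\<Sum>k\<in>{1..n}. cost H k (M k))" using nu_sum[OF KB] by simp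
  have "H.whitehead (M0 k) = H.whitehead (H.normalise k (M k))" if k: "k \<in> {1..n}" for k
  proof (rule H.whitehead_cong)
    show "H.nmove k (M0 k)" by (rule nm(1)[OF k])
    show "H.nmove k (H.normalise k (M k))" by (rule H.nmove_normalise[OF k MH[OF k]])
    show "M0 k j = H.normalise k (M k) j" if j: "j \<in> {1..n}" for j
    proof -
      have jn: "j \<le> n" using j by simp
      show ?thesis using H.normalise_same[OF nm(1)[OF k] jn] Mk[OF k jn] Mk[OF k, of 0]
        by (cases "j = k") (simp_all add: H.normalise_def)
    qed
  qed
  then have "H.move_product [1..<Suc n] M0 = H.move_product [1..<Suc n] (\<lambda>k. H.normalise k (M k))"
    by (intro H.move_product_cong) auto
  then have 5: "K = img (H.move_product [1..<Suc n] (\<lambda>k. H.normalise k (M k))) H" using M0(2) by simp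
  have 6: "E B H K" if B: "compatible n B" "\<And>k. k \<in> {1..n} ==> constant_on_petals B k (M k)" for B
  proof -
    have "H.system B M0" unfolding H.system_def using nm(1) cB[OF B(1)] B(2) by blast
    then show ?thesis unfolding E_def H.carried_products_eq[OF B(1)] using H M0(2) by blast
  qed
  show ?thesis using 2 3 4 5 6 by (intro bexI[OF _ 1] conjI ballI allI impI) blast+
qed

end

lemma finite_compatible: "finite {A. compatible n A}"
proof (rule finite_subset)
  show "{A. compatible n A} \<subseteq> (\<lambda>f k. if k \<le> n then f k else {}) ` ({0..n} \<rightarrow>\<^sub>E Pow (Pow {0..n}))"
  proof
    fix A assume "A \<in> {A. compatible n A}"
    then have A: "compatible n A" by simp
    have "A k \<subseteq> Pow {0..n}" if "k \<le> n" for k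
      using compatibleD(2)[OF A that] unfolding partition_on_def by blast
    then have "restrict A {0..n} \<in> {0..n} \<rightarrow>\<^sub>E Pow (Pow {0..n})" by (auto simp: PiE_iff)
    moreover have "A = (\<lambda>k. if k \<le> n then restrict A {0..n} k else {})"
      using compatibleD(1)[OF A] by (auto simp: fun_eq_iff)
    ultimately show "A \<in> (\<lambda>f k. if k \<le> n then f k else {}) ` ({0..n} \<rightarrow>\<^sub>E Pow (Pow {0..n}))" by blast
  qed
qed (intro finite_imageI finite_PiE finite_atLeastAtMost, simp)

context factored_group
begin

text \<open>Generated by no move at all, this is the trivial tree: one petal at each label.\<close>

definition least_tree :: "nat => nat set set" where
  "least_tree = generated_tree n ({} :: (nat \<times> (nat => 'a)) set)"

lemma compatible_least_tree: "compatible n least_tree"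
  unfolding least_tree_def by (rule compatible_generated_tree[OF n1]) auto

lemma least_tree_le: "compatible n A ==> tree_le least_tree A"
  unfolding least_tree_def by (rule generated_tree_le[OF _ compatible_least_tree[unfolded least_tree_def]]) auto

lemma E_least_tree: assumes "E least_tree H K" shows "K = H"
proof -
  have H: "basis H" using E_basis[OF assms] by blast
  interpret H: free_product G n H by (rule basis_fp[OF H])
  obtain M where M: "H.system least_tree M" "K = img (H.move_product [1..<Suc n] M) H"
    using assms unfolding E_def H.carried_products_eq[OF compatible_least_tree] by blast
  have "H.whitehead (M k) = H.whitehead (\<lambda>_. \<one>)" if k: "k \<in> {1..n}" for k
  proof (rule H.whitehead_cong)
    show nm: "H.nmove k (M k)" using H.system_nmove[OF M(1) k] .
    show "H.nmove k (\<lambda>_. \<one>)" by (rule H.nmove_one[OF k])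
    fix j assume j: "j \<in> {1..n}"
    show "M k j = \<one>"
    proof (cases "j = k")
      case False
      have "same_petal least_tree k j 0" unfolding least_tree_def same_petal_generated using j k False by auto
      then have "M k j = M k 0" using M(1) k unfolding H.system_def constant_on_petals_def by blast
      then show ?thesis using H.nmoveD(2)[OF nm] by simp
    qed (simp add: H.nmoveD(3)[OF nm])
  qed
  then have "H.move_product [1..<Suc n] M = H.move_product [1..<Suc n] (\<lambda>_ _. \<one>)"
    by (intro H.move_product_cong) auto
  also have "\<dots> = (\<lambda>g\<in>carrier G. g)" by (rule H.move_product_one) auto
  finally show ?thesis using M(2) img_id[OF H, of "\<lambda>g\<in>carrier G. g"] by simp
qed

end

context weighted_group
begin

lemma finite_E: assumes A: "compatible n A" shows "finite {K. E A H K}"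
proof (cases "basis H")
  case True
  have "{K. E A H K} \<subseteq> (\<lambda>M. img (free_product.move_product G n H [1..<Suc n] (\<lambda>k. free_product.normalise G k (M k))) H) `
      ({1..n} \<rightarrow>\<^sub>E ({0..n} \<rightarrow>\<^sub>E \<Union>(range H)))"
  proof
    fix K assume "K \<in> {K. E A H K}"
    then have K: "E A H K" by simp
    show "K \<in> (\<lambda>M. img (free_product.move_product G n H [1..<Suc n] (\<lambda>k. free_product.normalise G k (M k))) H) `
        ({1..n} \<rightarrow>\<^sub>E ({0..n} \<rightarrow>\<^sub>E \<Union>(range H)))"
      using E_moves[OF A K] by blast
  qed
  moreover have "finite ({1..n} \<rightarrow>\<^sub>E ({0..n} \<rightarrow>\<^sub>E \<Union>(range H)))"
  proof -
    have "\<Union>(range H) \<subseteq> (\<Union>i\<in>{1..n}. H i)" using basisD(1)[OF True] by fastforce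
    then have "finite (\<Union>(range H))" using basis_finite[OF True] finite_subset by (metis finite_UN finite_atLeastAtMost)
    then show ?thesis by (intro finite_PiE finite_atLeastAtMost)
  qed
  ultimately show ?thesis by (meson finite_imageI finite_subset)
next
  case False
  then have "{K. E A H K} = {}" using E_basis by blast
  then show ?thesis by simp
qed

text \<open>Both norms are sums over the factors, of base values and of costs, so a drop is already
  visible in a single component.\<close>

lemma reducible_iff:
  assumes H: "basis H" and B: "compatible n B"
  shows "(\<exists>K. E B H K \<and> nu K < nu H) \<longleftrightarrow> move_costs.carried n H B \<inter> move_costs.reductive n H (cost H) (bse H) \<noteq> {}"
proof -
  interpret mc: move_costs n H "cost H" "bse H" by (rule move_costs_basis[OF H])
  show ?thesis
  proof
    assume "\<exists>K. E B H K \<and> nu K < nu H"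
    then obtain K where K: "E B H K" "nu K < nu H" by blast
    obtain M where M: "\<forall>k\<in>{1..n}. (k, M k) \<in> mc.carried B" "nu K = (\<Sum>k\<in>{1..n}. cost H k (M k))"
      using E_moves[OF B K(1)] by (elim bexE conjE)
    have "\<exists>k\<in>{1..n}. cost H k (M k) < bse H k"
    proof (rule ccontr)
      assume "\<not> ?thesis"
      then have "(\<Sum>k\<in>{1..n}. bse H k) \<le> (\<Sum>k\<in>{1..n}. cost H k (M k))" by (intro sum_mono) (auto simp: not_less)
      then show False using K(2) M(2) nu_sum[OF H] by simp
    qed
    then obtain k where "k \<in> {1..n}" "cost H k (M k) < bse H k" by blast
    then have "(k, M k) \<in> mc.carried B \<inter> mc.reductive" using M(1) by (auto simp: mc.reductive_def mc.carried_def)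
    then show "mc.carried B \<inter> mc.reductive \<noteq> {}" by blast
  next
    assume "mc.carried B \<inter> mc.reductive \<noteq> {}"
    then obtain k m where km: "(k, m) \<in> mc.carried B" "(k, m) \<in> mc.reductive" by auto
    obtain K where K: "E B H K" "nu K + bse H k = nu H + cost H k m" using carried_move[OF H B km(1)] by (elim exE conjE)
    moreover have "cost H k m < bse H k" using km(2) by (simp add: mc.reductive_def)
    ultimately show "\<exists>K. E B H K \<and> nu K < nu H" by (intro exI[of _ K]) simp
  qed
qed

lemma single_move_tree:
  assumes H: "basis H" and km: "(k, m) \<in> move_costs.moves n H"
  shows "compatible n (generated_tree n {(k, m)})" "(k, m) \<in> move_costs.carried n H (generated_tree n {(k, m)})"
proof -
  interpret mc: move_costs n H "cost H" "bse H" by (rule move_costs_basis[OF H])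
  have "k \<noteq> 0" using mc.movesD[OF km] by auto
  then show "compatible n (generated_tree n {(k, m)})"
    by (intro compatible_generated_tree[OF n1]) (auto simp: moves_compatible_def)
  show "(k, m) \<in> mc.carried (generated_tree n {(k, m)})"
    using km generated_tree_constant[of k m "{(k, m)}" n] by (simp add: mc.carried_def)
qed

section \<open>Neutral moves and plateaus of the norm\<close>

definition zero_tree :: "(nat => nat set set) => (nat => 'a set) => nat => nat set set" where
  "zero_tree A H = generated_tree n {(x, m) \<in> move_costs.carried n H A. cost H x m = bse H x}"

text \<open>The tree \<open>B\<close> may reach the basis of a neutral move through another system
  of moves. The syllable counts agree, however, so by \<open>turn_count_partition\<close> the
  neutral move is constant wherever the other one is. Conversely, in the absence of carried
  reductive moves, each component of a norm-preserving change must be neutral.\<close>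

lemma zero_tree:
  assumes H: "basis H" and A: "compatible n A" and min: "\<forall>K. E A H K --> nu H \<le> nu K"
  shows "compatible n (zero_tree A H)"
    "compatible n B ==> (\<forall>K. E A H K \<and> nu K = nu H --> E B H K) \<longleftrightarrow> tree_le (zero_tree A H) B"
proof -
  interpret H: free_product G n H by (rule basis_fp[OF H])
  interpret mc: move_costs n H "cost H" "bse H" by (rule move_costs_basis[OF H])
  define Z where "Z = {(x, m) \<in> mc.carried A. cost H x m = bse H x}"
  have Zc: "Z \<subseteq> mc.carried A" by (auto simp: Z_def)
  have nored: "mc.carried A \<inter> mc.reductive = {}" using reducible_iff[OF H A] min by (metis not_le)
  show zc: "compatible n (zero_tree A H)" unfolding zero_tree_def Z_def[symmetric]
  proof (rule compatible_generated_tree[OF n1])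
    show "moves_compatible n u v" if "u \<in> Z" "v \<in> Z" for u v using mc.carried_compatible[OF A] that Zc by blast
    show "(0, m) \<notin> Z" for m using Zc by (auto simp: mc.carried_def mc.moves_def)
  qed
  show "(\<forall>K. E A H K \<and> nu K = nu H --> E B H K) \<longleftrightarrow> tree_le (zero_tree A H) B" if B: "compatible n B"
  proof
    assume all: "\<forall>K. E A H K \<and> nu K = nu H --> E B H K"
    show "tree_le (zero_tree A H) B" unfolding zero_tree_def Z_def[symmetric]
    proof (rule generated_tree_le[OF B zc[unfolded zero_tree_def, folded Z_def]])
      fix k m assume km: "(k, m) \<in> Z"
      then have kc: "(k, m) \<in> mc.carried A" "cost H k m = bse H k" by (auto simp: Z_def)
      have k: "k \<in> {1..n}" using kc(1) by (auto simp: mc.carried_def mc.moves_def)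
      obtain K where K: "E A H K" "nu K + bse H k = nu H + cost H k m"
        "\<forall>g\<in>carrier G. syllables G n K k g = turn_count G k m (m 0) (nform G n H g)"
        using carried_move[OF H A kc(1)] by (elim exE conjE)
      then have EB: "E B H K" using all kc(2) by simp
      obtain M where M: "\<forall>k\<in>{1..n}. (k, M k) \<in> mc.carried B"
        "\<forall>k\<in>{1..n}. \<forall>g\<in>carrier G. syllables G n K k g = turn_count G k (M k) (M k 0) (nform G n H g)"
        using E_moves[OF B EB] by (elim bexE conjE)
      show "constant_on_petals B k m" unfolding constant_on_petals_def
      proof (intro allI impI)
        fix s t assume st: "same_petal B k s t"
        have "constant_on_petals B k (M k)" using M(1) k by (simp add: mc.carried_def)
        then have Mst: "M k s = M k t" using st unfolding constant_on_petals_def by blast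
        have r: "s \<le> n" "t \<le> n" "s \<noteq> k" "t \<noteq> k" using same_petal_range[OF B st] by auto
        show "m s = m t"
          by (rule H.turn_count_partition[where m = "M k", OF _ k basis_nontrivial[OF H] r Mst]) (use K(3) M(2) k in simp)
      qed
    qed
  next
    assume le: "tree_le (zero_tree A H) B"
    show "\<forall>K. E A H K \<and> nu K = nu H --> E B H K"
    proof (intro allI impI, elim conjE)
      fix K assume K: "E A H K" "nu K = nu H"
      obtain M where M0: "\<forall>k\<in>{1..n}. (k, M k) \<in> mc.carried A" "nu K = (\<Sum>k\<in>{1..n}. cost H k (M k))"
        "\<forall>B. compatible n B --> (\<forall>k\<in>{1..n}. constant_on_petals B k (M k)) --> E B H K"
        using E_moves[OF A K(1)] by (elim bexE conjE)
      have M: "(k, M k) \<in> mc.carried A" if "k \<in> {1..n}" for k using M0(1) that by blast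
      have ge: "bse H k \<le> cost H k (M k)" if "k \<in> {1..n}" for k
      proof (rule ccontr)
        assume "\<not> ?thesis"
        then have "(k, M k) \<in> mc.reductive" using M[OF that] by (simp add: mc.reductive_def mc.carried_def)
        then show False using nored M[OF that] by blast
      qed
      have eq: "bse H k = cost H k (M k)" if k: "k \<in> {1..n}" for k
      proof (rule ccontr)
        assume "bse H k \<noteq> cost H k (M k)"
        then have "bse H k < cost H k (M k)" using ge[OF k] by simp
        then have "(\<Sum>k\<in>{1..n}. bse H k) < (\<Sum>k\<in>{1..n}. cost H k (M k))"
          using ge k by (intro sum_strict_mono_ex1) blast+
        then show False using K(2) M0(2) nu_sum[OF H] by simp
      qed
      show "E B H K"
      proof (rule M0(3)[rule_format, OF B])
        fix k assume k: "k \<in> {1..n}"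
        have "(k, M k) \<in> Z" using M[OF k] eq[OF k] by (simp add: Z_def)
        then have "constant_on_petals (zero_tree A H) k (M k)" unfolding zero_tree_def Z_def[symmetric] by (rule generated_tree_constant)
        then show "constant_on_petals B k (M k)" by (rule constant_on_petals_mono[OF zc B le])
      qed
    qed
  qed
qed

lemma descending_trees_contractible:
  assumes H: "basis H" and A: "compatible n A"
    and ne: "{B. compatible n B \<and> tree_le A B \<and> (\<exists>K. E B H K \<and> nu K < nu H)} \<noteq> {}"
  shows "order_contractible tree_le {B. compatible n B \<and> tree_le A B \<and> (\<exists>K. E B H K \<and> nu K < nu H)}"
proof -
  interpret mc: move_costs n H "cost H" "bse H" by (rule move_costs_basis[OF H])
  have "{B. compatible n B \<and> tree_le A B \<and> (\<exists>K. E B H K \<and> nu K < nu H)} = mc.reductive_trees A"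
    unfolding mc.reductive_trees_def using reducible_iff[OF H] by (intro Collect_cong) metis
  then show ?thesis using mc.reductive_trees_contractible[OF A] ne by simp
qed

text \<open>The condition on \<open>A\<close> forces it to be its own zero tree, hence generated by
  neutral moves, as \<open>reductive_trees_nonempty\<close> demands.\<close>

lemma descent_exists:
  assumes H: "basis H" and A: "compatible n A" and min: "\<forall>K. E A H K --> nu H \<le> nu K"
    and core: "\<And>B. compatible n B ==> \<forall>K. E A H K \<and> nu K = nu H --> E B H K ==> tree_le A B"
    and red: "compatible n B'" "E B' H K'" "nu K' < nu H"
  shows "\<exists>B. compatible n B \<and> tree_le A B \<and> (\<exists>K. E B H K \<and> nu K < nu H)"
proof -
  interpret mc: move_costs n H "cost H" "bse H" by (rule move_costs_basis[OF H])
  note z = zero_tree[OF H A min]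
  have refl: "tree_le (zero_tree A H) (zero_tree A H)" using porder_tree_le[of "{zero_tree A H}" n] z(1) by (simp add: porder_def)
  have "tree_le A (zero_tree A H)" using core[OF z(1)] z(2)[OF z(1)] refl by blast
  moreover have "tree_le (zero_tree A H) A" using z(2)[OF A] by blast
  ultimately have "A = zero_tree A H" using tree_le_antisym[OF A z(1)] by blast
  then have gen: "A = generated_tree n {(x, m) \<in> mc.carried A. cost H x m = bse H x}" by (simp add: zero_tree_def)
  have "mc.carried B' \<inter> mc.reductive \<noteq> {}" using reducible_iff[OF H red(1)] red(2,3) by blast
  then have "mc.reductive \<noteq> {}" by blast
  from mc.reductive_trees_nonempty[OF A gen this] obtain B where
    "compatible n B" "tree_le A B" "mc.carried B \<inter> mc.reductive \<noteq> {}" by (auto simp: mc.reductive_trees_def)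
  then show ?thesis using reducible_iff[OF H] by blast
qed

text \<open>At a global minimiser no move is reductive, so the uncrossed versions of two neutral
  moves still cost at least the base values. If the moves crossed, a test word of positive weight
  would make the total strictly smaller. Hence all neutral moves are compatible, and together they
  generate \<open>A0\<close>.\<close>

lemma plateau_tree:
  assumes H: "basis H" and min: "\<And>K. basis K ==> nu H \<le> nu K"
    and test: "\<And>w. red_word G n H w ==> length w \<le> 3 ==> word_prod G w \<in> Q \<and> 0 < wt (word_prod G w)"
  shows "\<exists>A0. compatible n A0 \<and> (\<forall>A K. compatible n A --> E A H K \<and> nu K = nu H --> E A0 H K)"
proof -
  interpret H: free_product G n H by (rule basis_fp[OF H])
  interpret mc: move_costs n H "cost H" "bse H" by (rule move_costs_basis[OF H])
  have nored: "bse H k \<le> cost H k m" if km: "(k, m) \<in> mc.moves" for k m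
  proof (rule ccontr)
    assume "\<not> ?thesis"
    then have "(k, m) \<in> mc.carried (generated_tree n {(k, m)}) \<inter> mc.reductive"
      using single_move_tree(2)[OF H km] km by (simp add: mc.reductive_def)
    then obtain K where "E (generated_tree n {(k, m)}) H K" "nu K < nu H"
      using reducible_iff[OF H single_move_tree(1)[OF H km]] by blast
    then show False using min E_basis by (metis not_le)
  qed
  define Z where "Z = {(x, m) \<in> mc.moves. cost H x m = bse H x}"
  have comp: "moves_compatible n u v" if u: "u \<in> Z" and v: "v \<in> Z" for u v
  proof (rule ccontr)
    assume nc: "\<not> moves_compatible n u v"
    obtain x m where um: "u = (x, m)" by (cases u)
    obtain y l where vl: "v = (y, l)" by (cases v)
    have xy: "x \<noteq> y" and cr: "crossing n x m y l \<noteq> {}" using nc um vl by (auto simp: moves_compatible_def)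
    have mm: "(x, m) \<in> mc.moves" "(y, l) \<in> mc.moves" "cost H x m = bse H x" "cost H y l = bse H y" using u v um vl by (auto simp: Z_def)
    have d: "x \<in> {1..n}" "y \<in> {1..n}" "x \<noteq> 0" "y \<noteq> 0" "x \<le> n" "y \<le> n" using mc.movesD[OF mm(1)] mc.movesD[OF mm(2)] by auto
    have lH: "l j \<in> H y" if "j \<le> n" for j using mc.movesD[OF mm(2)] that by (auto simp: PiE_iff)
    let ?m = "uncross m (crossing n x m y l) y" and ?l = "uncross l (crossing n x m y l) x"
    have "(x, ?m) \<in> mc.moves" "(y, ?l) \<in> mc.moves"
      by (rule mc.uncross_moves[OF mm(1) d(6)], rule mc.uncross_moves'[OF mm(2) d(5)])
    then have ge: "bse H x \<le> cost H x ?m" "bse H y \<le> cost H y ?l" using nored by blast+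
    let ?L = "\<lambda>g. turn_count G x ?m (?m 0) (H.nf g) + turn_count G y ?l (?l 0) (H.nf g)"
    let ?R = "\<lambda>g. turn_count G x m (m 0) (H.nf g) + turn_count G y l (l 0) (H.nf g)"
    have le: "?L g \<le> ?R g" if "g \<in> Q" for g
    proof (rule turn_count_uncross[OF xy d(3,4)])
      show "\<forall>p\<in>set (H.nf g). fst p \<le> n" using H.nf(1)[of g] that Q_carrier by (auto simp: red_word_def)
    qed
    obtain s where s: "s \<in> crossing n x m y l" using cr by blast
    then have sn: "s \<le> n" "s \<noteq> x" "s \<noteq> y" by (auto simp: crossing_def)
    obtain h where h: "h \<in> H y" "h \<noteq> \<one>" using basis_nontrivial[OF H d(2)] by blast
    have hne: "l j \<otimes> h \<noteq> l j" if "j \<le> n" for j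
      using lH[OF that] h H.factor_carrier[OF d(2)] by simp
    \<comment> \<open>For \<open>s = 0\<close> there is no factor to choose from and the value does
      not occur in the word.\<close>
    define a where "a = (SOME a. a \<in> H s \<and> a \<noteq> \<one>)"
    define w where "w = (if s = 0 then [(y, h)] else [(s, a), (y, h), (s, a)])"
    have rw: "H.red w" "length w \<le> 3"
    proof -
      have "a \<in> H s \<and> a \<noteq> \<one>" if "s \<noteq> 0"
      proof -
        have "s \<in> {1..n}" using that sn by simp
        then have "\<exists>a. a \<in> H s \<and> a \<noteq> \<one>" using basis_nontrivial[OF H] by blast
        then show ?thesis unfolding a_def by (rule someI_ex)
      qed
      then show "H.red w" using h d sn by (cases "s = 0") (auto simp: w_def red_word_Cons)
      show "length w \<le> 3" by (simp add: w_def)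
    qed
    let ?g = "word_prod G w"
    have gQ: "?g \<in> Q" "0 < wt ?g" using test[OF rw] by auto
    have strict: "?L ?g < ?R ?g"
      using turn_count_uncross_strict[where G = G, OF xy d(3,4) s hne[OF sn(1)] hne[OF d(5)] w_def] H.nf_wp[OF rw(1)] by simp
    have "(\<Sum>g\<in>Q. wt g * ?L g) < (\<Sum>g\<in>Q. wt g * ?R g)"
    proof (rule sum_strict_mono_ex1[OF finite_Q])
      show "\<forall>g\<in>Q. wt g * ?L g \<le> wt g * ?R g" using le by (intro ballI mult_le_mono2)
      show "\<exists>g\<in>Q. wt g * ?L g < wt g * ?R g" by (rule bexI[OF _ gQ(1)]) (use strict gQ(2) in simp)
    qed
    then have "cost H x ?m + cost H y ?l < cost H x m + cost H y l"
      unfolding cost_def by (simp add: sum.distrib distrib_left)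
    then show False using ge mm(3,4) by simp
  qed
  define A0 where "A0 = generated_tree n Z"
  have A0: "compatible n A0" unfolding A0_def
    by (rule compatible_generated_tree[OF n1 comp]) (auto simp: Z_def mc.moves_def)
  have "E A0 H K" if A: "compatible n A" and K: "E A H K" "nu K = nu H" for A K
  proof -
    have mA: "\<forall>K. E A H K --> nu H \<le> nu K" using min E_basis by blast
    have "tree_le (zero_tree A H) A0"
      unfolding zero_tree_def
    proof (rule generated_tree_le[OF A0 zero_tree(1)[OF H A mA, unfolded zero_tree_def]])
      fix k m assume "(k, m) \<in> {(x, m) \<in> mc.carried A. cost H x m = bse H x}"
      then have "(k, m) \<in> Z" by (auto simp: Z_def mc.carried_def)
      then show "constant_on_petals A0 k m" unfolding A0_def by (rule generated_tree_constant)
    qed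
    then show ?thesis using zero_tree(2)[OF H A mA A0] K by blast
  qed
  then show ?thesis using A0 by blast
qed

end

section \<open>Nielsen reduction\<close>

context free_product
begin

definition factor_word :: "(nat \<times> 'a) list => bool" where
  "factor_word w \<longleftrightarrow> (\<forall>p\<in>set w. fst p \<in> {1..n} \<and> snd p \<in> H (fst p))"

lemma factor_word_carrier: "factor_word w ==> \<forall>p\<in>set w. snd p \<in> carrier G"
  unfolding factor_word_def using factor_carrier by blast

lemma red_factor_word: "red w ==> factor_word w"
  by (simp add: red_word_def factor_word_def)

lemma length_lmul: "length (lmul i h w) \<le> Suc (length w)"
  by (cases w) (auto simp: lmul_def)

lemma length_nf_le: "factor_word w ==> length (nf (wp w)) \<le> length w"
proof (induction w)
  case (Cons p w)
  have p: "fst p \<in> {1..n}" "snd p \<in> H (fst p)" and w: "factor_word w" using Cons.prems by (auto simp: factor_word_def)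
  have "nf (wp (p # w)) = lmul (fst p) (snd p) (nf (wp w))"
    using nf_lmul[OF p wp_closed[OF factor_word_carrier[OF w]]] by simp
  then show ?case using length_lmul[of "fst p" "snd p" "nf (wp w)"] Cons.IH[OF w] by simp
qed simp

lemma finite_ball:
  assumes "\<And>i. i \<in> {1..n} ==> finite (H i)" shows "finite {g \<in> carrier G. length (nf g) \<le> N}"
proof (rule finite_subset)
  let ?S = "{1..n} \<times> (\<Union>i\<in>{1..n}. H i)"
  show "{g \<in> carrier G. length (nf g) \<le> N} \<subseteq> wp ` {w. set w \<subseteq> ?S \<and> length w \<le> N}"
  proof
    fix g assume g: "g \<in> {g \<in> carrier G. length (nf g) \<le> N}"
    have "p \<in> ?S" if p: "p \<in> set (nf g)" for p
    proof -
      have "fst p \<in> {1..n}" "snd p \<in> H (fst p)" using nf(1)[of g] g p by (auto simp: red_word_def)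
      then show ?thesis unfolding mem_Times_iff by blast
    qed
    then have "set (nf g) \<subseteq> ?S" by blast
    then show "g \<in> wp ` {w. set w \<subseteq> ?S \<and> length w \<le> N}" using g nf(2)[of g] by (intro image_eqI[of _ _ "nf g"]) auto
  qed
  show "finite (wp ` {w. set w \<subseteq> ?S \<and> length w \<le> N})" using assms by (intro finite_imageI finite_lists_length_le) auto
qed

end

context factored_group
begin

text \<open>The family \<open>Gi\<close> is arbitrary outside \<open>{1..n}\<close>, whereas bases
  are empty there.\<close>

definition Gb :: "nat => 'a set" where
  "Gb = (\<lambda>i. if i \<in> {1..n} then Gi i else {})"

lemma basis_Gb: "basis Gb"
proof -
  have "red_word G n Gb w \<longleftrightarrow> red_word G n Gi w" for w
    unfolding red_word_def by (auto simp: Gb_def)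
  then have rw: "reduced_word G n Gb w \<longleftrightarrow> reduced_word G n Gi w" for w by (simp add: reduced_word_iff)
  have U: "(\<Union>i\<in>{1..n}. Gb i) = (\<Union>i\<in>{1..n}. Gi i)" by (simp add: Gb_def)
  have "internal_free_product G n Gb" using ifp_Gi unfolding internal_free_product_def rw U by (simp add: Gb_def)
  moreover have "\<exists>g\<in>carrier G. Gb i = conj_set G g (Gi i)" if "i \<in> {1..n}" for i
    using conjugate_refl[OF Gi_carrier[OF that]] that by (simp add: conjugate_def Gb_def)
  ultimately show ?thesis by (simp add: is_basis_def Gb_def)
qed

sublocale Gb: free_product G n Gb
  by (rule basis_fp[OF basis_Gb])

definition nbr_bases :: "(nat => 'a set) => (nat => 'a set) => bool" where
  "nbr_bases H K \<longleftrightarrow> (\<exists>A. compatible n A \<and> E A H K)"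

lemma Gb_carrier: "Gb i \<subseteq> carrier G"
  by (rule basisD(3)[OF basis_Gb])

lemma exists_conjugator: assumes H: "basis H" and i: "i \<in> {1..n}" shows "\<exists>w\<in>carrier G. H i = conj_set G w (Gb i)"
  using basisD(2)[OF H i] i by (simp add: conjugate_def Gb_def)

text \<open>The conjugator is not unique, since it may be multiplied on the right by elements of
  \<open>Gb i\<close>; the shortest one gives the complexity that Nielsen reduction lowers.\<close>

definition conj_length :: "(nat => 'a set) => nat => nat" where
  "conj_length H i = (LEAST l. \<exists>w\<in>carrier G. H i = conj_set G w (Gb i) \<and> length (Gb.nf w) = l)"

lemma conj_length_le: "w \<in> carrier G ==> H i = conj_set G w (Gb i) ==> conj_length H i \<le> length (Gb.nf w)"
  unfolding conj_length_def by (rule Least_le) blast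

lemma conj_length_attained:
  assumes "basis H" "i \<in> {1..n}" shows "\<exists>w\<in>carrier G. H i = conj_set G w (Gb i) \<and> length (Gb.nf w) = conj_length H i"
proof -
  have "\<exists>l. \<exists>w\<in>carrier G. H i = conj_set G w (Gb i) \<and> length (Gb.nf w) = l" using exists_conjugator[OF assms] by blast
  then show ?thesis unfolding conj_length_def by (rule LeastI_ex)
qed

lemma conj_set_factor: assumes "i \<in> {1..n}" "g \<in> Gb i" shows "conj_set G g (Gb i) = Gb i"
proof -
  have gc: "g \<in> carrier G" using assms Gb_carrier by blast
  have sub: "conj_set G g (Gb i) \<subseteq> Gb i" if g: "g \<in> Gb i" for g
    unfolding conj_set_def using Gb.factor_closed[OF assms(1)] Gb.factor_inv[OF assms(1)] g by blast
  have "Gb i = conj_set G g (conj_set G (inv g) (Gb i))" using gc Gb_carrier by (simp add: conj_set_comp conj_set_one)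
  also have "\<dots> \<subseteq> conj_set G g (Gb i)" using sub[OF Gb.factor_inv[OF assms]] by (auto simp: conj_set_def)
  finally show ?thesis using sub[OF assms(2)] by blast
qed

text \<open>If no \<open>W i @ [(i, g)]\<close> is a prefix of \<open>W j\<close>, nothing cancels beyond the first syllable of a product of
  elements of the factors \<open>w\<^sub>i G\<^sub>i w\<^sub>i\<inverse>\<close>.\<close>

lemma nielsen_prefix:
  assumes H: "basis H" and W: "\<And>i. i \<in> {1..n} ==> Gb.red (W i)" "\<And>i. i \<in> {1..n} ==> W i = [] \<or> fst (last (W i)) \<noteq> i"
    and HW: "\<And>i. i \<in> {1..n} ==> H i = conj_set G (word_prod G (W i)) (Gb i)"
    and no: "\<And>i j g r. i \<in> {1..n} ==> j \<in> {1..n} ==> i \<noteq> j ==> W j \<noteq> W i @ (i, g) # r"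
  shows "red_word G n H (p # v) ==> \<exists>g r. Gb.nf (word_prod G (p # v)) = W (fst p) @ (fst p, g) # r"
proof (induction v arbitrary: p)
  have main: "\<exists>g r. Gb.nf (h \<otimes> x) = W i @ (i, g) # r"
    if i: "i \<in> {1..n}" and h: "h \<in> H i" "h \<noteq> \<one>" and x: "x \<in> carrier G"
      and sx: "x = \<one> \<or> (\<exists>j g r. j \<in> {1..n} \<and> j \<noteq> i \<and> Gb.nf x = W j @ (j, g) # r)" for i h x
  proof -
    let ?w = "word_prod G (W i)"
    have wc: "?w \<in> carrier G" by (rule Gb.red_wp_closed[OF W(1)[OF i]])
    obtain c where c: "c \<in> Gb i" "h = ?w \<otimes> c \<otimes> inv ?w" using h(1) HW[OF i] by (auto simp: conj_set_def)
    have cc: "c \<in> carrier G" using c(1) Gb_carrier by blast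
    have c1: "c \<noteq> \<one>" using c(2) h(2) wc by auto
    define y where "y = inv ?w \<otimes> x"
    have yc: "y \<in> carrier G" using wc x by (simp add: y_def)
    have xy: "x = ?w \<otimes> y" using wc x by (simp add: y_def m_assoc[symmetric])
    \<comment> \<open>Otherwise the normal form of \<open>x\<close> begins with \<open>W i\<close>
      and an \<open>i\<close>-syllable, and also with \<open>W j\<close> and a
      \<open>j\<close>-syllable. Of two prefixes of one word one extends the other, which is the
      excluded relation between \<open>W i\<close> and \<open>W j\<close>.\<close>
    have start: "Gb.nf y = [] \<or> fst (hd (Gb.nf y)) \<noteq> i"
    proof (rule ccontr)
      assume a: "\<not> ?thesis"
      then obtain d r where dr: "Gb.nf y = (i, d) # r" by (cases "Gb.nf y") (auto simp: prod_eq_iff)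
      have rr: "Gb.red (W i @ (i, d) # r)"
        using W[OF i] Gb.nf(1)[OF yc] dr by (auto simp: red_word_append)
      have "word_prod G (W i @ (i, d) # r) = ?w \<otimes> y"
        using Gb.wp_append[of "W i" "(i, d) # r"] Gb.red_carrier[OF W(1)[OF i]] Gb.red_carrier[OF Gb.nf(1)[OF yc]] Gb.nf(2)[OF yc]
        unfolding dr by metis
      then have nfx: "Gb.nf x = W i @ (i, d) # r" using Gb.nf_wp[OF rr] xy by simp
      show False using sx
      proof
        assume "x = \<one>"
        then show False using nfx by simp
      next
        assume "\<exists>j g r. j \<in> {1..n} \<and> j \<noteq> i \<and> Gb.nf x = W j @ (j, g) # r"
        then obtain j g r' where j: "j \<in> {1..n}" "j \<noteq> i" "W i @ (i, d) # r = W j @ (j, g) # r'" using nfx by auto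
        from j(3) obtain us where "W i = W j @ us \<and> us @ (i, d) # r = (j, g) # r' \<or> W i @ us = W j \<and> (i, d) # r = us @ (j, g) # r'"
          by (auto simp: append_eq_append_conv2)
        then show False
        proof
          assume u: "W i = W j @ us \<and> us @ (i, d) # r = (j, g) # r'"
          show False
          proof (cases us)
            case Nil
            then show False using u j(2) by simp
          next
            case (Cons p us')
            then have "W i = W j @ (j, g) # us'" using u by simp
            then show False using no[OF j(1) i j(2)] by blast
          qed
        next
          assume u: "W i @ us = W j \<and> (i, d) # r = us @ (j, g) # r'"
          show False
          proof (cases us)
            case Nil
            then show False using u j(2) by simp
          next
            case (Cons p us')
            then have "W j = W i @ (i, d) # us'" using u by auto
            then show False using no[OF i j(1)] j(2) by blast
          qed
        qed
      qed
    qed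
    have rc: "Gb.red ((i, c) # Gb.nf y)" using i c(1) c1 Gb.nf(1)[OF yc] start by (auto simp: red_word_Cons)
    have rr: "Gb.red (W i @ (i, c) # Gb.nf y)" using W[OF i] rc by (auto simp: red_word_append)
    have "word_prod G (W i @ (i, c) # Gb.nf y) = ?w \<otimes> word_prod G ((i, c) # Gb.nf y)"
      using Gb.red_carrier[OF W(1)[OF i]] Gb.red_carrier[OF rc] by (intro Gb.wp_append) blast+
    also have "\<dots> = ?w \<otimes> (c \<otimes> y)" using Gb.nf(2)[OF yc] by simp
    also have "\<dots> = h \<otimes> x" using c(2) wc cc x by (simp add: y_def m_assoc)
    finally have "word_prod G (W i @ (i, c) # Gb.nf y) = h \<otimes> x" .
    then have "Gb.nf (h \<otimes> x) = W i @ (i, c) # Gb.nf y" using Gb.nf_wp[OF rr] by metis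
    then show ?thesis by blast
  qed
  interpret H: free_product G n H by (rule basis_fp[OF H])
  {
    case Nil
    then show ?case using main[of "fst p" "snd p" \<one>] by (auto simp: red_word_Cons)
  next
    case (Cons q v)
    have p: "fst p \<in> {1..n}" "snd p \<in> H (fst p)" "snd p \<noteq> \<one>" "fst p \<noteq> fst q" and qv: "H.red (q # v)"
      using Cons.prems by (auto simp: red_word_Cons)
    have q: "fst q \<in> {1..n}" using qv by (simp add: red_word_Cons)
    obtain g r where gr: "Gb.nf (word_prod G (q # v)) = W (fst q) @ (fst q, g) # r" using Cons.IH[OF qv] by blast
    have "word_prod G (p # q # v) = snd p \<otimes> word_prod G (q # v)" by simp
    then show ?case using main[OF p(1-3) H.red_wp_closed[OF qv]] gr q p(4) by metis
  }
qed

text \<open>The inverse of \<open>g\<close>, conjugated by the product of \<open>W i\<close>, is an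
  element of \<open>H i\<close>. Conjugating \<open>H j\<close> by it deletes the syllable
  \<open>(i, g)\<close> from the conjugator of \<open>H j\<close> and leaves all other factors in
  place.\<close>

lemma nielsen_step:
  assumes H: "basis H" and W: "\<And>i. i \<in> {1..n} ==> Gb.red (W i)"
    and HW: "\<And>i. i \<in> {1..n} ==> H i = conj_set G (word_prod G (W i)) (Gb i)" "\<And>i. i \<in> {1..n} ==> length (W i) = conj_length H i"
    and ij: "i \<in> {1..n}" "j \<in> {1..n}" "i \<noteq> j" "W j = W i @ (i, g) # r"
  shows "\<exists>K. nbr_bases H K \<and> (\<Sum>i\<in>{1..n}. conj_length K i) < (\<Sum>i\<in>{1..n}. conj_length H i)"
proof -
  interpret H: free_product G n H by (rule basis_fp[OF H])
  let ?w = "word_prod G (W i)"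
  have wc: "?w \<in> carrier G" by (rule Gb.red_wp_closed[OF W[OF ij(1)]])
  have gG: "g \<in> Gb i" and gr: "Gb.red ((i, g) # r)" using W[OF ij(2)] ij(4) by (auto simp: red_word_append red_word_Cons)
  have gc: "g \<in> carrier G" using gG Gb_carrier by blast
  have rr: "Gb.red r" using gr by (simp add: red_word_Cons)
  have rc: "word_prod G r \<in> carrier G" by (rule Gb.red_wp_closed[OF rr])
  define x where "x = ?w \<otimes> inv g \<otimes> inv ?w"
  have xH: "x \<in> H i" unfolding HW(1)[OF ij(1)] x_def conj_set_def using Gb.factor_inv[OF ij(1) gG] by blast
  have xc: "x \<in> carrier G" using xH H.factor_carrier ij(1) by blast
  define m where "m = (\<lambda>s. if s = j then x else \<one>)"
  have nm: "H.nmove i m" unfolding H.nmove_def m_def using ij xH H.factor_one[OF ij(1)] by auto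
  define A where "A = generated_tree n {(i, m)}"
  have A: "compatible n A" unfolding A_def using ij(1)
    by (intro compatible_generated_tree[OF n1]) (auto simp: moves_compatible_def)
  have cst: "constant_on_petals A i m" unfolding A_def by (rule generated_tree_constant) simp
  have cb: "carried_by G n H A (H.whitehead m)" unfolding H.carried_by_iff[OF A] using nm cst by blast
  define K where "K = img (H.whitehead m) H"
  have "compose (carrier G) (H.whitehead m) (\<lambda>x\<in>carrier G. x) \<in> carried_products G n H A"
    by (rule carried_products.cp_step[OF cb carried_products.cp_id])
  moreover have "img (compose (carrier G) (H.whitehead m) (\<lambda>x\<in>carrier G. x)) H = K"
    unfolding K_def by (rule img_cong[OF H]) (simp add: compose_def)
  ultimately have EK: "E A H K" unfolding E_def using H by blast
  have Ks: "K s = conj_set G (m s) (H s)" if "s \<in> {1..n}" for s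
    unfolding K_def img_def conj_set_def by (rule image_cong[OF refl H.whitehead(2)[OF nm that]])
  have other: "conj_length K s = conj_length H s" if "s \<in> {1..n}" "s \<noteq> j" for s
  proof -
    have "K s = H s" using Ks[OF that(1)] conj_set_one[OF basisD(3)[OF H]] that(2) by (simp add: m_def)
    then show ?thesis by (simp add: conj_length_def)
  qed
  have wj: "word_prod G (W j) = ?w \<otimes> (g \<otimes> word_prod G r)"
    unfolding ij(4) using Gb.wp_append[of "W i" "(i, g) # r"] Gb.red_carrier[OF W[OF ij(1)]] Gb.red_carrier[OF gr] by auto
  have fw: "Gb.factor_word (W i @ r)" using Gb.red_factor_word[OF W[OF ij(1)]] Gb.red_factor_word[OF rr] by (auto simp: Gb.factor_word_def)
  have wr: "word_prod G (W i @ r) = ?w \<otimes> word_prod G r"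
    using Gb.red_carrier[OF W[OF ij(1)]] Gb.red_carrier[OF rr] by (intro Gb.wp_append) blast+
  have "x \<otimes> word_prod G (W j) = ?w \<otimes> (inv g \<otimes> (g \<otimes> word_prod G r))"
    unfolding wj x_def using wc gc rc by (simp add: m_assoc inv_solve_left')
  also have "\<dots> = word_prod G (W i @ r)" unfolding wr using wc gc rc by (simp add: m_assoc[symmetric])
  finally have xw: "x \<otimes> word_prod G (W j) = word_prod G (W i @ r)" .
  have "K j = conj_set G (x \<otimes> word_prod G (W j)) (Gb j)"
    using Ks[OF ij(2)] HW(1)[OF ij(2)] conj_set_comp[OF xc Gb.red_wp_closed[OF W[OF ij(2)]] Gb_carrier] by (simp add: m_def)
  then have "conj_length K j \<le> length (Gb.nf (word_prod G (W i @ r)))"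
    unfolding xw by (intro conj_length_le) (use Gb.wp_closed[OF Gb.factor_word_carrier[OF fw]] in simp_all)
  also have "\<dots> \<le> length (W i @ r)" by (rule Gb.length_nf_le[OF fw])
  also have "\<dots> < conj_length H j" using HW(2)[OF ij(2)] ij(4) by simp
  finally have less: "conj_length K j < conj_length H j" .
  have "(\<Sum>i\<in>{1..n}. conj_length K i) < (\<Sum>i\<in>{1..n}. conj_length H i)"
  proof (rule sum_strict_mono_ex1)
    show "\<forall>s\<in>{1..n}. conj_length K s \<le> conj_length H s"
    proof
      fix s assume "s \<in> {1..n}"
      then show "conj_length K s \<le> conj_length H s" using other[of s] less by (cases "s = j") simp_all
    qed
  qed (use less ij(2) in blast)+
  then show ?thesis unfolding nbr_bases_def using A EK by blast
qed

text \<open>Induction on the total length of the shortest conjugators. When no Nielsen step applies,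
  the one-syllable normal form of an element of \<open>Gb k\<close> must begin with the conjugator
  \<open>W\<close> of its first \<open>H\<close>-syllable followed by a further syllable; so this
  syllable has label \<open>k\<close> and \<open>W k\<close> is empty.\<close>

lemma connected_to_Gb: "basis H ==> nbr_bases\<^sup>*\<^sup>* H Gb"
proof (induction "\<Sum>i\<in>{1..n}. conj_length H i" arbitrary: H rule: less_induct)
  case less
  note H = less.prems
  interpret H: free_product G n H by (rule basis_fp[OF H])
  have "\<forall>i\<in>{1..n}. \<exists>w. w \<in> carrier G \<and> H i = conj_set G w (Gb i) \<and> length (Gb.nf w) = conj_length H i"
    using conj_length_attained[OF H] by blast
  then obtain u where u: "\<forall>i\<in>{1..n}. u i \<in> carrier G \<and> H i = conj_set G (u i) (Gb i) \<and> length (Gb.nf (u i)) = conj_length H i"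
    by (rule bchoice[THEN exE])
  define W where "W = (\<lambda>i. Gb.nf (u i))"
  have uc: "u i \<in> carrier G" if "i \<in> {1..n}" for i using u that by blast
  have W: "Gb.red (W i)" "word_prod G (W i) = u i" if "i \<in> {1..n}" for i
    unfolding W_def using Gb.nf[OF uc[OF that]] by auto
  have HW: "H i = conj_set G (word_prod G (W i)) (Gb i)" "length (W i) = conj_length H i" if "i \<in> {1..n}" for i
    using u that W(2)[OF that] by (auto simp: W_def)
  \<comment> \<open>A last syllable in the factor \<open>Gb i\<close> itself leaves
    \<open>Gb i\<close> invariant under conjugation and could be dropped from a shortest
    conjugator.\<close>
  have Wl: "W i = [] \<or> fst (last (W i)) \<noteq> i" if i: "i \<in> {1..n}" for i
  proof (rule ccontr)
    assume a: "\<not> ?thesis"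
    then have ne: "W i \<noteq> []" and l: "fst (last (W i)) = i" by auto
    have Wi: "W i = butlast (W i) @ [last (W i)]" using ne by simp
    have rb: "Gb.red (butlast (W i))" "Gb.red [last (W i)]" using W(1)[OF i] by (subst (asm) Wi, simp add: red_word_append)+
    have g: "snd (last (W i)) \<in> Gb i" using rb(2) l by (simp add: red_word_Cons)
    have bc: "word_prod G (butlast (W i)) \<in> carrier G" by (rule Gb.red_wp_closed[OF rb(1)])
    have gc: "snd (last (W i)) \<in> carrier G" using g Gb_carrier by blast
    have "word_prod G (W i) = word_prod G (butlast (W i)) \<otimes> snd (last (W i))"
      using Gb.wp_append[of "butlast (W i)" "[last (W i)]"] Gb.red_carrier[OF rb(1)] gc Wi by auto
    then have "H i = conj_set G (word_prod G (butlast (W i))) (conj_set G (snd (last (W i))) (Gb i))"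
      using HW(1)[OF i] conj_set_comp[OF bc gc Gb_carrier] by simp
    then have "H i = conj_set G (word_prod G (butlast (W i))) (Gb i)" using conj_set_factor[OF i g] by simp
    from conj_length_le[of _ H, OF bc this] have "conj_length H i \<le> length (butlast (W i))"
      using Gb.nf_wp[OF rb(1)] by simp
    moreover have "0 < length (W i)" using ne by simp
    ultimately show False using HW(2)[OF i] by simp
  qed
  show ?case
  proof (cases "\<exists>i j g r. i \<in> {1..n} \<and> j \<in> {1..n} \<and> i \<noteq> j \<and> W j = W i @ (i, g) # r")
    case True
    then obtain i j g r where ij: "i \<in> {1..n}" "j \<in> {1..n}" "i \<noteq> j" "W j = W i @ (i, g) # r" by (elim exE conjE)
    have "\<exists>K. nbr_bases H K \<and> (\<Sum>i\<in>{1..n}. conj_length K i) < (\<Sum>i\<in>{1..n}. conj_length H i)"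
      by (rule nielsen_step[OF H _ _ _ ij]) (fact W(1), fact HW(1), fact HW(2))
    then obtain K where K: "nbr_bases H K" "(\<Sum>i\<in>{1..n}. conj_length K i) < (\<Sum>i\<in>{1..n}. conj_length H i)"
      by (elim exE conjE)
    have "basis K" using K(1) E_basis by (auto simp: nbr_bases_def)
    then have "nbr_bases\<^sup>*\<^sup>* K Gb" using less.hyps[OF K(2)] by blast
    then show ?thesis using K(1) by (meson converse_rtranclp_into_rtranclp)
  next
    case False
    have no: "W j \<noteq> W i @ (i, g) # r" if "i \<in> {1..n}" "j \<in> {1..n}" "i \<noteq> j" for i j g r using False that by blast
    have "W k = []" if k: "k \<in> {1..n}" for k
    proof -
      obtain g where g: "g \<in> Gb k" "g \<noteq> \<one>" using basis_nontrivial[OF basis_Gb k] by blast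
      have gc: "g \<in> carrier G" using g Gb_carrier by blast
      have "H.nf g \<noteq> []" using H.nf(2)[OF gc] g(2) by auto
      then obtain p v where pv: "H.nf g = p # v" by (cases "H.nf g") auto
      have pr: "H.red (p # v)" "word_prod G (p # v) = g" using H.nf[OF gc] unfolding pv by blast+
      have "\<exists>c r. Gb.nf (word_prod G (p # v)) = W (fst p) @ (fst p, c) # r"
        by (rule nielsen_prefix[OF H _ _ _ _ pr(1)]) (fact W(1), fact Wl, fact HW(1), fact no)
      then obtain c r where "Gb.nf g = W (fst p) @ (fst p, c) # r" unfolding pr(2) by blast
      then have "[(k, g)] = W (fst p) @ (fst p, c) # r" using Gb.nf_factor[OF k g] by simp
      then show ?thesis by (cases "W (fst p)") auto
    qed
    then have "H i = Gb i" if "i \<in> {1..n}" for i using HW(1)[OF that] conj_set_one[OF Gb_carrier] that by simp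
    moreover have "H i = Gb i" if "i \<notin> {1..n}" for i using basisD(1)[OF H that] basisD(1)[OF basis_Gb that] by simp
    ultimately have "H = Gb" by (intro ext) blast
    then show ?thesis by simp
  qed
qed

text \<open>Every link of a Nielsen path is realised by a carried product, so the group acts
  transitively on bases. This gives the finite quotient and the encoding of bases by
  automorphisms.\<close>

lemma basis_eq_img: assumes "basis H" shows "\<exists>\<phi>\<in>Aut1. H = img \<phi> Gb"
proof -
  have "(\<exists>\<phi>\<in>Aut1. H = img \<phi> Gb)" if "nbr_bases\<^sup>*\<^sup>* H Gb" for H
    using that
  proof (induction rule: converse_rtranclp_induct)
    case base
    have "img (\<lambda>g\<in>carrier G. g) Gb = Gb" by (rule img_id[OF basis_Gb]) simp
    then show ?case using id_Aut1 by metis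
  next
    case (step H K)
    obtain \<phi> where \<phi>: "\<phi> \<in> Aut1" "K = img \<phi> Gb" using step.IH by blast
    obtain A where "compatible n A" "E A H K" using step.hyps by (auto simp: nbr_bases_def)
    then have EK: "E A K H" using E_sym by blast
    then obtain \<rho> where \<rho>: "\<rho> \<in> carried_products G n K A" "H = img \<rho> K" "basis K" by (auto simp: E_def)
    have "\<rho> \<in> Aut1" by (rule carried_products_Aut1[OF \<rho>(3,1)])
    then show ?case using Aut1_compose \<phi> \<rho>(2) img_compose[OF basis_Gb] by metis
  qed
  then show ?thesis using connected_to_Gb[OF assms] by blast
qed

lemma connected_bases: assumes "basis H" "basis K" shows "nbr_bases\<^sup>*\<^sup>* H K"
proof -
  have "symp nbr_bases" unfolding symp_def nbr_bases_def using E_sym by blast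
  then have "nbr_bases\<^sup>*\<^sup>* Gb K" using connected_to_Gb[OF assms(2)] by (rule sympD[OF symp_rtranclp])
  then show ?thesis by (rule rtranclp_trans[OF connected_to_Gb[OF assms(1)]])
qed

end

section \<open>Invariant norms\<close>

context weighted_group
begin

lemma nu_img:
  assumes H: "basis H" and \<phi>: "\<phi> \<in> Aut1" and Q: "\<phi> ` Q = Q" and wt: "\<And>g. g \<in> Q ==> wt (\<phi> g) = wt g"
  shows "nu (img \<phi> H) = nu H"
proof -
  interpret H: free_product G n H by (rule basis_fp[OF H])
  have a: "\<phi> \<in> auto G" by (rule Aut1_auto[OF \<phi>])
  have inj: "inj_on \<phi> Q" using autoD(2)[OF a] Q_carrier by (meson bij_betw_def inj_on_subset)
  have "nu (img \<phi> H) = (\<Sum>g\<in>\<phi> ` Q. wt g * length (nform G n (img \<phi> H) g))" by (simp add: nu_def Q)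
  also have "\<dots> = (\<Sum>g\<in>Q. wt (\<phi> g) * length (nform G n (img \<phi> H) (\<phi> g)))" using inj by (simp add: sum.reindex)
  also have "\<dots> = nu H" unfolding nu_def
  proof (rule sum.cong[OF refl])
    fix g assume g: "g \<in> Q"
    then have "nform G n (img \<phi> H) (\<phi> g) = map (\<lambda>p. (fst p, \<phi> (snd p))) (H.nf g)"
      unfolding img_def using H.free_product_image(2)[OF a] Q_carrier by blast
    then show "wt (\<phi> g) * length (nform G n (img \<phi> H) (\<phi> g)) = wt g * length (H.nf g)" using wt[OF g] by simp
  qed
  finally show ?thesis .
qed

text \<open>A basis is encoded by an automorphism taking it to \<open>Gb\<close>, which is
  determined by its values on the finite standard factors. The \<open>Gb\<close>-length of such a
  value equals the \<open>H\<close>-length of an element of \<open>Q\<close>, hence is at most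
  \<open>N\<close>.\<close>

lemma finite_small_bases:
  assumes S: "(\<Union>i\<in>{1..n}. Gb i) \<subseteq> Q" and wt: "\<And>g. g \<in> Q ==> 0 < wt g"
  shows "finite {H. basis H \<and> nu H \<le> N}"
proof -
  let ?S = "\<Union>i\<in>{1..n}. Gb i" and ?X = "{H. basis H \<and> nu H \<le> N}"
  have "\<forall>H\<in>?X. \<exists>\<psi>. \<psi> \<in> Aut1 \<and> img \<psi> H = Gb"
  proof
    fix H assume "H \<in> ?X"
    then obtain \<phi> where \<phi>: "\<phi> \<in> Aut1" "H = img \<phi> Gb" using basis_eq_img by blast
    obtain \<psi> where \<psi>: "\<psi> \<in> Aut1" "\<And>g. g \<in> carrier G ==> \<psi> (\<phi> g) = g"
      "\<And>g. g \<in> carrier G ==> \<phi> (\<psi> g) = g" using Aut1_inverse[OF \<phi>(1)] by blast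
    have "img \<psi> H = Gb" unfolding \<phi>(2)
      using img_compose[OF basis_Gb, of \<psi> \<phi>] img_id[OF basis_Gb, of "compose (carrier G) \<psi> \<phi>"] \<psi>(2) by (simp add: compose_def)
    then show "\<exists>\<psi>. \<psi> \<in> Aut1 \<and> img \<psi> H = Gb" using \<psi>(1) by blast
  qed
  then obtain \<Psi> where \<Psi>: "\<forall>H\<in>?X. \<Psi> H \<in> Aut1 \<and> img (\<Psi> H) H = Gb" by (rule bchoice[THEN exE])
  let ?r = "\<lambda>H. restrict (\<Psi> H) ?S"
  have "inj_on ?r ?X"
  proof (rule inj_onI)
    fix H K assume HK: "H \<in> ?X" "K \<in> ?X" and eq: "?r H = ?r K"
    have \<psi>: "\<Psi> H \<in> Aut1" "\<Psi> K \<in> Aut1" "img (\<Psi> H) H = Gb" "img (\<Psi> K) K = Gb" and B: "basis H" "basis K" using \<Psi> HK by auto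
    have same: "\<Psi> H g = \<Psi> K g" if g: "g \<in> carrier G" for g
    proof (rule Gb.hom_eqI[OF _ _ _ g])
      show "\<Psi> H \<in> hom G G" "\<Psi> K \<in> hom G G" using autoD(1) Aut1_auto \<psi> by blast+
      fix i h assume "i \<in> {1..n}" "h \<in> Gb i"
      then have "h \<in> ?S" by blast
      then show "\<Psi> H h = \<Psi> K h" using fun_cong[OF eq, of h] by simp
    qed
    obtain \<phi> where \<phi>: "\<phi> \<in> Aut1" "\<And>g. g \<in> carrier G ==> \<phi> (\<Psi> H g) = g"
      "\<And>g. g \<in> carrier G ==> \<Psi> H (\<phi> g) = g" using Aut1_inverse[OF \<psi>(1)] by blast
    have "img \<phi> Gb = H" unfolding \<psi>(3)[symmetric]
      using img_compose[OF B(1), of \<phi> "\<Psi> H"] img_id[OF B(1), of "compose (carrier G) \<phi> (\<Psi> H)"] \<phi>(2) by (simp add: compose_def)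
    moreover have "img \<phi> Gb = K" unfolding \<psi>(4)[symmetric]
      using img_compose[OF B(2), of \<phi> "\<Psi> K"] img_id[OF B(2), of "compose (carrier G) \<phi> (\<Psi> K)"] \<phi>(2) same by (simp add: compose_def)
    ultimately show "H = K" by simp
  qed
  moreover have "?r ` ?X \<subseteq> ?S \<rightarrow>\<^sub>E {g \<in> carrier G. length (Gb.nf g) \<le> N}"
  proof (rule image_subsetI)
    fix H assume H: "H \<in> ?X"
    have \<psi>: "\<Psi> H \<in> Aut1" "img (\<Psi> H) H = Gb" and B: "basis H" "nu H \<le> N" using \<Psi> H by auto
    interpret H: free_product G n H by (rule basis_fp[OF B(1)])
    show "?r H \<in> ?S \<rightarrow>\<^sub>E {g \<in> carrier G. length (Gb.nf g) \<le> N}"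
    proof (rule restrict_PiE_iff[THEN iffD2], rule ballI)
      fix g assume g: "g \<in> ?S"
      then have gQ: "g \<in> Q" and gc: "g \<in> carrier G" using S Q_carrier by blast+
      have "nform G n (img (\<Psi> H) H) (\<Psi> H g) = map (\<lambda>p. (fst p, \<Psi> H (snd p))) (H.nf g)"
        unfolding img_def by (rule H.free_product_image(2)[OF Aut1_auto[OF \<psi>(1)] gc])
      then have "length (Gb.nf (\<Psi> H g)) = length (H.nf g)" unfolding \<psi>(2) by simp
      also have "\<dots> \<le> wt g * length (H.nf g)" using wt[OF gQ] by simp
      also have "\<dots> \<le> nu H" unfolding nu_def using finite_Q gQ by (intro member_le_sum) auto
      finally show "\<Psi> H g \<in> {g \<in> carrier G. length (Gb.nf g) \<le> N}"
        using B(2) H.auto_closed[OF Aut1_auto[OF \<psi>(1)] gc] by simp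
    qed
  qed
  moreover have "finite (?S \<rightarrow>\<^sub>E {g \<in> carrier G. length (Gb.nf g) \<le> N})"
    using basis_finite[OF basis_Gb] Gb.finite_ball by (intro finite_PiE) auto
  ultimately show ?thesis by (meson finite_imageD finite_subset)
qed

end

context factored_group
begin

lemma weighted_groupI: "finite Q ==> Q \<subseteq> carrier G ==> weighted_group G n Gi Q"
  by (intro weighted_group.intro factored_group_axioms weighted_group_axioms.intro)

text \<open>The first part of the norm has finitely many minimisers; the second one, of lower order, adds all short words
  over these, so that the uncrossing inequality becomes strict at the minimisers.\<close>

lemma exists_invariant_norm:
  assumes F: "finite F" "F \<subseteq> Aut1" "(\<lambda>g\<in>carrier G. g) \<in> F" "\<And>\<phi> \<psi>. \<phi> \<in> F ==> \<psi> \<in> F ==> compose (carrier G) \<phi> \<psi> \<in> F"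
  obtains Q wt where "weighted_group G n Gi Q"
    "\<And>f H. f \<in> F ==> basis H ==> weighted_group.nu G n Q wt (img f H) = weighted_group.nu G n Q wt H"
    "\<And>H w. basis H ==> (\<And>K. basis K ==> weighted_group.nu G n Q wt H \<le> weighted_group.nu G n Q wt K) ==>
       red_word G n H w ==> length w \<le> 3 ==> word_prod G w \<in> Q \<and> 0 < wt (word_prod G w)"
proof -
  let ?S = "\<Union>i\<in>{1..n}. Gb i"
  have Fa: "\<phi> \<in> auto G" if "\<phi> \<in> F" for \<phi> using F(2) Aut1_auto that by blast
  have Sc: "?S \<subseteq> carrier G" using Gb_carrier by blast
  \<comment> \<open>The images of the standard factors under \<open>F\<close>: an invariant set,
    large enough for \<open>finite_small_bases\<close>.\<close>
  define Q1 where "Q1 = (\<Union>\<phi>\<in>F. \<phi> ` ?S)"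
  have Q1: "finite Q1" "Q1 \<subseteq> carrier G"
    unfolding Q1_def using F(1) basis_finite[OF basis_Gb] Gb.auto_closed[OF Fa] Sc by (auto simp: subset_iff)
  have SQ1: "?S \<subseteq> Q1"
  proof
    fix g assume g: "g \<in> ?S"
    then have "g = (\<lambda>g\<in>carrier G. g) g" using Sc by auto
    then show "g \<in> Q1" unfolding Q1_def using F(3) g by blast
  qed
  have onto: "f ` X = X" if "f \<in> F" "finite X" "X \<subseteq> carrier G" "f ` X \<subseteq> X" for f X
  proof -
    have "inj_on f X" using autoD(2)[OF Fa[OF that(1)]] that(3) by (meson bij_betw_def inj_on_subset)
    then show ?thesis using endo_inj_surj[OF that(2,4)] by blast
  qed
  have Q1F: "f ` Q1 = Q1" if f: "f \<in> F" for f
  proof (rule onto[OF f Q1])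
    show "f ` Q1 \<subseteq> Q1"
    proof (rule image_subsetI)
      fix g assume "g \<in> Q1"
      then obtain \<phi> s where s: "\<phi> \<in> F" "s \<in> ?S" "g = \<phi> s" unfolding Q1_def by blast
      then have "f g = compose (carrier G) f \<phi> s" using Sc by (auto simp: compose_def)
      then show "f g \<in> Q1" unfolding Q1_def using F(4)[OF f s(1)] s(2) by blast
    qed
  qed
  interpret one: weighted_group G n Gi Q1 "\<lambda>_. 1" by (rule weighted_groupI[OF Q1])
  define M1 where "M1 = {H. basis H \<and> (\<forall>K. basis K --> one.nu H \<le> one.nu K)}"
  have finM1: "finite M1"
  proof (rule finite_subset)
    show "M1 \<subseteq> {H. basis H \<and> one.nu H \<le> one.nu Gb}" using basis_Gb by (auto simp: M1_def)
    show "finite {H. basis H \<and> one.nu H \<le> one.nu Gb}" by (rule one.finite_small_bases[OF SQ1]) simp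
  qed
  obtain H1 where H1: "basis H1" "\<And>K. basis K ==> one.nu H1 \<le> one.nu K"
    using ex_has_least_nat[of basis Gb one.nu] basis_Gb by blast
  \<comment> \<open>Length 3 accommodates the test words of
    \<open>turn_count_uncross_strict\<close>. The set is invariant because \<open>F\<close> permutes
    the minimisers of the first norm and carries normal forms to normal forms.\<close>
  define Q2 where "Q2 = (\<Union>H\<in>M1. word_prod G ` {w. red_word G n H w \<and> length w \<le> 3})"
  have Q2: "finite Q2" "Q2 \<subseteq> carrier G"
  proof -
    have fin: "finite {w. red_word G n H w \<and> length w \<le> 3}" if "H \<in> M1" for H
    proof (rule finite_subset)
      let ?X = "{1..n} \<times> (\<Union>i\<in>{1..n}. H i)"
      have "p \<in> ?X" if "red_word G n H w" "p \<in> set w" for w p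
      proof -
        have "fst p \<in> {1..n}" "snd p \<in> H (fst p)" using that by (auto simp: red_word_def)
        then show ?thesis unfolding mem_Times_iff by blast
      qed
      then show "{w. red_word G n H w \<and> length w \<le> 3} \<subseteq> {w. set w \<subseteq> ?X \<and> length w \<le> 3}" by blast
      have "basis H" using that by (simp add: M1_def)
      then show "finite {w. set w \<subseteq> ?X \<and> length w \<le> 3}" using basis_finite by (intro finite_lists_length_le) auto
    qed
    then show "finite Q2" unfolding Q2_def using finM1 by blast
    show "Q2 \<subseteq> carrier G"
    proof
      fix g assume "g \<in> Q2"
      then obtain H w where w: "H \<in> M1" "red_word G n H w" "g = word_prod G w" unfolding Q2_def by blast
      have "basis H" using w(1) by (simp add: M1_def)
      then show "g \<in> carrier G" using free_product.red_wp_closed[OF basis_fp w(2)] w(3) by simp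
    qed
  qed
  have M1F: "img f H \<in> M1" if f: "f \<in> F" and H: "H \<in> M1" for f H
  proof -
    have B1: "basis H" using H by (simp add: M1_def)
    have B: "basis H" "basis (img f H)" using B1 img_basis[OF B1] f F(2) by blast+
    have "one.nu (img f H) = one.nu H" by (rule one.nu_img[OF B1 _ Q1F[OF f]]) (use f F(2) in blast, rule refl)
    then show ?thesis using H B by (simp add: M1_def)
  qed
  have Q2F: "f ` Q2 = Q2" if f: "f \<in> F" for f
  proof (rule onto[OF f Q2])
    show "f ` Q2 \<subseteq> Q2"
    proof (rule image_subsetI)
      fix g assume "g \<in> Q2"
      then obtain H w where w: "H \<in> M1" "red_word G n H w" "length w \<le> 3" "g = word_prod G w" unfolding Q2_def by blast
      have H: "basis H" using w(1) by (simp add: M1_def)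
      interpret H: free_product G n H by (rule basis_fp[OF H])
      have gc: "g \<in> carrier G" using H.red_wp_closed[OF w(2)] w(4) by simp
      have K: "basis (img f H)" "img f H \<in> M1" using M1F[OF f w(1)] by (simp_all add: M1_def)
      interpret K: free_product G n "img f H" by (rule basis_fp[OF K(1)])
      have fgc: "f g \<in> carrier G" by (rule H.auto_closed[OF Fa[OF f] gc])
      have "length (K.nf (f g)) = length (H.nf g)"
        unfolding img_def using H.free_product_image(2)[OF Fa[OF f] gc] by simp
      then have "length (K.nf (f g)) \<le> 3" using w(3,4) H.nf_wp[OF w(2)] by simp
      then have "f g \<in> word_prod G ` {w. red_word G n (img f H) w \<and> length w \<le> 3}"
        using K.nf[OF fgc] by (intro image_eqI[of _ _ "K.nf (f g)"]) simp_all
      then show "f g \<in> Q2" unfolding Q2_def using K(2) by blast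
    qed
  qed
  interpret two: weighted_group G n Gi Q2 "\<lambda>_. 1" by (rule weighted_groupI[OF Q2])
  \<comment> \<open>One unit of the first norm outweighs the whole second norm of \<open>H1\<close>,
    so a minimiser of the combined norm also minimises the first one.\<close>
  define N where "N = Suc (two.nu H1)"
  define wt where "wt = (\<lambda>g. (if g \<in> Q1 then N else 0) + (if g \<in> Q2 then 1 else 0))"
  define Q where "Q = Q1 \<union> Q2"
  have Q: "finite Q" "Q \<subseteq> carrier G" using Q1 Q2 by (auto simp: Q_def)
  interpret w: weighted_group G n Gi Q wt by (rule weighted_groupI[OF Q])
  have nu: "w.nu H = N * one.nu H + two.nu H" for H
  proof -
    have "w.nu H = (\<Sum>g\<in>Q. (if g \<in> Q1 then N * length (nform G n H g) else 0) + (if g \<in> Q2 then length (nform G n H g) else 0))"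
      unfolding w.nu_def by (intro sum.cong refl) (simp add: wt_def)
    also have "\<dots> = (\<Sum>g\<in>Q \<inter> Q1. N * length (nform G n H g)) + (\<Sum>g\<in>Q \<inter> Q2. length (nform G n H g))"
      unfolding sum.distrib using Q(1) by (simp add: sum.inter_restrict)
    also have "\<dots> = (\<Sum>g\<in>Q1. N * length (nform G n H g)) + (\<Sum>g\<in>Q2. length (nform G n H g))"
      by (simp add: Q_def Int_absorb1)
    finally show ?thesis unfolding one.nu_def two.nu_def by (simp add: sum_distrib_left)
  qed
  have inv: "w.nu (img f H) = w.nu H" if f: "f \<in> F" and H: "basis H" for f H
  proof -
    have "one.nu (img f H) = one.nu H" by (rule one.nu_img[OF H _ Q1F[OF f]]) (use f F(2) in blast, rule refl)
    moreover have "two.nu (img f H) = two.nu H" by (rule two.nu_img[OF H _ Q2F[OF f]]) (use f F(2) in blast, rule refl)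
    ultimately show ?thesis by (simp add: nu)
  qed
  have test: "word_prod G w \<in> Q \<and> 0 < wt (word_prod G w)"
    if H: "basis H" and min: "\<And>K. basis K ==> w.nu H \<le> w.nu K" and w: "red_word G n H w" "length w \<le> 3" for H w
  proof -
    have "one.nu H \<le> one.nu H1"
    proof (rule ccontr)
      assume "\<not> ?thesis"
      then have "N * (one.nu H1 + 1) \<le> N * one.nu H" by (intro mult_le_mono2) simp
      then have "w.nu H1 < w.nu H" by (simp add: nu N_def)
      then show False using min[OF H1(1)] by simp
    qed
    then have "H \<in> M1" using H H1(2) by (auto simp: M1_def intro: order_trans)
    then have "word_prod G w \<in> Q2" unfolding Q2_def using w by blast
    then show ?thesis by (simp add: Q_def wt_def)
  qed
  show ?thesis
  proof (rule that[of Q wt])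
    show "weighted_group G n Gi Q" by (rule weighted_groupI[OF Q])
  qed (fact inv, fact test)
qed

end

section \<open>The complex of a free product of finite groups\<close>

context factored_group
begin

definition vert :: "(nat => 'a set) => (nat => nat set set) => 'a vtx" where
  "vert H A = {(K, A) | K. E A H K}"

abbreviation L :: "'a vtx set" where
  "L \<equiv> L_vertices G n Gi"

lemma L_vert: "L = {vert H A | H A. basis H \<and> compatible n A}"
  unfolding vert_def by (rule L_vertices_eq)

lemma vert_cases:
  assumes "C \<in> L" obtains H A where "C = vert H A" "basis H" "compatible n A"
  using assms unfolding L_vert by (elim CollectE exE conjE)

lemma vert_eqI: "compatible n A ==> E A H K ==> vert H A = vert K A"
  unfolding vert_def using E_sym E_trans by blast

lemma vert_eq_iff:
  assumes "basis H" "compatible n A" shows "vert H A = vert K A \<longleftrightarrow> E A H K"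
proof
  assume "vert H A = vert K A"
  moreover have "(H, A) \<in> vert H A" using E_refl[OF assms(1)] by (simp add: vert_def)
  ultimately have "E A K H" by (simp add: vert_def)
  then show "E A H K" by (rule E_sym[OF assms(2)])
qed (rule vert_eqI[OF assms(2)])

lemma vert_le:
  assumes "compatible n A" "compatible n B" "basis H" "basis K"
  shows "L_le (vert H A) (vert K B) \<longleftrightarrow> tree_le A B \<and> E B K H"
proof
  assume "L_le (vert H A) (vert K B)"
  then obtain X where X: "E A H X" "E B K X" "tree_le A B" unfolding L_le_def vert_def by blast
  have "E B H X" by (rule E_mono[OF assms(1,2) X(3,1)])
  then show "tree_le A B \<and> E B K H" using X E_trans E_sym[OF assms(2)] by blast
next
  assume "tree_le A B \<and> E B K H"
  then show "L_le (vert H A) (vert K B)" unfolding L_le_def vert_def using E_refl[OF assms(3), of A] by blast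
qed

lemma vact_vert:
  assumes \<phi>: "\<phi> \<in> Aut1" and H: "basis H" shows "vact \<phi> (vert H A) = vert (img \<phi> H) A"
proof (rule equalityI; rule subsetI)
  fix q assume "q \<in> vact \<phi> (vert H A)"
  then obtain K where "q = (img \<phi> K, A)" "E A H K" by (auto simp: vact_def vert_def img_def)
  then show "q \<in> vert (img \<phi> H) A" using E_img[OF \<phi>] by (simp add: vert_def)
next
  fix q assume "q \<in> vert (img \<phi> H) A"
  then obtain K where K: "q = (K, A)" "E A (img \<phi> H) K" by (auto simp: vert_def)
  have KB: "basis K" using E_basis[OF K(2)] by blast
  obtain \<psi> where \<psi>: "\<psi> \<in> Aut1" "\<And>g. g \<in> carrier G ==> \<psi> (\<phi> g) = g" "\<And>g. g \<in> carrier G ==> \<phi> (\<psi> g) = g"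
    using Aut1_inverse[OF \<phi>] by blast
  have "img \<psi> (img \<phi> H) = H" "img \<phi> (img \<psi> K) = K"
    using img_compose[OF H, of \<psi> \<phi>] img_id[OF H, of "compose (carrier G) \<psi> \<phi>"] \<psi>(2)
      img_compose[OF KB, of \<phi> \<psi>] img_id[OF KB, of "compose (carrier G) \<phi> \<psi>"] \<psi>(3) by (simp_all add: compose_def)
  then have "(img \<psi> K, A) \<in> vert H A" "q = (\<lambda>i. \<phi> ` img \<psi> K i, A)"
    using E_img[OF \<psi>(1) K(2)] K(1) by (simp_all add: vert_def img_def)
  then show "q \<in> vact \<phi> (vert H A)" unfolding vact_def by (intro image_eqI[of _ _ "(img \<psi> K, A)"]) simp_all
qed

lemma vact_L: "\<phi> \<in> Aut1 ==> C \<in> L ==> vact \<phi> C \<in> L"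
proof (erule vert_cases)
  fix H A assume \<phi>: "\<phi> \<in> Aut1" and H: "C = vert H A" "basis H" "compatible n A"
  show "vact \<phi> C \<in> L" unfolding L_vert H(1) vact_vert[OF \<phi> H(2)] using img_basis[OF H(2) \<phi>] H(3) by blast
qed

lemma vact_compose:
  assumes "\<phi> \<in> Aut1" "\<psi> \<in> Aut1" "C \<in> L" shows "vact (compose (carrier G) \<phi> \<psi>) C = vact \<phi> (vact \<psi> C)"
proof -
  obtain H A where H: "C = vert H A" "basis H" using vert_cases[OF assms(3)] by metis
  then show ?thesis using vact_vert assms img_basis Aut1_compose img_compose by simp
qed

lemma vact_id: "C \<in> L ==> \<phi> \<in> Aut1 ==> (\<And>g. g \<in> carrier G ==> \<phi> g = g) ==> vact \<phi> C = C"
proof (erule vert_cases)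
  fix H A assume \<phi>: "\<phi> \<in> Aut1" "\<And>g. g \<in> carrier G ==> \<phi> g = g" and H: "C = vert H A" "basis H"
  show "vact \<phi> C = C" unfolding H(1) vact_vert[OF \<phi>(1) H(2)] using img_id[OF H(2) \<phi>(2)] by simp
qed

lemma vact_inverse:
  assumes \<phi>: "\<phi> \<in> Aut1" obtains \<psi> where "\<psi> \<in> Aut1" "\<And>C. C \<in> L ==> vact \<psi> (vact \<phi> C) = C" "\<And>C. C \<in> L ==> vact \<phi> (vact \<psi> C) = C"
proof -
  obtain \<psi> where \<psi>: "\<psi> \<in> Aut1" "\<And>g. g \<in> carrier G ==> \<psi> (\<phi> g) = g" "\<And>g. g \<in> carrier G ==> \<phi> (\<psi> g) = g"
    using Aut1_inverse[OF \<phi>] by blast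
  have "vact \<psi> (vact \<phi> C) = C" "vact \<phi> (vact \<psi> C) = C" if C: "C \<in> L" for C
    using vact_compose[OF \<psi>(1) \<phi> C] vact_compose[OF \<phi> \<psi>(1) C] vact_id[OF C Aut1_compose[OF \<psi>(1) \<phi>]]
      vact_id[OF C Aut1_compose[OF \<phi> \<psi>(1)]] \<psi>(2,3) by (simp_all add: compose_def)
  then show ?thesis using that \<psi>(1) by blast
qed

text \<open>A translate has the same tree, and comparable vertices with equal trees coincide. So the
  support of a fixed point, being a chain, is fixed vertex by vertex.\<close>

lemma vact_comparable:
  assumes C: "C \<in> L" and \<phi>: "\<phi> \<in> Aut1" and "L_le (vact \<phi> C) C \<or> L_le C (vact \<phi> C)" shows "vact \<phi> C = C"
proof -
  obtain H A where H: "C = vert H A" "basis H" "compatible n A" by (rule vert_cases[OF C])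
  have v: "vact \<phi> C = vert (img \<phi> H) A" "basis (img \<phi> H)" using vact_vert[OF \<phi> H(2)] img_basis[OF H(2) \<phi>] H(1) by simp_all
  have "E A H (img \<phi> H) \<or> E A (img \<phi> H) H"
    using assms(3) vert_le[OF H(3,3) v(2) H(2)] vert_le[OF H(3,3) H(2) v(2)] v(1) H(1) by auto
  then show ?thesis using vert_eqI[OF H(3)] v(1) H(1) by metis
qed

lemma fixed_support:
  assumes t: "t \<in> realization_points L_le L" and \<phi>: "\<phi> \<in> Aut1" and fx: "fixes_point G n Gi \<phi> t" and C: "t C \<noteq> 0"
  shows "C \<in> L" "vact \<phi> C = C"
proof -
  obtain \<sigma> where \<sigma>: "is_chain L_le L \<sigma>" "t \<in> closed_simplex \<sigma>" using t by (auto simp: realization_points_def)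
  have sup: "D \<in> \<sigma>" if "t D \<noteq> 0" for D using closed_simplexD(2)[OF \<sigma>(2)] that by blast
  show CL: "C \<in> L" using sup[OF C] \<sigma>(1) by (auto simp: is_chain_def)
  then have "t (vact \<phi> C) \<noteq> 0" using fx C by (simp add: fixes_point_def)
  then have "L_le (vact \<phi> C) C \<or> L_le C (vact \<phi> C)" using sup C \<sigma>(1) unfolding is_chain_def by blast
  then show "vact \<phi> C = C" by (rule vact_comparable[OF CL \<phi>])
qed

lemma L_complex_topspace: "topspace (L_complex G n Gi) = realization_points L_le L"
  by (simp add: L_complex_def)

lemma support_nonempty:
  assumes "t \<in> realization_points R P" shows "\<exists>C. t C \<noteq> 0"
proof (rule ccontr)
  assume "\<not> ?thesis"
  then have "t = (\<lambda>_. 0)" by auto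
  moreover obtain \<sigma> where "t \<in> closed_simplex \<sigma>" using assms by (auto simp: realization_points_def)
  ultimately show False using closed_simplexD(3)[of t \<sigma>] by simp
qed

text \<open>By \<open>fixed_support\<close> the vertices in the support of a fixed point are fixed
  themselves, so the fixed points form the full subcomplex on the fixed vertices; topologically this
  reduces fixed sets to realizations.\<close>

lemma fixed_set_eq:
  assumes F: "F \<subseteq> Aut1"
  shows "fixed_set G n Gi F = realization_points L_le {C \<in> L. \<forall>\<phi>\<in>F. vact \<phi> C = C}" (is "_ = realization_points L_le ?P")
proof (rule equalityI; rule subsetI)
  fix t assume "t \<in> fixed_set G n Gi F"
  then have t: "t \<in> realization_points L_le L" "\<And>\<phi>. \<phi> \<in> F ==> fixes_point G n Gi \<phi> t"
    by (simp_all add: fixed_set_def L_complex_topspace)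
  obtain \<sigma> where \<sigma>: "is_chain L_le L \<sigma>" "t \<in> closed_simplex \<sigma>" using t(1) by (auto simp: realization_points_def)
  define \<tau> where "\<tau> = {C. t C \<noteq> 0}"
  have sub: "\<tau> \<subseteq> \<sigma>" unfolding \<tau>_def by (rule closed_simplexD(4)[OF \<sigma>(2)])
  have fin: "finite \<sigma>" using \<sigma>(1) by (simp add: is_chain_def)
  have CP: "C \<in> ?P" if "C \<in> \<tau>" for C
  proof -
    have C: "t C \<noteq> 0" using that by (simp add: \<tau>_def)
    have "C \<in> L" using that sub \<sigma>(1) by (auto simp: is_chain_def)
    moreover have "vact \<phi> C = C" if \<phi>: "\<phi> \<in> F" for \<phi> using fixed_support(2)[OF t(1) _ t(2)[OF \<phi>] C] \<phi> F by blast
    ultimately show ?thesis by simp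
  qed
  have ne: "\<tau> \<noteq> {}" using support_nonempty[OF t(1)] by (simp add: \<tau>_def)
  have ch: "is_chain L_le ?P \<tau>" unfolding is_chain_def
  proof (intro conjI)
    show "\<tau> \<subseteq> ?P" using CP by (rule subsetI)
    show "finite \<tau>" by (rule finite_subset[OF sub fin])
    show "\<forall>x\<in>\<tau>. \<forall>y\<in>\<tau>. L_le x y \<or> L_le y x" using \<sigma>(1) sub unfolding is_chain_def by blast
  qed (rule ne)
  have "sum t \<tau> = sum t \<sigma>" by (rule sum.mono_neutral_left[OF fin sub]) (auto simp: \<tau>_def)
  then have "t \<in> closed_simplex \<tau>" using closed_simplexD[OF \<sigma>(2)] unfolding closed_simplex_def by (simp add: \<tau>_def)
  then show "t \<in> realization_points L_le ?P" unfolding realization_points_def using ch by blast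
next
  fix t assume "t \<in> realization_points L_le ?P"
  then obtain \<sigma> where \<sigma>: "is_chain L_le ?P \<sigma>" "t \<in> closed_simplex \<sigma>" by (auto simp: realization_points_def)
  have tL: "t \<in> realization_points L_le L"
    using realization_points_mono[of ?P L L_le] \<open>t \<in> realization_points L_le ?P\<close> by blast
  have "fixes_point G n Gi \<phi> t" if \<phi>: "\<phi> \<in> F" for \<phi>
    unfolding fixes_point_def
  proof
    fix C assume C: "C \<in> L"
    have \<phi>1: "\<phi> \<in> Aut1" using \<phi> F by blast
    obtain \<psi> where \<psi>: "\<psi> \<in> Aut1" "\<And>C. C \<in> L ==> vact \<psi> (vact \<phi> C) = C" "\<And>C. C \<in> L ==> vact \<phi> (vact \<psi> C) = C"
      using vact_inverse[OF \<phi>1] by blast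
    have fixd: "vact \<phi> D = D" if "D \<in> \<sigma>" for D using that \<phi> \<sigma>(1) by (auto simp: is_chain_def)
    show "t (vact \<phi> C) = t C"
    proof (cases "vact \<phi> C \<in> \<sigma>")
      case True
      then have "vact \<phi> (vact \<phi> C) = vact \<phi> C" by (rule fixd)
      then have "vact \<phi> C = C" using \<psi>(2)[OF vact_L[OF \<phi>1 C]] \<psi>(2)[OF C] by simp
      then show ?thesis by simp
    next
      case False
      then have "C \<notin> \<sigma>" using fixd by metis
      then show ?thesis using closed_simplexD(2)[OF \<sigma>(2)] False by simp
    qed
  qed
  then show "t \<in> fixed_set G n Gi F" using tL by (simp add: fixed_set_def L_complex_topspace)
qed

theorem contractible_fixed_poset:
  assumes F: "finite F" "F \<subseteq> Aut1" "(\<lambda>g\<in>carrier G. g) \<in> F" "\<And>\<phi> \<psi>. \<phi> \<in> F ==> \<psi> \<in> F ==> compose (carrier G) \<phi> \<psi> \<in> F"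
  shows "{C \<in> L. \<forall>\<phi>\<in>F. vact \<phi> C = C} \<noteq> {}"
    "contractible_space (realization L_le {C \<in> L. \<forall>\<phi>\<in>F. vact \<phi> C = C})"
proof -
  obtain Q wt where wg: "weighted_group G n Gi Q"
    and inv: "\<And>f H. f \<in> F ==> basis H ==> weighted_group.nu G n Q wt (img f H) = weighted_group.nu G n Q wt H"
    and test: "\<And>H w. basis H ==> (\<And>K. basis K ==> weighted_group.nu G n Q wt H \<le> weighted_group.nu G n Q wt K) ==>
       red_word G n H w ==> length w \<le> 3 ==> word_prod G w \<in> Q \<and> 0 < wt (word_prod G w)"
    using exists_invariant_norm[OF F] by blast
  interpret w: weighted_group G n Gi Q wt by (rule wg)
  let ?T = "{A. compatible n A}" and ?Bs = "{H. basis H}"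
  interpret r: reduction_action ?Bs E ?T tree_le w.nu "img ` F"
  proof
    show "finite ?T" by (rule finite_compatible)
    show "porder tree_le ?T" by (rule porder_tree_le) simp
    show "?Bs \<noteq> {}" using basis_Gb by blast
    show "H \<in> ?Bs \<and> K \<in> ?Bs" if "E A H K" for A H K using E_basis[OF that] by simp
    show "E A H H" if "A \<in> ?T" "H \<in> ?Bs" for A H using E_refl that by simp
    show "E A K H" if "A \<in> ?T" "E A H K" for A H K using E_sym that by simp
    show "E A H K'" if "A \<in> ?T" "E A H K" "E A K K'" for A H K K' using E_trans that by blast
    show "E B H K" if "A \<in> ?T" "B \<in> ?T" "tree_le A B" "E A H K" for A B H K using E_mono that by simp
    show "\<exists>A0\<in>?T. (\<forall>B\<in>?T. tree_le A0 B) \<and> (\<forall>H K. E A0 H K --> K = H)"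
      by (rule bexI[of _ least_tree]) (use least_tree_le E_least_tree compatible_least_tree in auto)
    show "finite {K. E A H K}" if "A \<in> ?T" for A H using w.finite_E that by simp
    show "order_contractible tree_le {B \<in> ?T. tree_le A B \<and> (\<exists>K. E B H K \<and> w.nu K < w.nu H)}"
      if "A \<in> ?T" "H \<in> ?Bs" "\<forall>K. E A H K --> w.nu H \<le> w.nu K"
        "{B \<in> ?T. tree_le A B \<and> (\<exists>K. E B H K \<and> w.nu K < w.nu H)} \<noteq> {}" for A H
      using w.descending_trees_contractible[of H A] that by simp
    show "\<exists>j\<in>?T. \<forall>B\<in>?T. (\<forall>K. E A H K \<and> w.nu K = w.nu H --> E B H K) \<longleftrightarrow> tree_le j B"
      if "A \<in> ?T" "H \<in> ?Bs" "\<forall>K. E A H K --> w.nu H \<le> w.nu K" for A H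
      using w.zero_tree[of H A] that by (intro bexI[of _ "w.zero_tree A H"] ballI) simp_all
    show "\<exists>B\<in>?T. tree_le A B \<and> (\<exists>K. E B H K \<and> w.nu K < w.nu H)"
      if "A \<in> ?T" "H \<in> ?Bs" "\<forall>K. E A H K --> w.nu H \<le> w.nu K"
        "\<forall>B\<in>?T. (\<forall>K. E A H K \<and> w.nu K = w.nu H --> E B H K) --> tree_le A B"
        "B' \<in> ?T" "E B' H K'" "w.nu K' < w.nu H" for A H B' K'
      using w.descent_exists[of H A B' K'] that by simp
    show "(\<lambda>H K. \<exists>A\<in>?T. E A H K)\<^sup>*\<^sup>* H K" if "H \<in> ?Bs" "K \<in> ?Bs" for H K
    proof -
      have "nbr_bases = (\<lambda>H K. \<exists>A\<in>?T. E A H K)" by (intro ext) (simp add: nbr_bases_def)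
      then show ?thesis using connected_bases[of H K] that by simp
    qed
    show "\<exists>A0\<in>?T. \<forall>A\<in>?T. \<forall>K. E A H K \<and> w.nu K = w.nu H --> E A0 H K"
      if "H \<in> ?Bs" "\<forall>K\<in>?Bs. w.nu H \<le> w.nu K" for H
    proof -
      have H: "basis H" and min: "\<And>K. basis K ==> w.nu H \<le> w.nu K" using that by auto
      have short: "word_prod G w \<in> Q \<and> 0 < wt (word_prod G w)" if "red_word G n H w" "length w \<le> 3" for w
        by (rule test[OF H _ that]) (fact min)
      have "\<exists>A0. compatible n A0 \<and>
          (\<forall>A K. compatible n A --> E A H K \<and> w.nu K = w.nu H --> E A0 H K)"
        by (rule w.plateau_tree[OF H]) (fact min, fact short)
      then obtain A0 where "compatible n A0"
        "\<forall>A K. compatible n A --> E A H K \<and> w.nu K = w.nu H --> E A0 H K"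
        by (elim exE conjE)
      then show ?thesis by (intro bexI[of _ A0]) simp_all
    qed
    fix f assume "f \<in> img ` F"
    then obtain \<phi> where \<phi>: "f = img \<phi>" "\<phi> \<in> F" by blast
    have \<phi>1: "\<phi> \<in> Aut1" using \<phi>(2) F(2) by blast
    show "f H \<in> ?Bs" if "H \<in> ?Bs" for H using img_basis[OF _ \<phi>1] that \<phi>(1) by simp
    show "w.nu (f H) = w.nu H" if "H \<in> ?Bs" for H using inv[OF \<phi>(2)] that \<phi>(1) by simp
    show "E A (f H) (f K)" if "A \<in> ?T" "E A H K" for A H K using E_img[OF \<phi>1 that(2)] \<phi>(1) by simp
  qed
  have vx: "r.vx H A = vert H A" for H A by (simp add: r.vx_def vert_def)
  have fx: "vact \<phi> (vert H A) = vert H A \<longleftrightarrow> E A H (img \<phi> H)"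
    if "basis H" "compatible n A" "\<phi> \<in> F" for \<phi> H A
    using vact_vert[of \<phi> H A] vert_eq_iff[OF that(1,2), of "img \<phi> H"] that F(2) by auto
  have eq: "r.fixed_vertices = {C \<in> L. \<forall>\<phi>\<in>F. vact \<phi> C = C}"
  proof (rule equalityI; rule subsetI)
    fix C assume "C \<in> r.fixed_vertices"
    then obtain H A where C: "C = vert H A" "basis H" "compatible n A" "\<And>\<phi>. \<phi> \<in> F ==> E A H (img \<phi> H)"
      unfolding r.fixed_vertices_def vx by blast
    have "C \<in> L" unfolding L_vert using C by blast
    then show "C \<in> {C \<in> L. \<forall>\<phi>\<in>F. vact \<phi> C = C}" using fx[OF C(2,3)] C(1,4) by simp
  next
    fix C assume "C \<in> {C \<in> L. \<forall>\<phi>\<in>F. vact \<phi> C = C}"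
    then have C: "C \<in> L" "\<And>\<phi>. \<phi> \<in> F ==> vact \<phi> C = C" by simp_all
    obtain H A where H: "C = vert H A" "basis H" "compatible n A" by (rule vert_cases[OF C(1)])
    have "E A H (img \<phi> H)" if "\<phi> \<in> F" for \<phi> using fx[OF H(2,3) that] C(2)[OF that] H(1) by simp
    then show "C \<in> r.fixed_vertices" unfolding r.fixed_vertices_def vx using H by blast
  qed
  show "{C \<in> L. \<forall>\<phi>\<in>F. vact \<phi> C = C} \<noteq> {}" using r.contractible_fixed_vertices(1) eq by simp
  show "contractible_space (realization L_le {C \<in> L. \<forall>\<phi>\<in>F. vact \<phi> C = C})"
    using r.contractible_fixed_vertices(2) eq by (simp add: L_le_eq)
qed

lemma L_le_refl: "C \<in> L ==> L_le C C"
proof (erule vert_cases)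
  fix H A assume H: "C = vert H A" "basis H" "compatible n A"
  have "tree_le A A" using porder_tree_le[of "{A}" n] H(3) by (simp add: porder_def)
  then show "L_le C C" using vert_le[OF H(3,3,2,2)] E_refl[OF H(2)] H(1) by simp
qed

text \<open>A stabilising automorphism fixes a vertex of the support, hence takes the basis
  \<open>H\<close> to one of the finitely many bases in that vertex. On the finite factors of
  \<open>H\<close> this leaves finitely many values, and these determine the automorphism.\<close>

lemma finite_stabilizer:
  assumes t: "t \<in> realization_points L_le L" shows "finite {\<phi> \<in> Aut1. fixes_point G n Gi \<phi> t}"
proof -
  \<comment> \<open>The empty set of test elements only serves to reach \<open>finite_E\<close>,
    which speaks of classes and not of norms.\<close>
  interpret w: weighted_group G n Gi "{}" "\<lambda>_. 0" by (rule weighted_groupI) simp_all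
  obtain C where C: "t C \<noteq> 0" using support_nonempty[OF t] by blast
  obtain \<sigma> where \<sigma>: "is_chain L_le L \<sigma>" "t \<in> closed_simplex \<sigma>" using t by (auto simp: realization_points_def)
  have "C \<in> \<sigma>" using closed_simplexD(2)[OF \<sigma>(2)] C by blast
  then have CL: "C \<in> L" using \<sigma>(1) by (auto simp: is_chain_def)
  obtain H A where H: "C = vert H A" "basis H" "compatible n A" by (rule vert_cases[OF CL])
  interpret H: free_product G n H by (rule basis_fp[OF H(2)])
  let ?S = "\<Union>i\<in>{1..n}. H i" and ?U = "\<Union>K\<in>{K. E A H K}. \<Union>i\<in>{1..n}. K i"
  let ?X = "{\<phi> \<in> Aut1. fixes_point G n Gi \<phi> t}"
  have finU: "finite ?U" using w.finite_E[OF H(3)] E_basis basis_finite by (intro finite_UN_I) auto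
  have "(\<lambda>\<phi>. restrict \<phi> ?S) ` ?X \<subseteq> ?S \<rightarrow>\<^sub>E ?U"
  proof (rule image_subsetI)
    fix \<phi> assume "\<phi> \<in> ?X"
    then have \<phi>: "\<phi> \<in> Aut1" "fixes_point G n Gi \<phi> t" by simp_all
    have "vact \<phi> C = C" by (rule fixed_support(2)[OF t \<phi> C])
    then have "E A H (img \<phi> H)" using vact_vert[OF \<phi>(1) H(2)] vert_eq_iff[OF H(2,3), of "img \<phi> H"] H(1) by simp
    then have "\<phi> h \<in> ?U" if "h \<in> ?S" for h using that by (auto simp: img_def)
    then show "restrict \<phi> ?S \<in> ?S \<rightarrow>\<^sub>E ?U" by (simp only: restrict_PiE_iff) blast
  qed
  moreover have "finite (?S \<rightarrow>\<^sub>E ?U)" using finU basis_finite[OF H(2)] by (intro finite_PiE) auto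
  moreover have "inj_on (\<lambda>\<phi>. restrict \<phi> ?S) ?X"
  proof (rule inj_onI)
    fix \<phi> \<psi> assume "\<phi> \<in> ?X" "\<psi> \<in> ?X" and eq: "restrict \<phi> ?S = restrict \<psi> ?S"
    then have a: "\<phi> \<in> auto G" "\<psi> \<in> auto G" using Aut1_auto by auto
    show "\<phi> = \<psi>"
    proof (rule H.auto_ext_eqI[OF a(1) autoD(1)[OF a(2)] autoD(3)[OF a(2)]])
      fix i h assume "i \<in> {1..n}" "h \<in> H i"
      then have "h \<in> ?S" by blast
      then show "\<phi> h = \<psi> h" using fun_cong[OF eq, of h] by simp
    qed
  qed
  ultimately show ?thesis by (meson finite_imageD finite_subset)
qed

lemma chain_least:
  assumes "is_chain L_le L \<sigma>" shows "\<exists>C\<in>\<sigma>. \<forall>D\<in>\<sigma>. L_le C D"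
proof -
  have trans: "L_le C X" if c: "C \<in> L" "D \<in> L" "X \<in> L" "L_le C D" "L_le D X" for C D X
  proof -
    obtain H A where H: "C = vert H A" "basis H" "compatible n A" by (rule vert_cases[OF c(1)])
    obtain K B where K: "D = vert K B" "basis K" "compatible n B" by (rule vert_cases[OF c(2)])
    obtain M Z where M: "X = vert M Z" "basis M" "compatible n Z" by (rule vert_cases[OF c(3)])
    have 1: "tree_le A B" "E B K H" using c(4) vert_le[OF H(3) K(3) H(2) K(2)] H(1) K(1) by simp_all
    have 2: "tree_le B Z" "E Z M K" using c(5) vert_le[OF K(3) M(3) K(2) M(2)] K(1) M(1) by simp_all
    have "E Z K H" by (rule E_mono[OF K(3) M(3) 2(1) 1(2)])
    then have "E Z M H" by (rule E_trans[OF 2(2)])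
    moreover have "tree_le A Z"
      using porder_tree_le[of "{A, B, Z}" n] H(3) K(3) M(3) 1(1) 2(1) unfolding porder_def by blast
    ultimately show ?thesis using vert_le[OF H(3) M(3) H(2) M(2)] H(1) M(1) by simp
  qed
  have "finite \<sigma>" "\<sigma> \<noteq> {}" "\<sigma> \<subseteq> L" "\<forall>x\<in>\<sigma>. \<forall>y\<in>\<sigma>. L_le x y \<or> L_le y x" using assms by (simp_all add: is_chain_def)
  then show ?thesis
  proof (induction rule: finite_ne_induct)
    case (singleton x)
    then show ?case using L_le_refl by simp
  next
    case (insert x \<sigma>)
    then obtain C where C: "C \<in> \<sigma>" "\<forall>D\<in>\<sigma>. L_le C D" by auto
    show ?case
    proof (cases "L_le C x")
      case True
      then show ?thesis using C by blast
    next
      case False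
      then have xC: "L_le x C" using insert.prems(2) C(1) by blast
      have L: "x \<in> L" "C \<in> L" "\<sigma> \<subseteq> L" using insert.prems(1) C(1) by auto
      have "L_le x D" if "D \<in> \<sigma>" for D using trans[OF L(1,2) _ xC] C(2) L(3) that by blast
      then show ?thesis using L_le_refl[OF L(1)] by (intro bexI[of _ x]) auto
    qed
  qed
qed

text \<open>The basis of the least vertex of a chain can be moved to \<open>Gb\<close>. The larger
  vertices contain this basis as well, so the translated chain consists of classes of
  \<open>Gb\<close> under the finitely many trees.\<close>

lemma finite_orbits: "finite (simplex_orbits G n Gi)"
proof (rule finite_subset)
  let ?V = "vert Gb ` {A. compatible n A}" and ?o = "\<lambda>\<sigma>. {vact \<phi> ` \<sigma> | \<phi>. \<phi> \<in> Aut1}"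
  show "finite (?o ` Pow ?V)" using finite_compatible by simp
  have VL: "?V \<subseteq> L" unfolding L_vert using basis_Gb by blast
  show "simplex_orbits G n Gi \<subseteq> ?o ` Pow ?V"
  proof
    fix O' assume "O' \<in> simplex_orbits G n Gi"
    then obtain \<sigma> where \<sigma>: "is_chain L_le L \<sigma>" "O' = ?o \<sigma>" unfolding simplex_orbits_def by blast
    obtain C where C: "C \<in> \<sigma>" "\<forall>D\<in>\<sigma>. L_le C D" using chain_least[OF \<sigma>(1)] by blast
    have sL: "\<sigma> \<subseteq> L" using \<sigma>(1) by (simp add: is_chain_def)
    obtain H A where H: "C = vert H A" "basis H" "compatible n A" using vert_cases C(1) sL by blast
    obtain \<phi> where \<phi>: "\<phi> \<in> Aut1" "H = img \<phi> Gb" using basis_eq_img[OF H(2)] by blast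
    obtain \<psi> where \<psi>: "\<psi> \<in> Aut1" "\<And>C. C \<in> L ==> vact \<psi> (vact \<phi> C) = C" "\<And>C. C \<in> L ==> vact \<phi> (vact \<psi> C) = C"
      using vact_inverse[OF \<phi>(1)] by blast
    define \<tau> where "\<tau> = vact \<psi> ` \<sigma>"
    have "vact \<psi> D \<in> ?V" if D: "D \<in> \<sigma>" for D
    proof -
      obtain K B where K: "D = vert K B" "basis K" "compatible n B" using vert_cases D sL by blast
      have "E B K H" using C(2) D vert_le[OF H(3) K(3) H(2) K(2)] H(1) K(1) by simp
      then have "D = vact \<phi> (vert Gb B)" using vert_eqI[OF K(3)] K(1) \<phi> vact_vert[OF \<phi>(1) basis_Gb] by simp
      moreover have "vert Gb B \<in> ?V" using K(3) by simp
      ultimately show ?thesis using \<psi>(2) VL by auto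
    qed
    then have \<tau>V: "\<tau> \<subseteq> ?V" by (auto simp: \<tau>_def)
    have \<sigma>\<tau>: "\<sigma> = vact \<phi> ` \<tau>" unfolding \<tau>_def image_image using \<psi>(3) sL by (auto simp: subset_iff image_iff)
    have \<tau>L: "\<tau> \<subseteq> L" using \<tau>V VL by blast
    have sub: "?o (vact \<alpha> ` \<rho>) \<subseteq> ?o \<rho>" if \<rho>: "\<rho> \<subseteq> L" and \<alpha>: "\<alpha> \<in> Aut1" for \<rho> \<alpha>
    proof
      fix X assume "X \<in> ?o (vact \<alpha> ` \<rho>)"
      then obtain \<beta> where \<beta>: "\<beta> \<in> Aut1" "X = vact \<beta> ` vact \<alpha> ` \<rho>" by blast
      have "X = vact (compose (carrier G) \<beta> \<alpha>) ` \<rho>"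
        unfolding \<beta>(2) image_image by (rule image_cong[OF refl]) (use vact_compose[OF \<beta>(1) \<alpha>] \<rho> in auto)
      then show "X \<in> ?o \<rho>" using Aut1_compose[OF \<beta>(1) \<alpha>] by blast
    qed
    have "?o \<sigma> \<subseteq> ?o \<tau>" unfolding \<sigma>\<tau> by (rule sub[OF \<tau>L \<phi>(1)])
    moreover have "?o \<tau> \<subseteq> ?o \<sigma>" unfolding \<tau>_def by (rule sub[OF sL \<psi>(1)])
    ultimately have "O' = ?o \<tau>" using \<sigma>(2) by (intro equalityI) simp_all
    then show "O' \<in> ?o ` Pow ?V" using \<tau>V by blast
  qed
qed

lemma contractible_fixed_set:
  assumes F: "finite F" "F \<subseteq> Aut1" "(\<lambda>g\<in>carrier G. g) \<in> F" "\<And>\<phi> \<psi>. \<phi> \<in> F ==> \<psi> \<in> F ==> compose (carrier G) \<phi> \<psi> \<in> F"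
  shows "fixed_set G n Gi F \<noteq> {}" "contractible_space (subtopology (L_complex G n Gi) (fixed_set G n Gi F))"
proof -
  let ?P = "{C \<in> L. \<forall>\<phi>\<in>F. vact \<phi> C = C}"
  obtain C where C: "C \<in> ?P" using contractible_fixed_poset(1)[OF F] by blast
  then have "(\<lambda>v. if v = C then 1 else 0) \<in> realization_points L_le ?P"
    by (intro vertex_in_realization_points L_le_refl) auto
  then show "fixed_set G n Gi F \<noteq> {}" unfolding fixed_set_eq[OF F(2)] by blast
  have "subtopology (L_complex G n Gi) (fixed_set G n Gi F) = realization L_le ?P"
    unfolding fixed_set_eq[OF F(2)] L_complex_def by (rule subtopology_realization) blast
  then show "contractible_space (subtopology (L_complex G n Gi) (fixed_set G n Gi F))"
    using contractible_fixed_poset(2)[OF F] by simp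
qed

lemma subgroup_AutoGroupD:
  assumes F: "subgroup F (AutoGroup G)"
  shows "(\<lambda>g\<in>carrier G. g) \<in> F" "\<phi> \<in> F ==> \<psi> \<in> F ==> compose (carrier G) \<phi> \<psi> \<in> F"
proof -
  show "(\<lambda>g\<in>carrier G. g) \<in> F" using subgroup.one_closed[OF F] by (simp add: AutoGroup_def BijGroup_def)
  assume a: "\<phi> \<in> F" "\<psi> \<in> F"
  have "F \<subseteq> Bij (carrier G)" using subgroup.subset[OF F] by (auto simp: AutoGroup_def auto_def)
  then have "\<phi> \<in> Bij (carrier G)" "\<psi> \<in> Bij (carrier G)" using a by blast+
  then show "compose (carrier G) \<phi> \<psi> \<in> F" using subgroup.m_closed[OF F a] by (simp add: AutoGroup_def BijGroup_def)
qed

end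

text \<open>Contractibility of the whole complex is the case of the trivial group. Nonemptiness is
  asserted separately, because \<open>contractible_space\<close> also holds for the empty space; the
  finite quotient is expressed by finitely many orbits of simplices.\<close>

theorem theorem1p1:
  fixes G :: "('a, 'b) monoid_scheme" and n :: nat and Gi :: "nat \<Rightarrow> 'a set"
  assumes "group G"
    and "n \<ge> 1"
    and "\<forall>i \<in> {1..n}. subgroup (Gi i) G \<and> finite (Gi i) \<and> Gi i \<noteq> {\<one>\<^bsub>G\<^esub>}"
    and "internal_free_product G n Gi"
  shows "topspace (L_complex G n Gi) \<noteq> {} \<and> contractible_space (L_complex G n Gi)
    \<and> (\<forall>t \<in> topspace (L_complex G n Gi).
          finite {\<phi> \<in> SigmaAut1 G n Gi. fixes_point G n Gi \<phi> t})
    \<and> finite (simplex_orbits G n Gi)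
    \<and> (\<forall>F. subgroup F (AutoGroup G) \<and> F \<subseteq> SigmaAut1 G n Gi \<and> finite F \<longrightarrow>
          fixed_set G n Gi F \<noteq> {} \<and>
          contractible_space (subtopology (L_complex G n Gi) (fixed_set G n Gi F)))"
proof -
  interpret group G by fact
  interpret factored_group G n Gi by unfold_locales (use assms in auto)
  have id: "compose (carrier G) (\<lambda>g\<in>carrier G. g) (\<lambda>g\<in>carrier G. g) = (\<lambda>g\<in>carrier G. g)"
    by (auto simp: compose_def)
  have F1: "finite {\<lambda>g\<in>carrier G. g}" "{\<lambda>g\<in>carrier G. g} \<subseteq> Aut1" "(\<lambda>g\<in>carrier G. g) \<in> {\<lambda>g\<in>carrier G. g}"
    using id_Aut1 by auto
  have F2: "compose (carrier G) \<phi> \<psi> \<in> {\<lambda>g\<in>carrier G. g}" if "\<phi> \<in> {\<lambda>g\<in>carrier G. g}" "\<psi> \<in> {\<lambda>g\<in>carrier G. g}" for \<phi> \<psi>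
    using that id by simp
  have all: "{C \<in> L. \<forall>\<phi>\<in>{\<lambda>g\<in>carrier G. g}. vact \<phi> C = C} = L" using vact_id[OF _ id_Aut1] by auto
  have "fixed_set G n Gi {\<lambda>g\<in>carrier G. g} = topspace (L_complex G n Gi)"
    unfolding fixed_set_eq[OF F1(2)] all L_complex_topspace ..
  then have "topspace (L_complex G n Gi) \<noteq> {}" "contractible_space (L_complex G n Gi)"
    using contractible_fixed_set[OF F1 F2] by simp_all
  moreover have "\<forall>t \<in> topspace (L_complex G n Gi). finite {\<phi> \<in> SigmaAut1 G n Gi. fixes_point G n Gi \<phi> t}"
    using finite_stabilizer L_complex_topspace by simp
  moreover have "fixed_set G n Gi F \<noteq> {} \<and> contractible_space (subtopology (L_complex G n Gi) (fixed_set G n Gi F))"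
    if F: "subgroup F (AutoGroup G)" "F \<subseteq> SigmaAut1 G n Gi" "finite F" for F
    using contractible_fixed_set[OF F(3,2) subgroup_AutoGroupD[OF F(1)]] by blast
  ultimately show ?thesis using finite_orbits by blast
qed

end
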